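(* Let $f_1,\ldots,f_N:\mathbb{R}^n\to\mathbb{R}$ and $g:\mathbb{R}^n\to\overline{\mathbb{R}}$ be such that: $f_1,\ldots,f_N$ are differentiable with locally Lipschitz continuous gradients; $g$ is proper and convex, has closed domain, and is locally Lipschitz on its domain; and $\Phi:=f_1+\cdots+f_N+g$ is bounded below. Let $\beta=0$ if $N=1$, and $\beta\in(1/2,1)$ otherwise. If $\Phi$ is semialgebraic and has bounded subgradient trajectories, then for any bounded set $X_0\subset\operatorname{dom}\Phi$, there exist $\bar\alpha,c>0$ such that any sequence $(x_k)_{k\in\mathbb{N}}$ generated by proximal random reshuffling (PRR) with $D_i:=\{\nabla f_i\}$, initialized in $X_0$, with $$\alpha\in(0,\bar\alpha]\quad\text{and}\quad\alpha_k=\frac{\alpha}{(k+1)^\beta},\quad\forall k\in\mathbb{N},$$ converges to a $(0,0)$-near approximate $\partial\Phi$-stationary point (that is, a point $x^*$ with $d(0,\partial\Phi(x^* ))=0$), and satisfies $$\sum_{i=0}^\infty\|x_{i+1}-x_i\|\leqslant c\quad\text{and}\quad\min_{i\in\{0,\ldots,k\}}d(0,\partial\Phi(x_i))=o(k^{\beta-1})\ \text{ as } k\to\infty.$$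
   Context: Notation: $\mathbb{R}^n$ carries an inner product with induced norm $\|\cdot\|$; $\overline{\mathbb{R}}=\mathbb{R}\cup\{\pm\infty\}$; $\mathbb{N}=\{0,1,2,\ldots\}$; $\operatorname{dom}\Phi=\{x:\Phi(x)<\infty\}$; $d(x,S)=\inf\{\|x-y\|:y\in S\}$ (equal to $+\infty$ if $S=\emptyset$). $\partial\Phi$ is the Clarke subdifferential of $\Phi$, which in this setting is $\partial\Phi(x)=\sum_{i=1}^N\nabla f_i(x)+\partial g(x)$ with $\partial g$ the convex subdifferential. A subset of $\mathbb{R}^n$ is semialgebraic if it is a finite union of sets of the form $\{x: p_1(x)>0,\ldots,p_r(x)>0,p_{r+1}(x)=0,\ldots,p_q(x)=0\}$ with $p_1,\ldots,p_q$ real polynomials; $\Phi$ is semialgebraic if its epigraph (equivalently its graph $\{(x,t)\in\mathbb{R}^n\times\mathbb{R}:\Phi(x)=t\}$) is. A subgradient trajectory of $\Phi$ is a maximal solution of $x'\in-\partial\Phi(x)$: a function $x:[0,T)\to\mathbb{R}^n$, $T\in(0,\infty]$, absolutely continuous on compact subintervals, with $x'(t)\in-\partial\Phi(x(t))$ for almost every $t$, that cannot be extended to a solution on a larger interval. $\Phi$ has bounded subgradient trajectories if each of its subgradient trajectories is bounded. PRR algorithm (with $D_i=\{\nabla f_i\}$): given step sizes $\alpha_0,\alpha_1,\ldots>0$ and $x_0\in\operatorname{dom}\Phi$, for $k=0,1,2,\ldots$: set $x_{k,0}=x_k$; choose an arbitrary permutation $\sigma^k$ of $\{1,\ldots,N\}$;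 for $i=1,\ldots,N$ set $x_{k,i}=x_{k,i-1}-\alpha_k\nabla f_{\sigma^k_i}(x_{k,i-1})$; set $x_{k+1}=\operatorname{prox}_{\alpha_k g}(x_{k,N})$, where $\operatorname{prox}_{h}(x)=\operatorname{argmin}_{y\in\mathbb{R}^n}\{h(y)+\|y-x\|^2/2\}$. "Initialized in $X_0$" means $x_0\in X_0$. *)

theory Defs
  imports "HOL-Analysis.Analysis"
begin

section \<open>Extended-real-valued functions\<close>

definition edom :: "('a \<Rightarrow> ereal) \<Rightarrow> 'a set" where
  "edom F = {x. F x < \<infinity>}"

definition ereal_epigraph :: "('a \<Rightarrow> ereal) \<Rightarrow> ('a \<times> real) set" where
  "ereal_epigraph F = {(x, t). F x \<le> ereal t}"

definition proper_function :: "('a \<Rightarrow> ereal) \<Rightarrow> bool" where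
  "proper_function F \<longleftrightarrow> (\<forall>x. F x \<noteq> -\<infinity>) \<and> edom F \<noteq> {}"

definition convex_function :: "('a::real_vector \<Rightarrow> ereal) \<Rightarrow> bool" where
  "convex_function F \<longleftrightarrow> convex (ereal_epigraph F)"

definition locally_lipschitz_on :: "'a::metric_space set \<Rightarrow> ('a \<Rightarrow> 'b::metric_space) \<Rightarrow> bool" where
  "locally_lipschitz_on S F \<longleftrightarrow> (\<forall>x\<in>S. \<exists>u>0. \<exists>L. L-lipschitz_on (cball x u \<inter> S) F)"

definition gradient :: "('a::euclidean_space \<Rightarrow> real) \<Rightarrow> 'a \<Rightarrow> 'a" where
  "gradient f x = (THE D. GDERIV f x :> D)"

text \<open>The infimum is taken in \<^typ>\<open>ereal\<close>, so the distance to the empty set is \<open>\<infinity>\<close>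
  (\<^const>\<open>infdist\<close> and \<^const>\<open>setdist\<close> would give \<open>0\<close>).\<close>

definition edist_set :: "'a::real_normed_vector \<Rightarrow> 'a set \<Rightarrow> ereal" where
  "edist_set x S = (INF y\<in>S. ereal (norm (x - y)))"

section \<open>Semialgebraic sets and functions\<close>

text \<open>\<^const>\<open>real_polynomial_function\<close> is the algebra of functions generated by the constants and
  the linear functionals, that is, the polynomials in the coordinates with respect to any basis.\<close>

definition basic_semialgebraic :: "'a::euclidean_space set \<Rightarrow> bool" where
  "basic_semialgebraic S \<longleftrightarrow>
     (\<exists>P Q. finite P \<and> finite Q \<and> (\<forall>p\<in>P \<union> Q. real_polynomial_function p) \<and>
        S = {x. (\<forall>p\<in>P. p x > 0) \<and> (\<forall>q\<in>Q. q x = 0)})"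

definition semialgebraic :: "'a::euclidean_space set \<Rightarrow> bool" where
  "semialgebraic S \<longleftrightarrow> (\<exists>\<B>. finite \<B> \<and> (\<forall>B\<in>\<B>. basic_semialgebraic B) \<and> S = \<Union>\<B>)"

definition semialgebraic_function :: "('a::euclidean_space \<Rightarrow> ereal) \<Rightarrow> bool" where
  "semialgebraic_function F \<longleftrightarrow> semialgebraic (ereal_epigraph F)"

section \<open>The Clarke subdifferential\<close>

text \<open>Clarke's construction through the normal cone to the epigraph, the polar of the Clarke tangent
  cone. Lemma \<open>clarke_subdifferential_objective\<close> below recovers the explicit formula
  \<open>\<partial>\<Phi>(x) = \<Sum>\<^sub>i \<nabla>f\<^sub>i(x) + \<partial>g(x)\<close> for the objective functions considered here.\<close>

definition clarke_tangent_cone :: "'a::real_normed_vector set \<Rightarrow> 'a \<Rightarrow> 'a set" where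
  "clarke_tangent_cone S x =
     {v. \<forall>u t. (\<forall>k. u k \<in> S) \<and> u \<longlonglongrightarrow> x \<and> (\<forall>k. t k > 0) \<and> t \<longlonglongrightarrow> (0::real) \<longrightarrow>
           (\<exists>w. w \<longlonglongrightarrow> v \<and> (\<forall>k::nat. u k + t k *\<^sub>R w k \<in> S))}"

definition clarke_normal_cone :: "'a::real_inner set \<Rightarrow> 'a \<Rightarrow> 'a set" where
  "clarke_normal_cone S x = {z. \<forall>v\<in>clarke_tangent_cone S x. z \<bullet> v \<le> 0}"

definition clarke_subdifferential :: "('a::euclidean_space \<Rightarrow> ereal) \<Rightarrow> 'a \<Rightarrow> 'a set" where
  "clarke_subdifferential F x =
     {v. \<bar>F x\<bar> \<noteq> \<infinity> \<and> (v, -1) \<in> clarke_normal_cone (ereal_epigraph F) (x, real_of_ereal (F x))}"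

definition convex_subdifferential :: "('a::euclidean_space \<Rightarrow> ereal) \<Rightarrow> 'a \<Rightarrow> 'a set" where
  "convex_subdifferential F x = {v. \<bar>F x\<bar> \<noteq> \<infinity> \<and> (\<forall>y. F x + ereal (v \<bullet> (y - x)) \<le> F y)}"

section \<open>Subgradient trajectories\<close>

definition absolutely_continuous_on :: "real set \<Rightarrow> (real \<Rightarrow> 'a::real_normed_vector) \<Rightarrow> bool" where
  "absolutely_continuous_on I x \<longleftrightarrow>
     (\<forall>\<epsilon>>0. \<exists>\<delta>>0. \<forall>(n::nat) a b.
        (\<forall>i<n. a i \<le> b i \<and> {a i..b i} \<subseteq> I) \<and>
        disjoint_family_on (\<lambda>i. {a i<..<b i}) {..<n} \<and> (\<Sum>i<n. b i - a i) < \<delta> \<longrightarrow>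
        (\<Sum>i<n. norm (x (b i) - x (a i))) < \<epsilon>)"

text \<open>The half-open interval \<open>[0,T)\<close>, with \<open>T = \<infinity>\<close> allowed.\<close>

definition time_interval :: "ereal \<Rightarrow> real set" where
  "time_interval T = {t. 0 \<le> t \<and> ereal t < T}"

text \<open>Values of \<open>x\<close> outside \<open>[0,T)\<close> are irrelevant: the two-sided derivative involves them only at
  \<open>t = 0\<close>, a null set.\<close>

definition subgradient_solution ::
  "('a::euclidean_space \<Rightarrow> ereal) \<Rightarrow> ereal \<Rightarrow> (real \<Rightarrow> 'a) \<Rightarrow> bool" where
  "subgradient_solution F T x \<longleftrightarrow> 0 < T \<and>
     (\<forall>a b. {a..b} \<subseteq> time_interval T \<longrightarrow> absolutely_continuous_on {a..b} x) \<and>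
     (AE t in lborel. t \<in> time_interval T \<longrightarrow>
        (\<exists>v. (x has_vector_derivative v) (at t) \<and> v \<in> uminus ` clarke_subdifferential F (x t)))"

definition subgradient_trajectory ::
  "('a::euclidean_space \<Rightarrow> ereal) \<Rightarrow> ereal \<Rightarrow> (real \<Rightarrow> 'a) \<Rightarrow> bool" where
  "subgradient_trajectory F T x \<longleftrightarrow> subgradient_solution F T x \<and>
     \<not> (\<exists>T' y. T < T' \<and> subgradient_solution F T' y \<and> (\<forall>t\<in>time_interval T. y t = x t))"

definition has_bounded_subgradient_trajectories :: "('a::euclidean_space \<Rightarrow> ereal) \<Rightarrow> bool" where
  "has_bounded_subgradient_trajectories F \<longleftrightarrow>
     (\<forall>T x. subgradient_trajectory F T x \<longrightarrow> bounded (x ` time_interval T))"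

section \<open>Proximal random reshuffling\<close>

definition objective :: "nat \<Rightarrow> (nat \<Rightarrow> 'a \<Rightarrow> real) \<Rightarrow> ('a \<Rightarrow> ereal) \<Rightarrow> 'a \<Rightarrow> ereal" where
  "objective N f g x = ereal (\<Sum>i=1..N. f i x) + g x"

text \<open>The set of minimizers; it is a singleton when the function is proper, convex and lower
  semicontinuous.\<close>

definition prox :: "('a::euclidean_space \<Rightarrow> ereal) \<Rightarrow> 'a \<Rightarrow> 'a set" where
  "prox h x = {y. is_arg_min (\<lambda>z. h z + ereal ((norm (z - x))\<^sup>2 / 2)) (\<lambda>_. True) y}"

definition prr_sequence ::
  "nat \<Rightarrow> (nat \<Rightarrow> 'a::euclidean_space \<Rightarrow> real) \<Rightarrow> ('a \<Rightarrow> ereal) \<Rightarrow> (nat \<Rightarrow> real) \<Rightarrow> (nat \<Rightarrow> 'a) \<Rightarrow> bool"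
where
  "prr_sequence N f g \<alpha> x \<longleftrightarrow>
     (\<forall>k. \<alpha> k > 0) \<and> x 0 \<in> edom (objective N f g) \<and>
     (\<exists>\<sigma> X. \<forall>k.
        \<sigma> k permutes {1..N} \<and> X k 0 = x k \<and>
        (\<forall>i\<in>{1..N}. X k i = X k (i - 1) - \<alpha> k *\<^sub>R gradient (f (\<sigma> k i)) (X k (i - 1))) \<and>
        x (Suc k) \<in> prox (\<lambda>y. ereal (\<alpha> k) * g y) (X k N))"

section \<open>The sum rule for the objective\<close>

lemma GDERIV_gradient:
  fixes f :: "'a::euclidean_space \<Rightarrow> real"
  assumes "f differentiable (at x)"
  shows "GDERIV f x :> gradient f x"
proof -
  obtain f' where f': "(f has_derivative f') (at x)"
    using assms by (auto simp: differentiable_def)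
  have lin: "linear f'" using f' has_derivative_linear by blast
  have "f' h = h \<bullet> (\<Sum>b\<in>Basis. f' b *\<^sub>R b)" for h
  proof -
    have "f' h = f' (\<Sum>b\<in>Basis. (h \<bullet> b) *\<^sub>R b)" by (simp add: euclidean_representation)
    also have "\<dots> = (\<Sum>b\<in>Basis. (h \<bullet> b) *\<^sub>R f' b)"
      using lin by (simp add: linear_sum linear_scale)
    also have "\<dots> = h \<bullet> (\<Sum>b\<in>Basis. f' b *\<^sub>R b)"
      by (simp add: inner_sum_right mult.commute)
    finally show ?thesis .
  qed
  then have "f' = (\<lambda>h. h \<bullet> (\<Sum>b\<in>Basis. f' b *\<^sub>R b))" by (rule ext)
  with f' have ex: "GDERIV f x :> (\<Sum>b\<in>Basis. f' b *\<^sub>R b)"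
    unfolding gderiv_def by metis
  have un: "D = E" if "GDERIV f x :> D" "GDERIV f x :> E" for D E
  proof -
    have "(\<lambda>h. h \<bullet> D) = (\<lambda>h. h \<bullet> E)"
      using that has_derivative_unique unfolding gderiv_def by blast
    then have "(D - E) \<bullet> (D - E) = 0" by (metis inner_diff_right right_minus_eq)
    then show ?thesis by simp
  qed
  show ?thesis unfolding gradient_def using ex un by (metis theI)
qed

lemma locally_lipschitz_on_imp_continuous_on:
  assumes "locally_lipschitz_on S F"
  shows "continuous_on S F"
proof (rule continuous_on_sequentiallyI)
  fix X a assume X: "\<forall>n::nat. X n \<in> S" "a \<in> S" "X \<longlonglongrightarrow> a"
  then obtain u L where u: "u > 0" "L-lipschitz_on (cball a u \<inter> S) F"
    using assms unfolding locally_lipschitz_on_def by blast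
  have c: "continuous_on (cball a u \<inter> S) F" using u(2) by (rule lipschitz_on_continuous_on)
  have "\<forall>\<^sub>F n in sequentially. X n \<in> cball a u \<inter> S"
    using tendstoD[OF X(3) u(1)] by eventually_elim (use X in \<open>auto simp: dist_commute\<close>)
  then show "(\<lambda>n. F (X n)) \<longlonglongrightarrow> F a"
    using continuous_on_tendsto_compose[OF c X(3)] u X by auto
qed

lemma clarke_subdifferential_objective:
  fixes f :: "nat \<Rightarrow> 'a::euclidean_space \<Rightarrow> real" and g :: "'a \<Rightarrow> ereal"
  assumes diff: "\<And>i y. i \<in> {1..N} \<Longrightarrow> f i differentiable (at y)"
    and grad: "\<And>i. i \<in> {1..N} \<Longrightarrow> locally_lipschitz_on UNIV (gradient (f i))"
    and g: "proper_function g" "convex_function g"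
    and glip: "locally_lipschitz_on (edom g) (\<lambda>y. real_of_ereal (g y))"
  shows "clarke_subdifferential (objective N f g) x =
           (\<lambda>v. (\<Sum>i=1..N. gradient (f i) x) + v) ` convex_subdifferential g x"
proof -
  define h where "h y = (\<Sum>i=1..N. f i y)" for y
  define G where "G y = (\<Sum>i=1..N. gradient (f i) y)" for y
  define r where "r y = real_of_ereal (g y)" for y
  let ?F = "objective N f g"
  have F: "?F y = ereal (h y) + g y" for y by (simp add: objective_def h_def)
  have hG: "(h has_derivative (\<lambda>d. d \<bullet> G y)) (at y)" for y
  proof -
    have "(f i has_derivative (\<lambda>d. d \<bullet> gradient (f i) y)) (at y)" if "i \<in> {1..N}" for i
      using GDERIV_gradient[OF diff[OF that]] by (simp add: gderiv_def)
    then have "((\<lambda>y. \<Sum>i=1..N. f i y) has_derivative (\<lambda>d. \<Sum>i=1..N. d \<bullet> gradient (f i) y)) (at y)"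
      by (rule has_derivative_sum)
    then show ?thesis unfolding h_def G_def by (simp add: inner_sum_right)
  qed
  have Gc: "continuous_on UNIV G" unfolding G_def
    using locally_lipschitz_on_imp_continuous_on[OF grad] by (intro continuous_on_sum)
  have rc: "continuous_on (edom g) r" unfolding r_def
    using locally_lipschitz_on_imp_continuous_on[OF glip] .
  have gr: "g y = ereal (r y)" if "y \<in> edom g" for y
    using that g(1) unfolding r_def edom_def proper_function_def by (cases "g y") auto
  have ginf: "g y = \<infinity>" if "y \<notin> edom g" for y
    using that unfolding edom_def by auto
  have fin: "\<bar>?F y\<bar> \<noteq> \<infinity> \<longleftrightarrow> y \<in> edom g" "\<bar>g y\<bar> \<noteq> \<infinity> \<longleftrightarrow> y \<in> edom g" for y
    by (cases "y \<in> edom g"; simp add: F gr ginf)+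
  have epi: "(y, t) \<in> ereal_epigraph ?F \<longleftrightarrow> y \<in> edom g \<and> h y + r y \<le> t" for y t
    unfolding ereal_epigraph_def by (cases "y \<in> edom g"; simp add: F gr ginf)
  have epig: "(y, t) \<in> ereal_epigraph g \<longleftrightarrow> y \<in> edom g \<and> r y \<le> t" for y t
    unfolding ereal_epigraph_def by (cases "y \<in> edom g"; simp add: gr ginf)
  have cvx: "z + s *\<^sub>R (y - z) \<in> edom g \<and> r (z + s *\<^sub>R (y - z)) \<le> r z + s * (r y - r z)"
    if "z \<in> edom g" "y \<in> edom g" "0 \<le> s" "s \<le> 1" for y z s
  proof -
    have "(1 - s) *\<^sub>R (z, r z) + s *\<^sub>R (y, r y) \<in> ereal_epigraph g"
      using g(2) that epig unfolding convex_function_def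
      by (intro convexD) auto
    moreover have "(1 - s) *\<^sub>R (z, r z) + s *\<^sub>R (y, r y)
        = (z + s *\<^sub>R (y - z), r z + s * (r y - r z))"
      by (simp add: algebra_simps)
    ultimately show ?thesis using epig by simp
  qed
  show ?thesis
  proof (cases "x \<in> edom g")
    case False
    then show ?thesis
      unfolding clarke_subdifferential_def convex_subdifferential_def fin by simp
  next
    case xd: True
    have Fx: "real_of_ereal (?F x) = h x + r x" using xd by (simp add: F gr)
    have csd: "v \<in> convex_subdifferential g x \<longleftrightarrow> (\<forall>y\<in>edom g. r x + v \<bullet> (y - x) \<le> r y)" for v
    proof -
      have "g x + ereal (v \<bullet> (y - x)) \<le> g y \<longleftrightarrow> (y \<in> edom g \<longrightarrow> r x + v \<bullet> (y - x) \<le> r y)" for y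
        using xd by (cases "y \<in> edom g"; simp add: gr ginf)
      then show ?thesis unfolding convex_subdifferential_def fin using xd by auto
    qed
    have tangent: "(y - x, (y - x) \<bullet> G x + (r y - r x))
        \<in> clarke_tangent_cone (ereal_epigraph ?F) (x, h x + r x)" if yd: "y \<in> edom g" for y
      unfolding clarke_tangent_cone_def
    proof (intro CollectI allI impI, elim conjE)
      fix u :: "nat \<Rightarrow> 'a \<times> real" and t :: "nat \<Rightarrow> real"
      assume u: "\<forall>k. u k \<in> ereal_epigraph ?F" "u \<longlonglongrightarrow> (x, h x + r x)"
        and t: "\<forall>k. 0 < t k" "t \<longlonglongrightarrow> 0"
      define z where "z k = fst (u k)" for k
      have zd: "z k \<in> edom g" and zu: "h (z k) + r (z k) \<le> snd (u k)" for k
        using u(1) epi[of "fst (u k)" "snd (u k)"] by (auto simp: z_def)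
      have zx: "z \<longlonglongrightarrow> x" using tendsto_fst[OF u(2)] by (simp add: z_def[abs_def])
      define q where "q k = (h (z k + t k *\<^sub>R (y - z k)) - h (z k)) / t k" for k
      have "\<exists>s. 0 < s \<and> s < t k \<and> q k = (y - z k) \<bullet> G (z k + s *\<^sub>R (y - z k))" for k
      proof -
        have "((\<lambda>s. h (z k + s *\<^sub>R (y - z k))) has_real_derivative
                ((y - z k) \<bullet> G (z k + s *\<^sub>R (y - z k)))) (at s)" for s
        proof -
          have "((\<lambda>s. z k + s *\<^sub>R (y - z k)) has_derivative (\<lambda>d. d *\<^sub>R (y - z k))) (at s)"
            by (auto intro!: derivative_eq_intros)
          from has_derivative_compose[OF this hG]
          show ?thesis by (simp add: has_field_derivative_def mult_commute_abs)
        qed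
        then obtain s where "0 < s" "s < t k"
          "h (z k + t k *\<^sub>R (y - z k)) - h (z k + 0 *\<^sub>R (y - z k))
             = (t k - 0) * ((y - z k) \<bullet> G (z k + s *\<^sub>R (y - z k)))"
          using MVT2[of 0 "t k" "\<lambda>s. h (z k + s *\<^sub>R (y - z k))"
              "\<lambda>s. (y - z k) \<bullet> G (z k + s *\<^sub>R (y - z k))"] t(1) by blast
        then show ?thesis by (intro exI[of _ s]) (simp add: q_def)
      qed
      then obtain s where s: "\<And>k. 0 < s k" "\<And>k. s k < t k"
        "\<And>k. q k = (y - z k) \<bullet> G (z k + s k *\<^sub>R (y - z k))" by metis
      have "s \<longlonglongrightarrow> 0"
        by (rule tendsto_sandwich[OF _ _ tendsto_const t(2)])
           (use s in \<open>auto intro!: always_eventually simp: less_imp_le\<close>)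
      then have "(\<lambda>k. z k + s k *\<^sub>R (y - z k)) \<longlonglongrightarrow> x + 0 *\<^sub>R (y - x)"
        by (intro tendsto_intros zx)
      then have "(\<lambda>k. G (z k + s k *\<^sub>R (y - z k))) \<longlonglongrightarrow> G x"
        using continuous_on_tendsto_compose[OF Gc, of _ x] by simp
      then have ql: "q \<longlonglongrightarrow> (y - x) \<bullet> G x"
        unfolding s(3)[abs_def] by (intro tendsto_intros zx)
      have rl: "(\<lambda>k. r (z k)) \<longlonglongrightarrow> r x"
        using continuous_on_tendsto_compose[OF rc zx xd] zd by simp
      define w where "w k = (if t k \<le> 1 then (y - z k, q k + (r y - r (z k))) else 0)" for k
      have "\<forall>\<^sub>F k in sequentially. t k < 1" using t(2) by (rule order_tendstoD) simp
      then have ev: "\<forall>\<^sub>F k in sequentially. (y - z k, q k + (r y - r (z k))) = w k"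
        by eventually_elim (simp add: w_def)
      have "(\<lambda>k. (y - z k, q k + (r y - r (z k)))) \<longlonglongrightarrow> (y - x, (y - x) \<bullet> G x + (r y - r x))"
        by (intro tendsto_intros zx ql rl)
      then have wl: "w \<longlonglongrightarrow> (y - x, (y - x) \<bullet> G x + (r y - r x))"
        using tendsto_cong[OF ev] by simp
      have "u k + t k *\<^sub>R w k \<in> ereal_epigraph ?F" for k
      proof (cases "t k \<le> 1")
        case True
        have eq: "u k + t k *\<^sub>R w k
          = (z k + t k *\<^sub>R (y - z k), snd (u k) + t k * (q k + (r y - r (z k))))"
          using True by (simp add: w_def z_def prod_eq_iff)
        have "t k * q k = h (z k + t k *\<^sub>R (y - z k)) - h (z k)"
          using t(1)[rule_format, of k] by (simp add: q_def)
        then show ?thesis unfolding eq epi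
          using cvx[OF zd yd, of "t k" k] True t(1)[rule_format, of k] zu[of k]
          by (auto simp: distrib_left)
      qed (use u(1) in \<open>simp add: w_def\<close>)
      with wl show "\<exists>w. w \<longlonglongrightarrow> (y - x, (y - x) \<bullet> G x + (r y - r x)) \<and>
          (\<forall>k. u k + t k *\<^sub>R w k \<in> ereal_epigraph ?F)" by blast
    qed
    have normal: "v \<bullet> d \<le> e"
      if v: "v - G x \<in> convex_subdifferential g x"
        and de: "(d, e) \<in> clarke_tangent_cone (ereal_epigraph ?F) (x, h x + r x)" for v d e
    proof -
      define t :: "nat \<Rightarrow> real" where "t k = inverse (real (Suc k))" for k
      have t: "t k > 0" for k by (simp add: t_def)
      have tl: "t \<longlonglongrightarrow> 0" unfolding t_def by (rule LIMSEQ_inverse_real_of_nat)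
      have "(x, h x + r x) \<in> ereal_epigraph ?F" using epi xd by simp
      with de[unfolded clarke_tangent_cone_def, simplified, rule_format,
          of "\<lambda>_. (x, h x + r x)" t] t tl
      obtain w where w: "w \<longlonglongrightarrow> (d, e)" "\<And>k. (x, h x + r x) + t k *\<^sub>R w k \<in> ereal_epigraph ?F"
        by auto
      define p where "p k = fst (w k)" for k
      have pl: "p \<longlonglongrightarrow> d" using tendsto_fst[OF w(1)] by (simp add: p_def[abs_def])
      have el: "(\<lambda>k. snd (w k)) \<longlonglongrightarrow> e" using tendsto_snd[OF w(1)] by simp
      have wk: "x + t k *\<^sub>R p k \<in> edom g"
          "h (x + t k *\<^sub>R p k) + r (x + t k *\<^sub>R p k) \<le> h x + r x + t k * snd (w k)" for k
        using w(2)[of k] epi[of "x + t k *\<^sub>R p k" "h x + r x + t k * snd (w k)"]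
        by (cases "w k"; simp add: p_def)+
      define q where "q k = (h (x + t k *\<^sub>R p k) - h x) / t k" for k
      have le: "q k + (v - G x) \<bullet> p k \<le> snd (w k)" for k
      proof -
        have "r x + (v - G x) \<bullet> (t k *\<^sub>R p k) \<le> r (x + t k *\<^sub>R p k)"
          using v[unfolded csd, rule_format, OF wk(1)[of k]] by simp
        moreover have "t k * q k = h (x + t k *\<^sub>R p k) - h x" using t[of k] by (simp add: q_def)
        ultimately have "t k * (q k + (v - G x) \<bullet> p k) \<le> t k * snd (w k)"
          using wk(2)[of k] by (simp add: distrib_left)
        then show ?thesis using t[of k] by simp
      qed
      have "q \<longlonglongrightarrow> d \<bullet> G x"
      proof -
        have "\<exists>s. 0 < s \<and> s < t k \<and> q k = p k \<bullet> G (x + s *\<^sub>R p k)" for k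
        proof -
          have "((\<lambda>s. h (x + s *\<^sub>R p k)) has_real_derivative (p k \<bullet> G (x + s *\<^sub>R p k))) (at s)" for s
          proof -
            have "((\<lambda>s. x + s *\<^sub>R p k) has_derivative (\<lambda>d. d *\<^sub>R p k)) (at s)"
              by (auto intro!: derivative_eq_intros)
            from has_derivative_compose[OF this hG]
            show ?thesis by (simp add: has_field_derivative_def mult_commute_abs)
          qed
          then obtain s where "0 < s" "s < t k"
            "h (x + t k *\<^sub>R p k) - h (x + 0 *\<^sub>R p k) = (t k - 0) * (p k \<bullet> G (x + s *\<^sub>R p k))"
            using MVT2[of 0 "t k" "\<lambda>s. h (x + s *\<^sub>R p k)" "\<lambda>s. p k \<bullet> G (x + s *\<^sub>R p k)"] t
            by blast
          then show ?thesis by (intro exI[of _ s]) (simp add: q_def)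
        qed
        then obtain s where s: "\<And>k. 0 < s k" "\<And>k. s k < t k"
          "\<And>k. q k = p k \<bullet> G (x + s k *\<^sub>R p k)" by metis
        have "s \<longlonglongrightarrow> 0"
          by (rule tendsto_sandwich[OF _ _ tendsto_const tl])
             (use s in \<open>auto intro!: always_eventually simp: less_imp_le\<close>)
        then have "(\<lambda>k. x + s k *\<^sub>R p k) \<longlonglongrightarrow> x + 0 *\<^sub>R d"
          by (intro tendsto_intros pl)
        then have "(\<lambda>k. G (x + s k *\<^sub>R p k)) \<longlonglongrightarrow> G x"
          using continuous_on_tendsto_compose[OF Gc, of _ x] by simp
        then show ?thesis unfolding s(3)[abs_def] by (intro tendsto_intros pl)
      qed
      then have "(\<lambda>k. q k + (v - G x) \<bullet> p k) \<longlonglongrightarrow> d \<bullet> G x + (v - G x) \<bullet> d"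
        by (intro tendsto_intros pl)
      then have "d \<bullet> G x + (v - G x) \<bullet> d \<le> e"
        using LIMSEQ_le[OF _ el] le by blast
      then show ?thesis by (simp add: inner_diff_right inner_diff_left inner_commute)
    qed
    have "v \<in> clarke_subdifferential ?F x \<longleftrightarrow> v - G x \<in> convex_subdifferential g x" for v
    proof
      assume "v \<in> clarke_subdifferential ?F x"
      then have le: "(v, -1) \<bullet> (y - x, (y - x) \<bullet> G x + (r y - r x)) \<le> 0" if "y \<in> edom g" for y
        using tangent[OF that] unfolding clarke_subdifferential_def clarke_normal_cone_def Fx by blast
      have "r x + (v - G x) \<bullet> (y - x) \<le> r y" if "y \<in> edom g" for y
        using le[OF that] by (simp add: inner_diff_left inner_commute[of "G x"])
      then show "v - G x \<in> convex_subdifferential g x" unfolding csd by blast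
    next
      assume "v - G x \<in> convex_subdifferential g x"
      then show "v \<in> clarke_subdifferential ?F x"
        unfolding clarke_subdifferential_def clarke_normal_cone_def Fx
        using normal xd fin(1)[of x] by auto
    qed
    moreover have "v \<in> (\<lambda>w. G x + w) ` convex_subdifferential g x
        \<longleftrightarrow> v - G x \<in> convex_subdifferential g x" for v
      by (auto simp: image_iff intro!: bexI[of _ "v - G x"])
    ultimately show ?thesis unfolding G_def[symmetric] by blast
  qed
qed

end

theory Submission
  imports Defs
begin

text \<open>
  By Tarski--Seidenberg, semialgebraic selections over a line can be chosen of bounded variation;
  together with the weak convexity of \<open>\<Phi>\<close> on bounded sets this yields finitely many critical values and a
  Kurdyka--Lojasiewicz inequality near every level. One pass of the algorithm decreases \<open>\<Phi>\<close> by
  \<open>|x' - x|\<^sup>2 / (2 a)\<close> up to an error \<open>O(a\<^sup>3)\<close>, produces a subgradient of size \<open>O(|x' - x| / a + a)\<close>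
  at \<open>x'\<close>, and satisfies a discrete evolution variational inequality; the errors vanish for
  \<open>N = 1\<close> and are summable along the sequence for \<open>\<beta> > 1/2\<close>.

  The length of the sequences is bounded uniformly by induction on the number of critical values below
  the initial level. If there were arbitrarily long sequences with step sizes tending to 0, their
  interpolations would converge along an ultrafilter to a curve satisfying the evolution variational
  inequality, hence to a maximal subgradient trajectory. It is bounded by assumption, so it approaches a
  critical value \<open>v\<close>, and the sequences reach a neighbourhood of the level \<open>v\<close> after a bounded
  length. There the Kurdyka--Lojasiewicz inequality bounds the length until the level falls below
  \<open>v - \<delta>\<close>, where the induction hypothesis applies. The rate follows by averaging the subgradients over the
  indices between \<open>k/2\<close> and \<open>k\<close>.
\<close>

text \<open>The Kurdyka--Lojasiewicz inequality rests on a divergent sum. If every level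
  \<open>v + t\<close> carried a bounded point of slope O(t), weak convexity would force points
  selected on levels s < t apart by about (t - s) / t, and such gaps add up like the harmonic
  series, against bounded variation. Hence t / |w| tends to 0 with t, and a semialgebraic quantity
  that tends to 0 does so at a power rate.

  The evolution variational inequality contains no derivatives, so it passes to pointwise limits;
  the price is that differentiability of the limit curve must be recovered afterwards. Up to an
  exponential factor the minimal norm of the subgradients along the curve is nonincreasing, hence
  continuous off a countable set, and there both one-sided difference quotients converge to the
  negative of the unique subgradient of minimal norm.

  All length estimates are uniform in the starting index of the step sizes, because the induction is
  applied to tails of sequences. The ball around the limit trajectory is fixed before \<delta> is
  chosen, which keeps the dependence of the constants free of circles.\<close>

section \<open>Increasing bijections of the line that respect finitely many points\<close>

definition same_gap :: "real set \<Rightarrow> real \<Rightarrow> real \<Rightarrow> bool" where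
  "same_gap Z a b \<longleftrightarrow> (\<forall>z\<in>Z. z \<noteq> a \<and> z \<noteq> b \<and> (z < a \<longleftrightarrow> z < b))"

lemma same_gap_sym: "same_gap Z a b \<Longrightarrow> same_gap Z b a"
  unfolding same_gap_def by auto

text \<open>Together with symmetry this is a partial equivalence relation whose classes are the
  components of the complement of \<open>Z\<close>; a point of \<open>Z\<close> is not even related
  to itself.\<close>

lemma same_gap_trans: "same_gap Z a b \<Longrightarrow> same_gap Z b c \<Longrightarrow> same_gap Z a c"
  unfolding same_gap_def by auto

lemma same_gap_between: "same_gap Z a b \<Longrightarrow> a \<le> c \<Longrightarrow> c \<le> b \<Longrightarrow> same_gap Z a c"
  unfolding same_gap_def by force

text \<open>A piecewise linear map with breakpoints \<open>l\<close>, \<open>a\<close>,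
  \<open>u\<close> that is the identity outside an interval around \<open>a\<close> and
  \<open>b\<close> containing no point of \<open>Z\<close>.\<close>

lemma shift_in_gap:
  assumes "finite Z" "same_gap Z a b"
  obtains \<zeta> where "strict_mono \<zeta>" "surj \<zeta>" "\<And>z. z \<in> Z \<Longrightarrow> \<zeta> z = z" "\<zeta> a = (b::real)"
proof -
  define m M where "m = min a b" and "M = max a b"
  obtain d1 where d1: "d1 > 0" "\<And>z. z \<in> Z \<Longrightarrow> z \<noteq> m \<Longrightarrow> d1 \<le> dist m z"
    using finite_set_avoid[OF assms(1)] by metis
  obtain d2 where d2: "d2 > 0" "\<And>z. z \<in> Z \<Longrightarrow> z \<noteq> M \<Longrightarrow> d2 \<le> dist M z"
    using finite_set_avoid[OF assms(1)] by metis
  \<comment> \<open>Half of a lower bound for the distances to \<open>Z\<close>, so that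
    \<open>a\<close> and \<open>b\<close> lie strictly between \<open>l\<close> and \<open>u\<close>
    while \<open>Z\<close> does not enter the open interval.\<close>
  define l u where "l = m - d1/2" and "u = M + d2/2"
  have l: "l < a" "l < b" using d1(1) by (auto simp: l_def m_def)
  have u: "a < u" "b < u" using d2(1) by (auto simp: u_def M_def)
  have Z: "z \<le> l \<or> u \<le> z" if "z \<in> Z" for z
  proof -
    have "z \<noteq> a" "z \<noteq> b" "z < a \<longleftrightarrow> z < b"
      using assms(2) that unfolding same_gap_def by blast+
    then have "z < m \<or> M < z" unfolding m_def M_def by linarith
    moreover from this have "z \<noteq> m" "z \<noteq> M" unfolding m_def M_def by linarith+
    then have "d1 \<le> dist m z" "d2 \<le> dist M z" using d1(2)[OF that] d2(2)[OF that] by blast+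
    ultimately show ?thesis using d1(1) d2(1)
      unfolding l_def u_def dist_real_def m_def M_def by linarith
  qed
  define k where "k = (b - l) / (a - l)"
  define k' where "k' = (u - b) / (u - a)"
  have k: "k > 0" "k * (a - l) = b - l" and k': "k' > 0" "k' * (u - a) = u - b"
    using l u by (auto simp: k_def k'_def)
  define \<zeta> where "\<zeta> t = (if t \<le> l then t else if t \<le> a then l + k * (t - l)
      else if t \<le> u then u - k' * (u - t) else t)" for t
  have 1: "\<zeta> s < \<zeta> t" if "s < t" for s t
  proof -
    have A: "l < l + k * (x - l) \<and> l + k * (x - l) \<le> b" if "l < x" "x \<le> a" for x
    proof -
      have "k * (x - l) \<le> k * (a - l)" using that k(1) by simp
      then show ?thesis using k that by simp
    qed
    have B: "b < u - k' * (u - x) \<and> u - k' * (u - x) \<le> u" if "a < x" "x \<le> u" for x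
    proof -
      have "k' * (u - x) < k' * (u - a)" using that k'(1) by simp
      then show ?thesis using k' that by simp
    qed
    have C: "l + k * (s - l) < l + k * (t - l)" "u - k' * (u - s) < u - k' * (u - t)"
      using that k(1) k'(1) by auto
    show ?thesis using that A[of s] A[of t] B[of s] B[of t] C l u unfolding \<zeta>_def by auto
  qed
  have 2: "\<exists>t. \<zeta> t = y" for y
  proof -
    consider "y \<le> l \<or> u < y" | "l < y" "y \<le> b" | "b < y" "y \<le> u" by linarith
    then show ?thesis
    proof cases
      case 1 then show ?thesis using l u by (intro exI[of _ y]) (auto simp: \<zeta>_def)
    next
      case 2
      define q where "q = (y - l) / k"
      have q: "k * q = y - l" "0 < q" using 2 k(1) by (auto simp: q_def)
      then have "k * q \<le> k * (a - l)" using 2 k by simp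
      then have "q \<le> a - l" using k(1) by simp
      then have "\<zeta> (l + q) = y" using q by (simp add: \<zeta>_def)
      then show ?thesis ..
    next
      case 3
      define q where "q = (u - y) / k'"
      have q: "k' * q = u - y" "0 \<le> q" using 3 k'(1) by (auto simp: q_def)
      then have "k' * q < k' * (u - a)" using 3 k' by simp
      then have "q < u - a" using k'(1) by simp
      then have "\<zeta> (u - q) = y" using q l by (simp add: \<zeta>_def)
      then show ?thesis ..
    qed
  qed
  show thesis
  proof (rule that)
    show "strict_mono \<zeta>" using 1 by (simp add: strict_mono_def)
    show "surj \<zeta>" using 2 by (metis surj_def)
    show "\<zeta> z = z" if "z \<in> Z" for z using Z[OF that] l u by (auto simp: \<zeta>_def)
    show "\<zeta> a = b" using l k by (simp add: \<zeta>_def)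
  qed
qed

text \<open>In the application \<open>Z\<close> consists of the roots of finitely many polynomials
  and \<open>s\<close> is the sign of the derivative of one more polynomial.\<close>

locale gap_monotone =
  fixes Z :: "real set" and s :: "real \<Rightarrow> real"
  assumes finZ: "finite Z" and s_nz: "\<And>t. t \<notin> Z \<Longrightarrow> s t \<noteq> 0"
    and s_gap: "\<And>a b. same_gap Z a b \<Longrightarrow> s a = s b"

text \<open>Such a \<open>u\<close> behaves like a polynomial whose derivative has the sign
  \<open>s\<close>. The last two clauses stand in for its infinite limits; phrased by single points,
  they also cover a polynomial composed with an increasing bijection.\<close>

definition (in gap_monotone) adapted :: "(real \<Rightarrow> real) \<Rightarrow> bool" where
  "adapted u \<longleftrightarrow> continuous_on UNIV u \<and>
     (\<forall>a b. a < b \<longrightarrow> same_gap Z a b \<longrightarrow> 0 < s a * (u b - u a)) \<and>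
     (\<forall>a. (\<forall>z\<in>Z. z < a) \<longrightarrow> (\<exists>b>a. s a * u b > 0)) \<and>
     (\<forall>a. (\<forall>z\<in>Z. a < z) \<longrightarrow> (\<exists>b<a. s a * u b < 0))"

context gap_monotone begin

lemma adapted_mono: "adapted u \<Longrightarrow> a < b \<Longrightarrow> same_gap Z a b \<Longrightarrow> 0 < s a * (u b - u a)"
  unfolding adapted_def by blast

text \<open>Inside a gap \<open>u\<close> stays positive in its direction of growth. This direction
  ends either at a point of \<open>Z\<close>, where \<open>v\<close> has the same sign and
  continuity carries it back into the gap, or at infinity, where \<open>adapted\<close> provides a
  positive value of \<open>v\<close>.\<close>

lemma gap_positive:
  assumes u: "adapted u" and v: "adapted v" and Z: "\<And>z. z \<in> Z \<Longrightarrow> sgn (u z) = sgn (v z)"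
    and t: "t \<notin> Z" "u t > 0"
  shows "\<exists>t'. same_gap Z t t' \<and> v t' > 0"
proof -
  have cu: "isCont u x" and cv: "isCont v x" for x
    using u v unfolding adapted_def by (auto simp: continuous_on_eq_continuous_at)
  consider "s t > 0" "\<forall>z\<in>Z. z < t" | "s t > 0" "\<exists>z\<in>Z. t < z" |
     "s t < 0" "\<forall>z\<in>Z. t < z" | "s t < 0" "\<exists>z\<in>Z. z < t"
    using s_nz[OF t(1)] t(1) by (metis linorder_neqE_linordered_idom)
  then show ?thesis
  proof cases
    case 1
    then obtain b where "b > t" "s t * v b > 0" using v unfolding adapted_def by blast
    then show ?thesis using 1
      by (intro exI[of _ b]) (force simp: same_gap_def zero_less_mult_iff)
  next
    case 3
    then obtain b where "b < t" "s t * v b < 0" using v unfolding adapted_def by blast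
    then show ?thesis using 3
      by (intro exI[of _ b]) (force simp: same_gap_def mult_less_0_iff)
  next
    case 2
    define z where "z = Min {z\<in>Z. t < z}"
    have "z \<in> {z\<in>Z. t < z}" unfolding z_def by (rule Min_in) (use finZ 2(2) in auto)
    then have z: "z \<in> Z" "t < z" by auto
    have zmin: "\<not> (t < y \<and> y < z)" if "y \<in> Z" for y
    proof -
      have "z \<le> y" if "t < y" unfolding z_def by (rule Min_le) (use finZ \<open>y \<in> Z\<close> that in auto)
      then show ?thesis by linarith
    qed
    have gap: "same_gap Z t b" if "t < b" "b < z" for b
      unfolding same_gap_def using zmin that t(1) by (metis less_trans linorder_neqE_linordered_idom not_less_iff_gr_or_eq)
    have "\<forall>\<^sub>F b in at_left z. u t \<le> u b"
    proof -
      have "u t \<le> u b" if "t < b" "b < z" for b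
        using adapted_mono[OF u that(1) gap[OF that]] 2(1) by (simp add: zero_less_mult_iff)
      then show ?thesis unfolding eventually_at_left_field using z(2) by blast
    qed
    then have "u t \<le> u z"
      using tendsto_lowerbound[of u "u z" "at_left z" "u t"] cu[of z]
      by (metis continuous_within isCont_def filterlim_at_split trivial_limit_at_left_real)
    then have "v z > 0" using Z[OF z(1)] t(2) by (metis less_le_trans sgn_1_pos)
    then have "\<forall>\<^sub>F b in at_left z. v b > 0"
      using cv[of z] by (metis isCont_def filterlim_at_split order_tendstoD(1))
    moreover have "\<forall>\<^sub>F b in at_left z. t < b \<and> b < z"
      unfolding eventually_at_left_field using z(2) by blast
    ultimately have "\<exists>b. v b > 0 \<and> t < b \<and> b < z"
      using eventually_happens'[OF trivial_limit_at_left_real eventually_conj] by blast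
    then show ?thesis using gap by blast
  next
    case 4
    define z where "z = Max {z\<in>Z. z < t}"
    have "z \<in> {z\<in>Z. z < t}" unfolding z_def by (rule Max_in) (use finZ 4(2) in auto)
    then have z: "z \<in> Z" "z < t" by auto
    have zmin: "\<not> (z < y \<and> y < t)" if "y \<in> Z" for y
    proof -
      have "y \<le> z" if "y < t" unfolding z_def by (rule Max_ge) (use finZ \<open>y \<in> Z\<close> that in auto)
      then show ?thesis by linarith
    qed
    have gap: "same_gap Z t b" if "z < b" "b < t" for b
      unfolding same_gap_def using zmin that t(1) by (metis less_trans linorder_neqE_linordered_idom not_less_iff_gr_or_eq)
    have "\<forall>\<^sub>F b in at_right z. u t \<le> u b"
    proof -
      have "u t \<le> u b" if "z < b" "b < t" for b
        using adapted_mono[OF u that(2) same_gap_sym[OF gap[OF that]]] s_gap[OF gap[OF that]] 4(1)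
        by (simp add: zero_less_mult_iff)
      then show ?thesis unfolding eventually_at_right_field using z(2) by blast
    qed
    then have "u t \<le> u z"
      using tendsto_lowerbound[of u "u z" "at_right z" "u t"] cu[of z]
      by (metis isCont_def filterlim_at_split trivial_limit_at_right_real)
    then have "v z > 0" using Z[OF z(1)] t(2) by (metis less_le_trans sgn_1_pos)
    then have "\<forall>\<^sub>F b in at_right z. v b > 0"
      using cv[of z] by (metis isCont_def filterlim_at_split order_tendstoD(1))
    moreover have "\<forall>\<^sub>F b in at_right z. z < b \<and> b < t"
      unfolding eventually_at_right_field using z(2) by blast
    ultimately have "\<exists>b. v b > 0 \<and> z < b \<and> b < t"
      using eventually_happens'[OF trivial_limit_at_right_real eventually_conj] by blast
    then show ?thesis using gap by blast
  qed
qed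

lemma gap_negative:
  assumes u: "adapted u" and v: "adapted v" and Z: "\<And>z. z \<in> Z \<Longrightarrow> sgn (u z) = sgn (v z)"
    and t: "t \<notin> Z" "u t < 0"
  shows "\<exists>t'. same_gap Z t t' \<and> v t' < 0"
proof -
  interpret neg: gap_monotone Z "\<lambda>t. - s t"
    by unfold_locales (use finZ s_nz s_gap in auto)
  have ad: "neg.adapted (\<lambda>t. - w t)" if "adapted w" for w
    using that unfolding neg.adapted_def adapted_def
    by (auto intro!: continuous_intros simp: right_diff_distrib)
  have "\<exists>t'. same_gap Z t t' \<and> - v t' > 0"
    by (rule neg.gap_positive[OF ad[OF u] ad[OF v]]) (use Z t in \<open>auto simp: sgn_minus\<close>)
  then show ?thesis by auto
qed

text \<open>A zero of \<open>u\<close> inside a gap is a strict crossing, so \<open>u\<close> and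
  hence \<open>v\<close> take both signs in the gap, and \<open>v\<close> vanishes in
  between.\<close>

lemma gap_sign:
  assumes u: "adapted u" and v: "adapted v" and Z: "\<And>z. z \<in> Z \<Longrightarrow> sgn (u z) = sgn (v z)"
    and t: "t \<notin> Z"
  shows "\<exists>t'. same_gap Z t t' \<and> sgn (v t') = sgn (u t)"
proof -
  consider "u t > 0" | "u t < 0" | "u t = 0" by linarith
  then show ?thesis
  proof cases
    case 1 then show ?thesis using gap_positive[OF u v Z t] by (metis sgn_1_pos)
  next
    case 2 then show ?thesis using gap_negative[OF u v Z t] by (metis sgn_1_neg)
  next
    case 3
    define d where "d = (if Z = {} then 1 else Min ((\<lambda>z. \<bar>z - t\<bar>) ` Z) / 2)"
    have d: "d > 0" "\<And>z. z \<in> Z \<Longrightarrow> d < \<bar>z - t\<bar>"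
    proof -
      have *: "Min ((\<lambda>z. \<bar>z - t\<bar>) ` Z) > 0" if "Z \<noteq> {}"
        using that finZ t by (subst Min_gr_iff) auto
      show "d > 0" using * by (auto simp: d_def)
      show "d < \<bar>z - t\<bar>" if "z \<in> Z" for z
      proof -
        have "Min ((\<lambda>z. \<bar>z - t\<bar>) ` Z) \<le> \<bar>z - t\<bar>" using finZ that by (intro Min_le) auto
        moreover have "Z \<noteq> {}" using that by auto
        ultimately show ?thesis using *[OF \<open>Z \<noteq> {}\<close>] by (simp add: d_def)
      qed
    qed
    have near: "same_gap Z t x" if "\<bar>x - t\<bar> \<le> d" for x
      unfolding same_gap_def using d(2) that by (smt (verit))
    have g: "same_gap Z (t - d) t" "same_gap Z t (t + d)"
      using near[of "t - d"] near[of "t + d"] d(1) by (auto intro: same_gap_sym)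
    have "0 < s t * (u (t + d) - u t)" "0 < s t * (u t - u (t - d))"
      using adapted_mono[OF u _ g(1)] adapted_mono[OF u _ g(2)] s_gap[OF g(1)] d(1) by auto
    then have pn: "0 < s t * u (t + d)" "s t * u (t - d) < 0" using 3 by auto
    have "\<exists>p. same_gap Z t p \<and> v p > 0" "\<exists>q. same_gap Z t q \<and> v q < 0"
    proof -
      have nZ: "t + d \<notin> Z" "t - d \<notin> Z" using g by (auto simp: same_gap_def)
      from pn consider "u (t + d) > 0" "u (t - d) < 0" | "u (t + d) < 0" "u (t - d) > 0"
        by (auto simp: zero_less_mult_iff mult_less_0_iff)
      then show "\<exists>p. same_gap Z t p \<and> v p > 0" "\<exists>q. same_gap Z t q \<and> v q < 0"
        using gap_positive[OF u v Z nZ(1)] gap_negative[OF u v Z nZ(1)] gap_positive[OF u v Z nZ(2)]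
          gap_negative[OF u v Z nZ(2)] g same_gap_sym same_gap_trans by meson+
    qed
    then obtain p q where pq: "same_gap Z t p" "v p > 0" "same_gap Z t q" "v q < 0" by blast
    have cv: "continuous_on S v" for S using v unfolding adapted_def by (auto intro: continuous_on_subset)
    have pqg: "same_gap Z p q" using pq same_gap_sym same_gap_trans by blast
    have "\<exists>x. same_gap Z p x \<and> v x = 0"
    proof (cases "p \<le> q")
      case True
      then obtain x where "p \<le> x" "x \<le> q" "v x = 0"
        using IVT2'[of v q 0 p] pq cv by force
      then show ?thesis using same_gap_between[OF pqg] by blast
    next
      case False
      then obtain x where "q \<le> x" "x \<le> p" "v x = 0"
        using IVT'[of v q 0 p] pq cv by force
      then show ?thesis using same_gap_between[OF same_gap_sym[OF pqg]] same_gap_trans[OF pqg] by blast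
    qed
    then show ?thesis using 3 pq(1) same_gap_trans by force
  qed
qed

text \<open>A gap holds at most one zero of \<open>u\<close> and one of \<open>v\<close>, and by
  \<open>gap_sign\<close> the second exists when the first does. Moving the zeros of
  \<open>u\<close> onto those of \<open>v\<close> one at a time aligns all signs, because the same
  \<open>s\<close> governs the monotonicity of both functions.\<close>

lemma sign_reparametrization:
  assumes u: "adapted u" and v: "adapted v" and Z: "\<And>z. z \<in> Z \<Longrightarrow> sgn (u z) = sgn (v z)"
    and fin: "finite {t. u t = 0}"
  obtains \<eta> where "strict_mono \<eta>" "surj \<eta>" "\<And>z. z \<in> Z \<Longrightarrow> \<eta> z = z"
    "\<And>t. sgn (u t) = sgn (v (\<eta> t))"
proof -
  define W where "W = {w. w \<notin> Z \<and> u w = 0}"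
  have "finite W" by (rule finite_subset[OF _ fin]) (auto simp: W_def)
  have one: "a = b" if "same_gap Z a b" "u' a = u' b" "adapted u'" for u' a b
    using adapted_mono[OF that(3), of a b] adapted_mono[OF that(3), of b a] that same_gap_sym
    by (metis cancel_comm_monoid_add_class.diff_cancel less_irrefl linorder_neqE_linordered_idom mult_zero_right)
  have "\<forall>w\<in>W. \<exists>w'. same_gap Z w w' \<and> v w' = 0"
    using gap_sign[OF u v Z] unfolding W_def by (metis (mono_tags, lifting) mem_Collect_eq sgn_0_0)
  then obtain \<psi> where \<psi>: "\<And>w. w \<in> W \<Longrightarrow> same_gap Z w (\<psi> w)" "\<And>w. w \<in> W \<Longrightarrow> v (\<psi> w) = 0" by metis
  have "\<exists>\<eta>. strict_mono \<eta> \<and> surj \<eta> \<and> (\<forall>z\<in>Z. \<eta> z = z) \<and> (\<forall>w\<in>W0. \<eta> w = \<psi> w)" if "W0 \<subseteq> W" for W0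
    using finite_subset[OF that \<open>finite W\<close>] that
  proof (induction W0 rule: finite_induct)
    case empty
    show ?case by (intro exI[of _ "\<lambda>x. x"]) (auto simp: strict_mono_def)
  next
    case (insert w W0)
    then obtain \<eta> where \<eta>: "strict_mono \<eta>" "surj \<eta>" "\<And>z. z \<in> Z \<Longrightarrow> \<eta> z = z" "\<And>w. w \<in> W0 \<Longrightarrow> \<eta> w = \<psi> w"
      by auto
    have wW: "w \<in> W" using insert by auto
    \<comment> \<open>The new shift is applied before \<open>\<eta>\<close>, so its target is the
      preimage \<open>c\<close> of \<open>\<psi> w\<close>.\<close>
    obtain c where c: "\<psi> w = \<eta> c" using \<eta>(2) by (metis surj_def)
    have zc: "z \<noteq> w \<and> z \<noteq> c \<and> (z < w \<longleftrightarrow> z < c)" if "z \<in> Z" for z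
    proof -
      have "z \<noteq> w \<and> \<eta> z \<noteq> \<eta> c \<and> (z < w \<longleftrightarrow> \<eta> z < \<eta> c)"
        using \<psi>(1)[OF wW] that \<eta>(3)[OF that] c unfolding same_gap_def by auto
      then show ?thesis using strict_mono_less[OF \<eta>(1)] strict_mono_eq[OF \<eta>(1)] by auto
    qed
    \<comment> \<open>The zeros treated before lie in other gaps, since \<open>u\<close> is
      injective on a gap; they can join the points that the shift has to fix.\<close>
    have "same_gap (Z \<union> W0) w c"
    proof -
      have "y \<noteq> w \<and> y \<noteq> c \<and> (y < w \<longleftrightarrow> y < c)" if y: "y \<in> W0" for y
      proof -
        have yW: "y \<in> W" "y \<noteq> w" using y insert by auto
        have "\<not> same_gap Z y w" using one[OF _ _ u, of y w] yW wW by (auto simp: W_def)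
        then obtain z where z: "z \<in> Z" "(z < y) \<noteq> (z < w)"
          using yW wW unfolding same_gap_def W_def by auto
        have "z \<noteq> y" "z \<noteq> w" using z(1) yW wW by (auto simp: W_def)
        then have "(z < y \<and> w < z) \<or> (y < z \<and> z < w)" using z(2) by auto
        then show ?thesis using zc[OF z(1)] by auto
      qed
      then show ?thesis unfolding same_gap_def using zc by blast
    qed
    then obtain \<zeta> where \<zeta>: "strict_mono \<zeta>" "surj \<zeta>" "\<And>z. z \<in> Z \<union> W0 \<Longrightarrow> \<zeta> z = z" "\<zeta> w = c"
      using shift_in_gap[of "Z \<union> W0"] finZ insert(1) by (metis finite_UnI)
    show ?case
    proof (intro exI[of _ "\<eta> \<circ> \<zeta>"] conjI)
      show "surj (\<eta> \<circ> \<zeta>)" using \<eta>(2) \<zeta>(2) by (rule comp_surj[rotated])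
    qed (use \<eta> \<zeta> c in \<open>auto simp: strict_mono_def\<close>)
  qed
  from this[OF subset_refl] obtain \<eta> where \<eta>: "strict_mono \<eta>" "surj \<eta>"
      "\<And>z. z \<in> Z \<Longrightarrow> \<eta> z = z" "\<And>w. w \<in> W \<Longrightarrow> \<eta> w = \<psi> w"
    by blast
  have gap\<eta>: "same_gap Z t (\<eta> t)" if "t \<notin> Z" for t
    unfolding same_gap_def using that \<eta>(3) strict_mono_less[OF \<eta>(1)] strict_mono_eq[OF \<eta>(1)] by metis
  have "sgn (u t) = sgn (v (\<eta> t))" for t
  proof (cases "t \<in> Z")
    case True then show ?thesis using Z \<eta>(3) by simp
  next
    case tZ: False
    have e: "\<eta> t \<notin> Z" using gap\<eta>[OF tZ] by (auto simp: same_gap_def)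
    show ?thesis
    proof (rule ccontr)
      assume ne: "sgn (u t) \<noteq> sgn (v (\<eta> t))"
      \<comment> \<open>With the roles of \<open>u\<close> and \<open>v\<close> exchanged,
        \<open>gap_sign\<close> finds a point of the gap where \<open>u\<close> has the sign of
        \<open>v (\<eta> t)\<close>. Since \<open>u t\<close> has another sign, \<open>u\<close> has
        a root \<open>w\<close> in the gap, and the side of \<open>w\<close> on which
        \<open>t\<close> lies decides both signs.\<close>
      obtain t2 where t2: "same_gap Z (\<eta> t) t2" "sgn (u t2) = sgn (v (\<eta> t))"
        using gap_sign[OF v u _ e] Z by metis
      have g2: "same_gap Z t t2" using same_gap_trans[OF gap\<eta>[OF tZ] t2(1)] .
      have tW: "u t \<noteq> 0" using ne \<eta>(4)[of t] \<psi>(2)[of t] tZ by (auto simp: W_def)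
      have cu: "continuous_on S u" for S
        using u unfolding adapted_def by (auto intro: continuous_on_subset)
      have "\<exists>w. same_gap Z t w \<and> u w = 0"
      proof (cases "u t2 = 0")
        case True then show ?thesis using g2 by blast
      next
        case False
        then have op: "(u t < 0 \<and> u t2 > 0) \<or> (u t > 0 \<and> u t2 < 0)"
          using ne t2(2) tW by (metis linorder_neqE_linordered_idom sgn_1_neg sgn_1_pos)
        have root: "\<exists>x. a \<le> x \<and> x \<le> b \<and> u x = 0"
          if "a \<le> b" "(u a < 0 \<and> u b > 0) \<or> (u a > 0 \<and> u b < 0)" for a b
          using that(2)
        proof
          assume "u a < 0 \<and> u b > 0"
          then show ?thesis using IVT'[of u a 0 b, OF _ _ that(1) cu] by auto
        next
          assume "u a > 0 \<and> u b < 0"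
          then show ?thesis using IVT2'[of u b 0 a, OF _ _ that(1) cu] by auto
        qed
        show ?thesis
        proof (cases "t \<le> t2")
          case True
          then have "\<exists>x. t \<le> x \<and> x \<le> t2 \<and> u x = 0" using op by (rule root)
          then show ?thesis using same_gap_between[OF g2] by blast
        next
          case False
          then have "t2 \<le> t" by simp
          then have "\<exists>x. t2 \<le> x \<and> x \<le> t \<and> u x = 0" by (rule root) (use op in blast)
          then show ?thesis using same_gap_between[OF same_gap_sym[OF g2]] same_gap_trans[OF g2] by blast
        qed
      qed
      then obtain w where w: "same_gap Z t w" "u w = 0" by blast
      then have wW: "w \<in> W" by (auto simp: W_def same_gap_def)
      have vw: "v (\<eta> w) = 0" using \<eta>(4) \<psi>(2) wW by simp
      have gw: "same_gap Z (\<eta> t) (\<eta> w)"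
        using gap\<eta>[OF tZ] gap\<eta>[of w] w wW same_gap_sym same_gap_trans unfolding W_def by blast
      have st: "s t = s (\<eta> t)" "s t = s w" "s t = s (\<eta> w)"
        using s_gap gap\<eta>[OF tZ] w(1) gw by metis+
      have "t \<noteq> w" using tW w by auto
      then have "sgn (s t * u t) = sgn (s t * v (\<eta> t))"
      proof (cases "t < w")
        case True
        have "\<eta> t < \<eta> w" using True \<eta>(1) by (simp add: strict_mono_def)
        then have "s t * u t < 0" "s t * v (\<eta> t) < 0"
          using adapted_mono[OF u True w(1)] adapted_mono[OF v _ gw] w vw st by auto
        then show ?thesis by simp
      next
        case False
        then have "w < t" using \<open>t \<noteq> w\<close> by simp
        then have "\<eta> w < \<eta> t" using \<eta>(1) by (simp add: strict_mono_def)
        then have "s t * u t > 0" "s t * v (\<eta> t) > 0"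
          using adapted_mono[OF u \<open>w < t\<close> same_gap_sym[OF w(1)]]
            adapted_mono[OF v _ same_gap_sym[OF gw]] w vw st by auto
        then show ?thesis by simp
      qed
      then show False using ne s_nz[OF tZ] by (simp add: sgn_mult sgn_0_0)
    qed
  qed
  then show thesis using that \<eta> by blast
qed

end

subsection \<open>Sign-determined sets\<close>

definition sign_eq :: "('e \<Rightarrow> real) set \<Rightarrow> 'e \<Rightarrow> 'e \<Rightarrow> bool" where
  "sign_eq F x y \<longleftrightarrow> (\<forall>p\<in>F. sgn (p x) = sgn (p y))"

lemmas real_polynomial_const = real_polynomial_function.intros(2)
lemmas real_polynomial_mult = real_polynomial_function.intros(4)

lemma sgn_eq_iff: "sgn (a::real) = sgn b \<longleftrightarrow> (a > 0 \<longleftrightarrow> b > 0) \<and> (a < 0 \<longleftrightarrow> b < 0)"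
  by (simp add: sgn_if)

lemma sign_eq_sym: "sign_eq F x y \<Longrightarrow> sign_eq F y x"
  by (auto simp: sign_eq_def)

lemma sign_eq_subset: "sign_eq F x y \<Longrightarrow> G \<subseteq> F \<Longrightarrow> sign_eq G x y"
  by (auto simp: sign_eq_def)

definition sign_determined :: "('e \<Rightarrow> real) set \<Rightarrow> 'e set \<Rightarrow> bool" where
  "sign_determined F S \<longleftrightarrow> (\<forall>x y. sign_eq F x y \<longrightarrow> x \<in> S \<longrightarrow> y \<in> S)"

text \<open>Finitely many polynomials have finitely many sign vectors, so a set that depends only on
  the sign vector is a finite union of cells, each of them basic. In this form complements and
  intersections are immediate.\<close>

lemma semialgebraic_iff_sign_determined:
  "semialgebraic S \<longleftrightarrow> (\<exists>F. finite F \<and> Ball F real_polynomial_function \<and> sign_determined F S)"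
proof
  assume "semialgebraic S"
  then obtain B where B: "finite B" "\<And>b. b \<in> B \<Longrightarrow> basic_semialgebraic b" "S = \<Union>B"
    unfolding semialgebraic_def by (metis (no_types))
  have "\<forall>b\<in>B. \<exists>F. finite F \<and> Ball F real_polynomial_function \<and> sign_determined F b"
  proof
    fix b assume "b \<in> B"
    from B(2)[OF this] obtain P Q where PQ: "finite P" "finite Q" "\<forall>p\<in>P \<union> Q. real_polynomial_function p"
      "b = {x. (\<forall>p\<in>P. p x > 0) \<and> (\<forall>q\<in>Q. q x = 0)}"
      unfolding basic_semialgebraic_def by (elim exE conjE) (rule that)
    have "sign_determined (P \<union> Q) b"
      unfolding sign_determined_def
    proof (intro allI impI)
      fix x y assume e: "sign_eq (P \<union> Q) x y" and x: "x \<in> b"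
      have "p y > 0" if "p \<in> P" for p
      proof -
        have "sgn (p x) = sgn (p y)" using e that unfolding sign_eq_def by blast
        moreover have "p x > 0" using x that unfolding PQ(4) by blast
        ultimately show ?thesis by (metis sgn_1_pos)
      qed
      moreover have "q y = 0" if "q \<in> Q" for q
      proof -
        have "sgn (q x) = sgn (q y)" using e that unfolding sign_eq_def by blast
        moreover have "q x = 0" using x that unfolding PQ(4) by blast
        ultimately show ?thesis by (metis sgn_0_0)
      qed
      ultimately show "y \<in> b" unfolding PQ(4) by blast
    qed
    then show "\<exists>F. finite F \<and> Ball F real_polynomial_function \<and> sign_determined F b"
      using PQ by (intro exI[of _ "P \<union> Q"]) auto
  qed
  then obtain F where F: "\<And>b. b \<in> B \<Longrightarrow> finite (F b)" "\<And>b. b \<in> B \<Longrightarrow> Ball (F b) real_polynomial_function"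
    "\<And>b. b \<in> B \<Longrightarrow> sign_determined (F b) b" by metis
  have "sign_determined (\<Union>b\<in>B. F b) S"
    unfolding sign_determined_def
  proof (intro allI impI)
    fix x y assume e: "sign_eq (\<Union>b\<in>B. F b) x y" and x: "x \<in> S"
    then obtain b where b: "b \<in> B" "x \<in> b" using B(3) by auto
    then have "sign_eq (F b) x y" using e by (auto intro: sign_eq_subset)
    then have "y \<in> b" using F(3)[OF b(1)] b(2) unfolding sign_determined_def by blast
    then show "y \<in> S" using b B(3) by auto
  qed
  then show "\<exists>F. finite F \<and> Ball F real_polynomial_function \<and> sign_determined F S"
    using F B(1) by (intro exI[of _ "\<Union>b\<in>B. F b"]) auto
next
  assume "\<exists>F. finite F \<and> Ball F real_polynomial_function \<and> sign_determined F S"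
  then obtain F where F: "finite F" "Ball F real_polynomial_function" "sign_determined F S" by blast
  define cell where "cell x = {y. sign_eq F x y}" for x
  \<comment> \<open>A cell is coded by the sets of members of \<open>F\<close> that are positive and
    negative on it, so there are finitely many cells.\<close>
  define h where "h = (\<lambda>(A, B). {y. \<forall>p\<in>F. (p \<in> A \<longleftrightarrow> p y > 0) \<and> (p \<in> B \<longleftrightarrow> p y < 0)})"
  have "cell x = h ({p\<in>F. p x > 0}, {p\<in>F. p x < 0})" for x
    unfolding cell_def sign_eq_def sgn_eq_iff h_def prod.case by (intro Collect_cong) blast
  then have "cell x \<in> h ` (Pow F \<times> Pow F)" for x by (rule image_eqI) auto
  then have "cell ` S \<subseteq> h ` (Pow F \<times> Pow F)" by blast
  then have "finite (cell ` S)" by (rule finite_subset) (use F(1) in auto)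
  moreover have "basic_semialgebraic (cell x)" for x
    unfolding basic_semialgebraic_def
  proof (intro exI conjI)
    let ?P = "{p\<in>F. p x > 0} \<union> (\<lambda>p y. - p y) ` {p\<in>F. p x < 0}"
    let ?Q = "{p\<in>F. p x = 0}"
    show "finite ?P" "finite ?Q" using F(1) by auto
    show "\<forall>p\<in>?P \<union> ?Q. real_polynomial_function p" using F(2) by auto
    show "cell x = {y. (\<forall>p\<in>?P. p y > 0) \<and> (\<forall>q\<in>?Q. q y = 0)}"
    proof (intro set_eqI iffI)
      fix y assume "y \<in> cell x"
      then show "y \<in> {y. (\<forall>p\<in>?P. p y > 0) \<and> (\<forall>q\<in>?Q. q y = 0)}"
        unfolding cell_def sign_eq_def by (force simp: sgn_eq_iff)
    next
      fix y assume y: "y \<in> {y. (\<forall>p\<in>?P. p y > 0) \<and> (\<forall>q\<in>?Q. q y = 0)}"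
      have "sgn (p x) = sgn (p y)" if "p \<in> F" for p
      proof -
        consider "p x > 0" | "p x < 0" | "p x = 0" by linarith
        then show ?thesis
        proof cases
          case 2
          then have "(\<lambda>y. - p y) \<in> ?P" using that by blast
          with y[unfolded mem_Collect_eq, THEN conjunct1] have "- p y > 0" by (rule bspec)
          then show ?thesis using 2 by simp
        qed (use y that in \<open>auto simp: sgn_eq_iff\<close>)
      qed
      then show "y \<in> cell x" by (auto simp: cell_def sign_eq_def)
    qed
  qed
  moreover have "S = \<Union>(cell ` S)"
    using F(3) unfolding sign_determined_def cell_def by (auto simp: sign_eq_def)
  ultimately show "semialgebraic S"
    unfolding semialgebraic_def by (intro exI[of _ "cell ` S"]) auto
qed

lemma semialgebraicE:
  assumes "semialgebraic S"
  obtains F where "finite F" "\<And>p. p \<in> F \<Longrightarrow> real_polynomial_function p"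
    "\<And>x y. sign_eq F x y \<Longrightarrow> x \<in> S \<longleftrightarrow> y \<in> S"
  using assms unfolding semialgebraic_iff_sign_determined sign_determined_def
  by (metis sign_eq_sym)

lemma semialgebraicI:
  assumes "finite F" "\<And>p. p \<in> F \<Longrightarrow> real_polynomial_function p"
    "\<And>x y. sign_eq F x y \<Longrightarrow> x \<in> S \<Longrightarrow> y \<in> S"
  shows "semialgebraic S"
  unfolding semialgebraic_iff_sign_determined sign_determined_def
  using assms by (intro exI[of _ F]) blast

named_theorems semialgebraic_intros

lemma semialgebraic_not [semialgebraic_intros]:
  assumes "semialgebraic {x. P x}" shows "semialgebraic {x. \<not> P x}"
proof -
  from semialgebraicE[OF assms] obtain F where "finite F"
    "\<And>p. p \<in> F \<Longrightarrow> real_polynomial_function p" "\<And>x y. sign_eq F x y \<Longrightarrow> P x \<longleftrightarrow> P y"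
    by auto
  then show ?thesis by (intro semialgebraicI[of F]) auto
qed

lemma semialgebraic_conj [semialgebraic_intros]:
  assumes "semialgebraic {x. P x}" "semialgebraic {x. Q x}"
  shows "semialgebraic {x. P x \<and> Q x}"
proof -
  from semialgebraicE[OF assms(1)] obtain F where F: "finite F"
    "\<And>p. p \<in> F \<Longrightarrow> real_polynomial_function p" "\<And>x y. sign_eq F x y \<Longrightarrow> P x \<longleftrightarrow> P y"
    by auto
  from semialgebraicE[OF assms(2)] obtain G where G: "finite G"
    "\<And>p. p \<in> G \<Longrightarrow> real_polynomial_function p" "\<And>x y. sign_eq G x y \<Longrightarrow> Q x \<longleftrightarrow> Q y"
    by auto
  show ?thesis
  proof (rule semialgebraicI[of "F \<union> G"])
    fix x y assume "sign_eq (F \<union> G) x y" "x \<in> {x. P x \<and> Q x}"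
    then show "y \<in> {x. P x \<and> Q x}"
      using F(3)[of x y] G(3)[of x y] by (auto simp: sign_eq_def)
  qed (use F G in auto)
qed

lemma semialgebraic_disj [semialgebraic_intros]:
  assumes "semialgebraic {x. P x}" "semialgebraic {x. Q x}"
  shows "semialgebraic {x. P x \<or> Q x}"
proof -
  have "{x. P x \<or> Q x} = {x. \<not> (\<not> P x \<and> \<not> Q x)}" by blast
  then show ?thesis
    using semialgebraic_not[OF semialgebraic_conj[OF assms[THEN semialgebraic_not]]] by (simp only:)
qed

lemma semialgebraic_imp [semialgebraic_intros]:
  assumes "semialgebraic {x. P x}" "semialgebraic {x. Q x}"
  shows "semialgebraic {x. P x \<longrightarrow> Q x}"
  using semialgebraic_disj[OF semialgebraic_not[OF assms(1)] assms(2)] by (simp only: imp_conv_disj)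

lemma semialgebraic_less [semialgebraic_intros]:
  assumes "real_polynomial_function p" "real_polynomial_function q"
  shows "semialgebraic {x. p x < q x}"
proof (rule semialgebraicI[of "{\<lambda>x. q x - p x}"])
  fix x y assume "sign_eq {\<lambda>x. q x - p x} x y" "x \<in> {x. p x < q x}"
  then have "sgn (q y - p y) = 1" by (simp add: sign_eq_def)
  then show "y \<in> {x. p x < q x}" by (simp add: sgn_1_pos)
qed (use assms in auto)

lemma semialgebraic_le [semialgebraic_intros]:
  "real_polynomial_function p \<Longrightarrow> real_polynomial_function q \<Longrightarrow> semialgebraic {x. p x \<le> q x}"
  by (simp only: not_less[symmetric] semialgebraic_not[OF semialgebraic_less[of q p]])

lemma semialgebraic_eq [semialgebraic_intros]:
  "real_polynomial_function p \<Longrightarrow> real_polynomial_function q \<Longrightarrow> semialgebraic {x. p x = q x}"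
  by (simp only: eq_iff semialgebraic_conj[OF semialgebraic_le[of p q] semialgebraic_le[of q p]])

lemma semialgebraic_const [semialgebraic_intros]: "semialgebraic {x. c}"
  by (cases c) (auto intro: semialgebraicI[of "{}"])

lemma semialgebraic_preimage:
  assumes S: "semialgebraic S" and f: "polynomial_function f"
  shows "semialgebraic {x. f x \<in> S}"
proof -
  from semialgebraicE[OF S] obtain F where F: "finite F"
    "\<And>p. p \<in> F \<Longrightarrow> real_polynomial_function p" "\<And>x y. sign_eq F x y \<Longrightarrow> x \<in> S \<longleftrightarrow> y \<in> S"
    by auto
  show ?thesis
  proof (rule semialgebraicI[of "(\<lambda>p. p \<circ> f) ` F"])
    fix x y assume "sign_eq ((\<lambda>p. p \<circ> f) ` F) x y" "x \<in> {x. f x \<in> S}"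
    then show "y \<in> {x. f x \<in> S}" using F(3)[of "f x" "f y"] by (simp add: sign_eq_def)
  qed (use F(1,2) f in \<open>auto intro: real_polynomial_function_compose\<close>)
qed

lemma semialgebraic_finite_conj:
  assumes "finite I" "\<And>i. i \<in> I \<Longrightarrow> semialgebraic {x. P i x}"
  shows "semialgebraic {x. \<forall>i\<in>I. P i x}"
  using assms
proof (induction I rule: finite_induct)
  case (insert i I)
  have "semialgebraic {x. P i x}" "semialgebraic {x. \<forall>j\<in>I. P j x}" using insert by auto
  from semialgebraic_conj[OF this] show ?case by (simp only: ball_simps)
qed (use semialgebraic_const[of True] semialgebraic_const[of False] in simp)

subsection \<open>Piecewise rational functions\<close>

text \<open>Elimination divides by leading coefficients and distinguishes cases by degrees, so its
  data are quotients of polynomials glued along semialgebraic sets. A zero denominator is allowed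
  and gives the value 0.\<close>

inductive piecewise_rational :: "('e::euclidean_space \<Rightarrow> real) \<Rightarrow> bool" where
  quot: "real_polynomial_function a \<Longrightarrow> real_polynomial_function b \<Longrightarrow>
    piecewise_rational (\<lambda>x. a x / b x)"
| branch: "semialgebraic S \<Longrightarrow> piecewise_rational f \<Longrightarrow> piecewise_rational g \<Longrightarrow>
    piecewise_rational (\<lambda>x. if x \<in> S then f x else g x)"

lemma piecewise_rational_poly: "real_polynomial_function a \<Longrightarrow> piecewise_rational a"
  using piecewise_rational.quot[of a "\<lambda>x. 1"] by (simp add: real_polynomial_const)

lemma piecewise_rational_const [simp]: "piecewise_rational (\<lambda>x. c)"
  by (intro piecewise_rational_poly real_polynomial_const)

lemma piecewise_rational_if:
  "semialgebraic {x. P x} \<Longrightarrow> piecewise_rational f \<Longrightarrow> piecewise_rational g \<Longrightarrow>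
    piecewise_rational (\<lambda>x. if P x then f x else g x)"
  using piecewise_rational.branch[of "{x. P x}"] by simp

text \<open>Operations commute with case distinctions, so closure under them has to be checked on
  quotients only.\<close>

lemma piecewise_rational_lift1:
  assumes "piecewise_rational f"
    and "\<And>a b. real_polynomial_function a \<Longrightarrow> real_polynomial_function b \<Longrightarrow>
      piecewise_rational (\<lambda>x. h x (a x / b x))"
  shows "piecewise_rational (\<lambda>x. h x (f x))"
  using assms(1)
proof induction
  case (branch S f g)
  then show ?case using piecewise_rational.branch[of S "\<lambda>x. h x (f x)" "\<lambda>x. h x (g x)"]
    by (simp add: if_distrib)
qed (use assms(2) in auto)

lemma piecewise_rational_lift2:
  fixes f g :: "'a::euclidean_space \<Rightarrow> real"
  assumes f: "piecewise_rational f" and g: "piecewise_rational g"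
    and h: "\<And>a b c d :: 'a \<Rightarrow> real. real_polynomial_function a \<Longrightarrow> real_polynomial_function b \<Longrightarrow>
      real_polynomial_function c \<Longrightarrow> real_polynomial_function d \<Longrightarrow>
      piecewise_rational (\<lambda>x. h (a x / b x) (c x / d x))"
  shows "piecewise_rational (\<lambda>x. h (f x) (g x))"
proof (rule piecewise_rational_lift1[OF f])
  fix a b :: "'a \<Rightarrow> real" assume ab: "real_polynomial_function a" "real_polynomial_function b"
  show "piecewise_rational (\<lambda>x. h (a x / b x) (g x))"
    by (rule piecewise_rational_lift1[OF g, where h = "\<lambda>x. h (a x / b x)"]) (rule h[OF ab])
qed

lemma piecewise_rational_add:
  assumes "piecewise_rational f" "piecewise_rational g"
  shows "piecewise_rational (\<lambda>x. f x + g x)"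
proof (rule piecewise_rational_lift2[OF assms])
  fix a b c d :: "'a \<Rightarrow> real"
  assume p: "real_polynomial_function a" "real_polynomial_function b" "real_polynomial_function c"
    "real_polynomial_function d"
  \<comment> \<open>Division by zero yields 0, so the common denominator is correct only where both
    denominators are nonzero.\<close>
  have "(\<lambda>x. a x / b x + c x / d x) = (\<lambda>x. if b x = 0 then c x / d x else if d x = 0 then a x / b x
      else (a x * d x + c x * b x) / (b x * d x))"
    by (auto simp: add_frac_eq)
  moreover have "piecewise_rational \<dots>"
    using p by (intro piecewise_rational_if semialgebraic_eq piecewise_rational.quot) (auto intro: real_polynomial_const)
  ultimately show "piecewise_rational (\<lambda>x. a x / b x + c x / d x)" by simp
qed

lemma piecewise_rational_mult:
  assumes "piecewise_rational f" "piecewise_rational g"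
  shows "piecewise_rational (\<lambda>x. f x * g x)"
proof (rule piecewise_rational_lift2[OF assms])
  fix a b c d :: "'a \<Rightarrow> real"
  assume p: "real_polynomial_function a" "real_polynomial_function b" "real_polynomial_function c"
    "real_polynomial_function d"
  then show "piecewise_rational (\<lambda>x. a x / b x * (c x / d x))"
    using piecewise_rational.quot[of "\<lambda>x. a x * c x" "\<lambda>x. b x * d x"] by (simp add: real_polynomial_mult)
qed

lemma piecewise_rational_inverse:
  assumes "piecewise_rational f"
  shows "piecewise_rational (\<lambda>x. inverse (f x))"
proof (rule piecewise_rational_lift1[OF assms])
  fix a b :: "'a \<Rightarrow> real"
  assume "real_polynomial_function a" "real_polynomial_function b"
  then show "piecewise_rational (\<lambda>x. inverse (a x / b x))"
    using piecewise_rational.quot[of b a] by simp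
qed

lemma piecewise_rational_minus:
  "piecewise_rational f \<Longrightarrow> piecewise_rational (\<lambda>x. - f x)"
  using piecewise_rational_mult[of "\<lambda>x. -1" f] by simp

lemma piecewise_rational_sum:
  assumes "finite I" "\<And>i. i \<in> I \<Longrightarrow> piecewise_rational (f i)"
  shows "piecewise_rational (\<lambda>x. \<Sum>i\<in>I. f i x)"
  using assms by (induction I rule: finite_induct) (auto intro: piecewise_rational_add)

lemma semialgebraic_piecewise_rational:
  assumes "piecewise_rational f" shows "semialgebraic {x. f x > 0}"
  using assms
proof induction
  case (quot a b)
  have "{x. a x / b x > 0} = {x. a x * b x > 0}" by (auto simp: zero_less_divide_iff zero_less_mult_iff)
  then show ?case using quot by (auto intro!: semialgebraic_less)
next
  case (branch S f g)
  have "{x. (if x \<in> S then f x else g x) > 0} = {x. (x \<in> S \<and> f x > 0) \<or> (\<not> x \<in> S \<and> g x > 0)}" by auto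
  then show ?case using branch by (auto intro!: semialgebraic_intros)
qed

lemma semialgebraic_piecewise_rational_eq0:
  assumes "piecewise_rational f" shows "semialgebraic {x. f x = 0}"
proof -
  have "{x. f x = 0} = {x. \<not> f x > 0 \<and> \<not> - f x > 0}" by auto
  then show ?thesis using assms
    by (auto intro!: semialgebraic_conj semialgebraic_not semialgebraic_piecewise_rational
       intro: piecewise_rational_minus simp only:)
qed

text \<open>Piecewise rational functions have semialgebraic signs, so allowing them in the data that
  determines a set gives nothing new.\<close>

lemma semialgebraic_sign_determined:
  assumes "finite F" "\<And>f. f \<in> F \<Longrightarrow> piecewise_rational f"
    and S: "\<And>x y. sign_eq F x y \<Longrightarrow> x \<in> S \<Longrightarrow> y \<in> S"
  shows "semialgebraic S"
proof -
  have "\<forall>f\<in>F. \<exists>G. finite G \<and> Ball G real_polynomial_function \<and>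
      (\<forall>x y. sign_eq G x y \<longrightarrow> (f x > 0 \<longleftrightarrow> f y > 0) \<and> (f x < 0 \<longleftrightarrow> f y < 0))"
  proof
    fix f assume f: "f \<in> F"
    have f': "piecewise_rational f" "piecewise_rational (\<lambda>x. - f x)"
      using assms(2)[OF f] piecewise_rational_minus by auto
    from semialgebraicE[OF semialgebraic_piecewise_rational[OF f'(1)]] obtain G1 where G1: "finite G1"
      "\<And>p. p \<in> G1 \<Longrightarrow> real_polynomial_function p" "\<And>x y. sign_eq G1 x y \<Longrightarrow> f x > 0 \<longleftrightarrow> f y > 0"
      by auto
    from semialgebraicE[OF semialgebraic_piecewise_rational[OF f'(2)]] obtain G2 where G2: "finite G2"
      "\<And>p. p \<in> G2 \<Longrightarrow> real_polynomial_function p" "\<And>x y. sign_eq G2 x y \<Longrightarrow> f x < 0 \<longleftrightarrow> f y < 0"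
      by auto
    show "\<exists>G. finite G \<and> Ball G real_polynomial_function \<and>
      (\<forall>x y. sign_eq G x y \<longrightarrow> (f x > 0 \<longleftrightarrow> f y > 0) \<and> (f x < 0 \<longleftrightarrow> f y < 0))"
      using G1 G2 by (intro exI[of _ "G1 \<union> G2"]) (auto dest: sign_eq_subset[of "G1 \<union> G2"])
  qed
  then obtain G where G: "\<And>f. f \<in> F \<Longrightarrow> finite (G f)" "\<And>f. f \<in> F \<Longrightarrow> Ball (G f) real_polynomial_function"
    "\<And>f x y. f \<in> F \<Longrightarrow> sign_eq (G f) x y \<Longrightarrow> (f x > 0 \<longleftrightarrow> f y > 0) \<and> (f x < 0 \<longleftrightarrow> f y < 0)" by metis
  show ?thesis
  proof (rule semialgebraicI[of "\<Union>(G ` F)"])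
    fix x y assume e: "sign_eq (\<Union>(G ` F)) x y" and x: "x \<in> S"
    have "sgn (f x) = sgn (f y)" if "f \<in> F" for f
    proof -
      have "sign_eq (G f) x y" using e that by (auto intro: sign_eq_subset)
      from G(3)[OF that this] show ?thesis by (simp add: sgn_eq_iff)
    qed
    then show "y \<in> S" using S x by (auto simp: sign_eq_def)
  qed (use assms(1) G in auto)
qed

subsection \<open>Polynomials with piecewise rational coefficients\<close>

definition parametric_poly :: "('e::euclidean_space \<Rightarrow> real poly) \<Rightarrow> bool" where
  "parametric_poly P \<longleftrightarrow> (\<exists>d. \<forall>x. degree (P x) \<le> d) \<and> (\<forall>i. piecewise_rational (\<lambda>x. coeff (P x) i))"

lemma parametric_poly_add:
  assumes "parametric_poly P" "parametric_poly Q" shows "parametric_poly (\<lambda>x. P x + Q x)"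
proof -
  obtain d e where "\<And>x. degree (P x) \<le> d" "\<And>x. degree (Q x) \<le> e"
    using assms unfolding parametric_poly_def by blast
  then have "degree (P x + Q x) \<le> max d e" for x
    by (intro degree_add_le) (auto intro: le_max_iff_disj[THEN iffD2])
  then show ?thesis using assms unfolding parametric_poly_def
    by (auto intro: piecewise_rational_add)
qed

lemma parametric_poly_mult:
  assumes "parametric_poly P" "parametric_poly Q" shows "parametric_poly (\<lambda>x. P x * Q x)"
proof -
  obtain d e where "\<And>x. degree (P x) \<le> d" "\<And>x. degree (Q x) \<le> e"
    using assms unfolding parametric_poly_def by blast
  then have "degree (P x * Q x) \<le> d + e" for x
    using degree_mult_le[of "P x" "Q x"] by (meson add_mono order_trans)
  then show ?thesis using assms unfolding parametric_poly_def coeff_mult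
    by (auto intro!: piecewise_rational_sum piecewise_rational_mult)
qed

lemma parametric_poly_pderiv:
  assumes "parametric_poly P" shows "parametric_poly (\<lambda>x. pderiv (P x))"
proof -
  obtain d where d: "\<And>x. degree (P x) \<le> d" using assms unfolding parametric_poly_def by blast
  have "degree (pderiv (P x)) \<le> d" for x
    using d[of x] by (simp add: degree_pderiv)
  then show ?thesis using assms unfolding parametric_poly_def coeff_pderiv
    by (auto intro!: piecewise_rational_mult)
qed

lemma parametric_poly_if:
  assumes "semialgebraic {x. A x}" "parametric_poly P" "parametric_poly Q"
  shows "parametric_poly (\<lambda>x. if A x then P x else Q x)"
proof -
  obtain d e where "\<And>x. degree (P x) \<le> d" "\<And>x. degree (Q x) \<le> e"
    using assms unfolding parametric_poly_def by blast
  then have "degree (if A x then P x else Q x) \<le> max d e" for x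
    by (auto intro: le_max_iff_disj[THEN iffD2])
  moreover have "coeff (if A x then P x else Q x) i = (if A x then coeff (P x) i else coeff (Q x) i)"
    for x i by simp
  ultimately show ?thesis using assms unfolding parametric_poly_def
    by (intro conjI exI[of _ "max d e"]) (auto intro!: piecewise_rational_if simp del: if_split)
qed

lemma parametric_poly_monom:
  assumes "piecewise_rational f" shows "parametric_poly (\<lambda>x. monom (f x) n)"
proof -
  have "degree (monom (f x) n) \<le> n" for x by (rule degree_monom_le)
  moreover have "piecewise_rational (\<lambda>x. coeff (monom (f x) n) i)" for i
    using assms by (cases "i = n") auto
  ultimately show ?thesis unfolding parametric_poly_def by auto
qed

lemma parametric_poly_const [simp]: "parametric_poly (\<lambda>x. c)"
  unfolding parametric_poly_def by auto

text \<open>The uniform degree bound turns the vanishing of all higher coefficients into a finite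
  conjunction.\<close>

lemma semialgebraic_degree:
  assumes "parametric_poly Q" shows "semialgebraic {x. Q x \<noteq> 0 \<and> degree (Q x) = n}"
proof -
  obtain e where e: "\<And>x. degree (Q x) \<le> e" using assms unfolding parametric_poly_def by blast
  have "Q x \<noteq> 0 \<and> degree (Q x) = n \<longleftrightarrow> \<not> coeff (Q x) n = 0 \<and> (\<forall>i\<in>{n<..e}. coeff (Q x) i = 0)" for x
  proof
    assume "Q x \<noteq> 0 \<and> degree (Q x) = n"
    then show "\<not> coeff (Q x) n = 0 \<and> (\<forall>i\<in>{n<..e}. coeff (Q x) i = 0)"
      by (metis coeff_eq_0 greaterThanAtMost_iff leading_coeff_0_iff)
  next
    assume a: "\<not> coeff (Q x) n = 0 \<and> (\<forall>i\<in>{n<..e}. coeff (Q x) i = 0)"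
    have "coeff (Q x) i = 0" if "i > n" for i
      using a that e[of x] coeff_eq_0[of "Q x" i] by (cases "i \<le> e") auto
    then have "degree (Q x) \<le> n" by (intro degree_le) auto
    then show "Q x \<noteq> 0 \<and> degree (Q x) = n" using a le_degree[of "Q x" n] by auto
  qed
  moreover have "semialgebraic {x. \<not> coeff (Q x) n = 0 \<and> (\<forall>i\<in>{n<..e}. coeff (Q x) i = 0)}"
    using assms unfolding parametric_poly_def
    by (intro semialgebraic_conj semialgebraic_not semialgebraic_finite_conj
        semialgebraic_piecewise_rational_eq0) auto
  ultimately show ?thesis by simp
qed

text \<open>Long division, by induction on a bound for the degree of the dividend. At parameters
  where \<open>Q\<close> has degree \<open>n\<close> its leading coefficient can be inverted;
  elsewhere the dividend is replaced by 0, which preserves the bound.\<close>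

lemma parametric_poly_mod_fixed_degree:
  assumes Q: "parametric_poly Q" and P: "parametric_poly P"
    and m: "\<And>x i. m \<le> i \<Longrightarrow> coeff (P x) i = 0"
  shows "\<exists>R. parametric_poly R \<and> (\<forall>x. Q x \<noteq> 0 \<and> degree (Q x) = n \<longrightarrow> R x = P x mod Q x)"
  using P m
proof (induction m arbitrary: P)
  case 0
  then have "P x = 0" for x by (intro poly_eqI) simp
  then show ?case by (intro exI[of _ "\<lambda>x. 0"]) simp
next
  case (Suc m)
  show ?case
  proof (cases "m < n")
    case True
    have "P x = P x mod Q x" if "Q x \<noteq> 0" "degree (Q x) = n" for x
    proof -
      have "degree (P x) \<le> m" using Suc.prems(2) by (intro degree_le) auto
      then show ?thesis using True that by (simp add: mod_poly_less)
    qed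
    then show ?thesis using Suc.prems(1) by blast
  next
    case False
    let ?T = "\<lambda>x. Q x \<noteq> 0 \<and> degree (Q x) = n"
    let ?c = "\<lambda>x. - (coeff (P x) m * inverse (coeff (Q x) n))"
    \<comment> \<open>One division step: the coefficient at \<open>m\<close> is cancelled by a
      multiple of \<open>Q\<close>, which leaves the remainder unchanged.\<close>
    define P1 where "P1 x = (if ?T x then P x + monom (?c x) (m - n) * Q x else 0)" for x
    have "parametric_poly P1" unfolding P1_def
      by (intro parametric_poly_if semialgebraic_degree Q parametric_poly_add Suc.prems(1)
          parametric_poly_mult parametric_poly_monom piecewise_rational_minus piecewise_rational_mult
          piecewise_rational_inverse parametric_poly_const)
         (use Q Suc.prems(1) in \<open>auto simp: parametric_poly_def\<close>)
    moreover have "coeff (P1 x) i = 0" if "m \<le> i" for x i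
    proof (cases "?T x")
      case T: True
      have co: "coeff (P1 x) i = coeff (P x) i + ?c x * coeff (Q x) (i - (m - n))"
        using T that by (simp add: P1_def coeff_monom_mult)
      show ?thesis
      proof (cases "i = m")
        case True
        have "coeff (Q x) n \<noteq> 0" using T by (metis leading_coeff_0_iff)
        then show ?thesis using co True False by simp
      next
        case i: False
        have "coeff (P x) i = 0" using Suc.prems(2)[of i x] that i by simp
        moreover have "coeff (Q x) (i - (m - n)) = 0"
          using T that i False by (intro coeff_eq_0) auto
        ultimately show ?thesis using co by simp
      qed
    qed (auto simp: P1_def)
    ultimately obtain R where R: "parametric_poly R" "\<And>x. ?T x \<Longrightarrow> R x = P1 x mod Q x"
      using Suc.IH by blast
    have "P1 x mod Q x = P x mod Q x" if "?T x" for x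
      using that by (simp add: P1_def)
    then show ?thesis using R by (intro exI[of _ R]) auto
  qed
qed

text \<open>Since \<open>p mod 0 = p\<close>, the value 0 is set for a vanishing divisor: the degree
  has to drop at every parameter for the induction in
  \<open>diagram_determined_finite\<close>.\<close>

definition param_mod :: "('e \<Rightarrow> real poly) \<Rightarrow> ('e \<Rightarrow> real poly) \<Rightarrow> 'e \<Rightarrow> real poly" where
  "param_mod P Q x = (if Q x = 0 then 0 else P x mod Q x)"

lemma parametric_poly_mod:
  assumes P: "parametric_poly P" and Q: "parametric_poly Q"
  shows "parametric_poly (param_mod P Q)"
proof -
  obtain d where d: "\<And>x. degree (P x) \<le> d" using P unfolding parametric_poly_def by blast
  obtain e where e: "\<And>x. degree (Q x) \<le> e" using Q unfolding parametric_poly_def by blast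
  have "\<exists>R. parametric_poly R \<and> (\<forall>x. R x = (if Q x \<noteq> 0 \<and> degree (Q x) < k then P x mod Q x else 0))" for k
  proof (induction k)
    case 0 show ?case by (intro exI[of _ "\<lambda>x. 0"]) auto
  next
    case (Suc k)
    then obtain R where R: "parametric_poly R"
      "\<And>x. R x = (if Q x \<noteq> 0 \<and> degree (Q x) < k then P x mod Q x else 0)" by blast
    obtain R' where R': "parametric_poly R'" "\<And>x. Q x \<noteq> 0 \<and> degree (Q x) = k \<Longrightarrow> R' x = P x mod Q x"
      using parametric_poly_mod_fixed_degree[OF Q P, of "Suc d" k] d
      by (metis coeff_eq_0 le_less_trans less_eq_Suc_le)
    show ?case
    proof (intro exI conjI)
      show "parametric_poly (\<lambda>x. if Q x \<noteq> 0 \<and> degree (Q x) = k then R' x else R x)"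
        by (intro parametric_poly_if semialgebraic_degree Q R R')
    qed (use R(2) R'(2) in \<open>auto simp: less_Suc_eq\<close>)
  qed
  then obtain R where R: "parametric_poly R"
    "\<And>x. R x = (if Q x \<noteq> 0 \<and> degree (Q x) < Suc e then P x mod Q x else 0)" by blast
  have "R = param_mod P Q" using R(2) e by (auto simp: param_mod_def fun_eq_iff less_Suc_eq_le)
  then show ?thesis using R(1) by simp
qed

lemma polynomial_on_line:
  assumes "real_polynomial_function p"
  shows "\<exists>P. parametric_poly P \<and> (\<forall>x t. poly (P x) t = p (x + t *\<^sub>R b))"
  using assms
proof induction
  case (linear f)
  interpret bounded_linear f by fact
  have "parametric_poly (\<lambda>x. monom (f x) 0 + monom (f b) 1)"
    by (intro parametric_poly_add parametric_poly_monom piecewise_rational_poly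
        real_polynomial_function.intros(1) piecewise_rational_const) fact
  then show ?case by (intro exI conjI) (auto simp: add scale poly_monom)
next
  case (const c)
  show ?case by (intro exI[of _ "\<lambda>x. [:c:]"]) auto
next
  case (add f g)
  then obtain P Q where "parametric_poly P" "\<forall>x t. poly (P x) t = f (x + t *\<^sub>R b)"
    "parametric_poly Q" "\<forall>x t. poly (Q x) t = g (x + t *\<^sub>R b)" by blast
  then show ?case by (intro exI[of _ "\<lambda>x. P x + Q x"]) (auto intro: parametric_poly_add)
next
  case (mult f g)
  then obtain P Q where "parametric_poly P" "\<forall>x t. poly (P x) t = f (x + t *\<^sub>R b)"
    "parametric_poly Q" "\<forall>x t. poly (Q x) t = g (x + t *\<^sub>R b)" by blast
  then show ?case by (intro exI[of _ "\<lambda>x. P x * Q x"]) (auto intro: parametric_poly_mult)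
qed

subsection \<open>Sign diagrams\<close>

lemma sgn_poly_same_gap:
  fixes r :: "real poly"
  assumes "same_gap Z a b" "\<And>t. poly r t = 0 \<Longrightarrow> t \<in> Z"
  shows "sgn (poly r a) = sgn (poly r b)"
proof -
  have cont: "continuous_on S (poly r)" for S
    by (intro continuous_at_imp_continuous_on ballI poly_isCont)
  have *: "sgn (poly r a) = sgn (poly r b)" if "same_gap Z a b" "a \<le> b" for a b
  proof (rule ccontr)
    assume ne: "sgn (poly r a) \<noteq> sgn (poly r b)"
    have nz: "poly r a \<noteq> 0" "poly r b \<noteq> 0" using assms(2) that(1) unfolding same_gap_def by blast+
    have "\<exists>x. a \<le> x \<and> x \<le> b \<and> poly r x = 0"
    proof (cases "poly r a < 0")
      case True
      then have "poly r b > 0" using ne nz by (auto simp: sgn_if split: if_splits)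
      then show ?thesis using IVT'[of "poly r" a 0 b] True that(2) cont by auto
    next
      case False
      then have "poly r b < 0" "poly r a > 0" using ne nz by (auto simp: sgn_if split: if_splits)
      then show ?thesis using IVT2'[of "poly r" b 0 a] that(2) cont by auto
    qed
    then obtain x where "a \<le> x" "x \<le> b" "poly r x = 0" by blast
    moreover from this have "same_gap Z a x" using same_gap_between that(1) by blast
    ultimately show False using assms(2) unfolding same_gap_def by blast
  qed
  show ?thesis
    using *[OF assms(1)] *[OF same_gap_sym[OF assms(1)], symmetric] by (meson linear)
qed

text \<open>The leading coefficients of a nonconstant polynomial and of its derivative have the same
  sign, and this sign prevails near infinity.\<close>

lemma poly_right_end:
  fixes p :: "real poly"
  assumes "\<And>t. a \<le> t \<Longrightarrow> sgn (poly (pderiv p) t) = \<sigma>" "\<sigma> \<noteq> 0"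
  shows "\<exists>b>a. \<sigma> * poly p b > 0"
proof -
  have main: "\<exists>b>a. poly p b > 0" if lc: "lead_coeff p > 0" for p :: "real poly"
  proof -
    obtain n where "\<And>x. x \<ge> n \<Longrightarrow> lead_coeff p \<le> poly p x" using poly_pinfty_gt_lc[OF lc] by blast
    from this[of "max n (a+1)"] lc show ?thesis by (intro exI[of _ "max n (a+1)"]) auto
  qed
  have dp: "pderiv p \<noteq> 0" using assms(1)[of a] assms(2) by auto
  then have deg: "degree p \<noteq> 0" using pderiv_eq_0_iff by blast
  have lcd: "lead_coeff (pderiv p) = real (degree p) * lead_coeff p"
    using deg by (simp add: coeff_pderiv degree_pderiv)
  have lc: "lead_coeff p \<noteq> 0" using deg by auto
  show ?thesis
  proof (cases "lead_coeff p > 0")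
    case True
    then have "lead_coeff (pderiv p) > 0" using lcd deg by simp
    then obtain n where "\<And>x. x \<ge> n \<Longrightarrow> lead_coeff (pderiv p) \<le> poly (pderiv p) x"
      using poly_pinfty_gt_lc by blast
    from this[of "max n a"] \<open>lead_coeff (pderiv p) > 0\<close> have "poly (pderiv p) (max n a) > 0" by simp
    then have "\<sigma> = 1" using assms(1)[of "max n a"] by simp
    then show ?thesis using main[OF True] by simp
  next
    case False
    then have "lead_coeff p < 0" using lc by linarith
    then have neg: "lead_coeff (- p) > 0" by simp
    have "lead_coeff (- pderiv p) > 0" using neg lcd deg by (simp add: mult_less_0_iff mult_pos_neg)
    then obtain n where "\<And>x. x \<ge> n \<Longrightarrow> lead_coeff (- pderiv p) \<le> poly (- pderiv p) x"
      using poly_pinfty_gt_lc by blast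
    from this[of "max n a"] \<open>lead_coeff (- pderiv p) > 0\<close> have "poly (pderiv p) (max n a) < 0" by simp
    then have "\<sigma> = -1" using assms(1)[of "max n a"] by simp
    then show ?thesis using main[OF neg] by auto
  qed
qed

lemma poly_left_end:
  fixes p :: "real poly"
  assumes "\<And>t. t \<le> a \<Longrightarrow> sgn (poly (pderiv p) t) = \<sigma>" "\<sigma> \<noteq> 0"
  shows "\<exists>b<a. \<sigma> * poly p b < 0"
proof -
  define q where "q = pcompose p [:0, -1:]"
  have q: "poly q x = poly p (- x)" "poly (pderiv q) x = - poly (pderiv p) (- x)" for x
    by (simp_all add: q_def poly_pcompose pderiv_pcompose pderiv_pCons)
  have "\<exists>b>-a. - \<sigma> * poly q b > 0"
    by (rule poly_right_end) (use assms in \<open>auto simp: q sgn_minus\<close>)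
  then obtain b where "b > - a" "- \<sigma> * poly q b > 0" by blast
  then show ?thesis using q by (intro exI[of _ "- b"]) auto
qed

text \<open>The central step of the Cohen--Hoermander procedure. \<open>Z\<close> collects the roots
  at \<open>x\<close> of the nonzero members of \<open>PP\<close>. Between them the derivative keeps
  its sign, so \<open>p\<close> and the transported \<open>q\<close> are adapted; by
  \<open>roots\<close> their signs agree on \<open>Z\<close>, and
  \<open>sign_reparametrization\<close> matches the zeros inside the gaps.\<close>

lemma sign_diagram_extend:
  fixes PP :: "('e \<Rightarrow> real poly) set"
  assumes fin: "finite PP" and \<phi>: "strict_mono \<phi>" "surj \<phi>"
    and match: "\<And>R t. R \<in> PP \<Longrightarrow> sgn (poly (R x) t) = sgn (poly (R y) (\<phi> t))"
    and D: "D \<in> PP" "D x = pderiv p" "D y = pderiv q" "pderiv p \<noteq> 0"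
    and roots: "\<And>R t. R \<in> PP \<Longrightarrow> R x \<noteq> 0 \<Longrightarrow> poly (R x) t = 0 \<Longrightarrow> sgn (poly p t) = sgn (poly q (\<phi> t))"
  obtains \<phi>' where "strict_mono \<phi>'" "surj \<phi>'" "\<And>t. sgn (poly p t) = sgn (poly q (\<phi>' t))"
    "\<And>R t. R \<in> PP \<Longrightarrow> sgn (poly (R x) t) = sgn (poly (R y) (\<phi>' t))"
proof -
  define Z where "Z = (\<Union>R\<in>{R\<in>PP. R x \<noteq> 0}. {t. poly (R x) t = 0})"
  define s where "s t = sgn (poly (pderiv p) t)" for t
  have finZ: "finite Z" unfolding Z_def using fin by (auto intro: poly_roots_finite)
  have gapR: "sgn (poly (R x) a) = sgn (poly (R x) b)" if "R \<in> PP" "same_gap Z a b" for R a b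
    by (cases "R x = 0") (use that in \<open>auto intro!: sgn_poly_same_gap[of Z] simp: Z_def\<close>)
  interpret gap_monotone Z s
  proof
    show "finite Z" by (rule finZ)
    show "s t \<noteq> 0" if "t \<notin> Z" for t
      using that D unfolding Z_def s_def by (auto simp: sgn_0_0)
    show "s a = s b" if "same_gap Z a b" for a b
      using gapR[OF D(1) that] D by (simp add: s_def)
  qed
  have q': "sgn (poly (pderiv q) (\<phi> t)) = s t" for t
    using match[OF D(1), of t] D by (simp add: s_def)
  have cont\<phi>: "continuous_on UNIV \<phi>"
    by (rule continuous_onI_mono) (use \<phi> in \<open>auto simp: strict_mono_less_eq\<close>)
  define u where "u = poly p"
  define v where "v t = poly q (\<phi> t)" for t
  have mvt: "0 < s a * (poly r c' - poly r c)"
    if cc: "c < c'" and sg: "\<And>\<xi>. c < \<xi> \<Longrightarrow> \<xi> < c' \<Longrightarrow> sgn (poly (pderiv r) \<xi>) = s a" and a: "a \<notin> Z"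
    for r c c' a
  proof -
    obtain \<xi> where \<xi>: "c < \<xi>" "\<xi> < c'" "poly r c' - poly r c = (c' - c) * poly (pderiv r) \<xi>"
      using poly_MVT[OF cc, of r] by blast
    have "poly (pderiv r) \<xi> \<noteq> 0" using sg[OF \<xi>(1,2)] s_nz[OF a] by auto
    then have "s a * poly (pderiv r) \<xi> > 0"
      using sg[OF \<xi>(1,2), symmetric] by (simp add: sgn_if)
    then have "0 < (c' - c) * (s a * poly (pderiv r) \<xi>)" using cc by simp
    then show ?thesis unfolding \<xi>(3) by (simp add: mult.left_commute)
  qed
  have adu: "adapted u" unfolding adapted_def
  proof (intro conjI allI impI)
    show "continuous_on UNIV u" by (auto simp: u_def intro: continuous_intros)
    fix a b :: real assume ab: "a < b" "same_gap Z a b"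
    show "0 < s a * (u b - u a)" unfolding u_def
    proof (rule mvt[OF ab(1)])
      show "sgn (poly (pderiv p) \<xi>) = s a" if "a < \<xi>" "\<xi> < b" for \<xi>
        using s_gap[OF same_gap_between[OF ab(2), of \<xi>]] that by (simp add: s_def)
    qed (use ab(2) in \<open>auto simp: same_gap_def\<close>)
  next
    fix a assume a: "\<forall>z\<in>Z. z < a"
    show "\<exists>b>a. 0 < s a * u b" unfolding u_def
    proof (rule poly_right_end)
      show "sgn (poly (pderiv p) t) = s a" if "a \<le> t" for t
        using s_gap[of a t] a that by (force simp: s_def same_gap_def)
    qed (use a s_nz[of a] in auto)
  next
    fix a assume a: "\<forall>z\<in>Z. a < z"
    show "\<exists>b<a. s a * u b < 0" unfolding u_def
    proof (rule poly_left_end)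
      show "sgn (poly (pderiv p) t) = s a" if "t \<le> a" for t
        using s_gap[of a t] a that by (force simp: s_def same_gap_def)
    qed (use a s_nz[of a] in auto)
  qed
  have adv: "adapted v" unfolding adapted_def
  proof (intro conjI allI impI)
    show "continuous_on UNIV v" unfolding v_def
      by (intro continuous_intros cont\<phi>)
    fix a b :: real assume ab: "a < b" "same_gap Z a b"
    show "0 < s a * (v b - v a)" unfolding v_def
    proof (rule mvt)
      show "\<phi> a < \<phi> b" using ab \<phi>(1) by (simp add: strict_mono_def)
      show "sgn (poly (pderiv q) \<xi>) = s a" if "\<phi> a < \<xi>" "\<xi> < \<phi> b" for \<xi>
      proof -
        obtain c where c: "\<xi> = \<phi> c" using \<phi>(2) by (metis surj_def)
        then have "a < c" "c < b" using that strict_mono_less[OF \<phi>(1)] by auto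
        then show ?thesis using s_gap[OF same_gap_between[OF ab(2), of c]] q' c by simp
      qed
    qed (use ab(2) in \<open>auto simp: same_gap_def\<close>)
  next
    fix a assume a: "\<forall>z\<in>Z. z < a"
    have "\<exists>b>\<phi> a. 0 < s a * poly q b"
    proof (rule poly_right_end)
      show "sgn (poly (pderiv q) t) = s a" if "\<phi> a \<le> t" for t
      proof -
        obtain c where c: "t = \<phi> c" using \<phi>(2) by (metis surj_def)
        then have "a \<le> c" using that strict_mono_less_eq[OF \<phi>(1)] by auto
        then show ?thesis using s_gap[of a c] a c q' by (force simp: same_gap_def)
      qed
    qed (use a s_nz[of a] in auto)
    then obtain b where b: "b > \<phi> a" "0 < s a * poly q b" by blast
    obtain c where c: "b = \<phi> c" using \<phi>(2) by (metis surj_def)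
    then show "\<exists>b>a. 0 < s a * v b" using b strict_mono_less[OF \<phi>(1)] unfolding v_def by auto
  next
    fix a assume a: "\<forall>z\<in>Z. a < z"
    have "\<exists>b<\<phi> a. s a * poly q b < 0"
    proof (rule poly_left_end)
      show "sgn (poly (pderiv q) t) = s a" if "t \<le> \<phi> a" for t
      proof -
        obtain c where c: "t = \<phi> c" using \<phi>(2) by (metis surj_def)
        then have "c \<le> a" using that strict_mono_less_eq[OF \<phi>(1)] by auto
        then show ?thesis using s_gap[of a c] a c q' by (force simp: same_gap_def)
      qed
    qed (use a s_nz[of a] in auto)
    then obtain b where b: "b < \<phi> a" "s a * poly q b < 0" by blast
    obtain c where c: "b = \<phi> c" using \<phi>(2) by (metis surj_def)
    then show "\<exists>b<a. s a * v b < 0" using b strict_mono_less[OF \<phi>(1)] unfolding v_def by auto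
  qed
  have "sgn (u z) = sgn (v z)" if "z \<in> Z" for z
    using that roots unfolding Z_def u_def v_def by auto
  moreover have "finite {t. u t = 0}"
  proof -
    have "p \<noteq> 0" using D(4) by auto
    then show ?thesis unfolding u_def by (rule poly_roots_finite)
  qed
  ultimately obtain \<eta> where \<eta>: "strict_mono \<eta>" "surj \<eta>" "\<And>z. z \<in> Z \<Longrightarrow> \<eta> z = z"
    "\<And>t. sgn (u t) = sgn (v (\<eta> t))"
    using sign_reparametrization[OF adu adv] by metis
  show thesis
  proof (rule that[of "\<phi> \<circ> \<eta>"])
    show "strict_mono (\<phi> \<circ> \<eta>)" using \<phi>(1) \<eta>(1) by (simp add: strict_mono_def)
    show "surj (\<phi> \<circ> \<eta>)" by (rule comp_surj[OF \<eta>(2) \<phi>(2)])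
    show "sgn (poly p t) = sgn (poly q ((\<phi> \<circ> \<eta>) t))" for t
      using \<eta>(4)[of t] by (simp add: u_def v_def)
    show "sgn (poly (R x) t) = sgn (poly (R y) ((\<phi> \<circ> \<eta>) t))" if R: "R \<in> PP" for R t
    proof -
      \<comment> \<open>An increasing bijection that fixes \<open>Z\<close> maps each gap into
        itself, so the signs already matched survive.\<close>
      have "sgn (poly (R x) t) = sgn (poly (R x) (\<eta> t))"
      proof (cases "t \<in> Z")
        case False
        have "same_gap Z t (\<eta> t)"
          unfolding same_gap_def
          using False \<eta>(3) strict_mono_less[OF \<eta>(1)] strict_mono_eq[OF \<eta>(1)] by metis
        then show ?thesis by (rule gapR[OF R])
      qed (use \<eta>(3) in auto)
      then show ?thesis using match[OF R, of "\<eta> t"] by simp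
    qed
  qed
qed

text \<open>A sign diagram records the order of the roots of the family and the signs at and between
  them. An increasing bijection of the line that matches all signs expresses equality of two
  diagrams without naming any root.\<close>

definition diagram_determined :: "('e::euclidean_space \<Rightarrow> real poly) set \<Rightarrow> bool" where
  "diagram_determined PP \<longleftrightarrow> (\<exists>F. finite F \<and> (\<forall>f\<in>F. piecewise_rational f) \<and>
     (\<forall>x y. sign_eq F x y \<longrightarrow> (\<exists>\<phi>. strict_mono \<phi> \<and> surj \<phi> \<and>
        (\<forall>P\<in>PP. \<forall>t. sgn (poly (P x) t) = sgn (poly (P y) (\<phi> t))))))"

lemma poly_degree_0: "degree p = 0 \<Longrightarrow> poly p t = coeff p 0" for p :: "real poly"
  by (metis degree_eq_zeroE coeff_pCons_0 poly_pCons poly_0 mult_zero_right add.right_neutral)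

text \<open>At a root of \<open>R\<close> the sign of \<open>P\<close> is that of
  \<open>P mod R\<close>. So the diagram of the derivative, the other members and these remainders
  supplies the hypothesis \<open>roots\<close> of \<open>sign_diagram_extend\<close>.\<close>

lemma diagram_determined_insert:
  assumes fin: "finite PP" and P: "parametric_poly P" and D: "D = (\<lambda>x. pderiv (P x))"
    and det: "diagram_determined (insert D PP \<union> param_mod P ` insert D PP)"
  shows "diagram_determined (insert P PP)"
proof -
  from det obtain F where F: "finite F" "\<forall>f\<in>F. piecewise_rational f"
    and F': "\<And>x y. sign_eq F x y \<Longrightarrow> \<exists>\<phi>. strict_mono \<phi> \<and> surj \<phi> \<and>
      (\<forall>P\<in>insert D PP \<union> param_mod P ` insert D PP. \<forall>t. sgn (poly (P x) t) = sgn (poly (P y) (\<phi> t)))"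
    unfolding diagram_determined_def by blast
  \<comment> \<open>Decides the sign of \<open>P\<close> at parameters where its derivative vanishes
    identically.\<close>
  let ?c = "\<lambda>x. coeff (P x) 0"
  show ?thesis unfolding diagram_determined_def
  proof (intro exI[of _ "insert ?c F"] conjI allI impI)
    show "finite (insert ?c F)" using F by simp
    show "\<forall>f\<in>insert ?c F. piecewise_rational f" using F P by (auto simp: parametric_poly_def)
    fix x y assume e: "sign_eq (insert ?c F) x y"
    then have "sign_eq F x y" by (auto intro: sign_eq_subset)
    from F'[OF this] obtain \<phi> where \<phi>12: "strict_mono \<phi>" "surj \<phi>" and \<phi>3:
      "\<forall>R \<in> insert D PP \<union> param_mod P ` insert D PP. \<forall>t. sgn (poly (R x) t) = sgn (poly (R y) (\<phi> t))"
      by blast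
    note \<phi> = \<phi>12 \<phi>3[rule_format]
    have zero: "R x = 0 \<longleftrightarrow> R y = 0" if "R \<in> insert D PP" for R
    proof -
      have "poly (R x) t = 0 \<longleftrightarrow> poly (R y) (\<phi> t) = 0" for t
        using \<phi>(3)[of R t] that by (metis UnI1 sgn_0_0)
      then have "(\<forall>t. poly (R x) t = 0) \<longleftrightarrow> (\<forall>t. poly (R y) t = 0)" using \<phi>(2) by (metis surj_def)
      then show ?thesis by (simp add: poly_all_0_iff_0)
    qed
    show "\<exists>\<phi>. strict_mono \<phi> \<and> surj \<phi> \<and> (\<forall>P\<in>insert P PP. \<forall>t. sgn (poly (P x) t) = sgn (poly (P y) (\<phi> t)))"
    proof (cases "pderiv (P x) = 0")
      case True
      then have "pderiv (P y) = 0" using zero[of D] by (simp add: D)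
      then have "degree (P x) = 0" "degree (P y) = 0" using True pderiv_eq_0_iff by blast+
      then have "sgn (poly (P x) t) = sgn (poly (P y) (\<phi> t))" for t
        using e by (simp add: poly_degree_0 sign_eq_def)
      then show ?thesis using \<phi> by (intro exI[of _ \<phi>]) auto
    next
      case False
      have "sgn (poly (P x) t) = sgn (poly (P y) (\<phi> t))"
        if R: "R \<in> insert D PP" "R x \<noteq> 0" "poly (R x) t = 0" for R t
      proof -
        have Ry: "R y \<noteq> 0" using zero[OF R(1)] R(2) by simp
        have ry: "poly (R y) (\<phi> t) = 0" using \<phi>(3)[of R t] R by (metis UnI1 sgn_0_0)
        have "poly (P z) s = poly (param_mod P R z) s" if "R z \<noteq> 0" "poly (R z) s = 0" for z s
        proof -
          have "P z = P z div R z * R z + P z mod R z" by simp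
          from this have "poly (P z) s = poly (P z div R z * R z + P z mod R z) s" by presburger
          also have "\<dots> = poly (P z mod R z) s" by (simp only: poly_add poly_mult that(2) mult_zero_right add_0_left)
          finally show ?thesis using that(1) by (simp add: param_mod_def)
        qed
        then show ?thesis using \<phi>(3)[of "param_mod P R" t] R Ry ry by auto
      qed
      moreover have "D \<in> insert D PP" "D x = pderiv (P x)" "D y = pderiv (P y)" by (auto simp: D)
      ultimately obtain \<phi>' where "strict_mono \<phi>'" "surj \<phi>'" "\<And>t. sgn (poly (P x) t) = sgn (poly (P y) (\<phi>' t))"
        "\<And>R t. R \<in> insert D PP \<Longrightarrow> sgn (poly (R x) t) = sgn (poly (R y) (\<phi>' t))"
        using sign_diagram_extend[of "insert D PP" \<phi> x y D "P x" "P y"] \<phi> fin False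
        by (metis UnI1 finite_insert)
      then show ?thesis by (intro exI[of _ \<phi>']) auto
    qed
  qed
qed

text \<open>Induction on the degree: members of top degree are removed one by one, each in exchange
  for its derivative and for remainders, all of smaller degree.\<close>

lemma diagram_determined_finite:
  assumes "finite PP" "\<And>P. P \<in> PP \<Longrightarrow> parametric_poly P"
  shows "diagram_determined PP"
proof -
  have bounded: "diagram_determined PP" if "finite PP"
    "\<And>P. P \<in> PP \<Longrightarrow> parametric_poly P \<and> (\<forall>x. degree (P x) \<le> d)" for d and PP :: "('a \<Rightarrow> real poly) set"
    using that
  proof (induction d arbitrary: PP)
    case 0
    show ?case unfolding diagram_determined_def
    proof (intro exI[of _ "(\<lambda>P x. coeff (P x) 0) ` PP"] conjI allI impI)
      fix x y assume "sign_eq ((\<lambda>P x. coeff (P x) 0) ` PP) x y"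
      then have "sgn (coeff (P x) 0) = sgn (coeff (P y) 0)" if "P \<in> PP" for P
        using that unfolding sign_eq_def by (metis (mono_tags, lifting) imageI)
      moreover have "poly (P x) t = coeff (P x) 0" if "P \<in> PP" for P x t
        using 0(2)[OF that] by (simp add: poly_degree_0)
      ultimately show "\<exists>\<phi>. strict_mono \<phi> \<and> surj \<phi> \<and> (\<forall>P\<in>PP. \<forall>t. sgn (poly (P x) t) = sgn (poly (P y) (\<phi> t)))"
        by (intro exI[of _ "\<lambda>t. t"]) (auto simp: strict_mono_def)
    qed (use 0 in \<open>auto simp: parametric_poly_def\<close>)
  next
    case (Suc d)
    \<comment> \<open>\<open>H\<close> holds members that may have degree \<open>Suc d\<close>,
      \<open>L\<close> those of degree at most \<open>d\<close>. Only \<open>H\<close> is counted by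
      the inner induction, so \<open>L\<close> may grow.\<close>
    have "diagram_determined (H \<union> L)"
      if "finite H" "finite L" "\<And>P. P \<in> H \<Longrightarrow> parametric_poly P \<and> (\<forall>x. degree (P x) \<le> Suc d)"
        "\<And>P. P \<in> L \<Longrightarrow> parametric_poly P \<and> (\<forall>x. degree (P x) \<le> d)" for H L :: "('a \<Rightarrow> real poly) set"
      using that
    proof (induction H arbitrary: L rule: finite_induct)
      case empty
      then show ?case using Suc.IH[of L] by auto
    next
      case (insert P H)
      define D where "D = (\<lambda>x. pderiv (P x))"
      have PP: "parametric_poly P" "\<And>x. degree (P x) \<le> Suc d" using insert.prems by auto
      have Dp: "parametric_poly D" using parametric_poly_pderiv[OF PP(1)] by (simp add: D_def)
      have Dd: "degree (D x) \<le> d" for x using PP(2)[of x] by (simp add: D_def degree_pderiv)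
      have all: "parametric_poly R" "degree (R x) \<le> Suc d" if "R \<in> insert D (H \<union> L)" for R x
        using that insert.prems(2)[of R] insert.prems(3)[of R] Dp Dd[of x] by (auto intro: le_SucI)
      have "degree (param_mod P R x) \<le> d" if "R \<in> insert D (H \<union> L)" for R x
      proof (cases "R x = 0")
        case False
        have "degree (R x) \<le> Suc d" by (rule all(2)[OF that])
        then show ?thesis using degree_mod_less[OF False, of "P x"] False by (auto simp: param_mod_def)
      qed (auto simp: param_mod_def)
      then have "diagram_determined (H \<union> (insert D L \<union> param_mod P ` insert D (H \<union> L)))"
        using insert.hyps insert.prems Dp Dd all(1) parametric_poly_mod[OF PP(1)]
        by (intro insert.IH) auto
      moreover have "H \<union> (insert D L \<union> param_mod P ` insert D (H \<union> L)) =
         insert D (H \<union> L) \<union> param_mod P ` insert D (H \<union> L)" by auto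
      ultimately have "diagram_determined (insert P (H \<union> L))"
        using insert.hyps insert.prems(1)
        by (intro diagram_determined_insert[OF _ PP(1) D_def]) (simp_all only: finite_Un)
      then show ?case by (simp only: Un_insert_left)
    qed
    from this[OF Suc.prems(1) finite.emptyI Suc.prems(2)] show ?case by simp
  qed
  have "\<forall>P\<in>PP. \<exists>d. \<forall>x. degree (P x) \<le> d" using assms unfolding parametric_poly_def by blast
  then obtain d where d: "\<And>P x. P \<in> PP \<Longrightarrow> degree (P x) \<le> d P" by metis
  have "degree (P x) \<le> sum d PP" if "P \<in> PP" for P x
    using d[OF that, of x] member_le_sum[OF that, of d] assms(1) by auto
  then show ?thesis using bounded[of PP "sum d PP"] assms by blast
qed

subsection \<open>The Tarski--Seidenberg theorem\<close>

text \<open>When the defining polynomials have equal sign diagrams on the lines through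
  \<open>x\<close> and \<open>y\<close>, the bijection of the parameters carries a point of
  \<open>S\<close> on the first line to a point of \<open>S\<close> on the second.\<close>

lemma semialgebraic_line_projection:
  assumes "semialgebraic S" shows "semialgebraic {x. \<exists>t. x + t *\<^sub>R b \<in> S}"
proof -
  from semialgebraicE[OF assms] obtain F where F: "finite F"
    "\<And>p. p \<in> F \<Longrightarrow> real_polynomial_function p" "\<And>x y. sign_eq F x y \<Longrightarrow> x \<in> S \<longleftrightarrow> y \<in> S" by metis
  have "\<forall>p\<in>F. \<exists>P. parametric_poly P \<and> (\<forall>x t. poly (P x) t = p (x + t *\<^sub>R b))"
    using polynomial_on_line F(2) by blast
  then obtain P where P: "\<And>p. p \<in> F \<Longrightarrow> parametric_poly (P p)"
    "\<And>p x t. p \<in> F \<Longrightarrow> poly (P p x) t = p (x + t *\<^sub>R b)" by metis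
  have "diagram_determined (P ` F)" using F(1) P(1) by (intro diagram_determined_finite) auto
  then obtain G where G: "finite G" "\<forall>f\<in>G. piecewise_rational f"
    and G': "\<And>x y. sign_eq G x y \<Longrightarrow> \<exists>\<phi>. \<forall>R\<in>P ` F. \<forall>t. sgn (poly (R x) t) = sgn (poly (R y) (\<phi> t))"
    unfolding diagram_determined_def by meson
  show ?thesis
  proof (rule semialgebraic_sign_determined[of G])
    fix x y assume "sign_eq G x y" "x \<in> {x. \<exists>t. x + t *\<^sub>R b \<in> S}"
    then obtain \<phi> t where *: "\<forall>R\<in>P ` F. \<forall>t. sgn (poly (R x) t) = sgn (poly (R y) (\<phi> t))"
      "x + t *\<^sub>R b \<in> S" using G' by blast
    have "sgn (p (x + t *\<^sub>R b)) = sgn (p (y + \<phi> t *\<^sub>R b))" if "p \<in> F" for p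
      using *(1) that P(2)[OF that] by (metis imageI)
    then have "sign_eq F (x + t *\<^sub>R b) (y + \<phi> t *\<^sub>R b)" by (simp add: sign_eq_def)
    then show "y \<in> {x. \<exists>t. x + t *\<^sub>R b \<in> S}" using F(3) *(2) by blast
  qed (use G in auto)
qed

theorem semialgebraic_Ex:
  fixes P :: "'a::euclidean_space \<Rightarrow> 'b::euclidean_space \<Rightarrow> bool"
  assumes "semialgebraic {z. P (fst z) (snd z)}"
  shows "semialgebraic {x. \<exists>y. P x y}"
proof -
  let ?S = "{z. P (fst z) (snd z)}"
  \<comment> \<open>Both components of \<open>z\<close> are kept and only the added vector ranges
    over a span, so that enlarging \<open>B\<close> by one vector is a projection along a single
    direction.\<close>
  have "semialgebraic {z. \<exists>w\<in>span B. z + (0, w) \<in> ?S}" if "finite B" for B :: "'b set"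
    using that
  proof (induction B rule: finite_induct)
    case empty
    show ?case using assms by simp
  next
    case (insert b B)
    have "(\<exists>w\<in>span (insert b B). z + (0, w) \<in> ?S) \<longleftrightarrow>
       (\<exists>t. z + t *\<^sub>R (0, b) \<in> {z. \<exists>w\<in>span B. z + (0, w) \<in> ?S})" for z :: "'a \<times> 'b"
    proof
      assume "\<exists>w\<in>span (insert b B). z + (0, w) \<in> ?S"
      then obtain w k where wk: "z + (0, w) \<in> ?S" "w - k *\<^sub>R b \<in> span B" unfolding span_insert by blast
      have "z + k *\<^sub>R (0, b) + (0, w - k *\<^sub>R b) = z + (0, w)" by (simp add: prod_eq_iff)
      then show "\<exists>t. z + t *\<^sub>R (0, b) \<in> {z. \<exists>w\<in>span B. z + (0, w) \<in> ?S}"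
        using wk by (intro exI[of _ k] CollectI bexI[of _ "w - k *\<^sub>R b"]) auto
    next
      assume "\<exists>t. z + t *\<^sub>R (0, b) \<in> {z. \<exists>w\<in>span B. z + (0, w) \<in> ?S}"
      then obtain t w where tw: "w \<in> span B" "z + t *\<^sub>R (0, b) + (0, w) \<in> ?S" by blast
      have "z + (0, t *\<^sub>R b + w) = z + t *\<^sub>R (0, b) + (0, w)" by (simp add: prod_eq_iff)
      moreover have "t *\<^sub>R b + w \<in> span (insert b B)"
        unfolding span_insert using tw(1) by (intro CollectI exI[of _ t]) simp
      ultimately show "\<exists>w\<in>span (insert b B). z + (0, w) \<in> ?S" using tw(2) by metis
    qed
    then show ?case using semialgebraic_line_projection[OF insert.IH, of "(0, b)"] by simp
  qed
  from this[of Basis] have "semialgebraic {z. \<exists>w. z + (0, w) \<in> ?S}" by simp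
  moreover have "polynomial_function (\<lambda>x::'a. (x, 0::'b))"
    by (intro polynomial_function_bounded_linear bounded_linear_Pair bounded_linear_ident bounded_linear_zero)
  ultimately have "semialgebraic {x. (x, 0) \<in> {z. \<exists>w. z + (0, w) \<in> ?S}}"
    by (rule semialgebraic_preimage)
  then show ?thesis by simp
qed

theorem semialgebraic_All:
  fixes P :: "'a::euclidean_space \<Rightarrow> 'b::euclidean_space \<Rightarrow> bool"
  assumes "semialgebraic {z. P (fst z) (snd z)}"
  shows "semialgebraic {x. \<forall>y. P x y}"
proof -
  have "{x. \<forall>y. P x y} = {x. \<not> (\<exists>y. \<not> P x y)}" by blast
  moreover have "semialgebraic {x. \<exists>y. \<not> P x y}"
    by (rule semialgebraic_Ex, rule semialgebraic_not, rule assms)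
  ultimately show ?thesis by (simp only: semialgebraic_not)
qed

subsection \<open>Polynomial maps\<close>

named_theorems poly_intros

lemmas [poly_intros] = polynomial_function_id[unfolded id_def] polynomial_function_const
  polynomial_function_add polynomial_function_diff polynomial_function_minus polynomial_function_mult

lemma polynomial_function_bounded_linear_compose:
  assumes "bounded_linear h" "polynomial_function f" shows "polynomial_function (\<lambda>x. h (f x))"
  using polynomial_function_compose[OF assms(2) polynomial_function_bounded_linear[OF assms(1)]]
  by (simp add: o_def)

lemma polynomial_function_fst [poly_intros]:
  "polynomial_function f \<Longrightarrow> polynomial_function (\<lambda>x. fst (f x))"
  by (rule polynomial_function_bounded_linear_compose[OF bounded_linear_fst])

lemma polynomial_function_snd [poly_intros]:
  "polynomial_function f \<Longrightarrow> polynomial_function (\<lambda>x. snd (f x))"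
  by (rule polynomial_function_bounded_linear_compose[OF bounded_linear_snd])

lemma polynomial_function_Pair [poly_intros]:
  assumes "polynomial_function f" "polynomial_function g" shows "polynomial_function (\<lambda>x. (f x, g x))"
proof -
  have "polynomial_function (\<lambda>x. (f x, 0) + (0, g x))"
    using assms
    by (intro polynomial_function_add polynomial_function_bounded_linear_compose[of "\<lambda>x. (x, 0)"]
      polynomial_function_bounded_linear_compose[of "\<lambda>x. (0, x)"])
      (auto intro: bounded_linear_Pair bounded_linear_ident bounded_linear_zero)
  then show ?thesis by simp
qed

lemma polynomial_function_times [poly_intros]:
  fixes f g :: "'a::euclidean_space \<Rightarrow> real"
  shows "polynomial_function f \<Longrightarrow> polynomial_function g \<Longrightarrow> polynomial_function (\<lambda>x. f x * g x)"
  using real_polynomial_mult by (simp add: real_polynomial_function_eq[symmetric])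

lemma polynomial_function_inner [poly_intros]:
  fixes f g :: "'a::euclidean_space \<Rightarrow> 'b::euclidean_space"
  assumes "polynomial_function f" "polynomial_function g"
  shows "polynomial_function (\<lambda>x. f x \<bullet> g x)"
proof -
  have "real_polynomial_function (\<lambda>x. \<Sum>b\<in>Basis. (f x \<bullet> b) * (g x \<bullet> b))"
    using assms polynomial_function_iff_Basis_inner[of f] polynomial_function_iff_Basis_inner[of g]
    by (intro real_polynomial_function_sum real_polynomial_mult) auto
  then show ?thesis by (simp add: euclidean_inner[symmetric] real_polynomial_function_eq)
qed

lemmas semialgebraic_relations [semialgebraic_intros] =
  semialgebraic_less[unfolded real_polynomial_function_eq]
  semialgebraic_le[unfolded real_polynomial_function_eq]
  semialgebraic_eq[unfolded real_polynomial_function_eq]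

lemmas [semialgebraic_intros] = semialgebraic_Ex semialgebraic_All

lemmas [semialgebraic_intros del] = semialgebraic_less semialgebraic_le semialgebraic_eq

subsection \<open>Semialgebraic sets fibred over a line\<close>

text \<open>The breakpoints of a fibre are roots of polynomials whose degrees are bounded
  independently of \<open>s\<close>; a polynomial that vanishes on the whole fibre never changes
  sign there and contributes none. The uniform \<open>K\<close> is what bounds the number of
  crossings of a level.\<close>

lemma semialgebraic_fibre_gaps:
  fixes W :: "('e::euclidean_space \<times> real) set"
  assumes "semialgebraic W"
  obtains K where "\<And>s. \<exists>Z. finite Z \<and> card Z \<le> K \<and>
    (\<forall>a b. same_gap Z a b \<longrightarrow> (s, a) \<in> W \<longrightarrow> (s, b) \<in> W)"
proof -
  from semialgebraicE[OF assms] obtain F where F: "finite F"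
    "\<And>p. p \<in> F \<Longrightarrow> real_polynomial_function p" "\<And>x y. sign_eq F x y \<Longrightarrow> x \<in> W \<longleftrightarrow> y \<in> W" by metis
  have "\<forall>p\<in>F. \<exists>P. parametric_poly P \<and> (\<forall>x t. poly (P x) t = p (x + t *\<^sub>R (0, 1)))"
    using polynomial_on_line F(2) by blast
  then obtain P where P: "\<And>p. p \<in> F \<Longrightarrow> parametric_poly (P p)"
    "\<And>p x t. p \<in> F \<Longrightarrow> poly (P p x) t = p (x + t *\<^sub>R (0, 1))" by metis
  have "\<forall>p\<in>F. \<exists>d. \<forall>x. degree (P p x) \<le> d" using P(1) unfolding parametric_poly_def by blast
  then obtain d where d: "\<And>p x. p \<in> F \<Longrightarrow> degree (P p x) \<le> d p" by metis
  show thesis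
  proof (rule that[of "sum d F"])
    fix s
    define G where "G = {p\<in>F. P p (s, 0) \<noteq> 0}"
    define Z where "Z = (\<Union>p\<in>G. {t. poly (P p (s, 0)) t = 0})"
    have "finite Z" using F(1) unfolding Z_def G_def by (auto intro: poly_roots_finite)
    moreover have "card Z \<le> sum d F"
    proof -
      have "card Z \<le> (\<Sum>p\<in>G. card {t. poly (P p (s, 0)) t = 0})"
        unfolding Z_def using F(1) by (intro card_UN_le) (auto simp: G_def)
      also have "\<dots> \<le> sum d G"
        using d by (intro sum_mono) (auto simp: G_def intro: order_trans[OF card_poly_roots_bound])
      also have "\<dots> \<le> sum d F" using F(1) by (intro sum_mono2) (auto simp: G_def)
      finally show ?thesis .
    qed
    moreover have "(s, b) \<in> W" if ab: "same_gap Z a b" "(s, a) \<in> W" for a b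
    proof -
      have "sgn (p (s, a)) = sgn (p (s, b))" if p: "p \<in> F" for p
      proof -
        have "sgn (poly (P p (s, 0)) a) = sgn (poly (P p (s, 0)) b)"
        proof (cases "P p (s, 0) = 0")
          case False
          then show ?thesis using p ab(1) by (intro sgn_poly_same_gap[of Z]) (auto simp: Z_def G_def)
        qed simp
        then show ?thesis using P(2)[OF p] by simp
      qed
      then show ?thesis using F(3)[of "(s, a)" "(s, b)"] ab(2) by (auto simp: sign_eq_def)
    qed
    ultimately show "\<exists>Z. finite Z \<and> card Z \<le> sum d F \<and>
      (\<forall>a b. same_gap Z a b \<longrightarrow> (s, a) \<in> W \<longrightarrow> (s, b) \<in> W)" by blast
  qed
qed

lemma semialgebraic_real_gaps:
  fixes T :: "real set"
  assumes "semialgebraic T"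
  shows "\<exists>Z. finite Z \<and> (\<forall>a b. same_gap Z a b \<longrightarrow> a \<in> T \<longrightarrow> b \<in> T)"
proof -
  have "semialgebraic {z :: real \<times> real. snd z \<in> T}"
    by (intro semialgebraic_preimage assms poly_intros)
  from semialgebraic_fibre_gaps[OF this] obtain K where K: "\<And>s. \<exists>Z. finite Z \<and> card Z \<le> K \<and>
    (\<forall>a b. same_gap Z a b \<longrightarrow> (s, a) \<in> {z :: real \<times> real. snd z \<in> T} \<longrightarrow> (s, b) \<in> {z. snd z \<in> T})" by metis
  from K[of 0] show ?thesis by auto
qed

lemma semialgebraic_real_right_germ:
  fixes T :: "real set"
  assumes "semialgebraic T"
  obtains \<delta> where "\<delta> > 0" "{a<..<a+\<delta>} \<subseteq> T \<or> {a<..<a+\<delta>} \<inter> T = {}"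
proof -
  obtain Z where Z: "finite Z" "\<And>a b. same_gap Z a b \<Longrightarrow> a \<in> T \<Longrightarrow> b \<in> T"
    using semialgebraic_real_gaps[OF assms] by blast
  obtain d where d: "d > 0" "\<And>z. z \<in> Z \<Longrightarrow> z \<noteq> a \<Longrightarrow> d \<le> dist a z"
    using finite_set_avoid[OF Z(1)] by metis
  have g: "same_gap Z x y" if "a < x" "x < a + d" "a < y" "y < a + d" for x y
    unfolding same_gap_def
  proof
    fix z assume "z \<in> Z"
    then have "z = a \<or> d \<le> \<bar>a - z\<bar>" using d(2) by (auto simp: dist_real_def)
    then show "z \<noteq> x \<and> z \<noteq> y \<and> (z < x \<longleftrightarrow> z < y)" using that by linarith
  qed
  show thesis
  proof (rule that[OF d(1)], cases "\<exists>x. a < x \<and> x < a + d \<and> x \<in> T")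
    case True
    then obtain x where x: "a < x" "x < a + d" "x \<in> T" by blast
    show "{a<..<a+d} \<subseteq> T \<or> {a<..<a+d} \<inter> T = {}"
      using Z(2)[OF g[OF x(1,2)] x(3)] by auto
  qed auto
qed

lemma semialgebraic_real_infinite:
  fixes T :: "real set"
  assumes "semialgebraic T" "infinite T"
  obtains a b where "a < b" "{a<..<b} \<subseteq> T"
proof -
  obtain Z where Z: "finite Z" "\<And>a b. same_gap Z a b \<Longrightarrow> a \<in> T \<Longrightarrow> b \<in> T"
    using semialgebraic_real_gaps[OF assms(1)] by blast
  obtain t where t: "t \<in> T" "t \<notin> Z" using assms(2) Z(1) by (meson finite_subset subsetI)
  obtain d where d: "d > 0" "\<And>z. z \<in> Z \<Longrightarrow> z \<noteq> t \<Longrightarrow> d \<le> dist t z"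
    using finite_set_avoid[OF Z(1)] by metis
  have "same_gap Z t x" if "t < x" "x < t + d" for x
    unfolding same_gap_def
  proof
    fix z assume "z \<in> Z"
    then have "z \<noteq> t \<and> d \<le> \<bar>t - z\<bar>" using d(2) t(2) by (auto simp: dist_real_def)
    then show "z \<noteq> t \<and> z \<noteq> x \<and> (z < t \<longleftrightarrow> z < x)" using that by linarith
  qed
  then have "{t<..<t+d} \<subseteq> T" using Z(2)[OF _ t(1)] by auto
  then show thesis using that[of t "t + d"] d(1) by simp
qed

subsection \<open>Curves of bounded variation\<close>

definition variation_bounded :: "real \<Rightarrow> real \<Rightarrow> (real \<Rightarrow> 'a::real_normed_vector) \<Rightarrow> real \<Rightarrow> bool" where
  "variation_bounded a b x K \<longleftrightarrow> (\<forall>n \<tau>. (\<forall>i<n. \<tau> i < \<tau> (Suc i)) \<longrightarrow> (\<forall>i\<le>n. a < \<tau> i \<and> \<tau> i < b) \<longrightarrow>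
     (\<Sum>i<n. norm (x (\<tau> (Suc i)) - x (\<tau> i))) \<le> K)"

text \<open>Banach's indicatrix: the variation of \<open>u\<close> is the integral over the levels \<open>s\<close> of the number of
  crossings of \<open>s\<close>, which is bounded by twice the number of roots of the polynomials describing \<open>u > s\<close>.\<close>

lemma semialgebraic_variation_bounded:
  fixes u :: "real \<Rightarrow> real"
  assumes W: "semialgebraic W" "\<And>s t. a < t \<Longrightarrow> t < b \<Longrightarrow> (s, t) \<in> W \<longleftrightarrow> s < u t"
    and R: "\<And>t. a < t \<Longrightarrow> t < b \<Longrightarrow> \<bar>u t\<bar> \<le> R"
  shows "\<exists>K. variation_bounded a b u K"
proof -
  obtain K where K: "\<And>s. \<exists>Z. finite Z \<and> card Z \<le> K \<and>
    (\<forall>a b. same_gap Z a b \<longrightarrow> (s, a) \<in> W \<longrightarrow> (s, b) \<in> W)"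
    using semialgebraic_fibre_gaps[OF W(1)] by metis
  have "(\<Sum>i<n. norm (u (\<tau> (Suc i)) - u (\<tau> i))) \<le> (2 * K) * (2 * \<bar>R\<bar>)"
    if mono: "\<forall>i<n. \<tau> i < \<tau> (Suc i)" and I: "\<forall>i\<le>n. a < \<tau> i \<and> \<tau> i < b" for n \<tau>
  proof -
    have tmono: "\<tau> i \<le> \<tau> j" if "i \<le> j" "j \<le> n" for i j
      using that
    proof (induction j rule: dec_induct)
      case (step k)
      then have "\<tau> i \<le> \<tau> k" "\<tau> k < \<tau> (Suc k)" using mono by auto
      then show ?case by simp
    qed simp
    \<comment> \<open>The levels crossed on the i-th interval. It is half-open so that membership
      means exactly that the truth of \<open>s < u\<close> changes; its measure is the
      increment.\<close>
    define J where "J i = {min (u (\<tau> i)) (u (\<tau> (Suc i))) ..< max (u (\<tau> i)) (u (\<tau> (Suc i)))}" for i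
    have J: "s \<in> J i \<longleftrightarrow> (s < u (\<tau> i)) \<noteq> (s < u (\<tau> (Suc i)))" for s i
      unfolding J_def by auto
    have count: "card {i. i < n \<and> s \<in> J i} \<le> 2 * K" for s
    proof -
      obtain Z where Z: "finite Z" "card Z \<le> K" "\<And>a b. same_gap Z a b \<Longrightarrow> (s, a) \<in> W \<Longrightarrow> (s, b) \<in> W"
        using K by metis
      \<comment> \<open>A breakpoint is charged to the closed partition intervals that contain it,
        at most two of them.\<close>
      define A where "A z = {i. i < n \<and> \<tau> i \<le> z \<and> z \<le> \<tau> (Suc i)}" for z
      have sub: "{i. i < n \<and> s \<in> J i} \<subseteq> (\<Union>z\<in>Z. A z)"
      proof
        fix i assume "i \<in> {i. i < n \<and> s \<in> J i}"
        then have i: "i < n" "(s < u (\<tau> i)) \<noteq> (s < u (\<tau> (Suc i)))" using J by auto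
        have "(s, \<tau> i) \<in> W \<longleftrightarrow> s < u (\<tau> i)" "(s, \<tau> (Suc i)) \<in> W \<longleftrightarrow> s < u (\<tau> (Suc i))"
          using W(2) I i(1) by auto
        then have "\<not> same_gap Z (\<tau> i) (\<tau> (Suc i))"
          using i(2) Z(3)[of "\<tau> i" "\<tau> (Suc i)"] Z(3)[of "\<tau> (Suc i)" "\<tau> i"] same_gap_sym by blast
        then obtain z where z: "z \<in> Z" "\<not> (z \<noteq> \<tau> i \<and> z \<noteq> \<tau> (Suc i) \<and> (z < \<tau> i \<longleftrightarrow> z < \<tau> (Suc i)))"
          unfolding same_gap_def by blast
        moreover have "\<tau> i < \<tau> (Suc i)" using mono i(1) by blast
        ultimately have "i \<in> A z" using i(1) unfolding A_def by auto
        then show "i \<in> (\<Union>z\<in>Z. A z)" using z(1) by blast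
      qed
      have cA: "card (A z) \<le> 2" for z
      proof (cases "A z = {}")
        case False
        define i0 where "i0 = Min (A z)"
        have fA: "finite (A z)" by (rule finite_subset[of _ "{..<n}"]) (auto simp: A_def)
        have i0: "i0 \<in> A z" "\<And>i. i \<in> A z \<Longrightarrow> i0 \<le> i"
          using Min_in[OF fA False] Min_le[OF fA] by (auto simp: i0_def)
        have "A z \<subseteq> {i0, Suc i0}"
        proof
          fix i assume i: "i \<in> A z"
          show "i \<in> {i0, Suc i0}"
          proof (rule ccontr)
            assume "i \<notin> {i0, Suc i0}"
            then have "Suc i0 < i" using i0(2)[OF i] by auto
            then have "\<tau> (Suc i0) \<le> \<tau> (i - 1)" "\<tau> (i - 1) < \<tau> i"
              using tmono[of "Suc i0" "i - 1"] mono[rule_format, of "i - 1"] i by (auto simp: A_def)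
            then show False using i0(1) i unfolding A_def by auto
          qed
        qed
        then have "card (A z) \<le> card {i0, Suc i0}" by (intro card_mono) auto
        then show ?thesis by simp
      qed simp
      have "card (\<Union>z\<in>Z. A z) \<le> (\<Sum>z\<in>Z. card (A z))" using Z(1) by (rule card_UN_le)
      also have "\<dots> \<le> (\<Sum>z\<in>Z. 2)" by (intro sum_mono cA)
      also have "\<dots> \<le> 2 * K" using Z(2) by simp
      finally have "card (\<Union>z\<in>Z. A z) \<le> 2 * K" .
      moreover have "finite (\<Union>z\<in>Z. A z)" using Z(1) unfolding A_def by auto
      ultimately show ?thesis using card_mono[OF _ sub] by linarith
    qed
    have JR: "J i \<subseteq> {-\<bar>R\<bar>..\<bar>R\<bar>}" if "i < n" for i
    proof -
      have "\<bar>u (\<tau> i)\<bar> \<le> R" "\<bar>u (\<tau> (Suc i))\<bar> \<le> R" using R I that by auto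
      then show ?thesis unfolding J_def by auto
    qed
    have "(\<Sum>i<n. norm (u (\<tau> (Suc i)) - u (\<tau> i))) = (\<Sum>i<n. measure lborel (J i))"
      by (intro sum.cong) (auto simp: J_def min_def max_def)
    also have "\<dots> = (\<Sum>i<n. \<integral>s. indicator (J i) s \<partial>lborel)" by simp
    also have "\<dots> = (\<integral>s. (\<Sum>i<n. indicator (J i) s) \<partial>lborel)"
      by (rule Bochner_Integration.integral_sum[symmetric]) (auto simp: J_def)
    also have "\<dots> \<le> (\<integral>s. real (2 * K) * indicator {-\<bar>R\<bar>..\<bar>R\<bar>} s \<partial>lborel)"
    proof (rule integral_mono)
      show "(\<Sum>i<n. indicator (J i) s) \<le> real (2 * K) * indicator {-\<bar>R\<bar>..\<bar>R\<bar>} s" for s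
      proof (cases "s \<in> {-\<bar>R\<bar>..\<bar>R\<bar>}")
        case True
        have "(\<Sum>i<n. indicator (J i) s :: real) = real (card {i. i < n \<and> s \<in> J i})"
          by (simp add: indicator_def sum.If_cases Int_def lessThan_def)
        then show ?thesis using count[of s] True by simp
      next
        case False
        then have "indicator (J i) s = (0::real)" if "i < n" for i using JR[OF that] by (auto simp: indicator_def)
        then show ?thesis using False by simp
      qed
    qed (auto simp: J_def)
    also have "\<dots> = (2 * K) * (2 * \<bar>R\<bar>)" by simp
    finally show ?thesis .
  qed
  then show ?thesis unfolding variation_bounded_def by blast
qed

text \<open>A lexicographic minimum: the coordinates are minimized in turn, each over the minimizers
  of the previous ones. Compactness makes the minima attained, first-order definability keeps the
  set semialgebraic, and in the end each fibre over the interval is a single point.\<close>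

lemma bounded_variation_selection:
  fixes S :: "(real \<times> 'a::euclidean_space) set"
  assumes S: "semialgebraic S"
    and cpt: "\<And>t. a < t \<Longrightarrow> t < b \<Longrightarrow> compact {x. (t, x) \<in> S}"
    and ne: "\<And>t. a < t \<Longrightarrow> t < b \<Longrightarrow> {x. (t, x) \<in> S} \<noteq> {}"
    and R: "\<And>t x. a < t \<Longrightarrow> t < b \<Longrightarrow> (t, x) \<in> S \<Longrightarrow> norm x \<le> R"
  obtains x K where "\<And>t. a < t \<Longrightarrow> t < b \<Longrightarrow> (t, x t) \<in> S" "variation_bounded a b x K"
proof -
  have "\<exists>S'\<subseteq>S. semialgebraic S' \<and>
      (\<forall>t. a < t \<longrightarrow> t < b \<longrightarrow> compact {x. (t, x) \<in> S'} \<and> {x. (t, x) \<in> S'} \<noteq> {}) \<and>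
      (\<forall>t x y c. (t, x) \<in> S' \<longrightarrow> (t, y) \<in> S' \<longrightarrow> c \<in> B \<longrightarrow> x \<bullet> c = y \<bullet> c)" if "finite B" for B
    using that
  proof (induction B rule: finite_induct)
    case empty
    then show ?case using S cpt ne by auto
  next
    case (insert c B)
    then obtain S' where S': "S' \<subseteq> S" "semialgebraic S'"
      "\<And>t. a < t \<Longrightarrow> t < b \<Longrightarrow> compact {x. (t, x) \<in> S'} \<and> {x. (t, x) \<in> S'} \<noteq> {}"
      "\<And>t x y c. (t, x) \<in> S' \<Longrightarrow> (t, y) \<in> S' \<Longrightarrow> c \<in> B \<Longrightarrow> x \<bullet> c = y \<bullet> c" by blast
    define T where "T = {z. z \<in> S' \<and> (\<forall>y. (fst z, y) \<in> S' \<longrightarrow> snd z \<bullet> c \<le> y \<bullet> c)}"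
    have t2: "semialgebraic T" unfolding T_def
      by (intro semialgebraic_intros poly_intros semialgebraic_preimage[OF S'(2)])
    have t3: "compact {x. (t, x) \<in> T} \<and> {x. (t, x) \<in> T} \<noteq> {}" if t: "a < t" "t < b" for t
    proof -
      have "\<exists>x\<in>{x. (t, x) \<in> S'}. \<forall>y\<in>{x. (t, x) \<in> S'}. x \<bullet> c \<le> y \<bullet> c"
        using S'(3)[OF t] by (intro continuous_attains_inf continuous_intros) auto
      then obtain x where x: "(t, x) \<in> S'" "\<And>y. (t, y) \<in> S' \<Longrightarrow> x \<bullet> c \<le> y \<bullet> c" by blast
      have "{x. (t, x) \<in> T} = {x. (t, x) \<in> S'} \<inter> {y. y \<bullet> c \<le> x \<bullet> c}"
        unfolding T_def using x by (auto intro: order_trans)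
      moreover have "closed {y. y \<bullet> c \<le> x \<bullet> c}" by (intro closed_Collect_le continuous_intros)
      moreover have "x \<in> {x. (t, x) \<in> S'} \<inter> {y. y \<bullet> c \<le> x \<bullet> c}" using x by auto
      ultimately show ?thesis using S'(3)[OF t] by (metis compact_Int_closed empty_iff)
    qed
    have t1: "T \<subseteq> S" using S'(1) by (auto simp: T_def)
    have t4: "x \<bullet> d = y \<bullet> d" if "(t, x) \<in> T" "(t, y) \<in> T" "d \<in> insert c B" for t x y d
    proof (cases "d = c")
      case True
      then show ?thesis using that(1,2) unfolding T_def by (intro antisym) auto
    next
      case False
      then show ?thesis using that by (intro S'(4)[of t]) (auto simp: T_def)
    qed
    show ?case
    proof (intro exI[of _ T] conjI allI impI)
      fix t assume "a < t" "t < b"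
      from t3[OF this] show "compact {x. (t, x) \<in> T}" "{x. (t, x) \<in> T} \<noteq> {}" by blast+
    next
      fix t x y d assume "(t, x) \<in> T" "(t, y) \<in> T" "d \<in> insert c B"
      then show "x \<bullet> d = y \<bullet> d" by (rule t4)
    qed (rule t1, rule t2)
  qed
  from this[OF finite_Basis] obtain S' where S': "S' \<subseteq> S" "semialgebraic S'"
    "\<And>t. a < t \<Longrightarrow> t < b \<Longrightarrow> {x. (t, x) \<in> S'} \<noteq> {}"
    "\<And>t x y c. (t, x) \<in> S' \<Longrightarrow> (t, y) \<in> S' \<Longrightarrow> c \<in> Basis \<Longrightarrow> x \<bullet> c = y \<bullet> c" by metis
  define x where "x t = (SOME x. (t, x) \<in> S')" for t
  have x: "(t, x t) \<in> S'" if "a < t" "t < b" for t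
    using S'(3)[OF that] unfolding x_def by (metis (mono_tags) Collect_empty_eq someI_ex)
  have "\<exists>K. variation_bounded a b (\<lambda>t. x t \<bullet> c) K" if c: "c \<in> Basis" for c
  proof (rule semialgebraic_variation_bounded)
    show "semialgebraic {z. \<exists>y. (snd z, y) \<in> S' \<and> fst z < y \<bullet> c}"
      by (intro semialgebraic_intros poly_intros semialgebraic_preimage[OF S'(2)])
    show "(s, t) \<in> {z. \<exists>y. (snd z, y) \<in> S' \<and> fst z < y \<bullet> c} \<longleftrightarrow> s < x t \<bullet> c" if "a < t" "t < b" for s t
    proof -
      note xt = x[OF that]
      show ?thesis
      proof
        assume "(s, t) \<in> {z. \<exists>y. (snd z, y) \<in> S' \<and> fst z < y \<bullet> c}"
        then obtain y where y: "(t, y) \<in> S'" "s < y \<bullet> c" by auto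
        from y(2) show "s < x t \<bullet> c" unfolding S'(4)[OF y(1) xt c] .
      next
        assume "s < x t \<bullet> c"
        with xt show "(s, t) \<in> {z. \<exists>y. (snd z, y) \<in> S' \<and> fst z < y \<bullet> c}"
          by (intro CollectI exI[of _ "x t"]) simp
      qed
    qed
    show "\<bar>x t \<bullet> c\<bar> \<le> R" if "a < t" "t < b" for t
      using R[OF that, of "x t"] subsetD[OF S'(1) x[OF that]] Basis_le_norm[OF c, of "x t"] by linarith
  qed
  then obtain K where K: "\<And>c. c \<in> Basis \<Longrightarrow> variation_bounded a b (\<lambda>t. x t \<bullet> c) (K c)" by metis
  have "(\<Sum>i<n. norm (x (\<tau> (Suc i)) - x (\<tau> i))) \<le> (\<Sum>c\<in>Basis. K c)"
    if "\<forall>i<n. \<tau> i < \<tau> (Suc i)" "\<forall>i\<le>n. a < \<tau> i \<and> \<tau> i < b" for n \<tau>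
  proof -
    have "(\<Sum>i<n. norm (x (\<tau> (Suc i)) - x (\<tau> i))) \<le>
        (\<Sum>i<n. \<Sum>c\<in>Basis. \<bar>(x (\<tau> (Suc i)) - x (\<tau> i)) \<bullet> c\<bar>)" by (intro sum_mono norm_le_l1)
    also have "\<dots> = (\<Sum>c\<in>Basis. \<Sum>i<n. norm (x (\<tau> (Suc i)) \<bullet> c - x (\<tau> i) \<bullet> c))"
      by (subst sum.swap) (simp add: inner_diff_left)
    also have "\<dots> \<le> (\<Sum>c\<in>Basis. K c)"
      using K[unfolded variation_bounded_def, rule_format] that by (intro sum_mono) blast
    finally show ?thesis .
  qed
  then have "variation_bounded a b x (\<Sum>c\<in>Basis. K c)" unfolding variation_bounded_def by blast
  then show thesis by (rule that[rotated]) (rule subsetD[OF S'(1) x])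
qed

subsection \<open>Decay of semialgebraic families\<close>

text \<open>The outer variable is \<open>t\<close> and the coefficients are polynomials in
  \<open>u\<close>, so that powers of \<open>t\<close> can be split off and \<open>t = 0\<close>
  leaves a polynomial in \<open>u\<close>.\<close>

lemma bivariate_poly:
  fixes p :: "real \<times> real \<Rightarrow> real"
  assumes "real_polynomial_function p"
  shows "\<exists>q :: real poly poly. \<forall>t u. p (t, u) = poly (poly q [:t:]) u"
  using assms
proof induction
  case (linear f)
  interpret bounded_linear f by fact
  have "f (t, u) = t * f (1, 0) + u * f (0, 1)" for t u
  proof -
    have "(t, u) = t *\<^sub>R (1, 0) + u *\<^sub>R (0, 1)" by simp
    then have "f (t, u) = f (t *\<^sub>R (1, 0) + u *\<^sub>R (0, 1))" by (rule arg_cong)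
    then show ?thesis by (simp only: add scaleR real_scaleR_def)
  qed
  moreover have "poly (poly [:[:0, c:], [:d:]:] [:t:]) u = t * d + u * c" for c d t u :: real by simp
  ultimately show ?case by metis
next
  case (const c)
  show ?case by (intro exI[of _ "[:[:c:]:]"]) simp
next
  case (add f g)
  then obtain q r where "\<forall>t u. f (t, u) = poly (poly q [:t:]) u" "\<forall>t u. g (t, u) = poly (poly r [:t:]) u"
    by blast
  then show ?case by (intro exI[of _ "q + r"]) simp
next
  case (mult f g)
  then obtain q r where "\<forall>t u. f (t, u) = poly (poly q [:t:]) u" "\<forall>t u. g (t, u) = poly (poly r [:t:]) u"
    by blast
  then show ?case by (intro exI[of _ "q * r"]) simp
qed

lemma bivariate_poly_bounded:
  fixes r :: "real poly poly"
  shows "\<exists>C. \<forall>t\<in>{0..1}. \<forall>u\<in>{0..1}. \<bar>poly (poly r [:t:]) u\<bar> \<le> C"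
proof (induction r)
  case (pCons a r)
  then obtain C where C: "\<And>t u. t \<in> {0..1} \<Longrightarrow> u \<in> {0..1} \<Longrightarrow> \<bar>poly (poly r [:t:]) u\<bar> \<le> C" by blast
  have "compact (poly a ` {0..1})"
    by (intro compact_continuous_image continuous_at_imp_continuous_on ballI poly_isCont compact_Icc)
  then obtain A where A: "\<And>u. u \<in> {0..1} \<Longrightarrow> \<bar>poly a u\<bar> \<le> A"
    using compact_imp_bounded[of "poly a ` {0..1}"] unfolding bounded_iff real_norm_def
    by (metis imageI)
  have "\<bar>poly (poly (pCons a r) [:t:]) u\<bar> \<le> A + C" if "t \<in> {0..1}" "u \<in> {0..1}" for t u
  proof -
    have "\<bar>t * poly (poly r [:t:]) u\<bar> \<le> 1 * C"
      unfolding abs_mult using that C[OF that] by (intro mult_mono) auto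
    then show ?thesis using A[OF that(2)] by simp
  qed
  then show ?case by blast
qed (auto intro: exI[of _ 0])

lemma order_factor:
  fixes q :: "'a::idom poly"
  assumes "q \<noteq> 0"
  obtains k r where "q = [:0, 1:] ^ k * r" "poly r 0 \<noteq> 0"
proof -
  obtain r where r: "q = [:- 0, 1:] ^ order 0 q * r" "\<not> [:- 0, 1:] dvd r"
    using order_decomp[OF assms, of 0] by blast
  from r(2) have "poly r 0 \<noteq> 0" using poly_eq_0_iff_dvd by blast
  then show thesis using that r(1) by simp
qed

text \<open>A crude form of Puiseux expansion. Split q = t^k r such that r0 = r(0,u) is not the zero
  polynomial, and r0 = u^d r1 with r1(0) nonzero. At a root with t > 0 this gives u^d r1(u) = - t
  r'(t,u), where |r1| is bounded below near 0 and r' is bounded.\<close>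

lemma bivariate_root_bound:
  fixes q :: "real poly poly"
  assumes "q \<noteq> 0"
  shows "\<exists>\<eta>>0. \<exists>C d. \<forall>t u. 0 < t \<longrightarrow> t \<le> 1 \<longrightarrow> 0 \<le> u \<longrightarrow> u < \<eta> \<longrightarrow> poly (poly q [:t:]) u = 0 \<longrightarrow> u ^ d \<le> C * t"
proof -
  obtain k r where r: "q = [:0, 1:] ^ k * r" "poly r 0 \<noteq> 0" using order_factor[OF assms] .
  obtain r0 r' where r': "r = pCons r0 r'" by (rule pCons_cases)
  have "r0 \<noteq> 0" using r(2) r' by simp
  then obtain d r1 where r1: "r0 = [:0, 1:] ^ d * r1" "poly r1 0 \<noteq> 0" by (rule order_factor)
  obtain C where C: "\<And>t u. t \<in> {0..1} \<Longrightarrow> u \<in> {0..1} \<Longrightarrow> \<bar>poly (poly r' [:t:]) u\<bar> \<le> C"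
    using bivariate_poly_bounded by blast
  define m where "m = \<bar>poly r1 0\<bar> / 2"
  have m: "m > 0" using r1(2) by (simp add: m_def)
  have "(\<lambda>u. \<bar>poly r1 u\<bar>) \<midarrow>0\<rightarrow> \<bar>poly r1 0\<bar>" by (rule tendsto_rabs) (use poly_isCont[of 0 r1] in \<open>simp add: isCont_def\<close>)
  then have "\<forall>\<^sub>F u in at 0. m < \<bar>poly r1 u\<bar>" by (rule order_tendstoD(1)) (use m in \<open>simp add: m_def\<close>)
  then obtain \<eta> where \<eta>: "\<eta> > 0" "\<And>u. u \<noteq> 0 \<Longrightarrow> \<bar>u\<bar> < \<eta> \<Longrightarrow> m < \<bar>poly r1 u\<bar>"
    unfolding eventually_at by (auto simp: dist_real_def)
  have \<eta>0: "m \<le> \<bar>poly r1 u\<bar>" if "0 \<le> u" "u < \<eta>" for u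
    using \<eta>(2)[of u] that by (cases "u = 0") (auto simp: m_def)
  have "u ^ d \<le> C / m * t"
    if t: "0 < t" "t \<le> 1" and u: "0 \<le> u" "u < min \<eta> 1" and root: "poly (poly q [:t:]) u = 0" for t u
  proof -
    have qr: "poly (poly q [:t:]) u = t ^ k * poly (poly r [:t:]) u" unfolding r(1) by (simp add: poly_power)
    then have "poly (poly r [:t:]) u = 0" using root t by simp
    then have "poly r0 u = - t * poly (poly r' [:t:]) u" by (simp add: r')
    then have "u ^ d * poly r1 u = - t * poly (poly r' [:t:]) u" unfolding r1(1) by (simp add: poly_power)
    then have "u ^ d * \<bar>poly r1 u\<bar> = t * \<bar>poly (poly r' [:t:]) u\<bar>"
      using t u by (metis abs_minus abs_mult abs_of_nonneg less_imp_le zero_le_power mult_minus_left)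
    also have "\<dots> \<le> t * C" using C[of t u] t u by (intro mult_left_mono) auto
    finally have "u ^ d * \<bar>poly r1 u\<bar> \<le> t * C" .
    moreover have "u ^ d * m \<le> u ^ d * \<bar>poly r1 u\<bar>" using \<eta>0[of u] u by (intro mult_left_mono) auto
    ultimately have "u ^ d * m \<le> t * C" by linarith
    then show "u ^ d \<le> C / m * t" using m by (simp add: field_simps)
  qed
  moreover have "min \<eta> 1 > 0" using \<eta>(1) by simp
  ultimately show ?thesis by blast
qed

text \<open>For small \<open>t\<close> the point \<open>(t, u)\<close> lies in \<open>U\<close> but
  \<open>(t, \<eta> / 2)\<close> does not, so a defining polynomial has a root between the two
  heights. The root dominates \<open>u\<close> and obeys
  \<open>bivariate_root_bound\<close>.\<close>

lemma semialgebraic_decay: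
  fixes U :: "(real \<times> real) set"
  assumes U: "semialgebraic U"
    and decay: "\<And>\<eta>. \<eta> > 0 \<Longrightarrow> \<exists>\<delta>>0. \<forall>t u. 0 < t \<longrightarrow> t < \<delta> \<longrightarrow> (t, u) \<in> U \<longrightarrow> u < \<eta>"
  shows "\<exists>\<delta>>0. \<exists>C. \<exists>d\<ge>1. \<forall>t u. 0 < t \<longrightarrow> t < \<delta> \<longrightarrow> 0 \<le> u \<longrightarrow> (t, u) \<in> U \<longrightarrow> u ^ d \<le> C * t"
proof -
  from semialgebraicE[OF U] obtain F where F: "finite F"
    "\<And>p. p \<in> F \<Longrightarrow> real_polynomial_function p" "\<And>x y. sign_eq F x y \<Longrightarrow> x \<in> U \<longleftrightarrow> y \<in> U" by metis
  have "\<forall>p\<in>F. \<exists>q :: real poly poly. \<forall>t u. p (t, u) = poly (poly q [:t:]) u"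
    using bivariate_poly F(2) by blast
  then obtain q :: "_ \<Rightarrow> real poly poly" where q: "\<And>p t u. p \<in> F \<Longrightarrow> p (t, u) = poly (poly (q p) [:t:]) u" by metis
  have "\<exists>\<eta>>0. \<exists>C\<ge>0. \<exists>d\<ge>1. \<forall>p\<in>G. \<forall>t u. 0 < t \<longrightarrow> t \<le> 1 \<longrightarrow> 0 \<le> u \<longrightarrow> u < \<eta> \<longrightarrow> q p \<noteq> 0 \<longrightarrow>
      poly (poly (q p) [:t:]) u = 0 \<longrightarrow> u ^ d \<le> C * t" if "finite G" for G
    using that
  proof (induction G rule: finite_induct)
    case empty
    show ?case by (auto intro!: exI[of _ 1])
  next
    case (insert p G)
    then obtain \<eta> C d where 1: "\<eta> > 0" "C \<ge> 0" "d \<ge> (1::nat)" "\<And>p t u. p \<in> G \<Longrightarrow> 0 < t \<Longrightarrow> t \<le> 1 \<Longrightarrow> 0 \<le> u \<Longrightarrow>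
      u < \<eta> \<Longrightarrow> q p \<noteq> 0 \<Longrightarrow> poly (poly (q p) [:t:]) u = 0 \<Longrightarrow> u ^ d \<le> C * t" by blast
    obtain \<eta>' C' d' where 2: "\<eta>' > 0" "\<And>t u. 0 < t \<Longrightarrow> t \<le> 1 \<Longrightarrow> 0 \<le> u \<Longrightarrow>
      u < \<eta>' \<Longrightarrow> q p \<noteq> 0 \<Longrightarrow> poly (poly (q p) [:t:]) u = 0 \<Longrightarrow> u ^ d' \<le> C' * t"
    proof (cases "q p = 0")
      case True
      then show ?thesis using that[of 1 0 0] by simp
    next
      case False
      from bivariate_root_bound[OF this] show ?thesis using that by blast
    qed
    show ?case
    proof (intro exI conjI ballI allI impI)
      \<comment> \<open>Below height 1 a larger exponent weakens the bound, so \<open>d + d'\<close>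
        serves all polynomials treated so far.\<close>
      show "min (min \<eta> \<eta>') 1 > 0" "C + \<bar>C'\<bar> \<ge> 0" "d + d' \<ge> 1" using 1 2 by auto
      fix p' t u assume a: "p' \<in> insert p G" "0 < t" "t \<le> 1" "0 \<le> u" "u < min (min \<eta> \<eta>') 1"
        "q p' \<noteq> 0" "poly (poly (q p') [:t:]) u = 0"
      have pw: "u ^ (d + d') \<le> u ^ d" "u ^ (d + d') \<le> u ^ d'" using a by (auto intro!: power_decreasing)
      have "C * t \<le> (C + \<bar>C'\<bar>) * t" "C' * t \<le> (C + \<bar>C'\<bar>) * t" using 1(2) a by (auto intro!: mult_right_mono)
      moreover have "u ^ d \<le> C * t \<or> u ^ d' \<le> C' * t" using 1(4)[of p' t u] 2(2)[of t u] a by auto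
      ultimately show "u ^ (d + d') \<le> (C + \<bar>C'\<bar>) * t" using pw by linarith
    qed
  qed
  from this[OF F(1)] obtain \<eta> C d where r: "\<eta> > 0" "d \<ge> (1::nat)" "\<And>p t u. p \<in> F \<Longrightarrow> 0 < t \<Longrightarrow> t \<le> 1 \<Longrightarrow> 0 \<le> u \<Longrightarrow>
      u < \<eta> \<Longrightarrow> q p \<noteq> 0 \<Longrightarrow> poly (poly (q p) [:t:]) u = 0 \<Longrightarrow> u ^ d \<le> C * t" by blast
  obtain \<delta> where \<delta>: "\<delta> > 0" "\<And>t u. 0 < t \<Longrightarrow> t < \<delta> \<Longrightarrow> (t, u) \<in> U \<Longrightarrow> u < \<eta> / 2"
    using decay[of "\<eta> / 2"] r(1) by auto
  have "u ^ d \<le> C * t" if t: "0 < t" "t < min \<delta> 1" and u: "0 \<le> u" "(t, u) \<in> U" for t u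
  proof -
    have lt: "u < \<eta> / 2" using \<delta>(2) t u by auto
    have "(t, \<eta> / 2) \<notin> U" using \<delta>(2)[of t "\<eta>/2"] t by auto
    then have "\<not> sign_eq F (t, u) (t, \<eta>/2)" using F(3) u(2) by blast
    then obtain p where p: "p \<in> F" "sgn (p (t, u)) \<noteq> sgn (p (t, \<eta>/2))" by (auto simp: sign_eq_def)
    define P where "P = poly (q p) [:t:]"
    have ne: "sgn (poly P u) \<noteq> sgn (poly P (\<eta>/2))" using p q[OF p(1)] by (simp add: P_def)
    then have "\<not> same_gap {t. poly P t = 0} u (\<eta>/2)"
      using sgn_poly_same_gap[of "{t. poly P t = 0}" u "\<eta>/2" P] by blast
    then obtain u' where "poly P u' = 0" "u \<le> u'" "u' \<le> \<eta> / 2"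
      using lt unfolding same_gap_def by force
    moreover have "q p \<noteq> 0" using ne by (auto simp: P_def)
    ultimately have "u' ^ d \<le> C * t" using r(3)[OF p(1), of t u'] t u lt r(1) by (auto simp: P_def)
    moreover have "u ^ d \<le> u' ^ d" using u(1) \<open>u \<le> u'\<close> by (intro power_mono) auto
    ultimately show ?thesis by linarith
  qed
  moreover have "min \<delta> 1 > 0" using \<delta>(1) by simp
  ultimately show ?thesis using r(2) by blast
qed

subsection \<open>The Kurdyka--Lojasiewicz inequality\<close>

text \<open>The objective enters only through a closed graph of subgradients and a subgradient
  inequality whose quadratic loss is uniform on balls.\<close>

locale weakly_convex_model =
  fixes D :: "'a::euclidean_space set" and \<phi> :: "'a \<Rightarrow> real" and SD :: "'a \<Rightarrow> 'a set"
  assumes D_closed: "closed D"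
    and \<phi>_cont: "continuous_on D \<phi>"
    and SD_dom: "\<And>x w. w \<in> SD x \<Longrightarrow> x \<in> D"
    and SD_closed: "\<And>X W x w. (\<And>n::nat. W n \<in> SD (X n)) \<Longrightarrow> X \<longlonglongrightarrow> x \<Longrightarrow> W \<longlonglongrightarrow> w \<Longrightarrow> w \<in> SD x"
    and weakly_convex: "\<And>R. \<exists>L>0. \<forall>x y w. x \<in> cball 0 R \<longrightarrow> y \<in> D \<inter> cball 0 R \<longrightarrow> w \<in> SD x \<longrightarrow>
          \<phi> x + w \<bullet> (y - x) - L * (norm (y - x))\<^sup>2 \<le> \<phi> y"

locale semialgebraic_model = weakly_convex_model +
  assumes graph_sa: "semialgebraic {z. fst z \<in> D \<and> \<phi> (fst z) = snd z}"
    and SD_sa: "semialgebraic {z. snd z \<in> SD (fst z)}"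

context weakly_convex_model begin

text \<open>The subgradient inequality is applied at whichever of the two points has the larger
  value, depending on the sign \<open>\<epsilon>\<close>; the difference of the values is
  \<open>t - s\<close> in either case.\<close>

lemma slope_lower_bound:
  assumes "\<And>t. 0 < t \<Longrightarrow> t < b \<Longrightarrow> x t \<in> cball 0 R"
    and level: "\<And>t. 0 < t \<Longrightarrow> t < b \<Longrightarrow> \<phi> (x t) = v + \<epsilon> * t" and \<epsilon>: "\<epsilon> = 1 \<or> \<epsilon> = -1"
    and slope: "\<And>t. 0 < t \<Longrightarrow> t < b \<Longrightarrow> \<exists>w\<in>SD (x t). norm w \<le> C * t"
  obtains L C' where "L > 0" "C' > 0" "\<And>s t. 0 < s \<Longrightarrow> s < t \<Longrightarrow> t < b \<Longrightarrow>
    t - s \<le> C' * t * norm (x t - x s) + L * (norm (x t - x s))\<^sup>2"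
proof -
  obtain L where L: "L > 0" "\<And>x y w. x \<in> cball 0 R \<Longrightarrow> y \<in> D \<inter> cball 0 R \<Longrightarrow> w \<in> SD x \<Longrightarrow>
      \<phi> x + w \<bullet> (y - x) - L * (norm (y - x))\<^sup>2 \<le> \<phi> y" using weakly_convex by blast
  have "t - s \<le> (\<bar>C\<bar> + 1) * t * norm (x t - x s) + L * (norm (x t - x s))\<^sup>2"
    if st: "0 < s" "s < t" "t < b" for s t
  proof -
    have key: "\<phi> (x p) - \<phi> (x q) \<le> (\<bar>C\<bar> + 1) * t * norm (x t - x s) + L * (norm (x t - x s))\<^sup>2"
      if pq: "(p = t \<and> q = s) \<or> (p = s \<and> q = t)" for p q
    proof -
      have p: "0 < p" "p < b" "p \<le> t" and q: "0 < q" "q < b" using pq st by auto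
      obtain w where w: "w \<in> SD (x p)" "norm w \<le> C * p" using slope[OF p(1,2)] by blast
      obtain w' where w': "w' \<in> SD (x q)" using slope[OF q] by blast
      have "\<phi> (x p) + w \<bullet> (x q - x p) - L * (norm (x q - x p))\<^sup>2 \<le> \<phi> (x q)"
        using L(2)[OF assms(1)[OF p(1,2)] _ w(1)] SD_dom[OF w'] assms(1)[OF q] by blast
      moreover have "- (w \<bullet> (x q - x p)) \<le> (\<bar>C\<bar> + 1) * t * norm (x q - x p)"
      proof -
        have "- (w \<bullet> (x q - x p)) \<le> norm w * norm (x q - x p)"
          using Cauchy_Schwarz_ineq2[of w "x q - x p"] by linarith
        also have "norm w \<le> (\<bar>C\<bar> + 1) * t"
        proof -
          have "C * p \<le> \<bar>C\<bar> * t" using p by (intro mult_mono) auto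
          then show ?thesis using w(2) st by (simp add: distrib_right)
        qed
        finally show ?thesis by (simp add: mult_right_mono)
      qed
      moreover have "norm (x q - x p) = norm (x t - x s)" using pq by (auto simp: norm_minus_commute)
      ultimately show ?thesis by simp
    qed
    have eq: "\<phi> (x t) - \<phi> (x s) = \<epsilon> * (t - s)" using level[of t] level[of s] st by (simp add: algebra_simps)
    show ?thesis using \<epsilon>
    proof
      assume "\<epsilon> = 1" then show ?thesis using key[of t s] eq by simp
    next
      assume "\<epsilon> = -1" then show ?thesis using key[of s t] eq by simp
    qed
  qed
  then show thesis using that[of L "\<bar>C\<bar> + 1"] L(1) by simp
qed

end

text \<open>Subdividing uniformly with mesh \<open>h\<close>, the increments are at least \<open>h / (2 C t)\<close> as soon as
  \<open>t\<close> is of order \<open>sqrt h\<close>, and the sum of these is a divergent harmonic sum.\<close>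

lemma slope_bound_contradicts_variation:
  fixes x :: "real \<Rightarrow> 'a::real_normed_vector"
  assumes b: "b > 0" and LC: "L > 0" "C > 0"
    and inc: "\<And>s t. 0 < s \<Longrightarrow> s < t \<Longrightarrow> t < b \<Longrightarrow>
      t - s \<le> C * t * norm (x t - x s) + L * (norm (x t - x s))\<^sup>2"
    and var: "variation_bounded 0 b x K"
  shows False
proof -
  define t0 where "t0 = b / 2"
  have t0: "0 < t0" "t0 < b" using b by (auto simp: t0_def)
  \<comment> \<open>From the index \<open>m * k\<close> on the quadratic term is at most
    \<open>h / 2\<close>: with \<open>h = t0 / k\<^sup>2\<close> this amounts to
    \<open>2 * C * j \<ge> k * sqrt (2 * L / t0)\<close>.\<close>
  obtain m :: nat where m: "m \<ge> 1" "real m \<ge> sqrt (2 * L / t0) / (2 * C)"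
  proof -
    obtain m' :: nat where "real m' \<ge> sqrt (2 * L / t0) / (2 * C)" using real_arch_simple by blast
    then show thesis using that[of "Suc m'"] by auto
  qed
  have bound: "ln (real k / (real m + 1)) \<le> 2 * C * K" if k: "k > m" for k :: nat
  proof -
    \<comment> \<open>The subdivision runs from \<open>m * k * h\<close>, which equals
      \<open>m * sqrt (t0 * h)\<close>, up to \<open>k * k * h = t0\<close>.\<close>
    define h where "h = t0 / real (k * k)"
    have kpos: "k > 0" using k by simp
    have h: "h > 0" using t0 kpos by (simp add: h_def)
    define \<tau> where "\<tau> i = real (m * k + i) * h" for i
    define n where "n = k * k - m * k"
    have nk: "m * k + n = k * k" using k by (simp add: n_def)
    have \<tau>_in: "0 < \<tau> i \<and> \<tau> i < b" if "i \<le> n" for i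
    proof -
      have "\<tau> i \<le> real (k * k) * h" unfolding \<tau>_def using that nk h
        by (intro mult_right_mono) (auto simp: of_nat_le_iff simp del: of_nat_mult of_nat_add)
      also have "\<dots> = t0" using kpos by (simp add: h_def)
      finally show ?thesis using t0 h m(1) kpos by (auto simp: \<tau>_def intro!: mult_pos_pos add_pos_nonneg)
    qed
    have \<tau>_mono: "\<tau> i < \<tau> (Suc i)" for i unfolding \<tau>_def using h by (intro mult_strict_right_mono) auto
    have V: "(\<Sum>i<n. norm (x (\<tau> (Suc i)) - x (\<tau> i))) \<le> K"
      using var \<tau>_in \<tau>_mono unfolding variation_bounded_def by blast
    have d: "1 / (2 * C * real (m * k + Suc i)) \<le> norm (x (\<tau> (Suc i)) - x (\<tau> i))" if i: "i < n" for i
    proof (rule ccontr)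
      let ?d = "norm (x (\<tau> (Suc i)) - x (\<tau> i))"
      define j where "j = real (m * k + Suc i)"
      assume "\<not> 1 / (2 * C * real (m * k + Suc i)) \<le> ?d"
      then have dj: "?d < 1 / (2 * C * j)" by (simp add: j_def)
      have j: "j > 0" "j \<ge> real m * real k" by (auto simp: j_def intro: add_pos_nonneg)
      have "h = \<tau> (Suc i) - \<tau> i" by (simp add: \<tau>_def algebra_simps)
      also have "\<dots> \<le> C * \<tau> (Suc i) * ?d + L * ?d\<^sup>2"
        using \<tau>_in[of i] \<tau>_in[of "Suc i"] \<tau>_mono[of i] i by (intro inc) auto
      finally have hle: "h \<le> C * \<tau> (Suc i) * ?d + L * ?d\<^sup>2" .
      have "C * \<tau> (Suc i) * ?d < C * \<tau> (Suc i) * (1 / (2 * C * j))"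
        using dj LC \<tau>_in[of "Suc i"] i by (intro mult_strict_left_mono) auto
      also have "\<dots> = C * (j * h) * (1 / (2 * C * j))" by (simp only: \<tau>_def j_def)
      also have "\<dots> = h / 2" using LC j(1) by (simp add: field_simps)
      finally have 1: "C * \<tau> (Suc i) * ?d < h / 2" .
      have "?d\<^sup>2 \<le> (1 / (2 * C * j))\<^sup>2" using dj by (intro power_mono) auto
      then have "L * ?d\<^sup>2 \<le> L * (1 / (2 * C * j))\<^sup>2" using LC by (intro mult_left_mono) auto
      also have "\<dots> \<le> h / 2"
      proof -
        have "sqrt (2 * L / t0) \<le> real m * (2 * C)" using m(2) LC by (simp add: divide_le_eq)
        then have "sqrt (2 * L / t0) * real k \<le> real m * (2 * C) * real k" by (intro mult_right_mono) auto
        also have "\<dots> \<le> 2 * C * j" using j(2) LC by simp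
        finally have "(sqrt (2 * L / t0) * real k)\<^sup>2 \<le> (2 * C * j)\<^sup>2"
          using t0 LC by (intro power_mono) auto
        then have "2 * L / t0 * (real k)\<^sup>2 \<le> (2 * C * j)\<^sup>2"
          using t0 LC by (simp add: power_mult_distrib)
        then have "2 * L * (real k)\<^sup>2 \<le> (2 * C * j)\<^sup>2 * t0" using t0 by (simp add: field_simps)
        then show ?thesis using t0 LC j kpos
          by (simp add: h_def field_simps power2_eq_square)
      qed
      finally show False using 1 hle by linarith
    qed
    \<comment> \<open>The harmonic sum over the indices from \<open>m * k + 1\<close> to
      \<open>k * k\<close> is bounded below by a telescoping sum of logarithms, which is unbounded
      in \<open>k\<close>.\<close>
    have "ln (real k / (real m + 1)) \<le> ln (real (m * k + n + 1) / real (m * k + 1))"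
    proof -
      have "real k * real (m * k + 1) \<le> real (k * k + 1) * (real m + 1)"
      proof -
        have "real k * 1 \<le> real k * real k" using kpos by (intro mult_left_mono) auto
        then show ?thesis by (simp add: algebra_simps)
      qed
      then have "real k / (real m + 1) \<le> real (k * k + 1) / real (m * k + 1)"
        by (simp add: divide_le_eq pos_le_divide_eq add_pos_nonneg del: of_nat_add of_nat_mult)
      then show ?thesis unfolding nk using kpos by (subst ln_le_cancel_iff) (auto simp del: of_nat_mult)
    qed
    also have "\<dots> = (\<Sum>i<n. ln (real (m * k + Suc i + 1) / real (m * k + Suc i)))"
    proof (induction n)
      case (Suc n)
      have cancel: "(A / B) * (E / A) = E / B" if "A \<noteq> 0" for A B E :: real using that by simp
      have "ln (real (m * k + Suc n + 1) / real (m * k + 1)) =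
        ln ((real (m * k + n + 1) / real (m * k + 1)) * (real (m * k + Suc n + 1) / real (m * k + Suc n)))"
      proof -
        have e: "m * k + Suc n = m * k + n + 1" by simp
        show ?thesis unfolding e by (subst cancel) (simp_all del: of_nat_add of_nat_Suc of_nat_mult)
      qed
      also have "\<dots> = ln (real (m * k + n + 1) / real (m * k + 1)) + ln (real (m * k + Suc n + 1) / real (m * k + Suc n))"
        by (intro ln_mult_pos divide_pos_pos) (auto simp del: of_nat_add of_nat_Suc of_nat_mult)
      finally show ?case using Suc by simp
    qed simp
    also have "\<dots> \<le> (\<Sum>i<n. 2 * C * norm (x (\<tau> (Suc i)) - x (\<tau> i)))"
    proof (rule sum_mono)
      fix i assume "i \<in> {..<n}"
      then have i: "i < n" by simp
      have "ln (real (m * k + Suc i + 1) / real (m * k + Suc i)) \<le> real (m * k + Suc i + 1) / real (m * k + Suc i) - 1"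
        by (intro ln_le_minus_one divide_pos_pos) (auto simp del: of_nat_add of_nat_Suc of_nat_mult)
      also have "\<dots> = 1 / real (m * k + Suc i)"
      proof -
        have "real (m * k + Suc i) \<noteq> 0" by (simp del: of_nat_add of_nat_Suc of_nat_mult)
        moreover have "real (m * k + Suc i + 1) = real (m * k + Suc i) + 1" by simp
        ultimately show ?thesis by (simp only: add_divide_distrib divide_self) simp
      qed
      also have "\<dots> = 2 * C * (1 / (2 * C * real (m * k + Suc i)))" using LC by (simp del: of_nat_add of_nat_mult)
      also have "\<dots> \<le> 2 * C * norm (x (\<tau> (Suc i)) - x (\<tau> i))"
        using d[OF i] LC by (intro mult_left_mono) auto
      finally show "ln (real (m * k + Suc i + 1) / real (m * k + Suc i)) \<le> 2 * C * norm (x (\<tau> (Suc i)) - x (\<tau> i))" .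
    qed
    also have "\<dots> \<le> 2 * C * K" using V LC by (simp add: sum_distrib_left[symmetric])
    finally show ?thesis .
  qed
  obtain k :: nat where k: "real k > max (real m) ((real m + 1) * exp (2 * C * K + 1))"
    using reals_Archimedean2 by blast
  then have km: "k > m" by simp
  have "exp (2 * C * K + 1) < real k / (real m + 1)" using k by (simp add: pos_less_divide_eq mult.commute add_nonneg_pos)
  then have "2 * C * K + 1 < ln (real k / (real m + 1))" using km by (subst exp_less_cancel_iff[symmetric]) (auto simp: exp_ln)
  then show False using bound[OF km] by simp
qed

context semialgebraic_model begin

text \<open>A semialgebraic selection of the points on the levels \<open>v + \<epsilon> * t\<close>
  has bounded variation, but by \<open>slope_lower_bound\<close> its increments have unbounded
  sums.\<close>

lemma no_flat_branch:
  assumes b: "b > 0" and \<epsilon>: "\<epsilon> = 1 \<or> \<epsilon> = -1" and C: "0 \<le> C"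
    and ne: "\<And>t. 0 < t \<Longrightarrow> t < b \<Longrightarrow> \<exists>x w. norm x \<le> R \<and> w \<in> SD x \<and> \<phi> x = v + \<epsilon> * t \<and> norm w \<le> C * t"
  shows False
proof -
  let ?G = "{z. fst z \<in> D \<and> \<phi> (fst z) = snd z}" and ?E = "{z. snd z \<in> SD (fst z)}"
  define S where "S = {z::real \<times> 'a. snd z \<bullet> snd z \<le> R * R \<and> (snd z, v + \<epsilon> * fst z) \<in> ?G \<and>
     (\<exists>w. (snd z, w) \<in> ?E \<and> w \<bullet> w \<le> (C * fst z) * (C * fst z))}"
  have S: "semialgebraic S" unfolding S_def
    by (intro semialgebraic_intros poly_intros semialgebraic_preimage[OF graph_sa]
        semialgebraic_preimage[OF SD_sa])
  have nsq: "x \<bullet> x \<le> c * c \<longleftrightarrow> norm x \<le> c" if "c \<ge> 0" for x :: 'a and c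
    using that by (simp add: norm_le_square power2_eq_square)
  have R0: "R \<ge> 0"
  proof -
    obtain x :: 'a where "norm x \<le> R" using ne[of "b/2"] b by auto
    then show ?thesis using norm_ge_zero order_trans by blast
  qed
  have Siff: "(t, x) \<in> S \<longleftrightarrow> norm x \<le> R \<and> x \<in> D \<and> \<phi> x = v + \<epsilon> * t \<and> (\<exists>w\<in>SD x. norm w \<le> C * t)"
    if "0 < t" for t x
  proof -
    have "0 \<le> C * t" using C that by simp
    from nsq[OF this] show ?thesis unfolding S_def by (auto simp: nsq[OF R0])
  qed
  have cpt: "compact {x. (t, x) \<in> S}" if t: "0 < t" for t
  proof -
    have "closed {x. (t, x) \<in> S}" unfolding closed_sequential_limits
    proof (intro allI impI, elim conjE)
      fix X l assume X: "\<forall>n. X n \<in> {x. (t, x) \<in> S}" and l: "X \<longlonglongrightarrow> l"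
      have Xn: "norm (X n) \<le> R" "X n \<in> D" "\<phi> (X n) = v + \<epsilon> * t" "\<exists>w\<in>SD (X n). norm w \<le> C * t" for n
        using X Siff[OF t] by auto
      obtain W where W: "\<And>n. W n \<in> SD (X n)" "\<And>n. norm (W n) \<le> C * t" using Xn(4) by metis
      have "compact (cball (0::'a) (C * t))" by simp
      moreover have "\<forall>n. W n \<in> cball 0 (C * t)" using W(2) by simp
      ultimately obtain w r where w: "w \<in> cball 0 (C * t)" "strict_mono (r :: nat \<Rightarrow> nat)" "(W \<circ> r) \<longlonglongrightarrow> w"
        unfolding compact_def by metis
      have "w \<in> SD l"
        by (rule SD_closed[of "W \<circ> r" "X \<circ> r"]) (use W w(3) LIMSEQ_subseq_LIMSEQ[OF l w(2)] in auto)
      moreover have "l \<in> D" using closed_sequentially[OF D_closed] Xn(2) l by blast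
      moreover have "norm l \<le> R" using LIMSEQ_le_const2[OF tendsto_norm[OF l]] Xn(1) by blast
      moreover have "\<phi> l = v + \<epsilon> * t"
      proof -
        have "(\<lambda>n. \<phi> (X n)) \<longlonglongrightarrow> \<phi> l"
          by (rule continuous_on_tendsto_compose[OF \<phi>_cont l]) (use Xn \<open>l \<in> D\<close> in auto)
        then show ?thesis unfolding Xn(3) by (simp add: LIMSEQ_const_iff)
      qed
      ultimately show "l \<in> {x. (t, x) \<in> S}" using w(1) Siff[OF t] by auto
    qed
    moreover have "bounded {x. (t, x) \<in> S}" using Siff[OF t] unfolding bounded_iff by blast
    ultimately show ?thesis by (simp add: compact_eq_bounded_closed)
  qed
  have Sne: "{x. (t, x) \<in> S} \<noteq> {}" if "0 < t" "t < b" for t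
    using ne[OF that] Siff[OF that(1)] SD_dom by blast
  have SR: "norm x \<le> R" if "0 < t" "t < b" "(t, x) \<in> S" for t x using Siff that by blast
  obtain x K where x: "\<And>t. 0 < t \<Longrightarrow> t < b \<Longrightarrow> (t, x t) \<in> S" and var: "variation_bounded 0 b x K"
    by (rule bounded_variation_selection[OF S, of 0 b R]) (use cpt Sne SR in blast)+
  have x': "x t \<in> cball 0 R" "\<phi> (x t) = v + \<epsilon> * t" "\<exists>w\<in>SD (x t). norm w \<le> C * t" if "0 < t" "t < b" for t
    using x[OF that] Siff[OF that(1)] by auto
  obtain L C' where "L > 0" "C' > 0" "\<And>s t. 0 < s \<Longrightarrow> s < t \<Longrightarrow> t < b \<Longrightarrow>
    t - s \<le> C' * t * norm (x t - x s) + L * (norm (x t - x s))\<^sup>2"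
    using slope_lower_bound[OF x'(1,2) \<epsilon> x'(3)] by blast
  then show False using slope_bound_contradicts_variation[OF b _ _ _ var] by blast
qed

text \<open>Critical points on all levels of an interval form a branch of slope 0, which
  \<open>no_flat_branch\<close> with \<open>C = 0\<close> excludes.\<close>

theorem finite_critical_values: "finite {t. \<exists>x. 0 \<in> SD x \<and> \<phi> x = t}"
proof (rule ccontr)
  let ?G = "{z. fst z \<in> D \<and> \<phi> (fst z) = snd z}" and ?E = "{z. snd z \<in> SD (fst z)}"
  define V where "V = {t. \<exists>x. (x, t) \<in> ?G \<and> (x, 0) \<in> ?E}"
  define VR where "VR R = {t. \<exists>x. x \<bullet> x \<le> R * R \<and> (x, t) \<in> ?G \<and> (x, 0) \<in> ?E}" for R :: real
  have sa: "semialgebraic V" "semialgebraic (VR R)" for R unfolding V_def VR_def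
    by (intro semialgebraic_intros poly_intros semialgebraic_preimage[OF graph_sa]
        semialgebraic_preimage[OF SD_sa])+
  assume "\<not> ?thesis"
  moreover have "{t. \<exists>x. 0 \<in> SD x \<and> \<phi> x = t} = V" unfolding V_def using SD_dom by auto
  ultimately have "infinite V" by simp
  then obtain a b where ab: "a < b" "{a<..<b} \<subseteq> V" using semialgebraic_real_infinite[OF sa(1)] by blast
  have cover: "V \<subseteq> (\<Union>n. VR (real n))"
  proof
    fix t assume "t \<in> V"
    then obtain x where x: "(x, t) \<in> ?G" "(x, 0) \<in> ?E" unfolding V_def by blast
    obtain n :: nat where "norm x \<le> real n" using real_arch_simple by blast
    then have "x \<bullet> x \<le> real n * real n" by (simp add: norm_le_square power2_eq_square)
    then show "t \<in> (\<Union>n. VR (real n))" unfolding VR_def using x by blast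
  qed
  \<comment> \<open>\<open>no_flat_branch\<close> asks for bounded points. As \<open>V\<close>
    contains an interval it is uncountable, so one of its countably many bounded parts is infinite
    and contains an interval as well.\<close>
  have "\<exists>n. infinite (VR (real n))"
  proof (rule ccontr)
    assume "\<not> (\<exists>n. infinite (VR (real n)))"
    then have "countable (\<Union>n. VR (real n))" by (intro countable_UN) (auto intro: countable_finite)
    then have "countable {a<..<b}" using cover ab(2) by (meson countable_subset order_trans)
    then show False using uncountable_open_interval[of a b] ab(1) by blast
  qed
  then obtain n where "infinite (VR (real n))" by blast
  then obtain a b where ab: "a < b" "{a<..<b} \<subseteq> VR (real n)"
    using semialgebraic_real_infinite[OF sa(2)] by blast
  show False
  proof (rule no_flat_branch[of "b - a" 1 0 "real n" a])
    fix t assume t: "0 < t" "t < b - a"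
    then have "a + t \<in> VR (real n)" using ab by auto
    then obtain x where "x \<bullet> x \<le> real n * real n" "\<phi> x = a + t" "0 \<in> SD x" unfolding VR_def by auto
    moreover from this have "norm x \<le> real n" by (simp add: norm_le_square power2_eq_square)
    ultimately show "\<exists>x w. norm x \<le> real n \<and> w \<in> SD x \<and> \<phi> x = a + 1 * t \<and> norm w \<le> 0 * t"
      by (intro exI[of _ x] exI[of _ 0]) simp
  qed (use ab in auto)
qed

text \<open>Membership \<open>(t, u) \<in> U\<close> means that some bounded point of the level has
  slope at most \<open>t / u\<close>. By \<open>no_flat_branch\<close> these \<open>u\<close> tend
  to 0 with \<open>t\<close>, hence at a power rate, and inserting \<open>u = t / norm w\<close>
  turns the rate into the inequality.\<close>

lemma kl_one_sided:
  assumes \<epsilon>: "\<epsilon> = 1 \<or> \<epsilon> = -1"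
  shows "\<exists>\<delta>>0. \<exists>c>0. \<exists>\<theta>. 0 < \<theta> \<and> \<theta> < 1 \<and> (\<forall>x w t. norm x \<le> R \<longrightarrow> w \<in> SD x \<longrightarrow> \<phi> x = v + \<epsilon> * t \<longrightarrow>
    0 < t \<longrightarrow> t < \<delta> \<longrightarrow> t powr \<theta> \<le> c * norm w)"
proof -
  let ?G = "{z. fst z \<in> D \<and> \<phi> (fst z) = snd z}" and ?E = "{z. snd z \<in> SD (fst z)}"
  define R' where "R' = \<bar>R\<bar>"
  define U where "U = {z :: real \<times> real. 0 < fst z \<and> 0 < snd z \<and> (\<exists>x w. x \<bullet> x \<le> R' * R' \<and> (x, v + \<epsilon> * fst z) \<in> ?G \<and>
     (x, w) \<in> ?E \<and> (w \<bullet> w) * (snd z * snd z) \<le> fst z * fst z)}"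
  have U: "semialgebraic U" unfolding U_def
    by (intro semialgebraic_intros poly_intros semialgebraic_preimage[OF graph_sa]
        semialgebraic_preimage[OF SD_sa])
  have nsq: "x \<bullet> x \<le> c * c \<longleftrightarrow> norm x \<le> c" if "c \<ge> 0" for x :: 'a and c
    using that by (simp add: norm_le_square power2_eq_square)
  have Uiff: "(t, u) \<in> U \<longleftrightarrow> 0 < t \<and> 0 < u \<and> (\<exists>x w. norm x \<le> R' \<and> w \<in> SD x \<and> \<phi> x = v + \<epsilon> * t \<and> norm w * u \<le> t)" for t u
  proof -
    have "(w \<bullet> w) * (u * u) \<le> t * t \<longleftrightarrow> norm w * u \<le> t" if "0 < t" "0 < u" for w :: 'a
    proof -
      have "(w \<bullet> w) * (u * u) = (norm w * u)\<^sup>2" by (simp add: power2_norm_eq_inner power_mult_distrib power2_eq_square[of u])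
      then show ?thesis using that abs_le_square_iff[of "norm w * u" t] by (simp add: power2_eq_square[of t])
    qed
    moreover have "x \<bullet> x \<le> R' * R' \<longleftrightarrow> norm x \<le> R'" for x :: 'a by (rule nsq) (simp add: R'_def)
    ultimately show ?thesis unfolding U_def
      by (simp only: mem_Collect_eq fst_conv snd_conv) (use SD_dom in metis)
  qed
  have decay: "\<exists>\<delta>>0. \<forall>t u. 0 < t \<longrightarrow> t < \<delta> \<longrightarrow> (t, u) \<in> U \<longrightarrow> u < \<eta>" if \<eta>: "\<eta> > 0" for \<eta>
  proof -
    have "polynomial_function (\<lambda>t::real. (t, \<eta>))" by (intro poly_intros)
    then have "semialgebraic {t. (t, \<eta>) \<in> U}" by (rule semialgebraic_preimage[OF U])
    then obtain \<delta> where \<delta>: "\<delta> > 0" "{0<..<0+\<delta>} \<subseteq> {t. (t, \<eta>) \<in> U} \<or> {0<..<0+\<delta>} \<inter> {t. (t, \<eta>) \<in> U} = {}"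
      by (rule semialgebraic_real_right_germ)
    have "\<not> {0<..<0+\<delta>} \<subseteq> {t. (t, \<eta>) \<in> U}"
    proof
      assume sub: "{0<..<0+\<delta>} \<subseteq> {t. (t, \<eta>) \<in> U}"
      show False
      proof (rule no_flat_branch[OF \<delta>(1) \<epsilon>, of "1 / \<eta>" R' v])
        fix t assume t: "0 < t" "t < \<delta>"
        then have "(t, \<eta>) \<in> U" using sub by auto
        then obtain x w where "norm x \<le> R'" "w \<in> SD x" "\<phi> x = v + \<epsilon> * t" "norm w * \<eta> \<le> t"
          unfolding Uiff by blast
        then show "\<exists>x w. norm x \<le> R' \<and> w \<in> SD x \<and> \<phi> x = v + \<epsilon> * t \<and> norm w \<le> 1 / \<eta> * t"
          using \<eta> by (intro exI[of _ x] exI[of _ w]) (simp add: field_simps)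
      qed (use \<eta> in simp)
    qed
    then have "{0<..<0+\<delta>} \<inter> {t. (t, \<eta>) \<in> U} = {}" using \<delta>(2) by blast
    then have no: "(t, \<eta>) \<notin> U" if "0 < t" "t < \<delta>" for t using that by (auto simp: disjoint_iff)
    have "u < \<eta>" if t: "0 < t" "t < \<delta>" and u: "(t, u) \<in> U" for t u
    proof (rule ccontr)
      assume "\<not> u < \<eta>"
      then have le: "norm w * \<eta> \<le> norm w * u" for w :: 'a by (intro mult_left_mono) auto
      have "(t, \<eta>) \<in> U" using u \<eta> unfolding Uiff by (meson le order_trans)
      then show False using no[OF t] by blast
    qed
    then show ?thesis using \<delta>(1) by blast
  qed
  obtain \<delta> C d where dec: "\<delta> > 0" "d \<ge> (1::nat)" "\<And>t u. 0 < t \<Longrightarrow> t < \<delta> \<Longrightarrow> 0 \<le> u \<Longrightarrow> (t, u) \<in> U \<Longrightarrow> u ^ d \<le> C * t"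
    using semialgebraic_decay[OF U decay] by blast
  obtain \<delta>1 where \<delta>1: "\<delta>1 > 0" "\<And>t u. 0 < t \<Longrightarrow> t < \<delta>1 \<Longrightarrow> (t, u) \<in> U \<Longrightarrow> u < 1"
    using decay[of 1] by auto
  define \<theta> where "\<theta> = real d / real (Suc d)"
  define c where "c = max C 1"
  have \<theta>: "0 < \<theta>" "\<theta> < 1" using dec(2) by (auto simp: \<theta>_def)
  have "t powr \<theta> \<le> c * norm w"
    if x: "norm x \<le> R" and w: "w \<in> SD x" and \<phi>x: "\<phi> x = v + \<epsilon> * t" and t: "0 < t" "t < min \<delta> \<delta>1" for x w t
  proof -
    have xR: "norm x \<le> R'" using x by (simp add: R'_def)
    have w0: "w \<noteq> 0"
    proof
      assume "w = 0"
      then have "(t, 1) \<in> U" unfolding Uiff using t xR w \<phi>x by (intro conjI exI[of _ x] exI[of _ w]) auto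
      then show False using \<delta>1(2)[of t 1] t by simp
    qed
    define u where "u = t / norm w"
    have u: "u > 0" "norm w * u = t" using t w0 by (auto simp: u_def)
    then have uU: "(t, u) \<in> U" unfolding Uiff using t xR w \<phi>x by auto
    then have u1: "u < 1" "u ^ d \<le> C * t" using dec(3)[of t u] \<delta>1(2)[of t u] t u by auto
    then have "u ^ Suc d \<le> C * t" using u by (simp add: mult_left_le_one_le order_trans[OF _ u1(2)])
    also have "\<dots> \<le> c * t" using t by (intro mult_right_mono) (auto simp: c_def)
    finally have "norm w ^ Suc d * u ^ Suc d \<le> norm w ^ Suc d * (c * t)" by (intro mult_left_mono) auto
    then have "t ^ Suc d \<le> norm w ^ Suc d * (c * t)" by (simp only: power_mult_distrib[symmetric] u(2))
    then have "t ^ d * t \<le> (norm w ^ Suc d * c) * t" by (simp add: algebra_simps)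
    then have "t ^ d \<le> norm w ^ Suc d * c" using t(1) by simp
    also have "\<dots> \<le> norm w ^ Suc d * c ^ Suc d"
      by (intro mult_left_mono self_le_power) (auto simp: c_def)
    also have "\<dots> = (c * norm w) ^ Suc d" by (simp only: power_mult_distrib mult.commute)
    also have "t ^ d = (t powr \<theta>) ^ Suc d"
    proof -
      have "(t powr \<theta>) ^ Suc d = t powr (real (Suc d) * \<theta>)" using t(1) by (intro powr_power) auto
      also have "real (Suc d) * \<theta> = real d" by (simp add: \<theta>_def del: of_nat_Suc)
      finally show ?thesis using t(1) by (simp add: powr_realpow)
    qed
    finally show ?thesis by (rule power_le_imp_le_base) (auto simp: c_def)
  qed
  moreover have "min \<delta> \<delta>1 > 0" "c > 0" using dec(1) \<delta>1(1) by (auto simp: c_def)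
  ultimately show ?thesis using \<theta> by meson
qed

text \<open>All exponents from \<open>\<theta>0\<close> up to 1 are available, since values closer
  than 1 to \<open>v\<close> make the left side decrease in \<theta>. \<open>error_sum\<close>
  relies on this freedom.\<close>

theorem kl_inequality:
  obtains \<delta> c \<theta>0 where "0 < \<delta>" "0 < c" "0 < \<theta>0" "\<theta>0 < 1"
    "\<And>\<theta> x w. \<theta>0 \<le> \<theta> \<Longrightarrow> \<theta> < 1 \<Longrightarrow> norm x \<le> R \<Longrightarrow> w \<in> SD x \<Longrightarrow> \<bar>\<phi> x - v\<bar> < \<delta> \<Longrightarrow> \<bar>\<phi> x - v\<bar> powr \<theta> \<le> c * norm w"
proof -
  obtain \<delta>1 c1 \<theta>1 where 1: "0 < \<delta>1" "0 < c1" "0 < \<theta>1" "\<theta>1 < 1" "\<And>x w t. norm x \<le> R \<Longrightarrow> w \<in> SD x \<Longrightarrow> \<phi> x = v + 1 * t \<Longrightarrow>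
    0 < t \<Longrightarrow> t < \<delta>1 \<Longrightarrow> t powr \<theta>1 \<le> c1 * norm w"
    using kl_one_sided[of 1 R v] by blast
  obtain \<delta>2 c2 \<theta>2 where 2: "0 < \<delta>2" "0 < c2" "0 < \<theta>2" "\<theta>2 < 1" "\<And>x w t. norm x \<le> R \<Longrightarrow> w \<in> SD x \<Longrightarrow> \<phi> x = v + (- 1) * t \<Longrightarrow>
    0 < t \<Longrightarrow> t < \<delta>2 \<Longrightarrow> t powr \<theta>2 \<le> c2 * norm w"
    using kl_one_sided[of "-1" R v] by blast
  show thesis
  proof (rule that[of "min (min \<delta>1 \<delta>2) 1" "max c1 c2" "max \<theta>1 \<theta>2"])
    fix \<theta> x w assume \<theta>: "max \<theta>1 \<theta>2 \<le> \<theta>" "\<theta> < 1" and x: "norm x \<le> R" "w \<in> SD x"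
      and lt: "\<bar>\<phi> x - v\<bar> < min (min \<delta>1 \<delta>2) 1"
    define t where "t = \<bar>\<phi> x - v\<bar>"
    have m: "c1 * norm w \<le> max c1 c2 * norm w" "c2 * norm w \<le> max c1 c2 * norm w"
      by (auto intro: mult_right_mono)
    consider "\<phi> x = v" | "\<phi> x = v + 1 * t" "0 < t" | "\<phi> x = v + (- 1) * t" "0 < t"
      unfolding t_def by (cases "\<phi> x" v rule: linorder_cases) auto
    then have "t powr \<theta> \<le> max c1 c2 * norm w"
    proof cases
      case eq: 1
      then show ?thesis using m(1) \<open>0 < c1\<close> by (simp add: t_def le_max_iff_disj)
    next
      case pos: 2
      have "t powr \<theta> \<le> t powr \<theta>1" using pos lt \<theta> by (intro powr_mono') (auto simp: t_def)
      also have "\<dots> \<le> c1 * norm w" using 1(5)[OF x pos] lt by (simp add: t_def)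
      finally show ?thesis using m by linarith
    next
      case 3
      have "t powr \<theta> \<le> t powr \<theta>2" using 3 lt \<theta> by (intro powr_mono') (auto simp: t_def)
      also have "\<dots> \<le> c2 * norm w" using \<open>0 < \<delta>2\<close> 2(5)[OF x 3] lt by (simp add: t_def)
      finally show ?thesis using m by linarith
    qed
    then show "\<bar>\<phi> x - v\<bar> powr \<theta> \<le> max c1 c2 * norm w" by (simp add: t_def)
  qed (use 1 2 in auto)
qed

end

subsection \<open>The composite objective\<close>

locale composite_problem =
  fixes N :: nat and f :: "nat \<Rightarrow> 'a::euclidean_space \<Rightarrow> real" and g :: "'a \<Rightarrow> ereal"
  assumes N: "1 \<le> N"
    and f_diff: "\<And>i x. i \<in> {1..N} \<Longrightarrow> f i differentiable (at x)"
    and f_grad: "\<And>i. i \<in> {1..N} \<Longrightarrow> locally_lipschitz_on UNIV (gradient (f i))"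
    and g_proper: "proper_function g"
    and g_convex: "convex_function g"
    and g_dom: "closed (edom g)"
    and g_lip: "locally_lipschitz_on (edom g) (\<lambda>x. real_of_ereal (g x))"
begin

abbreviation "D \<equiv> edom g"
definition "r y = real_of_ereal (g y)"
definition "h y = (\<Sum>i=1..N. f i y)"
definition "G y = (\<Sum>i=1..N. gradient (f i) y)"
definition "\<phi> y = h y + r y"
definition "SD x = {w. x \<in> D \<and> (\<forall>y\<in>D. r x + (w - G x) \<bullet> (y - x) \<le> r y)}"

lemma g_eq: "g y = ereal (r y)" if "y \<in> D"
  using that g_proper unfolding r_def edom_def proper_function_def by (cases "g y") auto

lemma g_infinite: "g y = \<infinity>" if "y \<notin> D"
  using that unfolding edom_def by auto

lemma objective_eq: "objective N f g y = (if y \<in> D then ereal (\<phi> y) else \<infinity>)"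
  by (auto simp: objective_def g_eq g_infinite \<phi>_def h_def)

lemma SD_eq: "clarke_subdifferential (objective N f g) x = SD x"
proof -
  have fin: "\<bar>g x\<bar> \<noteq> \<infinity> \<longleftrightarrow> x \<in> D" by (cases "x \<in> D") (auto simp: g_eq g_infinite)
  have "v \<in> convex_subdifferential g x \<longleftrightarrow> x \<in> D \<and> (\<forall>y\<in>D. r x + v \<bullet> (y - x) \<le> r y)" for v
  proof -
    have "x \<in> D \<Longrightarrow> g x + ereal (v \<bullet> (y - x)) \<le> g y \<longleftrightarrow> (y \<in> D \<longrightarrow> r x + v \<bullet> (y - x) \<le> r y)" for y
      by (cases "y \<in> D") (auto simp: g_eq g_infinite)
    then show ?thesis unfolding convex_subdifferential_def fin by blast
  qed
  then have cs: "convex_subdifferential g x = {v. x \<in> D \<and> (\<forall>y\<in>D. r x + v \<bullet> (y - x) \<le> r y)}" by blast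
  have "v \<in> (\<lambda>v. G x + v) ` convex_subdifferential g x \<longleftrightarrow> v \<in> SD x" for v
    unfolding cs SD_def image_iff by (auto intro!: exI[of _ "v - G x"])
  moreover have "clarke_subdifferential (objective N f g) x = (\<lambda>v. G x + v) ` convex_subdifferential g x"
    unfolding G_def using f_diff f_grad g_proper g_convex g_lip
    by (intro clarke_subdifferential_objective) auto
  ultimately show ?thesis by blast
qed

lemma r_convex:
  assumes "x \<in> D" "y \<in> D" "0 \<le> s" "s \<le> 1"
  shows "x + s *\<^sub>R (y - x) \<in> D" "r (x + s *\<^sub>R (y - x)) \<le> r x + s * (r y - r x)"
proof -
  have epi: "(y, t) \<in> ereal_epigraph g \<longleftrightarrow> y \<in> D \<and> r y \<le> t" for y t
    unfolding ereal_epigraph_def by (cases "y \<in> D") (auto simp: g_eq g_infinite)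
  have "(1 - s) *\<^sub>R (x, r x) + s *\<^sub>R (y, r y) \<in> ereal_epigraph g"
    using g_convex assms epi unfolding convex_function_def by (intro convexD) auto
  moreover have "(1 - s) *\<^sub>R (x, r x) + s *\<^sub>R (y, r y) = (x + s *\<^sub>R (y - x), r x + s * (r y - r x))"
    by (simp add: algebra_simps)
  ultimately show "x + s *\<^sub>R (y - x) \<in> D" "r (x + s *\<^sub>R (y - x)) \<le> r x + s * (r y - r x)"
    using epi by auto
qed

lemma h_derivative: "(h has_derivative (\<lambda>d. d \<bullet> G y)) (at y)"
proof -
  have "(f i has_derivative (\<lambda>d. d \<bullet> gradient (f i) y)) (at y)" if "i \<in> {1..N}" for i
    using GDERIV_gradient[OF f_diff[OF that]] by (simp add: gderiv_def)
  then have "((\<lambda>y. \<Sum>i=1..N. f i y) has_derivative (\<lambda>d. \<Sum>i=1..N. d \<bullet> gradient (f i) y)) (at y)"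
    by (rule has_derivative_sum)
  then show ?thesis unfolding h_def[abs_def] G_def by (simp add: inner_sum_right)
qed

lemma lipschitz_on_compact:
  fixes F :: "'a \<Rightarrow> 'b::metric_space"
  assumes "locally_lipschitz_on S F" "closed S"
  shows "\<exists>L>0. \<forall>x\<in>S \<inter> cball 0 R. \<forall>y\<in>S \<inter> cball 0 R. dist (F x) (F y) \<le> L * dist x y"
proof -
  \<comment> \<open>The passage from local to uniform Lipschitz bounds on a compact set is stated
    for time-dependent maps; here time has the single value 0.\<close>
  have "local_lipschitz {0::real} (S \<inter> cball 0 R) (\<lambda>_. F)"
    unfolding local_lipschitz_def
  proof (intro ballI)
    fix x and t :: real assume x: "x \<in> S \<inter> cball 0 R" "t \<in> {0}"
    then obtain u L where u: "u > 0" "L-lipschitz_on (cball x u \<inter> S) F"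
      using assms(1) unfolding locally_lipschitz_on_def by blast
    then have "L-lipschitz_on (cball x u \<inter> (S \<inter> cball 0 R)) F" by (rule_tac lipschitz_on_subset) auto
    then show "\<exists>u>0. \<exists>L. \<forall>t\<in>cball t u \<inter> {0}. L-lipschitz_on (cball x u \<inter> (S \<inter> cball 0 R)) F"
      using u(1) by blast
  qed
  moreover have "compact (S \<inter> cball 0 R)" using assms(2) by (simp add: closed_Int_compact)
  ultimately obtain L where L: "\<And>t. t \<in> {0::real} \<Longrightarrow> L-lipschitz_on (S \<inter> cball 0 R) F"
    using local_lipschitz_compact_implies_lipschitz[where X = "S \<inter> cball 0 R" and T = "{0::real}" and f = "\<lambda>_. F"]
    by auto
  then have "dist (F x) (F y) \<le> (L + 1) * dist x y" if "x \<in> S \<inter> cball 0 R" "y \<in> S \<inter> cball 0 R" for x y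
    using lipschitz_onD[OF L that] by (simp add: distrib_right add_increasing2)
  moreover have "L + 1 > 0" using lipschitz_on_nonneg[OF L] by simp
  ultimately show ?thesis by blast
qed

text \<open>One constant for all estimates on a ball. In the last clause only \<open>x\<close> is
  confined to the ball: convexity spreads the Lipschitz bound of \<open>r\<close> near
  \<open>x\<close> to its whole domain.\<close>

lemma uniform_constants:
  fixes R :: real
  obtains L where "L > 0"
    "\<And>i x y. i \<in> {1..N} \<Longrightarrow> norm x \<le> R \<Longrightarrow> norm y \<le> R \<Longrightarrow> norm (gradient (f i) x - gradient (f i) y) \<le> L * norm (x - y)"
    "\<And>i x. i \<in> {1..N} \<Longrightarrow> norm x \<le> R \<Longrightarrow> norm (gradient (f i) x) \<le> L"
    "\<And>x y. norm x \<le> R \<Longrightarrow> norm y \<le> R \<Longrightarrow> norm (G x - G y) \<le> L * norm (x - y)"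
    "\<And>x. norm x \<le> R \<Longrightarrow> norm (G x) \<le> L"
    "\<And>x y. norm x \<le> R \<Longrightarrow> norm y \<le> R \<Longrightarrow> \<bar>h y - h x - G x \<bullet> (y - x)\<bar> \<le> L * (norm (y - x))\<^sup>2"
    "\<And>x y. norm x \<le> R \<Longrightarrow> norm y \<le> R \<Longrightarrow> \<bar>h x - h y\<bar> \<le> L * norm (x - y)"
    "\<And>x y. x \<in> D \<Longrightarrow> y \<in> D \<Longrightarrow> norm x \<le> R \<Longrightarrow> r x - L * norm (x - y) \<le> r y"
proof -
  \<comment> \<open>One unit of room: the last clause looks at a point at distance 1 from
    \<open>x\<close>.\<close>
  define R' where "R' = max R 0 + 1"
  have "\<exists>L>0. \<forall>x\<in>UNIV \<inter> cball 0 R'. \<forall>y\<in>UNIV \<inter> cball 0 R'. dist (gradient (f i) x) (gradient (f i) y) \<le> L * dist x y"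
    if "i \<in> {1..N}" for i using f_grad[OF that] by (rule lipschitz_on_compact) simp
  then obtain Lf where Lf: "\<And>i. i \<in> {1..N} \<Longrightarrow> Lf i > 0"
    "\<And>i x y. i \<in> {1..N} \<Longrightarrow> norm x \<le> R' \<Longrightarrow> norm y \<le> R' \<Longrightarrow>
      norm (gradient (f i) x - gradient (f i) y) \<le> Lf i * norm (x - y)"
    by (metis IntI UNIV_I dist_norm mem_cball_0)
  obtain Lr where Lr: "Lr > 0" "\<And>x y. x \<in> D \<Longrightarrow> norm x \<le> R' \<Longrightarrow> y \<in> D \<Longrightarrow> norm y \<le> R' \<Longrightarrow> \<bar>r x - r y\<bar> \<le> Lr * norm (x - y)"
    using lipschitz_on_compact[OF g_lip g_dom, of R'] unfolding r_def dist_norm real_norm_def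
    by (metis IntI mem_cball_0)
  define S where "S = (\<Sum>i=1..N. Lf i + norm (gradient (f i) 0) + Lf i * R')"
  have R': "R' > 0" "R \<le> R'" by (auto simp: R'_def)
  have Si: "Lf i \<le> S" "norm (gradient (f i) 0) + Lf i * R' \<le> S" if "i \<in> {1..N}" for i
  proof -
    have "0 \<le> Lf j + norm (gradient (f j) 0) + Lf j * R'" if "j \<in> {1..N}" for j
    proof -
      have "0 < Lf j" "0 < Lf j * R'" using Lf(1)[OF that] R' by auto
      then show ?thesis using norm_ge_zero[of "gradient (f j) 0"] by linarith
    qed
    then have "Lf i + norm (gradient (f i) 0) + Lf i * R' \<le> S"
      unfolding S_def by (intro member_le_sum[OF that]) auto
    moreover have "0 < Lf i" "0 < Lf i * R'" "0 \<le> norm (gradient (f i) 0)" using Lf(1)[OF that] R' by auto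
    ultimately show "Lf i \<le> S" "norm (gradient (f i) 0) + Lf i * R' \<le> S" by linarith+
  qed
  have S0: "S > 0" using Si(1)[of 1] Lf(1)[of 1] N by auto
  have g1: "norm (gradient (f i) x - gradient (f i) y) \<le> S * norm (x - y)"
    if "i \<in> {1..N}" "norm x \<le> R'" "norm y \<le> R'" for i x y
    using Lf(2)[OF that] Si(1)[OF that(1)] by (meson mult_right_mono norm_ge_zero order_trans)
  have g2: "norm (gradient (f i) x) \<le> S" if "i \<in> {1..N}" "norm x \<le> R'" for i x
  proof -
    have "norm (gradient (f i) x) \<le> norm (gradient (f i) 0) + norm (gradient (f i) x - gradient (f i) 0)"
      by (rule norm_triangle_sub)
    also have "norm (gradient (f i) x - gradient (f i) 0) \<le> Lf i * norm (x - 0)"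
      using that R' by (intro Lf(2)) auto
    also have "\<dots> \<le> Lf i * R'" using that Lf(1)[OF that(1)] by (intro mult_left_mono) auto
    finally show ?thesis using Si(2)[OF that(1)] by simp
  qed
  define L where "L = real N * S + S + Lr"
  have L: "S \<le> L" "real N * S \<le> L" "Lr \<le> L" "L > 0" using S0 Lr(1)
    by (auto simp: L_def intro: add_nonneg_pos add_pos_pos)
  have G1: "norm (G x - G y) \<le> (real N * S) * norm (x - y)" if "norm x \<le> R'" "norm y \<le> R'" for x y
  proof -
    have "norm (G x - G y) \<le> (\<Sum>i=1..N. norm (gradient (f i) x - gradient (f i) y))"
      unfolding G_def sum_subtractf[symmetric] by (rule norm_sum)
    also have "\<dots> \<le> (\<Sum>i=1..N. S * norm (x - y))" by (intro sum_mono g1 that)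
    finally show ?thesis by simp
  qed
  have G2: "norm (G x) \<le> real N * S" if "norm x \<le> R'" for x
  proof -
    have "norm (G x) \<le> (\<Sum>i=1..N. norm (gradient (f i) x))" unfolding G_def by (rule norm_sum)
    also have "\<dots> \<le> (\<Sum>i=1..N. S)" by (intro sum_mono g2 that)
    finally show ?thesis by simp
  qed
  have mvt: "\<exists>z. norm z \<le> R' \<and> norm (z - x) \<le> norm (y - x) \<and> h y - h x = (y - x) \<bullet> G z"
    if "norm x \<le> R'" "norm y \<le> R'" for x y
  proof -
    have "((\<lambda>s. h (x + s *\<^sub>R (y - x))) has_real_derivative ((y - x) \<bullet> G (x + s *\<^sub>R (y - x)))) (at s)" for s
    proof -
      have "((\<lambda>s. x + s *\<^sub>R (y - x)) has_derivative (\<lambda>d. d *\<^sub>R (y - x))) (at s)"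
        by (auto intro!: derivative_eq_intros)
      from has_derivative_compose[OF this h_derivative]
      show ?thesis by (simp add: has_field_derivative_def mult_commute_abs)
    qed
    then obtain s where s: "0 < s" "s < 1"
      "h (x + 1 *\<^sub>R (y - x)) - h (x + 0 *\<^sub>R (y - x)) = (1 - 0) * ((y - x) \<bullet> G (x + s *\<^sub>R (y - x)))"
      using MVT2[of 0 1 "\<lambda>s. h (x + s *\<^sub>R (y - x))" "\<lambda>s. (y - x) \<bullet> G (x + s *\<^sub>R (y - x))"] by auto
    have "x + s *\<^sub>R (y - x) \<in> cball 0 R'"
    proof -
      have "(1 - s) *\<^sub>R x + s *\<^sub>R y \<in> cball 0 R'" using that s by (intro convexD) auto
      then show ?thesis by (simp add: algebra_simps)
    qed
    moreover have "norm (x + s *\<^sub>R (y - x) - x) \<le> norm (y - x)" using s by (simp add: mult_left_le_one_le)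
    ultimately show ?thesis using s(3) by (intro exI[of _ "x + s *\<^sub>R (y - x)"]) auto
  qed
  show thesis
  proof (rule that[OF L(4)])
    fix i and x y :: 'a assume "i \<in> {1..N}" "norm x \<le> R" "norm y \<le> R"
    then show "norm (gradient (f i) x - gradient (f i) y) \<le> L * norm (x - y)"
      using g1[of i x y] L(1) R' by (meson mult_right_mono norm_ge_zero order_trans)
  next
    fix i and x :: 'a assume "i \<in> {1..N}" "norm x \<le> R"
    then show "norm (gradient (f i) x) \<le> L" using g2[of i x] L(1) R' by linarith
  next
    fix x y :: 'a assume "norm x \<le> R" "norm y \<le> R"
    then show "norm (G x - G y) \<le> L * norm (x - y)"
      using G1[of x y] L(2) R' by (meson mult_right_mono norm_ge_zero order_trans)
  next
    fix x :: 'a assume "norm x \<le> R"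
    then show "norm (G x) \<le> L" using G2[of x] L(2) R' by linarith
  next
    fix x y :: 'a assume "norm x \<le> R" "norm y \<le> R"
    then have xy: "norm x \<le> R'" "norm y \<le> R'" using R' by auto
    obtain z where z: "norm z \<le> R'" "norm (z - x) \<le> norm (y - x)" "h y - h x = (y - x) \<bullet> G z" using mvt[OF xy] by blast
    have "h y - h x - G x \<bullet> (y - x) = (G z - G x) \<bullet> (y - x)"
      by (simp only: z(3) inner_diff_left[of "G z" "G x"] inner_commute[of "y - x" "G z"])
    then have "\<bar>h y - h x - G x \<bullet> (y - x)\<bar> \<le> norm (G z - G x) * norm (y - x)"
      using Cauchy_Schwarz_ineq2 by metis
    also have "\<dots> \<le> (L * norm (y - x)) * norm (y - x)"
    proof (rule mult_right_mono)
      have "norm (G z - G x) \<le> (real N * S) * norm (z - x)" by (rule G1[OF z(1) xy(1)])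
      also have "\<dots> \<le> L * norm (y - x)" using z(2) L S0 by (intro mult_mono) auto
      finally show "norm (G z - G x) \<le> L * norm (y - x)" .
    qed simp
    finally show "\<bar>h y - h x - G x \<bullet> (y - x)\<bar> \<le> L * (norm (y - x))\<^sup>2" by (simp add: power2_eq_square mult.assoc)
  next
    fix x y :: 'a assume "norm x \<le> R" "norm y \<le> R"
    then have xy: "norm y \<le> R'" "norm x \<le> R'" using R' by auto
    obtain z where z: "norm z \<le> R'" "h x - h y = (x - y) \<bullet> G z" using mvt[OF xy] by blast
    have "\<bar>h x - h y\<bar> \<le> norm (x - y) * norm (G z)" unfolding z(2) by (rule Cauchy_Schwarz_ineq2)
    also have "\<dots> \<le> norm (x - y) * L" using G2[OF z(1)] L(2) by (intro mult_left_mono) auto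
    finally show "\<bar>h x - h y\<bar> \<le> L * norm (x - y)" by (simp add: mult.commute)
  next
    fix x y assume x: "x \<in> D" and y: "y \<in> D" and nx: "norm x \<le> R"
    have "r x - Lr * norm (x - y) \<le> r y"
    proof (cases "norm (y - x) \<le> 1")
      case True
      have "norm y \<le> R'" using norm_triangle_sub[of y x] True nx by (simp add: R'_def)
      then show ?thesis using Lr(2)[OF x _ y] nx R' by force
    next
      case False
      define n where "n = norm (y - x)"
      have n: "n > 1" using False by (simp add: n_def)
      \<comment> \<open>The point of the segment at distance 1 from \<open>x\<close>; by convexity
        the slope of \<open>r\<close> from \<open>x\<close> to \<open>y\<close> is at least that
        from \<open>x\<close> to \<open>p\<close>.\<close>
      define p where "p = x + (1 / n) *\<^sub>R (y - x)"
      have p: "p \<in> D" "r p \<le> r x + (1 / n) * (r y - r x)"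
        unfolding p_def using r_convex[OF x y, of "1/n"] n by auto
      have np: "norm (p - x) = 1" using n by (simp add: p_def n_def[symmetric])
      have "norm p \<le> R'" using norm_triangle_sub[of p x] np nx by (simp add: R'_def)
      then have "\<bar>r p - r x\<bar> \<le> Lr * 1" using Lr(2)[OF p(1) _ x] nx R' np by force
      then have "- Lr \<le> (1 / n) * (r y - r x)" using p(2) by linarith
      then have "- Lr * n \<le> r y - r x" using n by (simp add: field_simps)
      then show ?thesis by (simp add: n_def norm_minus_commute)
    qed
    moreover have "Lr * norm (x - y) \<le> L * norm (x - y)" using L(3) by (intro mult_right_mono) auto
    ultimately show "r x - L * norm (x - y) \<le> r y" by linarith
  qed
qed

lemma nonneg_if_small_perturbation:
  fixes A B :: real
  assumes "\<And>s. 0 < s \<Longrightarrow> s \<le> 1 \<Longrightarrow> s \<le> s0 \<Longrightarrow> 0 \<le> s * A + s\<^sup>2 * B" "s0 > 0"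
  shows "0 \<le> A"
proof (rule ccontr)
  assume "\<not> 0 \<le> A"
  define s where "s = min (min 1 s0) (- A / (2 * (\<bar>B\<bar> + 1)))"
  have "0 < - A / (2 * (\<bar>B\<bar> + 1))" using \<open>\<not> 0 \<le> A\<close> by (intro divide_pos_pos) auto
  then have s: "0 < s" "s \<le> 1" "s \<le> s0" "s \<le> - A / (2 * (\<bar>B\<bar> + 1))"
    using assms(2) unfolding s_def by linarith+
  have "0 \<le> s * (A + s * B)" using assms(1)[OF s(1-3)] by (simp add: power2_eq_square algebra_simps)
  then have "0 \<le> A + s * B" using s(1) by (simp add: zero_le_mult_iff)
  moreover have "s * B \<le> s * (\<bar>B\<bar> + 1)" using s(1) by (intro mult_left_mono) auto
  moreover have "s * (\<bar>B\<bar> + 1) \<le> - A / 2"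
  proof -
    have "s * (2 * (\<bar>B\<bar> + 1)) \<le> - A" using s(4) by (subst (asm) pos_le_divide_eq) auto
    then show ?thesis by (simp add: algebra_simps)
  qed
  ultimately show False using \<open>\<not> 0 \<le> A\<close> by linarith
qed

text \<open>For a convex function a local lower bound with quadratic error already gives the global
  subgradient inequality, because along a segment the errors are of order \<open>s\<^sup>2\<close>.
  The lemma recognizes subgradients among limits of difference quotients and makes \<open>SD\<close>
  first-order definable.\<close>

lemma SD_localI:
  assumes x: "x \<in> D" and \<rho>: "\<rho> > 0"
    and loc: "\<And>y. y \<in> D \<Longrightarrow> norm (y - x) \<le> \<rho> \<Longrightarrow> \<phi> x + w \<bullet> (y - x) - L * (norm (y - x))\<^sup>2 \<le> \<phi> y"
  shows "w \<in> SD x"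
  unfolding SD_def
proof (intro CollectI conjI ballI x)
  fix y assume y: "y \<in> D"
  define R where "R = norm x + norm (y - x)"
  obtain M where M: "M > 0" "\<And>x y. norm x \<le> R \<Longrightarrow> norm y \<le> R \<Longrightarrow> \<bar>h y - h x - G x \<bullet> (y - x)\<bar> \<le> M * (norm (y - x))\<^sup>2"
    using uniform_constants[of R] by metis
  have "0 \<le> r y - r x - (w - G x) \<bullet> (y - x)"
  proof (rule nonneg_if_small_perturbation)
    show "\<rho> / (norm (y - x) + 1) > 0" using \<rho> by (simp add: add_nonneg_pos)
    fix s :: real assume s: "0 < s" "s \<le> 1" "s \<le> \<rho> / (norm (y - x) + 1)"
    define p where "p = x + s *\<^sub>R (y - x)"
    have px: "p - x = s *\<^sub>R (y - x)" by (simp add: p_def)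
    have p: "p \<in> D" "r p \<le> r x + s * (r y - r x)" unfolding p_def using r_convex[OF x y] s by auto
    have np: "norm (p - x) = s * norm (y - x)" unfolding px using s by simp
    have "s * (norm (y - x) + 1) \<le> \<rho>" using s(3) by (simp add: pos_le_divide_eq add_nonneg_pos)
    then have "norm (p - x) \<le> \<rho>" unfolding np using s by (simp add: distrib_left)
    then have 1: "\<phi> x + w \<bullet> (p - x) - L * (norm (p - x))\<^sup>2 \<le> \<phi> p" by (rule loc[OF p(1)])
    have "norm p \<le> norm x + norm (p - x)" by (rule norm_triangle_sub)
    also have "norm (p - x) \<le> norm (y - x)" unfolding np using s by (simp add: mult_left_le_one_le)
    finally have "norm p \<le> R" by (simp add: R_def)
    then have "\<bar>h p - h x - G x \<bullet> (p - x)\<bar> \<le> M * (norm (p - x))\<^sup>2" by (intro M(2)) (simp add: R_def)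
    then have "0 \<le> r p - r x + G x \<bullet> (p - x) - w \<bullet> (p - x) + (L + M) * (norm (p - x))\<^sup>2"
      using 1 unfolding \<phi>_def by (simp add: distrib_right abs_le_iff)
    also have "\<dots> \<le> s * (r y - r x) + G x \<bullet> (p - x) - w \<bullet> (p - x) + (L + M) * (norm (p - x))\<^sup>2"
      using p(2) by simp
    also have "\<dots> = s * (r y - r x - (w - G x) \<bullet> (y - x)) + s\<^sup>2 * ((L + M) * (norm (y - x))\<^sup>2)"
      unfolding np unfolding px by (simp add: algebra_simps power_mult_distrib inner_diff_left)
    finally show "0 \<le> s * (r y - r x - (w - G x) \<bullet> (y - x)) + s\<^sup>2 * ((L + M) * (norm (y - x))\<^sup>2)" .
  qed
  then show "r x + (w - G x) \<bullet> (y - x) \<le> r y" by simp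
qed

lemma r_continuous: "continuous_on D r"
  using locally_lipschitz_on_imp_continuous_on[OF g_lip] by (simp add: r_def[abs_def])

lemma G_continuous: "continuous_on UNIV G"
  unfolding G_def[abs_def] using locally_lipschitz_on_imp_continuous_on[OF f_grad] by (intro continuous_on_sum)

lemma h_continuous: "continuous_on S h"
  using h_derivative has_derivative_continuous by (metis continuous_at_imp_continuous_on)

sublocale weakly_convex_model D \<phi> SD
proof
  show "closed D" by (rule g_dom)
  show "continuous_on D \<phi>" unfolding \<phi>_def[abs_def] by (intro continuous_intros r_continuous h_continuous)
  show "x \<in> D" if "w \<in> SD x" for x w using that by (simp add: SD_def)
  show "w \<in> SD x" if W: "\<And>n::nat. W n \<in> SD (X n)" and X: "X \<longlonglongrightarrow> x" and Ww: "W \<longlonglongrightarrow> w" for X W x w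
    unfolding SD_def
  proof (intro CollectI conjI ballI)
    have XD: "X n \<in> D" for n using W by (simp add: SD_def)
    show xD: "x \<in> D" using closed_sequentially[OF g_dom] XD X by blast
    fix y assume y: "y \<in> D"
    have "(\<lambda>n. r (X n)) \<longlonglongrightarrow> r x"
      by (rule continuous_on_tendsto_compose[OF r_continuous X xD]) (simp add: XD)
    moreover have "(\<lambda>n. G (X n)) \<longlonglongrightarrow> G x"
      by (rule continuous_on_tendsto_compose[OF G_continuous X]) auto
    ultimately have "(\<lambda>n. r (X n) + (W n - G (X n)) \<bullet> (y - X n)) \<longlonglongrightarrow> r x + (w - G x) \<bullet> (y - x)"
      by (intro tendsto_intros X Ww)
    moreover have "r (X n) + (W n - G (X n)) \<bullet> (y - X n) \<le> r y" for n using W[of n] y by (simp add: SD_def)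
    ultimately show "r x + (w - G x) \<bullet> (y - x) \<le> r y" using LIMSEQ_le_const2 by blast
  qed
  show "\<exists>L>0. \<forall>x y w. x \<in> cball 0 R \<longrightarrow> y \<in> D \<inter> cball 0 R \<longrightarrow> w \<in> SD x \<longrightarrow>
          \<phi> x + w \<bullet> (y - x) - L * (norm (y - x))\<^sup>2 \<le> \<phi> y" for R
  proof -
    obtain M where M: "M > 0" "\<And>x y. norm x \<le> R \<Longrightarrow> norm y \<le> R \<Longrightarrow> \<bar>h y - h x - G x \<bullet> (y - x)\<bar> \<le> M * (norm (y - x))\<^sup>2"
      using uniform_constants[of R] by metis
    have "\<phi> x + w \<bullet> (y - x) - M * (norm (y - x))\<^sup>2 \<le> \<phi> y"
      if "x \<in> cball 0 R" "y \<in> D \<inter> cball 0 R" "w \<in> SD x" for x y w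
    proof -
      have "r x + (w - G x) \<bullet> (y - x) \<le> r y" using that by (simp add: SD_def)
      then show ?thesis using M(2)[of x y] that unfolding \<phi>_def by (simp add: inner_diff_left abs_le_iff)
    qed
    then show ?thesis using M(1) by blast
  qed
qed

lemma SD_convex: "convex (SD x)"
proof (rule convexI)
  fix v w and s t :: real assume vw: "v \<in> SD x" "w \<in> SD x" and st: "0 \<le> s" "0 \<le> t" "s + t = 1"
  show "s *\<^sub>R v + t *\<^sub>R w \<in> SD x"
    unfolding SD_def
  proof (intro CollectI conjI ballI)
    show "x \<in> D" using vw by (simp add: SD_def)
    fix y assume "y \<in> D"
    then have "(v - G x) \<bullet> (y - x) \<le> r y - r x" "(w - G x) \<bullet> (y - x) \<le> r y - r x" using vw by (auto simp: SD_def)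
    then have "s * ((v - G x) \<bullet> (y - x)) + t * ((w - G x) \<bullet> (y - x)) \<le> s * (r y - r x) + t * (r y - r x)"
      using st by (intro add_mono mult_left_mono)
    also have "\<dots> = r y - r x" using st(3) by (simp add: distrib_right[symmetric])
    also have "s * ((v - G x) \<bullet> (y - x)) + t * ((w - G x) \<bullet> (y - x)) = (s *\<^sub>R v + t *\<^sub>R w - (s + t) *\<^sub>R G x) \<bullet> (y - x)"
      by (simp add: inner_diff_left inner_add_left algebra_simps)
    finally show "r x + (s *\<^sub>R v + t *\<^sub>R w - G x) \<bullet> (y - x) \<le> r y" using st(3) by simp
  qed
qed

text \<open>The graph is the lower boundary of the epigraph, and membership in \<open>SD\<close> is
  a first-order formula over the graph, to which Tarski--Seidenberg applies.\<close>

lemma semialgebraic_model: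
  assumes sa: "semialgebraic_function (objective N f g)"
  shows "semialgebraic_model D \<phi> SD"
proof
  let ?\<Gamma> = "{z. fst z \<in> D \<and> \<phi> (fst z) = snd z}"
  let ?E = "ereal_epigraph (objective N f g)"
  have E: "semialgebraic ?E" using sa by (simp add: semialgebraic_function_def)
  have epi: "(x, t) \<in> ?E \<longleftrightarrow> x \<in> D \<and> \<phi> x \<le> t" for x t
    unfolding ereal_epigraph_def by (simp add: objective_eq)
  have "?\<Gamma> = {z. (fst z, snd z) \<in> ?E \<and> (\<forall>s. (fst z, s) \<in> ?E \<longrightarrow> snd z \<le> s)}"
    unfolding epi by (auto intro: antisym)
  moreover have "semialgebraic \<dots>"
    by (intro semialgebraic_intros poly_intros semialgebraic_preimage[OF E])
  ultimately show \<Gamma>: "semialgebraic ?\<Gamma>" by simp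
  \<comment> \<open>A single \<open>L\<close> serves as modulus and as inverse radius, and the
    condition \<open>L * norm (y - x) \<le> 1\<close> is squared to become polynomial.\<close>
  have "snd z \<in> SD (fst z) \<longleftrightarrow> (\<exists>t L. (fst z, t) \<in> ?\<Gamma> \<and> 0 < L \<and>
      (\<forall>y s. (y, s) \<in> ?\<Gamma> \<longrightarrow> L * L * ((y - fst z) \<bullet> (y - fst z)) \<le> 1 \<longrightarrow>
         t + snd z \<bullet> (y - fst z) - L * ((y - fst z) \<bullet> (y - fst z)) \<le> s))" for z :: "'a \<times> 'a"
  proof (cases z)
    case (Pair x w)
    have "w \<in> SD x \<longleftrightarrow> x \<in> D \<and> (\<exists>L>0. \<forall>y\<in>D. L * norm (y - x) \<le> 1 \<longrightarrow>
         \<phi> x + w \<bullet> (y - x) - L * (norm (y - x))\<^sup>2 \<le> \<phi> y)"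
    proof
      assume w: "w \<in> SD x"
      obtain L where L: "L > 0" "\<And>y. y \<in> D \<inter> cball 0 (norm x + 1) \<Longrightarrow>
          \<phi> x + w \<bullet> (y - x) - L * (norm (y - x))\<^sup>2 \<le> \<phi> y"
        using weakly_convex[of "norm x + 1"] w by force
      \<comment> \<open>With \<open>L + 1\<close> the radius is at most 1, so \<open>y\<close> stays
        in the ball for which \<open>L\<close> was chosen.\<close>
      have "\<phi> x + w \<bullet> (y - x) - (L + 1) * (norm (y - x))\<^sup>2 \<le> \<phi> y" if y: "y \<in> D" "(L + 1) * norm (y - x) \<le> 1" for y
      proof -
        have "norm (y - x) \<le> (L + 1) * norm (y - x)" using L(1) by (simp add: distrib_right)
        then have "norm y \<le> norm x + 1" using y(2) norm_triangle_sub[of y x] by linarith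
        then have "\<phi> x + w \<bullet> (y - x) - L * (norm (y - x))\<^sup>2 \<le> \<phi> y" using y(1) by (intro L(2)) auto
        moreover have "(L + 1) * (norm (y - x))\<^sup>2 = L * (norm (y - x))\<^sup>2 + (norm (y - x))\<^sup>2"
          by (simp add: distrib_right)
        ultimately show ?thesis using zero_le_power2[of "norm (y - x)"] by linarith
      qed
      then show "x \<in> D \<and> (\<exists>L>0. \<forall>y\<in>D. L * norm (y - x) \<le> 1 \<longrightarrow>
         \<phi> x + w \<bullet> (y - x) - L * (norm (y - x))\<^sup>2 \<le> \<phi> y)"
        using L(1) SD_dom[OF w] by (intro conjI exI[of _ "L + 1"]) auto
    next
      assume "x \<in> D \<and> (\<exists>L>0. \<forall>y\<in>D. L * norm (y - x) \<le> 1 \<longrightarrow>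
         \<phi> x + w \<bullet> (y - x) - L * (norm (y - x))\<^sup>2 \<le> \<phi> y)"
      then obtain L where L: "x \<in> D" "L > 0" "\<And>y. y \<in> D \<Longrightarrow> L * norm (y - x) \<le> 1 \<Longrightarrow>
         \<phi> x + w \<bullet> (y - x) - L * (norm (y - x))\<^sup>2 \<le> \<phi> y" by blast
      show "w \<in> SD x"
      proof (rule SD_localI[OF L(1)])
        show "1 / L > 0" using L(2) by simp
        show "\<phi> x + w \<bullet> (y - x) - L * (norm (y - x))\<^sup>2 \<le> \<phi> y" if "y \<in> D" "norm (y - x) \<le> 1 / L" for y
          using that L(2) by (intro L(3)) (simp_all add: pos_le_divide_eq mult.commute)
      qed
    qed
    moreover have "L * L * ((y - x) \<bullet> (y - x)) \<le> 1 \<longleftrightarrow> L * norm (y - x) \<le> 1" if "L > 0" for L y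
    proof -
      have "L * L * ((y - x) \<bullet> (y - x)) = (L * norm (y - x))\<^sup>2"
        by (simp add: power2_norm_eq_inner[symmetric] power_mult_distrib power2_eq_square)
      moreover have "(L * norm (y - x))\<^sup>2 \<le> 1 \<longleftrightarrow> L * norm (y - x) \<le> 1"
        using that abs_square_le_1[of "L * norm (y - x)"] by simp
      ultimately show ?thesis by simp
    qed
    ultimately show ?thesis unfolding Pair power2_norm_eq_inner by auto
  qed
  then have "{z. snd z \<in> SD (fst z)} = {z. \<exists>t L. (fst z, t) \<in> ?\<Gamma> \<and> 0 < L \<and>
      (\<forall>y s. (y, s) \<in> ?\<Gamma> \<longrightarrow> L * L * ((y - fst z) \<bullet> (y - fst z)) \<le> 1 \<longrightarrow>
         t + snd z \<bullet> (y - fst z) - L * ((y - fst z) \<bullet> (y - fst z)) \<le> s)}" by (rule Collect_cong)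
  moreover have "semialgebraic \<dots>"
    by (intro semialgebraic_intros poly_intros semialgebraic_preimage[OF \<Gamma>])
  ultimately show "semialgebraic {z. snd z \<in> SD (fst z)}" by simp
qed

end

subsection \<open>One step of proximal random reshuffling\<close>

definition prr_step :: "nat \<Rightarrow> (nat \<Rightarrow> 'a::euclidean_space \<Rightarrow> real) \<Rightarrow> ('a \<Rightarrow> ereal) \<Rightarrow> real \<Rightarrow> 'a \<Rightarrow> 'a \<Rightarrow> bool" where
  "prr_step N f g a x x' \<longleftrightarrow> (\<exists>\<sigma> X. \<sigma> permutes {1..N} \<and> X 0 = x \<and>
     (\<forall>i\<in>{1..N}. X i = X (i - 1) - a *\<^sub>R gradient (f (\<sigma> i)) (X (i - 1))) \<and>
     x' \<in> prox (\<lambda>y. ereal a * g y) (X N))"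

text \<open>The error terms of a step vanish when there is nothing to reshuffle.\<close>

definition reshuffling :: "nat \<Rightarrow> real" where
  "reshuffling N = (if N = 1 then 0 else 1)"

context composite_problem begin

text \<open>The minimizer is compared with points on the segment towards \<open>y\<close>; as these
  approach it, minimality becomes a subgradient inequality.\<close>

lemma prox_optimality:
  assumes x': "x' \<in> prox (\<lambda>y. ereal a * g y) z" and a: "a > 0"
  shows "x' \<in> D" "\<And>y. y \<in> D \<Longrightarrow> r x' + ((z - x') /\<^sub>R a) \<bullet> (y - x') \<le> r y"
proof -
  have min: "\<not> ereal a * g y + ereal ((norm (y - z))\<^sup>2 / 2) < ereal a * g x' + ereal ((norm (x' - z))\<^sup>2 / 2)" for y
    using x' unfolding prox_def is_arg_min_def by auto
  obtain y0 where "y0 \<in> D" using g_proper unfolding proper_function_def by blast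
  show x'D: "x' \<in> D"
  proof (rule ccontr)
    assume "x' \<notin> D"
    then show False using min[of y0] \<open>y0 \<in> D\<close> a by (simp add: g_infinite g_eq)
  qed
  have le: "a * r x' + (norm (x' - z))\<^sup>2 / 2 \<le> a * r y + (norm (y - z))\<^sup>2 / 2" if "y \<in> D" for y
    using min[of y] that x'D by (simp add: g_eq)
  show "r x' + ((z - x') /\<^sub>R a) \<bullet> (y - x') \<le> r y" if y: "y \<in> D" for y
  proof -
    have "0 \<le> a * (r y - r x') - (z - x') \<bullet> (y - x')"
    proof (rule nonneg_if_small_perturbation)
      show "(1::real) > 0" by simp
      fix s :: real assume s: "0 < s" "s \<le> 1" "s \<le> 1"
      define p where "p = x' + s *\<^sub>R (y - x')"
      have p: "p \<in> D" "r p \<le> r x' + s * (r y - r x')" unfolding p_def using r_convex[OF x'D y] s by auto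
      have "p - z = (x' - z) + s *\<^sub>R (y - x')" by (simp add: p_def)
      then have np: "(norm (p - z))\<^sup>2 = (norm (x' - z))\<^sup>2 + 2 * s * ((x' - z) \<bullet> (y - x')) + s\<^sup>2 * (norm (y - x'))\<^sup>2"
        by (simp only: power2_norm_eq_inner inner_add_left inner_add_right inner_scaleR_left inner_scaleR_right
            inner_commute[of "y - x'" "x' - z"]) (simp add: power2_eq_square algebra_simps)
      have "a * r x' + (norm (x' - z))\<^sup>2 / 2 \<le> a * r p + (norm (p - z))\<^sup>2 / 2" by (rule le[OF p(1)])
      also have "a * r p \<le> a * (r x' + s * (r y - r x'))" using p(2) a by simp
      finally have "0 \<le> a * (s * (r y - r x')) + s * ((x' - z) \<bullet> (y - x')) + s\<^sup>2 * (norm (y - x'))\<^sup>2 / 2"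
        unfolding np by (simp add: distrib_left add_divide_distrib)
      moreover have "(x' - z) \<bullet> (y - x') = - ((z - x') \<bullet> (y - x'))" by (simp add: inner_diff_left)
      ultimately show "0 \<le> s * (a * (r y - r x') - (z - x') \<bullet> (y - x')) + s\<^sup>2 * ((norm (y - x'))\<^sup>2 / 2)"
        by (simp add: algebra_simps)
    qed
    then have "(z - x') \<bullet> (y - x') \<le> (r y - r x') * a" by (simp add: mult.commute)
    then have "((z - x') \<bullet> (y - x')) / a \<le> r y - r x'" using a by (simp add: pos_divide_le_eq)
    then show ?thesis by (simp add: divide_inverse mult.commute)
  qed
qed

text \<open>A pass is a full gradient step with an error \<open>e\<close>, caused by gradients
  evaluated at the moving points \<open>X (j - 1)\<close>, which have drifted by at most
  \<open>N * a * L\<close>. For \<open>N = 1\<close> the only gradient is taken at \<open>x\<close>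
  itself, so \<open>e = 0\<close>.\<close>

lemma inner_loop:
  assumes L: "L > 0"
    "\<And>i x y. i \<in> {1..N} \<Longrightarrow> norm x \<le> R + 1 \<Longrightarrow> norm y \<le> R + 1 \<Longrightarrow> norm (gradient (f i) x - gradient (f i) y) \<le> L * norm (x - y)"
    "\<And>i x. i \<in> {1..N} \<Longrightarrow> norm x \<le> R + 1 \<Longrightarrow> norm (gradient (f i) x) \<le> L"
    and a: "0 < a" "a * (real N * L) \<le> 1" and x: "norm x \<le> R"
    and \<sigma>: "\<sigma> permutes {1..N}" and X: "X 0 = x" "\<And>i. i \<in> {1..N} \<Longrightarrow> X i = X (i - 1) - a *\<^sub>R gradient (f (\<sigma> i)) (X (i - 1))"
  shows "\<exists>e. X N = x - a *\<^sub>R (G x + e) \<and> norm e \<le> reshuffling N * (real N * real N * L * L) * a"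
proof -
  have \<sigma>in: "\<sigma> i \<in> {1..N}" if "i \<in> {1..N}" for i using permutes_in_image[OF \<sigma>] that by simp
  have near: "norm (X i - x) \<le> real i * (a * L)" if "i \<le> N" for i
    using that
  proof (induction i)
    case (Suc i)
    then have IH: "norm (X i - x) \<le> real i * (a * L)" by simp
    also have "\<dots> \<le> real N * (a * L)" using Suc.prems a L by (intro mult_right_mono) auto
    also have "\<dots> \<le> 1" using a by (simp add: algebra_simps)
    finally have "norm (X i) \<le> R + 1" using x norm_triangle_sub[of "X i" x] by linarith
    then have "norm (gradient (f (\<sigma> (Suc i))) (X i)) \<le> L" using Suc.prems by (intro L(3) \<sigma>in) auto
    then have "norm (a *\<^sub>R gradient (f (\<sigma> (Suc i))) (X i)) \<le> a * L" using a by simp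
    moreover have "X (Suc i) - x = (X i - x) - a *\<^sub>R gradient (f (\<sigma> (Suc i))) (X i)"
      using X(2)[of "Suc i"] Suc.prems by simp
    then have "norm (X (Suc i) - x) \<le> norm (X i - x) + norm (a *\<^sub>R gradient (f (\<sigma> (Suc i))) (X i))"
      by (simp only: norm_triangle_ineq4)
    moreover have "real (Suc i) * (a * L) = real i * (a * L) + a * L" by (simp add: distrib_right)
    ultimately show ?case using IH by linarith
  qed (simp add: X)
  have in_ball: "norm (X i) \<le> R + 1" if "i \<le> N" for i
  proof -
    have "norm (X i - x) \<le> real i * (a * L)" by (rule near[OF that])
    also have "\<dots> \<le> real N * (a * L)" using that a L by (intro mult_right_mono) auto
    also have "\<dots> \<le> 1" using a by (simp add: algebra_simps)
    finally show ?thesis using x norm_triangle_sub[of "X i" x] by linarith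
  qed
  have sumX: "X i = x - a *\<^sub>R (\<Sum>j=1..i. gradient (f (\<sigma> j)) (X (j - 1)))" if "i \<le> N" for i
    using that
  proof (induction i)
    case (Suc i)
    then show ?case using X(2)[of "Suc i"] by (simp add: scaleR_right_distrib)
  qed (simp add: X)
  have Gx: "G x = (\<Sum>j=1..N. gradient (f (\<sigma> j)) x)"
    unfolding G_def using sum.permute[OF \<sigma>, of "\<lambda>i. gradient (f i) x"] by (simp add: o_def)
  define e where "e = (\<Sum>j=1..N. gradient (f (\<sigma> j)) (X (j - 1)) - gradient (f (\<sigma> j)) x)"
  have "X N = x - a *\<^sub>R (G x + e)" using sumX[of N] by (simp add: e_def Gx sum_subtractf)
  moreover have "norm e \<le> reshuffling N * (real N * real N * L * L) * a"
  proof -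
    have "norm e \<le> (\<Sum>j=1..N. norm (gradient (f (\<sigma> j)) (X (j - 1)) - gradient (f (\<sigma> j)) x))"
      unfolding e_def by (rule norm_sum)
    also have "\<dots> \<le> (\<Sum>j=1..N. L * (reshuffling N * real N * (a * L)))"
    proof (rule sum_mono)
      fix j assume j: "j \<in> {1..N}"
      have "norm (gradient (f (\<sigma> j)) (X (j - 1)) - gradient (f (\<sigma> j)) x) \<le> L * norm (X (j - 1) - x)"
        using j x by (intro L(2) \<sigma>in in_ball) auto
      also have "norm (X (j - 1) - x) \<le> reshuffling N * real N * (a * L)"
      proof (cases "N = 1")
        case True
        then show ?thesis using j X(1) by (simp add: reshuffling_def)
      next
        case False
        have "norm (X (j - 1) - x) \<le> real (j - 1) * (a * L)" using j by (intro near) auto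
        also have "\<dots> \<le> real N * (a * L)" using j a L by (intro mult_right_mono) auto
        finally show ?thesis using False by (simp add: reshuffling_def)
      qed
      finally show "norm (gradient (f (\<sigma> j)) (X (j - 1)) - gradient (f (\<sigma> j)) x) \<le> L * (reshuffling N * real N * (a * L))"
        using L(1) by (simp add: mult_left_mono)
    qed
    finally show ?thesis by (simp add: algebra_simps)
  qed
  ultimately show ?thesis by blast
qed

text \<open>All four estimates come from the implicit form
  \<open>x' - x = - a * (G x + e + w)\<close>, where \<open>w\<close> is a subgradient of
  \<open>r\<close> at the new point \<open>x'\<close>.\<close>

lemma prr_step_bounds:
  fixes R :: real
  shows "\<exists>M>0. \<exists>abar>0. \<forall>a x x'. 0 < a \<longrightarrow> a \<le> abar \<longrightarrow> x \<in> D \<longrightarrow> norm x \<le> R \<longrightarrow> prr_step N f g a x x' \<longrightarrow>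
     x' \<in> D \<and> norm (x' - x) \<le> M * a \<and>
     \<phi> x' \<le> \<phi> x - (norm (x' - x))\<^sup>2 / (2 * a) + reshuffling N * M * a ^ 3 \<and>
     (\<exists>w\<in>SD x'. a * norm w \<le> 2 * norm (x' - x) + reshuffling N * M * a\<^sup>2) \<and>
     (\<forall>z\<in>D. norm z \<le> R \<longrightarrow> (norm (x' - z))\<^sup>2 / 2 - (norm (x - z))\<^sup>2 / 2 \<le> a * (\<phi> z - \<phi> x + M * (norm (x - z))\<^sup>2 + M * a))"
proof -
  define \<kappa> where "\<kappa> = reshuffling N"
  have \<kappa>: "0 \<le> \<kappa>" "\<kappa> \<le> 1" "\<kappa> * \<kappa> = \<kappa>" by (auto simp: \<kappa>_def reshuffling_def)
  obtain L where L: "L > 0"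
    "\<And>i x y. i \<in> {1..N} \<Longrightarrow> norm x \<le> R + 1 \<Longrightarrow> norm y \<le> R + 1 \<Longrightarrow> norm (gradient (f i) x - gradient (f i) y) \<le> L * norm (x - y)"
    "\<And>i x. i \<in> {1..N} \<Longrightarrow> norm x \<le> R + 1 \<Longrightarrow> norm (gradient (f i) x) \<le> L"
    "\<And>x y. norm x \<le> R + 1 \<Longrightarrow> norm y \<le> R + 1 \<Longrightarrow> norm (G x - G y) \<le> L * norm (x - y)"
    "\<And>x. norm x \<le> R + 1 \<Longrightarrow> norm (G x) \<le> L"
    "\<And>x y. norm x \<le> R + 1 \<Longrightarrow> norm y \<le> R + 1 \<Longrightarrow> \<bar>h y - h x - G x \<bullet> (y - x)\<bar> \<le> L * (norm (y - x))\<^sup>2"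
    "\<And>x y. norm x \<le> R + 1 \<Longrightarrow> norm y \<le> R + 1 \<Longrightarrow> \<bar>h x - h y\<bar> \<le> L * norm (x - y)"
    "\<And>x y. x \<in> D \<Longrightarrow> y \<in> D \<Longrightarrow> norm x \<le> R + 1 \<Longrightarrow> r x - L * norm (x - y) \<le> r y"
    using uniform_constants[of "R + 1"] by blast
  define c where "c = real N * real N * L * L"
  have c: "c \<ge> 0" using L(1) by (simp add: c_def)
  define M1 where "M1 = 2 * L + c"
  have M1: "M1 > 0" using L(1) c by (simp add: M1_def)
  define M where "M = M1 + c * c + c + L + (L * M1 + c * (2 * \<bar>R\<bar> + 1) + L * M1)"
  have M: "M1 \<le> M" "c * c \<le> M" "c \<le> M" "L \<le> M" "L * M1 + c * (2 * \<bar>R\<bar> + 1) + L * M1 \<le> M" "M > 0"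
    using c M1 L(1) by (auto simp: M_def intro!: add_nonneg_nonneg mult_nonneg_nonneg add_pos_nonneg)
  \<comment> \<open>In turn: to drop powers of \<open>a\<close>, to keep the inner loop and then
    \<open>x'\<close> within distance 1 of \<open>x\<close>, and to absorb the curvature term
    \<open>L * (norm d)\<^sup>2\<close> into a quarter of
    \<open>(norm d)\<^sup>2 / a\<close>.\<close>
  define abar where "abar = Min {1, 1 / (real N * L), 1 / M1, 1 / (4 * L)}"
  have abar: "abar > 0" using L(1) N M1 by (simp add: abar_def)
  show ?thesis
  proof (rule exI[of _ M], rule conjI, rule M(6))
    show "\<exists>abar>0. \<forall>a x x'. 0 < a \<longrightarrow> a \<le> abar \<longrightarrow> x \<in> D \<longrightarrow> norm x \<le> R \<longrightarrow> prr_step N f g a x x' \<longrightarrow>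
     x' \<in> D \<and> norm (x' - x) \<le> M * a \<and>
     \<phi> x' \<le> \<phi> x - (norm (x' - x))\<^sup>2 / (2 * a) + reshuffling N * M * a ^ 3 \<and>
     (\<exists>w\<in>SD x'. a * norm w \<le> 2 * norm (x' - x) + reshuffling N * M * a\<^sup>2) \<and>
     (\<forall>z\<in>D. norm z \<le> R \<longrightarrow> (norm (x' - z))\<^sup>2 / 2 - (norm (x - z))\<^sup>2 / 2 \<le> a * (\<phi> z - \<phi> x + M * (norm (x - z))\<^sup>2 + M * a))"
      unfolding \<kappa>_def[symmetric]
    proof (rule exI[of _ abar], intro conjI abar allI impI)
      fix a x x' assume a: "0 < a" "a \<le> abar" and x: "x \<in> D" "norm x \<le> R" and step: "prr_step N f g a x x'"
      have a': "a \<le> 1" "a * (real N * L) \<le> 1" "a * M1 \<le> 1" "a * (4 * L) \<le> 1"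
      proof -
        have "abar \<le> 1" "abar \<le> 1 / (real N * L)" "abar \<le> 1 / M1" "abar \<le> 1 / (4 * L)"
          unfolding abar_def by (rule Min_le; simp)+
        then have "a \<le> 1" "a \<le> 1 / (real N * L)" "a \<le> 1 / M1" "a \<le> 1 / (4 * L)" using a(2) by linarith+
        then show "a \<le> 1" "a * (real N * L) \<le> 1" "a * M1 \<le> 1" "a * (4 * L) \<le> 1"
          using L(1) M1 N by (simp_all add: pos_le_divide_eq del: times_divide_eq_right)
      qed
      from step obtain \<sigma> X where X: "\<sigma> permutes {1..N}" "X 0 = x"
        "\<And>i. i \<in> {1..N} \<Longrightarrow> X i = X (i - 1) - a *\<^sub>R gradient (f (\<sigma> i)) (X (i - 1))"
        "x' \<in> prox (\<lambda>y. ereal a * g y) (X N)" unfolding prr_step_def by blast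
      obtain e where e: "X N = x - a *\<^sub>R (G x + e)" "norm e \<le> \<kappa> * c * a"
        using inner_loop[OF L(1) L(2) L(3) a(1) a'(2) x(2) X(1,2,3)] unfolding \<kappa>_def c_def by blast
      define w where "w = (X N - x') /\<^sub>R a"
      define d where "d = x' - x"
      have x'D: "x' \<in> D" and w: "\<And>y. y \<in> D \<Longrightarrow> r x' + w \<bullet> (y - x') \<le> r y"
        using prox_optimality[OF X(4) a(1)] by (auto simp: w_def)
      have "a *\<^sub>R w = X N - x'" using a(1) by (simp add: w_def)
      then have d_eq: "d = - (a *\<^sub>R (G x + e + w))" unfolding d_def by (simp add: e(1) scaleR_right_distrib)
      have ec: "norm e \<le> c * a"
        using e(2) mult_right_mono[OF \<kappa>(2), of "c * a"] c a(1) by (simp add: mult.assoc)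
      also have "\<dots> \<le> c" using a a'(1) c by (simp add: mult_left_le)
      finally have ec1: "norm e \<le> c" .
      have nx: "norm x \<le> R + 1" using x by simp
      have rd: "r x' - r x \<le> w \<bullet> d" using w[OF x(1)] by (simp add: d_def inner_diff_right)
      have dM: "norm d \<le> M1 * a"
      proof -
        have "norm d * norm d = d \<bullet> d" by (simp add: norm_eq_sqrt_inner)
        also have "\<dots> = - (a * ((G x + e + w) \<bullet> d))" by (subst d_eq) (simp only: inner_minus_left inner_scaleR_left)
        also have "\<dots> = a * (- (G x \<bullet> d) - e \<bullet> d - w \<bullet> d)" by (simp add: inner_add_left algebra_simps)
        also have "\<dots> \<le> a * ((L + c + L) * norm d)"
        proof (rule mult_left_mono)
          have "- (G x \<bullet> d) \<le> L * norm d"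
            using Cauchy_Schwarz_ineq2[of "G x" d] mult_right_mono[OF L(5)[OF nx], of "norm d"] by simp
          moreover have "- (e \<bullet> d) \<le> c * norm d"
            using Cauchy_Schwarz_ineq2[of e d] mult_right_mono[OF ec1, of "norm d"] by simp
          \<comment> \<open>No bound on \<open>w\<close> is available yet; its component along
            \<open>d\<close> is controlled through the values of \<open>r\<close> at
            \<open>x\<close> and \<open>x'\<close>.\<close>
          moreover have "- (w \<bullet> d) \<le> L * norm d"
          proof -
            have "r x - L * norm (x - x') \<le> r x'" by (rule L(8)[OF x(1) x'D nx])
            then show ?thesis using rd by (simp add: d_def norm_minus_commute)
          qed
          ultimately show "- (G x \<bullet> d) - e \<bullet> d - w \<bullet> d \<le> (L + c + L) * norm d" by (simp add: distrib_right)
        qed (use a in simp)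
        also have "\<dots> = (M1 * a) * norm d" by (simp add: M1_def algebra_simps)
        finally have "norm d * norm d \<le> (M1 * a) * norm d" .
        then show ?thesis
          using mult_right_le_imp_le[of "norm d" "norm d" "M1 * a"] mult_pos_pos[OF M1 a(1)]
          by (cases "d = 0") simp_all
      qed
      have d1: "norm d \<le> 1" using dM a'(3) by (simp add: mult.commute)
      then have nx': "norm x' \<le> R + 1" using x(2) norm_triangle_sub[of x' x] by (simp add: d_def)
      show "x' \<in> D" by (rule x'D)
      show "norm (x' - x) \<le> M * a"
        unfolding d_def[symmetric] using dM mult_right_mono[OF M(1) less_imp_le[OF a(1)]] by linarith
      have dd: "(G x + e + w) \<bullet> d = - (norm d)\<^sup>2 / a"
      proof -
        have "a * ((G x + e + w) \<bullet> d) = - (d \<bullet> d)" by (subst (2) d_eq) (simp only: inner_minus_left inner_scaleR_left minus_minus)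
        then show ?thesis using a(1) by (simp add: power2_norm_eq_inner field_simps)
      qed
      show "\<phi> x' \<le> \<phi> x - (norm (x' - x))\<^sup>2 / (2 * a) + \<kappa> * M * a ^ 3"
      proof -
        have "h x' - h x \<le> G x \<bullet> d + L * (norm d)\<^sup>2" using L(6)[OF nx nx'] by (simp add: d_def abs_le_iff)
        then have "\<phi> x' - \<phi> x \<le> (G x + w) \<bullet> d + L * (norm d)\<^sup>2"
          using rd by (simp add: \<phi>_def inner_add_left)
        also have "\<dots> = - (norm d)\<^sup>2 / a - e \<bullet> d + L * (norm d)\<^sup>2"
          using dd by (simp add: inner_add_left)
        finally have "\<phi> x' - \<phi> x \<le> - (norm d)\<^sup>2 / a - e \<bullet> d + L * (norm d)\<^sup>2" .
        \<comment> \<open>Young's inequality, weighted so that half of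
          \<open>(norm d)\<^sup>2 / a\<close> survives this term and the curvature term.\<close>
        moreover have "- (e \<bullet> d) \<le> (norm d)\<^sup>2 / (4 * a) + a * (norm e)\<^sup>2"
        proof -
          have "- (e \<bullet> d) \<le> norm e * norm d" using Cauchy_Schwarz_ineq2[of e d] by simp
          also have "\<dots> \<le> (norm d)\<^sup>2 / (4 * a) + a * (norm e)\<^sup>2"
          proof -
            have "0 \<le> (norm d / (2 * sqrt a) - sqrt a * norm e)\<^sup>2" by simp
            also have "\<dots> = (norm d)\<^sup>2 / (4 * a) + a * (norm e)\<^sup>2 - norm e * norm d"
              using a(1) by (simp add: power2_diff power_divide power_mult_distrib)
            finally show ?thesis by simp
          qed
          finally show ?thesis .
        qed
        moreover have "L * (norm d)\<^sup>2 \<le> (norm d)\<^sup>2 / (4 * a)"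
        proof -
          have "a * (4 * L) * (norm d)\<^sup>2 \<le> 1 * (norm d)\<^sup>2" using a'(4) by (intro mult_right_mono) auto
          then show ?thesis using a(1) by (simp add: pos_le_divide_eq algebra_simps)
        qed
        moreover have "a * (norm e)\<^sup>2 \<le> \<kappa> * M * a ^ 3"
        proof -
          have "(norm e)\<^sup>2 \<le> (\<kappa> * c * a)\<^sup>2" using e(2) by (intro power_mono) auto
          also have "\<dots> = \<kappa> * (c * c) * a\<^sup>2" using \<kappa>(3) by (simp add: power2_eq_square) (metis mult.assoc mult.left_commute)
          also have "\<dots> \<le> \<kappa> * M * a\<^sup>2" using M(2) \<kappa>(1) by (intro mult_right_mono mult_left_mono) auto
          finally have "a * (norm e)\<^sup>2 \<le> a * (\<kappa> * M * a\<^sup>2)" using a(1) by (intro mult_left_mono) auto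
          then show ?thesis by (simp add: power3_eq_cube power2_eq_square algebra_simps)
        qed
        moreover have "- (norm d)\<^sup>2 / a = - (norm d)\<^sup>2 / (2 * a) - (norm d)\<^sup>2 / (4 * a) - (norm d)\<^sup>2 / (4 * a)"
          using a(1) by (simp add: field_simps)
        ultimately show ?thesis unfolding d_def[symmetric] by linarith
      qed
      show "\<exists>w\<in>SD x'. a * norm w \<le> 2 * norm (x' - x) + \<kappa> * M * a\<^sup>2"
      proof (rule bexI[of _ "G x' + w"])
        show "G x' + w \<in> SD x'" using x'D w by (simp add: SD_def)
        have "a *\<^sub>R (G x' + w) = a *\<^sub>R (G x' - G x) - a *\<^sub>R e - d"
          by (subst d_eq) (simp add: scaleR_right_distrib scaleR_right_diff_distrib)
        then have "a * norm (G x' + w) = norm (a *\<^sub>R (G x' - G x) - a *\<^sub>R e - d)"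
          using a(1) by (metis abs_of_pos norm_scaleR)
        also have "\<dots> \<le> norm (a *\<^sub>R (G x' - G x)) + norm (a *\<^sub>R e) + norm d"
          using norm_triangle_ineq4[of "a *\<^sub>R (G x' - G x) - a *\<^sub>R e" d]
            norm_triangle_ineq4[of "a *\<^sub>R (G x' - G x)" "a *\<^sub>R e"] by linarith
        also have "norm (a *\<^sub>R (G x' - G x)) \<le> norm d"
        proof -
          have "norm (a *\<^sub>R (G x' - G x)) \<le> a * (L * norm d)"
            using L(4)[OF nx' nx] a(1) by (simp add: d_def mult_left_mono)
          also have "\<dots> = (a * L) * norm d" by simp
          also have "\<dots> \<le> 1 * norm d"
          proof (rule mult_right_mono)
            have "a * L \<le> a * (4 * L)" using a L(1) by simp
            then show "a * L \<le> 1" using a'(4) by linarith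
          qed simp
          finally show ?thesis by simp
        qed
        also have "norm (a *\<^sub>R e) \<le> \<kappa> * M * a\<^sup>2"
        proof -
          have "norm (a *\<^sub>R e) \<le> a * (\<kappa> * c * a)" using e(2) a(1) by (simp add: mult_left_mono)
          also have "\<dots> = \<kappa> * c * a\<^sup>2" by (simp add: power2_eq_square)
          also have "\<dots> \<le> \<kappa> * M * a\<^sup>2" using M(3) \<kappa>(1) by (intro mult_right_mono mult_left_mono) auto
          finally show ?thesis .
        qed
        finally show "a * norm (G x' + w) \<le> 2 * norm (x' - x) + \<kappa> * M * a\<^sup>2" by (simp add: d_def)
      qed
      show "\<forall>z\<in>D. norm z \<le> R \<longrightarrow> (norm (x' - z))\<^sup>2 / 2 - (norm (x - z))\<^sup>2 / 2 \<le> a * (\<phi> z - \<phi> x + M * (norm (x - z))\<^sup>2 + M * a)"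
      proof (intro ballI impI)
        fix z assume z: "z \<in> D" "norm z \<le> R"
        have nz: "norm z \<le> R + 1" using z by simp
        have "x - z = (x' - z) - d" by (simp add: d_def)
        then have "(norm (x - z))\<^sup>2 = (norm (x' - z))\<^sup>2 - 2 * (d \<bullet> (x' - z)) + (norm d)\<^sup>2"
          by (simp only: power2_norm_eq_inner inner_diff_left inner_diff_right) (simp add: inner_commute)
        then have "(norm (x' - z))\<^sup>2 / 2 - (norm (x - z))\<^sup>2 / 2 \<le> d \<bullet> (x' - z)"
          using zero_le_power2[of "norm d"] by linarith
        also have "\<dots> = a * ((G x + e + w) \<bullet> (z - x'))"
          by (subst d_eq) (simp only: inner_minus_left inner_scaleR_left inner_minus_right[symmetric] minus_diff_eq,
             simp add: inner_diff_right algebra_simps)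
        also have "\<dots> = a * (G x \<bullet> (z - x) - G x \<bullet> d + e \<bullet> (z - x') + w \<bullet> (z - x'))"
          by (simp add: inner_add_left d_def inner_diff_right)
        also have "\<dots> \<le> a * (\<phi> z - \<phi> x + M * (norm (x - z))\<^sup>2 + M * a)"
        proof (rule mult_left_mono)
          have "G x \<bullet> (z - x) \<le> h z - h x + L * (norm (x - z))\<^sup>2"
            using L(6)[OF nx nz] by (simp add: abs_le_iff norm_minus_commute)
          moreover have "- (G x \<bullet> d) \<le> L * (M1 * a)"
          proof -
            have "- (G x \<bullet> d) \<le> norm (G x) * norm d" using Cauchy_Schwarz_ineq2[of "G x" d] by simp
            also have "\<dots> \<le> L * (M1 * a)" using L(5)[OF nx] dM L(1) by (intro mult_mono) auto
            finally show ?thesis .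
          qed
          moreover have "e \<bullet> (z - x') \<le> (c * a) * (2 * \<bar>R\<bar> + 1)"
          proof -
            have "e \<bullet> (z - x') \<le> norm e * norm (z - x')" by (rule norm_cauchy_schwarz)
            also have "\<dots> \<le> (c * a) * (2 * \<bar>R\<bar> + 1)"
            proof (rule mult_mono[OF ec])
              show "norm (z - x') \<le> 2 * \<bar>R\<bar> + 1" using norm_triangle_ineq4[of z x'] nx' z(2) by linarith
            qed (use c a in auto)
            finally show ?thesis .
          qed
          moreover have "w \<bullet> (z - x') \<le> r z - r x + L * (M1 * a)"
          proof -
            have "r x - L * norm (x - x') \<le> r x'" by (rule L(8)[OF x(1) x'D nx])
            moreover have "L * norm (x - x') \<le> L * (M1 * a)"
              using dM L(1) by (simp add: d_def norm_minus_commute)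
            ultimately show ?thesis using w[OF z(1)] by linarith
          qed
          moreover have "L * (norm (x - z))\<^sup>2 \<le> M * (norm (x - z))\<^sup>2" using M(4) by (intro mult_right_mono) auto
          moreover have "L * (M1 * a) + (c * a) * (2 * \<bar>R\<bar> + 1) + L * (M1 * a) \<le> M * a"
            using mult_right_mono[OF M(5), of a] a(1) by (simp add: algebra_simps)
          ultimately show "G x \<bullet> (z - x) - G x \<bullet> d + e \<bullet> (z - x') + w \<bullet> (z - x') \<le> \<phi> z - \<phi> x + M * (norm (x - z))\<^sup>2 + M * a"
            unfolding \<phi>_def by linarith
        qed (use a in simp)
        finally show "(norm (x' - z))\<^sup>2 / 2 - (norm (x - z))\<^sup>2 / 2 \<le> a * (\<phi> z - \<phi> x + M * (norm (x - z))\<^sup>2 + M * a)" .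
      qed
    qed
  qed
qed

lemma \<phi>_lipschitz: "\<exists>L>0. \<forall>x\<in>D. \<forall>y\<in>D. norm x \<le> R \<longrightarrow> norm y \<le> R \<longrightarrow> \<bar>\<phi> x - \<phi> y\<bar> \<le> L * norm (x - y)"
proof -
  obtain L where L: "L > 0"
    "\<And>x y. norm x \<le> R \<Longrightarrow> norm y \<le> R \<Longrightarrow> \<bar>h x - h y\<bar> \<le> L * norm (x - y)"
    "\<And>x y. x \<in> D \<Longrightarrow> y \<in> D \<Longrightarrow> norm x \<le> R \<Longrightarrow> r x - L * norm (x - y) \<le> r y"
    using uniform_constants[of R] by metis
  have "\<bar>\<phi> x - \<phi> y\<bar> \<le> (2 * L) * norm (x - y)" if "x \<in> D" "y \<in> D" "norm x \<le> R" "norm y \<le> R" for x y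
    using L(2)[OF that(3,4)] L(3)[OF that(1,2,3)] L(3)[OF that(2,1,4)] unfolding \<phi>_def
    by (simp add: norm_minus_commute abs_le_iff)
  then show ?thesis using L(1) by (intro exI[of _ "2 * L"]) auto
qed

end

subsection \<open>Curves with a variational inequality\<close>

lemma norm_add_scaleR_square:
  fixes u q :: "'a::real_inner"
  shows "(norm (u + k *\<^sub>R q))\<^sup>2 = (norm u)\<^sup>2 + 2 * k * (q \<bullet> u) + k * (k * (norm q)\<^sup>2)"
  by (simp only: power2_norm_eq_inner inner_add_left inner_add_right inner_commute[of u q]
      inner_scaleR_left inner_scaleR_right) (simp add: algebra_simps)

lemma norm_scaleR_inverse_le:
  fixes x :: "'a::real_normed_vector"
  assumes "k > 0" shows "norm (x /\<^sub>R k) \<le> B \<longleftrightarrow> norm x \<le> B * k"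
proof -
  have "norm (x /\<^sub>R k) = norm x / k"
    using assms by (simp add: divide_inverse_commute)
  then show ?thesis by (simp only: pos_divide_le_eq[OF assms])
qed

lemma norm_limit_le:
  assumes "F \<longlonglongrightarrow> l" "B \<longlonglongrightarrow> \<beta>" "\<And>n. norm (F n) \<le> B n"
  shows "norm l \<le> \<beta>"
  by (rule LIMSEQ_le[OF tendsto_norm[OF assms(1)] assms(2)]) (use assms(3) in blast)

lemma half_square_bound:
  fixes A B P E Q :: real
  shows "A = B + 2 * P + E \<Longrightarrow> 0 \<le> E \<Longrightarrow> A / 2 - B / 2 \<le> Q \<Longrightarrow> P \<le> Q"
  by linarith

lemma half_square_bound':
  fixes A B P E Q :: real
  shows "A = B - 2 * P + E \<Longrightarrow> B / 2 - A / 2 \<le> Q \<Longrightarrow> P - E / 2 \<le> Q"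
  by linarith

text \<open>One suitable \<open>h\<close> at each \<open>t\<close> suffices: the times at which the
  bound holds form a closed set, and a supremum below \<open>b\<close> could be passed.\<close>

lemma dini_increment:
  fixes F :: "real \<Rightarrow> real"
  assumes ab: "a \<le> b" and cont: "continuous_on {a..b} F"
    and dini: "\<And>t \<epsilon>. a \<le> t \<Longrightarrow> t < b \<Longrightarrow> 0 < \<epsilon> \<Longrightarrow> \<exists>h>0. t + h \<le> b \<and> F (t + h) - F t \<le> (c + \<epsilon>) * h"
  shows "F b - F a \<le> c * (b - a)"
proof (rule field_le_epsilon)
  fix e :: real assume e: "e > 0"
  define \<epsilon> where "\<epsilon> = e / (b - a + 1)"
  have \<epsilon>: "\<epsilon> > 0" using e ab by (simp add: \<epsilon>_def)
  define S where "S = {t\<in>{a..b}. F t - F a \<le> (c + \<epsilon>) * (t - a)}"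
  have "closed S"
  proof -
    have "closed ({a..b} \<inter> (\<lambda>t. F t - F a - (c + \<epsilon>) * (t - a)) -` {..0})"
      by (rule continuous_closed_preimage) (auto intro!: continuous_intros cont)
    moreover have "{a..b} \<inter> (\<lambda>t. F t - F a - (c + \<epsilon>) * (t - a)) -` {..0} = S" unfolding S_def by auto
    ultimately show ?thesis by simp
  qed
  moreover have aS: "a \<in> S" using ab by (simp add: S_def)
  moreover have bd: "bdd_above S" unfolding S_def by (auto intro: bdd_aboveI[of _ b])
  ultimately have s: "Sup S \<in> S" using closed_contains_Sup[of S] by blast
  have "Sup S = b"
  proof (rule ccontr)
    assume "Sup S \<noteq> b"
    then have sb: "a \<le> Sup S" "Sup S < b" using s by (auto simp: S_def)
    obtain k where k: "k > 0" "Sup S + k \<le> b" "F (Sup S + k) - F (Sup S) \<le> (c + \<epsilon>) * k"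
      using dini[OF sb \<epsilon>] by blast
    have "F (Sup S) - F a \<le> (c + \<epsilon>) * (Sup S - a)" using s by (simp add: S_def)
    then have "F (Sup S + k) - F a \<le> (c + \<epsilon>) * (Sup S + k - a)" using k(3) by (simp add: algebra_simps)
    then have "Sup S + k \<in> S" using sb k by (simp add: S_def)
    then have "Sup S + k \<le> Sup S" using bd by (rule cSup_upper)
    then show False using k(1) by simp
  qed
  then have "F b - F a \<le> (c + \<epsilon>) * (b - a)" using s by (simp add: S_def)
  also have "\<dots> \<le> c * (b - a) + e"
  proof -
    have "\<epsilon> * (b - a) \<le> \<epsilon> * (b - a + 1)" using \<epsilon> by simp
    also have "\<dots> = e" using ab by (simp add: \<epsilon>_def)
    finally show ?thesis by (simp add: distrib_right)
  qed
  finally show "F b - F a \<le> c * (b - a) + e" .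
qed

text \<open>\<open>sqrt ((norm u)\<^sup>2 + e\<^sup>2)\<close> replaces the norm, because a bound
  for the squared norm says little about the norm near zeros of \<open>u\<close>; the error is at
  most \<open>e\<close>.\<close>

lemma norm_increment:
  fixes u :: "real \<Rightarrow> 'a::real_inner"
  assumes ab: "a \<le> b" and cont: "continuous_on {a..b} u" and c: "c \<ge> 0"
    and dini: "\<And>t \<epsilon>. a \<le> t \<Longrightarrow> t < b \<Longrightarrow> 0 < \<epsilon> \<Longrightarrow>
      \<exists>h>0. t + h \<le> b \<and> (norm (u (t + h)))\<^sup>2 - (norm (u t))\<^sup>2 \<le> 2 * h * (c * norm (u t) + \<epsilon>)"
  shows "norm (u b) \<le> norm (u a) + c * (b - a)"
proof (rule field_le_epsilon)
  fix e :: real assume e: "e > 0"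
  define F where "F t = sqrt ((norm (u t))\<^sup>2 + e\<^sup>2)" for t
  have Fe: "F t \<ge> e" "F t > 0" "F t \<ge> norm (u t)" "(F t)\<^sup>2 = (norm (u t))\<^sup>2 + e\<^sup>2" "F t \<le> norm (u t) + e" for t
  proof -
    show 1: "F t \<ge> e" unfolding F_def using e by (intro real_le_rsqrt) simp
    then show "F t > 0" using e by simp
    show "F t \<ge> norm (u t)" unfolding F_def by (intro real_le_rsqrt) simp
    show "(F t)\<^sup>2 = (norm (u t))\<^sup>2 + e\<^sup>2" unfolding F_def by simp
    show "F t \<le> norm (u t) + e" unfolding F_def using e
      by (intro real_le_lsqrt) (auto simp: power2_sum)
  qed
  have "F b - F a \<le> c * (b - a)"
  proof (rule dini_increment[OF ab])
    show "continuous_on {a..b} F" unfolding F_def by (intro continuous_intros cont)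
    fix t \<epsilon> :: real assume t: "a \<le> t" "t < b" "0 < \<epsilon>"
    obtain k where k: "k > 0" "t + k \<le> b" "(norm (u (t + k)))\<^sup>2 - (norm (u t))\<^sup>2 \<le> 2 * k * (c * norm (u t) + \<epsilon> * e)"
      using dini[OF t(1,2), of "\<epsilon> * e"] t(3) e by auto
    have "2 * F t * (F (t + k) - F t) \<le> (F (t + k))\<^sup>2 - (F t)\<^sup>2"
      using zero_le_power2[of "F (t + k) - F t"] by (simp add: power2_eq_square algebra_simps)
    also have "\<dots> = (norm (u (t + k)))\<^sup>2 - (norm (u t))\<^sup>2" by (simp add: Fe)
    also have "\<dots> \<le> 2 * k * (c * norm (u t) + \<epsilon> * e)" by (rule k(3))
    also have "\<dots> \<le> 2 * k * (c * F t + \<epsilon> * F t)"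
      using Fe(1,3)[of t] c t(3) k(1) by (intro mult_left_mono add_mono) auto
    also have "\<dots> = 2 * F t * ((c + \<epsilon>) * k)" by (simp add: algebra_simps)
    finally have "F (t + k) - F t \<le> (c + \<epsilon>) * k" using Fe(2)[of t] by simp
    then show "\<exists>h>0. t + h \<le> b \<and> F (t + h) - F t \<le> (c + \<epsilon>) * h" using k by blast
  qed
  then show "norm (u b) \<le> norm (u a) + c * (b - a) + e" using Fe(3)[of b] Fe(5)[of a] by linarith
qed

lemma bounded_seq_subseq:
  fixes X :: "nat \<Rightarrow> 'c::euclidean_space"
  assumes "\<And>n. norm (X n) \<le> B"
  obtains l r where "strict_mono (r :: nat \<Rightarrow> nat)" "(X \<circ> r) \<longlonglongrightarrow> l" "norm l \<le> B"
proof -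
  have "compact (cball (0::'c) B)" "\<forall>n. X n \<in> cball 0 B" using assms by auto
  then obtain l r where "l \<in> cball 0 B" "strict_mono (r :: nat \<Rightarrow> nat)" "(X \<circ> r) \<longlonglongrightarrow> l"
    unfolding compact_def by metis
  then show thesis using that by auto
qed

lemma small_steps:
  assumes "\<eta> > 0"
  shows "(\<lambda>n. \<eta> / real (Suc n)) \<longlonglongrightarrow> 0" "\<And>n. \<eta> / real (Suc n) > 0" "\<And>n. \<eta> / real (Suc n) \<le> \<eta>"
proof -
  show "(\<lambda>n. \<eta> / real (Suc n)) \<longlonglongrightarrow> 0"
    using tendsto_mult[OF tendsto_const LIMSEQ_inverse_real_of_nat, of \<eta>] by (simp add: divide_inverse)
  show "\<eta> / real (Suc n) > 0" "\<eta> / real (Suc n) \<le> \<eta>" for n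
    using assms by (auto simp: divide_le_eq mult_le_cancel_left1)
qed

locale flow_model = weakly_convex_model +
  assumes SD_convex: "\<And>x. convex (SD x)"
    and SD_localI: "\<And>x \<rho> w L. x \<in> D \<Longrightarrow> \<rho> > 0 \<Longrightarrow>
      (\<And>y. y \<in> D \<Longrightarrow> norm (y - x) \<le> \<rho> \<Longrightarrow> \<phi> x + w \<bullet> (y - x) - L * (norm (y - x))\<^sup>2 \<le> \<phi> y) \<Longrightarrow> w \<in> SD x"

text \<open>A Lipschitz curve with an integrated form of the subgradient inclusion, free of
  derivatives. Test points are allowed up to norm \<open>R + 1\<close> so that the unit ball around
  each \<open>y t\<close> is covered.\<close>

locale evi_curve = flow_model D \<phi> SD for D :: "'a::euclidean_space set" and \<phi> SD +
  fixes y :: "real \<Rightarrow> 'a" and b R M :: real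
  assumes b_pos: "b > 0" and M_pos: "M > 0"
    and y_D: "\<And>t. 0 \<le> t \<Longrightarrow> t \<le> b \<Longrightarrow> y t \<in> D"
    and y_R: "\<And>t. 0 \<le> t \<Longrightarrow> t \<le> b \<Longrightarrow> norm (y t) \<le> R"
    and y_lip: "\<And>s t. 0 \<le> s \<Longrightarrow> s \<le> t \<Longrightarrow> t \<le> b \<Longrightarrow> norm (y t - y s) \<le> M * (t - s)"
    and evi: "\<And>s t z. 0 \<le> s \<Longrightarrow> s \<le> t \<Longrightarrow> t \<le> b \<Longrightarrow> z \<in> D \<Longrightarrow> norm z \<le> R + 1 \<Longrightarrow>
      (norm (y t - z))\<^sup>2 / 2 - (norm (y s - z))\<^sup>2 / 2 \<le>
        (t - s) * (\<phi> z - \<phi> (y s) + M * (norm (y s - z))\<^sup>2 + M * (t - s))"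
begin

lemma y_continuous: "continuous_on {0..b} y"
proof -
  have "M-lipschitz_on {0..b} y"
  proof (rule lipschitz_onI)
    fix s t assume st: "s \<in> {0..b}" "t \<in> {0..b}"
    show "dist (y s) (y t) \<le> M * dist s t"
      using y_lip[of s t] y_lip[of t s] st by (cases "s \<le> t") (auto simp: dist_norm norm_minus_commute)
  qed (use M_pos in simp)
  then show ?thesis by (rule lipschitz_on_continuous_on)
qed

lemma \<phi>_y_tendsto:
  assumes "\<And>n. 0 \<le> T n" "\<And>n. T n \<le> b" "T \<longlonglongrightarrow> t" "0 \<le> t" "t \<le> b"
  shows "(\<lambda>n. y (T n)) \<longlonglongrightarrow> y t" "(\<lambda>n. \<phi> (y (T n))) \<longlonglongrightarrow> \<phi> (y t)"
proof -
  show yt: "(\<lambda>n. y (T n)) \<longlonglongrightarrow> y t"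
    by (rule continuous_on_tendsto_compose[OF y_continuous assms(3)]) (use assms in auto)
  show "(\<lambda>n. \<phi> (y (T n))) \<longlonglongrightarrow> \<phi> (y t)"
    by (rule continuous_on_tendsto_compose[OF \<phi>_cont yt]) (use assms y_D in auto)
qed

text \<open>The inequality from \<open>t\<close> to \<open>t + H n\<close>, divided by
  \<open>H n\<close>, becomes in the limit a quadratic lower bound of \<phi> around
  \<open>y t\<close>, so that \<open>SD_localI\<close> applies with radius 1.\<close>

lemma right_limit_in_SD:
  assumes t: "0 \<le> t" and H: "\<And>n. H n > 0" "\<And>n. t + H n \<le> b" "H \<longlonglongrightarrow> 0"
    and q: "(\<lambda>n. (y (t + H n) - y t) /\<^sub>R H n) \<longlonglongrightarrow> p"
  shows "- p \<in> SD (y t)"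
proof (rule SD_localI[where \<rho> = 1 and L = M])
  have tb: "t \<le> b" using H(1,2)[of 0] by linarith
  show "y t \<in> D" using y_D t tb by blast
  fix z assume z: "z \<in> D" "norm (z - y t) \<le> 1"
  have nz: "norm z \<le> R + 1" using norm_triangle_sub[of z "y t"] z(2) y_R[OF t tb] by linarith
  let ?q = "\<lambda>n. (y (t + H n) - y t) /\<^sub>R H n"
  have le: "?q n \<bullet> (y t - z) \<le> \<phi> z - \<phi> (y t) + M * (norm (y t - z))\<^sup>2 + M * H n" for n
  proof -
    have e: "y (t + H n) - z = (y t - z) + H n *\<^sub>R ?q n" using H(1)[of n] by simp
    have "(norm (y (t + H n) - z))\<^sup>2 = (norm (y t - z))\<^sup>2 + 2 * (H n * (?q n \<bullet> (y t - z))) + H n * (H n * (norm (?q n))\<^sup>2)"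
      unfolding e mult.assoc[symmetric, of 2] by (rule norm_add_scaleR_square)
    moreover have "0 \<le> H n * (H n * (norm (?q n))\<^sup>2)" using H(1)[of n] by simp
    moreover have "(norm (y (t + H n) - z))\<^sup>2 / 2 - (norm (y t - z))\<^sup>2 / 2 \<le>
        (t + H n - t) * (\<phi> z - \<phi> (y t) + M * (norm (y t - z))\<^sup>2 + M * (t + H n - t))"
      using t H(1,2)[of n] z nz by (intro evi) auto
    ultimately have "H n * (?q n \<bullet> (y t - z)) \<le>
        (t + H n - t) * (\<phi> z - \<phi> (y t) + M * (norm (y t - z))\<^sup>2 + M * (t + H n - t))"
      by (rule half_square_bound)
    then have "H n * (?q n \<bullet> (y t - z)) \<le> H n * (\<phi> z - \<phi> (y t) + M * (norm (y t - z))\<^sup>2 + M * H n)"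
      unfolding add_diff_cancel_left' .
    then show ?thesis using H(1)[of n] by (simp only: mult_le_cancel_left_pos)
  qed
  have "p \<bullet> (y t - z) \<le> \<phi> z - \<phi> (y t) + M * (norm (y t - z))\<^sup>2 + M * 0"
  proof (rule LIMSEQ_le)
    show "(\<lambda>n. ?q n \<bullet> (y t - z)) \<longlonglongrightarrow> p \<bullet> (y t - z)" by (intro tendsto_intros q)
    show "(\<lambda>n. \<phi> z - \<phi> (y t) + M * (norm (y t - z))\<^sup>2 + M * H n)
      \<longlonglongrightarrow> \<phi> z - \<phi> (y t) + M * (norm (y t - z))\<^sup>2 + M * 0"
      by (intro tendsto_intros H(3))
  qed (use le in blast)
  then show "\<phi> (y t) + - p \<bullet> (z - y t) - M * (norm (z - y t))\<^sup>2 \<le> \<phi> z"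
    unfolding norm_minus_commute[of z "y t"] inner_diff_right inner_minus_left by linarith
qed simp

text \<open>Here the inequality starts at the moving time \<open>t - H n\<close>, so continuity of
  \<phi> along the curve enters. The quadratic remainder has the unfavourable sign, but it vanishes
  with \<open>H n\<close>.\<close>

lemma left_limit_in_SD:
  assumes t: "t \<le> b" and H: "\<And>n. H n > 0" "\<And>n. 0 \<le> t - H n" "H \<longlonglongrightarrow> 0"
    and q: "(\<lambda>n. (y t - y (t - H n)) /\<^sub>R H n) \<longlonglongrightarrow> p"
  shows "- p \<in> SD (y t)"
proof (rule SD_localI[where \<rho> = 1 and L = M])
  have t0: "0 \<le> t" using H(1,2)[of 0] by linarith
  show "y t \<in> D" using y_D t t0 by blast
  fix z assume z: "z \<in> D" "norm (z - y t) \<le> 1"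
  have nz: "norm z \<le> R + 1" using norm_triangle_sub[of z "y t"] z(2) y_R[OF t0 t] by linarith
  let ?q = "\<lambda>n. (y t - y (t - H n)) /\<^sub>R H n"
  let ?s = "\<lambda>n. t - H n"
  have le: "?q n \<bullet> (y t - z) - H n * (norm (?q n))\<^sup>2 / 2 \<le> \<phi> z - \<phi> (y (?s n)) + M * (norm (y (?s n) - z))\<^sup>2 + M * H n" for n
  proof -
    have e: "y (?s n) - z = (y t - z) + (- H n) *\<^sub>R ?q n" using H(1)[of n] by simp
    have "(norm (y (?s n) - z))\<^sup>2 = (norm (y t - z))\<^sup>2 + 2 * - H n * (?q n \<bullet> (y t - z)) + - H n * (- H n * (norm (?q n))\<^sup>2)"
      unfolding e by (rule norm_add_scaleR_square)
    then have "(norm (y (?s n) - z))\<^sup>2 = (norm (y t - z))\<^sup>2 - 2 * (H n * (?q n \<bullet> (y t - z))) + H n * (H n * (norm (?q n))\<^sup>2)"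
      by (simp only: mult_minus_left mult_minus_right minus_minus mult.assoc add_uminus_conv_diff)
    moreover have "(norm (y t - z))\<^sup>2 / 2 - (norm (y (?s n) - z))\<^sup>2 / 2 \<le>
        (t - ?s n) * (\<phi> z - \<phi> (y (?s n)) + M * (norm (y (?s n) - z))\<^sup>2 + M * (t - ?s n))"
      using t H(1,2)[of n] z nz by (intro evi) auto
    ultimately have "H n * (?q n \<bullet> (y t - z)) - H n * (H n * (norm (?q n))\<^sup>2) / 2 \<le>
       (t - ?s n) * (\<phi> z - \<phi> (y (?s n)) + M * (norm (y (?s n) - z))\<^sup>2 + M * (t - ?s n))"
      by (rule half_square_bound')
    moreover have "t - ?s n = H n" by simp
    moreover have "H n * (?q n \<bullet> (y t - z)) - H n * (H n * (norm (?q n))\<^sup>2) / 2 =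
       H n * (?q n \<bullet> (y t - z) - H n * (norm (?q n))\<^sup>2 / 2)"
      by (simp only: right_diff_distrib times_divide_eq_right)
    ultimately have "H n * (?q n \<bullet> (y t - z) - H n * (norm (?q n))\<^sup>2 / 2) \<le>
       H n * (\<phi> z - \<phi> (y (?s n)) + M * (norm (y (?s n) - z))\<^sup>2 + M * H n)"
      by (simp only:)
    then show ?thesis using H(1)[of n] by (simp only: mult_le_cancel_left_pos)
  qed
  have Hs: "?s \<longlonglongrightarrow> t" using tendsto_diff[OF tendsto_const H(3), of t] by simp
  have "0 \<le> ?s n" "?s n \<le> b" for n using H(1)[of n] H(2)[of n] t by auto
  note ys = \<phi>_y_tendsto[OF this Hs t0 t]
  have "p \<bullet> (y t - z) - 0 * (norm p)\<^sup>2 / 2 \<le> \<phi> z - \<phi> (y t) + M * (norm (y t - z))\<^sup>2 + M * 0"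
  proof (rule LIMSEQ_le)
    show "(\<lambda>n. ?q n \<bullet> (y t - z) - H n * (norm (?q n))\<^sup>2 / 2) \<longlonglongrightarrow> p \<bullet> (y t - z) - 0 * (norm p)\<^sup>2 / 2"
      by (intro tendsto_intros H(3) q) simp
    show "(\<lambda>n. \<phi> z - \<phi> (y (?s n)) + M * (norm (y (?s n) - z))\<^sup>2 + M * H n)
      \<longlonglongrightarrow> \<phi> z - \<phi> (y t) + M * (norm (y t - z))\<^sup>2 + M * 0"
      by (intro tendsto_intros H(3) ys)
  qed (use le in blast)
  then show "\<phi> (y t) + - p \<bullet> (z - y t) - M * (norm (z - y t))\<^sup>2 \<le> \<phi> z"
    unfolding norm_minus_commute[of z "y t"] inner_diff_right inner_minus_left by linarith
qed simp

lemma right_cluster: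
  assumes t: "0 \<le> t" and H: "\<And>n. H n > 0" "\<And>n. t + H n \<le> b" "H \<longlonglongrightarrow> 0"
  obtains p r where "strict_mono (r :: nat \<Rightarrow> nat)" "(\<lambda>n. (y (t + H (r n)) - y t) /\<^sub>R H (r n)) \<longlonglongrightarrow> p" "- p \<in> SD (y t)"
proof -
  have nb: "norm ((y (t + H n) - y t) /\<^sub>R H n) \<le> M" for n
    using y_lip[of t "t + H n"] t H(1,2)[of n] by (subst norm_scaleR_inverse_le) auto
  obtain p r where r: "strict_mono (r :: nat \<Rightarrow> nat)" "((\<lambda>n. (y (t + H n) - y t) /\<^sub>R H n) \<circ> r) \<longlonglongrightarrow> p"
    by (rule bounded_seq_subseq[OF nb]) (rule that)
  then have q: "(\<lambda>n. (y (t + H (r n)) - y t) /\<^sub>R H (r n)) \<longlonglongrightarrow> p" by (simp add: o_def)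
  moreover have "- p \<in> SD (y t)"
    by (rule right_limit_in_SD[OF t _ _ _ q]) (use H LIMSEQ_subseq_LIMSEQ[OF H(3) r(1)] in \<open>auto simp: o_def\<close>)
  ultimately show thesis using that r(1) by blast
qed

lemma SD_nonempty: "SD (y t) \<noteq> {}" if "0 \<le> t" "t < b"
proof -
  have "b - t > 0" using that by simp
  note ss = small_steps[OF this]
  have "t + (b - t) / real (Suc n) \<le> b" for n using ss(3)[of n] by linarith
  from right_cluster[OF that(1) ss(2) this ss(1)] show ?thesis by blast
qed

lemma SD_monotone:
  obtains L where "L > 0" "\<And>x z v w. norm x \<le> R \<Longrightarrow> norm z \<le> R \<Longrightarrow> v \<in> SD x \<Longrightarrow> w \<in> SD z \<Longrightarrow>
    - (2 * L * (norm (x - z))\<^sup>2) \<le> (v - w) \<bullet> (x - z)"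
proof -
  obtain L where L: "L > 0" "\<And>x y w. x \<in> cball 0 R \<Longrightarrow> y \<in> D \<inter> cball 0 R \<Longrightarrow> w \<in> SD x \<Longrightarrow>
          \<phi> x + w \<bullet> (y - x) - L * (norm (y - x))\<^sup>2 \<le> \<phi> y" using weakly_convex[of R] by blast
  have "- (2 * L * (norm (x - z))\<^sup>2) \<le> (v - w) \<bullet> (x - z)"
    if "norm x \<le> R" "norm z \<le> R" "v \<in> SD x" "w \<in> SD z" for x z v w
  proof -
    have "\<phi> x + v \<bullet> (z - x) - L * (norm (z - x))\<^sup>2 \<le> \<phi> z" "\<phi> z + w \<bullet> (x - z) - L * (norm (x - z))\<^sup>2 \<le> \<phi> x"
      using that SD_dom by (auto intro!: L(2))
    then show ?thesis by (simp add: norm_minus_commute inner_diff_left inner_diff_right)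
  qed
  then show thesis using that L(1) by blast
qed

text \<open>The distance to the fixed point \<open>y t\<close> grows at rate at most
  \<open>norm v\<close>, because \<open>SD\<close> is monotone up to a multiple of the squared
  distance, and over a time \<open>k\<close> the distance itself is at most
  \<open>M * k\<close>.\<close>

lemma speed_bound:
  obtains C where "C \<ge> 0" "\<And>t v k. 0 \<le> t \<Longrightarrow> 0 \<le> k \<Longrightarrow> t + k \<le> b \<Longrightarrow> v \<in> SD (y t) \<Longrightarrow>
    norm (y (t + k) - y t) \<le> (norm v + C * k) * k"
proof -
  obtain L where L: "L > 0" "\<And>x z v w. norm x \<le> R \<Longrightarrow> norm z \<le> R \<Longrightarrow> v \<in> SD x \<Longrightarrow> w \<in> SD z \<Longrightarrow>
    - (2 * L * (norm (x - z))\<^sup>2) \<le> (v - w) \<bullet> (x - z)" by (rule SD_monotone) (rule that)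
  have "norm (y (t + k) - y t) \<le> (norm v + (2 * L * M) * k) * k"
    if t: "0 \<le> t" "0 \<le> k" "t + k \<le> b" and v: "v \<in> SD (y t)" for t v k
  proof -
    define c where "c = norm v + (2 * L * M) * k"
    have "norm (y (t + k) - y t) \<le> norm (y t - y t) + c * (t + k - t)"
    proof (rule norm_increment)
      show "continuous_on {t..t + k} (\<lambda>a. y a - y t)"
        by (intro continuous_intros continuous_on_subset[OF y_continuous]) (use t in auto)
      show "c \<ge> 0" using L(1) M_pos t by (simp add: c_def)
      fix \<tau> \<epsilon> :: real assume \<tau>: "t \<le> \<tau>" "\<tau> < t + k" and \<epsilon>: "\<epsilon> > 0"
      define u where "u = y \<tau> - y t"
      define H where "H n = (t + k - \<tau>) / real (Suc n)" for n
      have H: "H n > 0" "\<tau> + H n \<le> t + k" "H \<longlonglongrightarrow> 0" for n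
        using small_steps[of "t + k - \<tau>"] \<tau> unfolding H_def[abs_def] by (auto simp: algebra_simps)
      have \<tau>0: "0 \<le> \<tau>" and Hb: "\<tau> + H n \<le> b" for n using \<tau> t order_trans[OF H(2) t(3)] by auto
      obtain p r where r: "strict_mono (r :: nat \<Rightarrow> nat)" "(\<lambda>n. (y (\<tau> + H (r n)) - y \<tau>) /\<^sub>R H (r n)) \<longlonglongrightarrow> p" "- p \<in> SD (y \<tau>)"
        by (rule right_cluster[OF \<tau>0 H(1) Hb H(3)]) (rule that)
      let ?q = "\<lambda>n. (y (\<tau> + H (r n)) - y \<tau>) /\<^sub>R H (r n)"
      have pu: "p \<bullet> u \<le> c * norm u"
      proof -
        have "- (2 * L * (norm u)\<^sup>2) \<le> (- p - v) \<bullet> u"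
          unfolding u_def using \<tau> t by (intro L(2) r(3) v y_R) auto
        then have "p \<bullet> u \<le> - (v \<bullet> u) + 2 * L * (norm u)\<^sup>2" by (simp add: inner_diff_left)
        also have "- (v \<bullet> u) \<le> norm v * norm u" using Cauchy_Schwarz_ineq2[of v u] by linarith
        also have "2 * L * (norm u)\<^sup>2 \<le> (2 * L * M) * k * norm u"
        proof -
          have "norm u \<le> M * (\<tau> - t)" unfolding u_def using \<tau> t by (intro y_lip) auto
          also have "\<dots> \<le> M * k" using \<tau> M_pos by (intro mult_left_mono) auto
          finally have "(2 * L) * norm u * norm u \<le> (2 * L) * (M * k) * norm u"
            using L(1) by (intro mult_right_mono mult_left_mono) auto
          then show ?thesis by (simp add: power2_eq_square algebra_simps)
        qed
        finally show ?thesis by (simp add: c_def distrib_right)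
      qed
      have Hr: "(\<lambda>n. H (r n)) \<longlonglongrightarrow> 0" using LIMSEQ_subseq_LIMSEQ[OF H(3) r(1)] by (simp add: o_def)
      have "(\<lambda>n. ?q n \<bullet> u + H (r n) * (norm (?q n))\<^sup>2 / 2) \<longlonglongrightarrow> p \<bullet> u + 0 * (norm p)\<^sup>2 / 2"
        by (intro tendsto_intros r(2) Hr) simp
      moreover have "p \<bullet> u + 0 * (norm p)\<^sup>2 / 2 < c * norm u + \<epsilon>" using pu \<epsilon> by simp
      ultimately have "\<forall>\<^sub>F n in sequentially. ?q n \<bullet> u + H (r n) * (norm (?q n))\<^sup>2 / 2 < c * norm u + \<epsilon>"
        by (rule order_tendstoD(2))
      then obtain n where n: "?q n \<bullet> u + H (r n) * (norm (?q n))\<^sup>2 / 2 < c * norm u + \<epsilon>"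
        by (auto simp: eventually_sequentially)
      define \<eta> where "\<eta> = H (r n)"
      have \<eta>: "\<eta> > 0" "\<tau> + \<eta> \<le> t + k" using H by (auto simp: \<eta>_def)
      have "y (\<tau> + \<eta>) - y t = u + \<eta> *\<^sub>R ?q n" using \<eta>(1) by (simp add: u_def \<eta>_def)
      then have "(norm (y (\<tau> + \<eta>) - y t))\<^sup>2 = (norm u)\<^sup>2 + 2 * \<eta> * (?q n \<bullet> u) + \<eta> * (\<eta> * (norm (?q n))\<^sup>2)"
        by (simp only: norm_add_scaleR_square)
      also have "\<dots> = (norm u)\<^sup>2 + 2 * \<eta> * (?q n \<bullet> u + \<eta> * (norm (?q n))\<^sup>2 / 2)"
        by (simp add: field_simps)
      finally have "(norm (y (\<tau> + \<eta>) - y t))\<^sup>2 - (norm u)\<^sup>2 = 2 * \<eta> * (?q n \<bullet> u + H (r n) * (norm (?q n))\<^sup>2 / 2)"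
        unfolding \<eta>_def by linarith
      also have "\<dots> \<le> 2 * \<eta> * (c * norm u + \<epsilon>)" using n \<eta>(1) by (intro mult_left_mono) auto
      finally show "\<exists>h>0. \<tau> + h \<le> t + k \<and> (norm (y (\<tau> + h) - y t))\<^sup>2 - (norm (y \<tau> - y t))\<^sup>2 \<le> 2 * h * (c * norm (y \<tau> - y t) + \<epsilon>)"
        using \<eta> by (auto simp: u_def)
    qed (use t in auto)
    then show ?thesis by (simp add: c_def)
  qed
  moreover have "2 * L * M \<ge> 0" using L(1) M_pos by simp
  ultimately show thesis using that by blast
qed

text \<open>The curve is compared with its own time shift by \<open>k\<close>. Since
  \<open>SD\<close> is monotone up to the constant \<open>2 * L\<close>, the squared distance
  discounted by \<open>exp (- (2 * K) * \<tau>)\<close> does not increase, as in Gronwall's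
  lemma.\<close>

lemma contraction:
  obtains K where "K > 0" "\<And>s t k. 0 \<le> s \<Longrightarrow> s \<le> t \<Longrightarrow> 0 \<le> k \<Longrightarrow> t + k < b \<Longrightarrow>
    norm (y (t + k) - y t) \<le> exp (K * (t - s)) * norm (y (s + k) - y s)"
proof -
  obtain L where L: "L > 0" "\<And>x z v w. norm x \<le> R \<Longrightarrow> norm z \<le> R \<Longrightarrow> v \<in> SD x \<Longrightarrow> w \<in> SD z \<Longrightarrow>
    - (2 * L * (norm (x - z))\<^sup>2) \<le> (v - w) \<bullet> (x - z)" by (rule SD_monotone) (rule that)
  define K where "K = 2 * L"
  have K: "K > 0" using L(1) by (simp add: K_def)
  have "norm (y (t + k) - y t) \<le> exp (K * (t - s)) * norm (y (s + k) - y s)"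
    if st: "0 \<le> s" "s \<le> t" "0 \<le> k" "t + k < b" for s t k
  proof -
    define u where "u \<tau> = y (\<tau> + k) - y \<tau>" for \<tau>
    define F where "F \<tau> = exp (- (2 * K) * \<tau>) * (norm (u \<tau>))\<^sup>2" for \<tau>
    have "F t - F s \<le> 0 * (t - s)"
    proof (rule dini_increment[OF st(2)])
      have "continuous_on {s..t} (\<lambda>\<tau>. y (\<tau> + k))"
        by (rule continuous_on_compose2[OF y_continuous]) (use st in \<open>auto intro!: continuous_intros\<close>)
      moreover have "continuous_on {s..t} y" by (rule continuous_on_subset[OF y_continuous]) (use st in auto)
      ultimately show "continuous_on {s..t} F" unfolding F_def u_def by (intro continuous_intros)
      fix \<tau> \<epsilon> :: real assume \<tau>: "s \<le> \<tau>" "\<tau> < t" and \<epsilon>: "\<epsilon> > 0"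
      define H where "H n = (t - \<tau>) / real (Suc n)" for n
      have H: "H n > 0" "\<tau> + H n \<le> t" "H \<longlonglongrightarrow> 0" for n
        using small_steps[of "t - \<tau>"] \<tau> unfolding H_def[abs_def] by (auto simp: algebra_simps)
      have \<tau>0: "0 \<le> \<tau>" "0 \<le> \<tau> + k" and Hb: "\<tau> + H n \<le> b" "\<tau> + k + H n \<le> b" for n
        using \<tau> st H(2)[of n] by auto
      obtain p r where r: "strict_mono (r :: nat \<Rightarrow> nat)" "(\<lambda>n. (y (\<tau> + H (r n)) - y \<tau>) /\<^sub>R H (r n)) \<longlonglongrightarrow> p" "- p \<in> SD (y \<tau>)"
        by (rule right_cluster[OF \<tau>0(1) H(1) Hb(1) H(3)]) (rule that)
      have Hr: "(\<lambda>n. H (r n)) \<longlonglongrightarrow> 0" using LIMSEQ_subseq_LIMSEQ[OF H(3) r(1)] by (simp add: o_def)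
      \<comment> \<open>A subsequence of the first one, so that both difference quotients converge
        along the same steps.\<close>
      obtain p' r' where r': "strict_mono (r' :: nat \<Rightarrow> nat)"
        "(\<lambda>n. (y (\<tau> + k + H (r (r' n))) - y (\<tau> + k)) /\<^sub>R H (r (r' n))) \<longlonglongrightarrow> p'" "- p' \<in> SD (y (\<tau> + k))"
        by (rule right_cluster[OF \<tau>0(2), of "\<lambda>n. H (r n)", OF H(1) Hb(2) Hr]) (rule that)
      define \<eta> where "\<eta> n = H (r (r' n))" for n
      define q where "q n = (y (\<tau> + \<eta> n) - y \<tau>) /\<^sub>R \<eta> n" for n
      define q' where "q' n = (y (\<tau> + k + \<eta> n) - y (\<tau> + k)) /\<^sub>R \<eta> n" for n
      have \<eta>: "\<eta> n > 0" "\<tau> + \<eta> n \<le> t" for n using H by (auto simp: \<eta>_def)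
      have \<eta>0: "\<eta> \<longlonglongrightarrow> 0" using LIMSEQ_subseq_LIMSEQ[OF Hr r'(1)] by (simp add: o_def \<eta>_def[abs_def])
      have ql: "q \<longlonglongrightarrow> p" using LIMSEQ_subseq_LIMSEQ[OF r(2) r'(1)] by (simp add: o_def q_def[abs_def] \<eta>_def)
      have ql': "q' \<longlonglongrightarrow> p'" using r'(2) by (simp add: q'_def[abs_def] \<eta>_def)
      have "- (2 * L * (norm (u \<tau>))\<^sup>2) \<le> (- p' - - p) \<bullet> u \<tau>"
        unfolding u_def using \<tau>0 Hb \<tau> st by (intro L(2) r(3) r'(3) y_R) auto
      then have mono: "(p' - p) \<bullet> u \<tau> \<le> K * (norm (u \<tau>))\<^sup>2" by (simp add: inner_diff_left K_def)
      have "(\<lambda>n. (q' n - q n) \<bullet> u \<tau> + \<eta> n * (norm (q' n - q n))\<^sup>2 / 2) \<longlonglongrightarrow> (p' - p) \<bullet> u \<tau> + 0 * (norm (p' - p))\<^sup>2 / 2"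
        by (intro tendsto_intros ql ql' \<eta>0) simp
      moreover have "(p' - p) \<bullet> u \<tau> + 0 * (norm (p' - p))\<^sup>2 / 2 < K * (norm (u \<tau>))\<^sup>2 + \<epsilon> / 2" using mono \<epsilon> by simp
      ultimately have "\<forall>\<^sub>F n in sequentially. (q' n - q n) \<bullet> u \<tau> + \<eta> n * (norm (q' n - q n))\<^sup>2 / 2 < K * (norm (u \<tau>))\<^sup>2 + \<epsilon> / 2"
        by (rule order_tendstoD(2))
      then obtain n where n: "(q' n - q n) \<bullet> u \<tau> + \<eta> n * (norm (q' n - q n))\<^sup>2 / 2 < K * (norm (u \<tau>))\<^sup>2 + \<epsilon> / 2"
        by (auto simp: eventually_sequentially)
      define k' where "k' = \<eta> n"
      have k': "k' > 0" "\<tau> + k' \<le> t" using \<eta> by (auto simp: k'_def)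
      have "u (\<tau> + k') = u \<tau> + k' *\<^sub>R (q' n - q n)"
        using k'(1) by (simp add: u_def q_def q'_def k'_def scaleR_right_diff_distrib add.commute add.left_commute)
      then have "(norm (u (\<tau> + k')))\<^sup>2 = (norm (u \<tau>))\<^sup>2 + 2 * k' * ((q' n - q n) \<bullet> u \<tau>) + k' * (k' * (norm (q' n - q n))\<^sup>2)"
        by (simp only: norm_add_scaleR_square)
      also have "\<dots> = (norm (u \<tau>))\<^sup>2 + 2 * k' * ((q' n - q n) \<bullet> u \<tau> + k' * (norm (q' n - q n))\<^sup>2 / 2)"
        by (simp add: field_simps)
      also have "\<dots> \<le> (norm (u \<tau>))\<^sup>2 + 2 * k' * (K * (norm (u \<tau>))\<^sup>2 + \<epsilon> / 2)"
        using n k'(1) unfolding k'_def[symmetric] by (intro add_left_mono mult_left_mono) auto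
      also have "\<dots> = (1 + 2 * K * k') * (norm (u \<tau>))\<^sup>2 + k' * \<epsilon>" by (simp add: algebra_simps)
      also have "\<dots> \<le> exp (2 * K * k') * (norm (u \<tau>))\<^sup>2 + k' * \<epsilon>"
        by (intro add_right_mono mult_right_mono exp_ge_add_one_self) simp
      finally have "F (\<tau> + k') \<le> exp (- (2 * K) * (\<tau> + k')) * (exp (2 * K * k') * (norm (u \<tau>))\<^sup>2 + k' * \<epsilon>)"
        unfolding F_def by (intro mult_left_mono) auto
      also have "\<dots> = F \<tau> + exp (- (2 * K) * (\<tau> + k')) * (k' * \<epsilon>)"
        unfolding F_def distrib_left mult.assoc[symmetric] exp_add[symmetric] by (simp add: algebra_simps)
      also have "exp (- (2 * K) * (\<tau> + k')) * (k' * \<epsilon>) \<le> 1 * (k' * \<epsilon>)"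
        using k'(1) \<epsilon> K \<tau>0(1) by (intro mult_right_mono) auto
      finally have "F (\<tau> + k') - F \<tau> \<le> (0 + \<epsilon>) * k'" by (simp add: mult.commute)
      then show "\<exists>h>0. \<tau> + h \<le> t \<and> F (\<tau> + h) - F \<tau> \<le> (0 + \<epsilon>) * h" using k' by blast
    qed
    then have "F t \<le> F s" by simp
    then have "exp (2 * K * t) * F t \<le> exp (2 * K * t) * F s" by (intro mult_left_mono) auto
    then have "(norm (u t))\<^sup>2 \<le> (exp (K * (t - s)))\<^sup>2 * (norm (u s))\<^sup>2"
      unfolding F_def mult.assoc[symmetric] exp_add[symmetric] by (simp add: exp_double[symmetric] algebra_simps)
    then have "(norm (u t))\<^sup>2 \<le> (exp (K * (t - s)) * norm (u s))\<^sup>2" by (simp add: power_mult_distrib)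
    then show ?thesis unfolding u_def by (rule power2_le_imp_le) simp
  qed
  then show thesis using that K by blast
qed

definition "minspeed t = Inf (norm ` SD (y t))"

lemma minspeed_le: "v \<in> SD (y t) \<Longrightarrow> minspeed t \<le> norm v"
  unfolding minspeed_def by (intro cInf_lower) (auto intro: bdd_belowI[of _ 0])

lemma minspeed_step:
  obtains C where "C \<ge> 0" "\<And>t k. 0 \<le> t \<Longrightarrow> 0 \<le> k \<Longrightarrow> t + k \<le> b \<Longrightarrow> t < b \<Longrightarrow>
    norm (y (t + k) - y t) \<le> (minspeed t + C * k) * k"
proof -
  obtain C where C: "C \<ge> 0" "\<And>t v k. 0 \<le> t \<Longrightarrow> 0 \<le> k \<Longrightarrow> t + k \<le> b \<Longrightarrow> v \<in> SD (y t) \<Longrightarrow>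
    norm (y (t + k) - y t) \<le> (norm v + C * k) * k" by (rule speed_bound) (rule that)
  have "norm (y (t + k) - y t) \<le> (minspeed t + C * k) * k" if t: "0 \<le> t" "0 \<le> k" "t + k \<le> b" "t < b" for t k
  proof (cases "k = 0")
    case False
    then have k: "k > 0" using t by simp
    have "norm (y (t + k) - y t) / k - C * k \<le> minspeed t"
      unfolding minspeed_def
    proof (rule cInf_greatest)
      show "norm ` SD (y t) \<noteq> {}" using SD_nonempty[OF t(1,4)] by simp
      fix x assume "x \<in> norm ` SD (y t)"
      then obtain v where "v \<in> SD (y t)" "x = norm v" by blast
      then have "norm (y (t + k) - y t) / k \<le> x + C * k" using C(2)[OF t(1-3)] k by (simp add: pos_divide_le_eq)
      then show "norm (y (t + k) - y t) / k - C * k \<le> x" by linarith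
    qed
    then have "norm (y (t + k) - y t) / k \<le> minspeed t + C * k" by simp
    then show ?thesis using k by (simp add: pos_divide_le_eq)
  qed simp
  then show thesis using that C(1) by blast
qed

text \<open>By the parallelogram law the midpoint of two distinct minimal elements of a convex set
  would be shorter.\<close>

lemma SD_minspeed_unique:
  assumes "v \<in> SD (y t)" "w \<in> SD (y t)" "norm v \<le> minspeed t" "norm w \<le> minspeed t"
  shows "v = w"
proof -
  define m where "m = minspeed t"
  have "(1/2) *\<^sub>R v + (1/2) *\<^sub>R w \<in> SD (y t)" using SD_convex assms(1,2) by (intro convexD) auto
  then have le: "m \<le> norm ((1/2) *\<^sub>R v + (1/2) *\<^sub>R w)" unfolding m_def by (rule minspeed_le)
  have m: "m \<ge> 0" using assms(3) norm_ge_zero order_trans unfolding m_def by blast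
  have nv: "(norm v)\<^sup>2 \<le> m\<^sup>2" "(norm w)\<^sup>2 \<le> m\<^sup>2" using assms(3,4) by (auto simp: m_def intro: power_mono)
  have "m\<^sup>2 \<le> (norm ((1/2) *\<^sub>R v + (1/2) *\<^sub>R w))\<^sup>2" using le m by (intro power_mono) auto
  moreover have "(norm ((1/2) *\<^sub>R v + (1/2) *\<^sub>R w))\<^sup>2 = (norm v)\<^sup>2 / 2 + (norm w)\<^sup>2 / 2 - (norm (v - w))\<^sup>2 / 4"
    by (simp add: power2_norm_eq_inner inner_add_left inner_add_right inner_diff_left inner_diff_right
        inner_commute[of w v]) (simp add: field_simps)
  ultimately have "(norm (v - w))\<^sup>2 \<le> 0" using nv by linarith
  then show ?thesis by simp
qed

text \<open>This is \<open>contraction\<close> divided by \<open>k\<close> as \<open>k\<close> tends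
  to 0: the left side produces a subgradient at \<open>y t\<close>, and the right side is bounded
  through \<open>minspeed s\<close>.\<close>

lemma minspeed_decay:
  obtains K where "K > 0" "\<And>s t. 0 \<le> s \<Longrightarrow> s \<le> t \<Longrightarrow> t < b \<Longrightarrow> minspeed t \<le> exp (K * (t - s)) * minspeed s"
proof -
  obtain K where K: "K > 0" "\<And>s t k. 0 \<le> s \<Longrightarrow> s \<le> t \<Longrightarrow> 0 \<le> k \<Longrightarrow> t + k < b \<Longrightarrow>
    norm (y (t + k) - y t) \<le> exp (K * (t - s)) * norm (y (s + k) - y s)" by (rule contraction) (rule that)
  obtain C where C: "C \<ge> 0" "\<And>t k. 0 \<le> t \<Longrightarrow> 0 \<le> k \<Longrightarrow> t + k \<le> b \<Longrightarrow> t < b \<Longrightarrow>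
    norm (y (t + k) - y t) \<le> (minspeed t + C * k) * k" by (rule minspeed_step) (rule that)
  have "minspeed t \<le> exp (K * (t - s)) * minspeed s" if st: "0 \<le> s" "s \<le> t" "t < b" for s t
  proof -
    define H where "H n = ((b - t) / 2) / real (Suc n)" for n
    have H: "H n > 0" "t + H n < b" "H \<longlonglongrightarrow> 0" for n
    proof -
      have "(b - t) / 2 > 0" using st by simp
      note ss = small_steps[OF this]
      show "H n > 0" "H \<longlonglongrightarrow> 0" using ss(1,2) by (auto simp: H_def[abs_def])
      have "H n \<le> (b - t) / 2" using ss(3)[of n] by (simp only: H_def)
      moreover have "(b - t) / 2 < b - t" using st by simp
      ultimately show "t + H n < b" by linarith
    qed
    have tb: "t + H n \<le> b" for n using H(2)[of n] by simp
    have t0: "0 \<le> t" using st by simp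
    obtain p r where r: "strict_mono (r :: nat \<Rightarrow> nat)" "(\<lambda>n. (y (t + H (r n)) - y t) /\<^sub>R H (r n)) \<longlonglongrightarrow> p" "- p \<in> SD (y t)"
      by (rule right_cluster[OF t0 H(1) tb H(3)]) (rule that)
    have Hr: "(\<lambda>n. H (r n)) \<longlonglongrightarrow> 0" using LIMSEQ_subseq_LIMSEQ[OF H(3) r(1)] by (simp add: o_def)
    have le: "norm ((y (t + H (r n)) - y t) /\<^sub>R H (r n)) \<le> exp (K * (t - s)) * (minspeed s + C * H (r n))" for n
    proof -
      have "norm (y (t + H (r n)) - y t) \<le> exp (K * (t - s)) * norm (y (s + H (r n)) - y s)"
        using st H(1)[of "r n"] H(2)[of "r n"] by (intro K(2)) auto
      also have "\<dots> \<le> exp (K * (t - s)) * ((minspeed s + C * H (r n)) * H (r n))"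
        using st H(1,2)[of "r n"] by (intro mult_left_mono C(2)) auto
      finally show ?thesis using H(1)[of "r n"] by (subst norm_scaleR_inverse_le) (simp_all add: mult.assoc)
    qed
    have "norm p \<le> exp (K * (t - s)) * (minspeed s + C * 0)"
      by (rule norm_limit_le[OF r(2) _ le]) (intro tendsto_intros Hr)
    then show ?thesis using minspeed_le[OF r(3)] by simp
  qed
  then show thesis using that K(1) by blast
qed

lemma tendsto_from_clusters:
  fixes F :: "real \<Rightarrow> 'c::euclidean_space"
  assumes \<eta>: "\<eta> > 0" and B: "\<And>k. 0 < k \<Longrightarrow> k < \<eta> \<Longrightarrow> norm (F k) \<le> B"
    and cl: "\<And>X l. (\<And>n::nat. 0 < X n \<and> X n < \<eta>) \<Longrightarrow> X \<longlonglongrightarrow> 0 \<Longrightarrow> (\<lambda>n. F (X n)) \<longlonglongrightarrow> l \<Longrightarrow> l = p"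
    and e: "e > 0"
  shows "\<exists>d>0. \<forall>k. 0 < k \<longrightarrow> k < d \<longrightarrow> norm (F k - p) < e"
proof (rule ccontr)
  assume no: "\<not> ?thesis"
  have "\<exists>k. 0 < k \<and> k < min \<eta> (1 / real (Suc n)) \<and> e \<le> norm (F k - p)" for n
  proof -
    have "min \<eta> (1 / real (Suc n)) > 0" using \<eta> by simp
    then show ?thesis using no by (meson not_le)
  qed
  then obtain X where X: "\<And>n. 0 < X n" "\<And>n. X n < min \<eta> (1 / real (Suc n))" "\<And>n. e \<le> norm (F (X n) - p)" by metis
  have Xl: "X \<longlonglongrightarrow> 0"
  proof (rule tendsto_sandwich[OF _ _ tendsto_const])
    show "(\<lambda>n. 1 / real (Suc n)) \<longlonglongrightarrow> 0" by (rule small_steps(1)) simp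
    show "\<forall>\<^sub>F n in sequentially. X n \<le> 1 / real (Suc n)" using X(2) by (intro always_eventually) (auto intro: less_imp_le)
  qed (use X(1) in \<open>auto intro!: always_eventually less_imp_le\<close>)
  have FB: "norm (F (X n)) \<le> B" for n by (rule B) (use X(1,2)[of n] in auto)
  obtain l r where r: "strict_mono (r :: nat \<Rightarrow> nat)" "((\<lambda>n. F (X n)) \<circ> r) \<longlonglongrightarrow> l"
    by (rule bounded_seq_subseq[of "\<lambda>n. F (X n)", OF FB]) (rule that)
  have l: "l = p"
    by (rule cl[of "X \<circ> r"]) (use X r LIMSEQ_subseq_LIMSEQ[OF Xl r(1)] in \<open>auto simp: o_def\<close>)
  have "(\<lambda>n. norm (F (X (r n)) - p)) \<longlonglongrightarrow> norm (l - p)" using r(2) by (intro tendsto_intros) (simp add: o_def)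
  then have "e \<le> norm (l - p)" using X(3) by (intro LIMSEQ_le_const) auto
  then show False using l e by simp
qed

text \<open>By \<open>minspeed_decay\<close> the function \<open>exp (- K * t) * minspeed t\<close>
  is monotone, so it has countably many discontinuities. At a time of continuity the cluster values
  of both one-sided quotients lie in the negative of \<open>SD (y t)\<close> with norm at most
  \<open>minspeed t\<close>, and such an element is unique.\<close>

lemma differentiable_off_countable:
  obtains S where "countable S" "\<And>t. 0 < t \<Longrightarrow> t < b \<Longrightarrow> t \<notin> S \<Longrightarrow> \<exists>w\<in>SD (y t). (y has_vector_derivative - w) (at t)"
proof -
  obtain K where K: "K > 0" "\<And>s t. 0 \<le> s \<Longrightarrow> s \<le> t \<Longrightarrow> t < b \<Longrightarrow> minspeed t \<le> exp (K * (t - s)) * minspeed s"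
    by (rule minspeed_decay) (rule that)
  obtain C where C: "C \<ge> 0" "\<And>t k. 0 \<le> t \<Longrightarrow> 0 \<le> k \<Longrightarrow> t + k \<le> b \<Longrightarrow> t < b \<Longrightarrow>
    norm (y (t + k) - y t) \<le> (minspeed t + C * k) * k" by (rule minspeed_step) (rule that)
  define Q where "Q t = - (exp (- K * t) * minspeed t)" for t
  define S where "S = {t\<in>{0..<b}. \<not> continuous (at t within {0..<b}) Q}"
  have "mono_on {0..<b} Q"
  proof (rule mono_onI)
    fix s t assume st: "s \<in> {0..<b}" "t \<in> {0..<b}" "s \<le> t"
    then have "exp (- K * t) * minspeed t \<le> exp (- K * t) * (exp (K * (t - s)) * minspeed s)"
      by (intro mult_left_mono K(2)) auto
    also have "\<dots> = exp (- K * s) * minspeed s"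
    proof -
      have "- K * t + K * (t - s) = - K * s" by (simp add: algebra_simps)
      then show ?thesis by (simp only: mult.assoc[symmetric] exp_add[symmetric])
    qed
    finally show "Q s \<le> Q t" by (simp add: Q_def)
  qed
  then have "countable S" unfolding S_def by (rule mono_on_ctble_discont)
  moreover have "\<exists>w\<in>SD (y t). (y has_vector_derivative - w) (at t)" if t: "0 < t" "t < b" "t \<notin> S" for t
  proof -
    have Qc: "continuous (at t within {0..<b}) Q" using t by (auto simp: S_def)
    define H where "H n = (b - t) / real (Suc n)" for n
    have H: "H n > 0" "t + H n \<le> b" "H \<longlonglongrightarrow> 0" for n
      using small_steps[of "b - t"] t unfolding H_def[abs_def] by (auto simp: algebra_simps)
    have right: "norm l \<le> minspeed t \<and> - l \<in> SD (y t)"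
      if X: "\<And>n. 0 < X n \<and> X n < b - t" "X \<longlonglongrightarrow> 0" and l: "(\<lambda>n. (y (t + X n) - y t) /\<^sub>R X n) \<longlonglongrightarrow> l" for X :: "nat \<Rightarrow> real" and l
    proof
      have XX: "0 < X n" "t + X n \<le> b" for n using X(1)[of n] by auto
      show "- l \<in> SD (y t)" using right_limit_in_SD[OF less_imp_le[OF t(1)] XX X(2) l] .
      have le: "norm ((y (t + X n) - y t) /\<^sub>R X n) \<le> minspeed t + C * X n" for n
        using C(2)[of t "X n"] XX[of n] t by (subst norm_scaleR_inverse_le) auto
      have "norm l \<le> minspeed t + C * 0"
        by (rule norm_limit_le[OF l _ le]) (intro tendsto_intros X(2))
      then show "norm l \<le> minspeed t" by simp
    qed
    have left: "norm l \<le> minspeed t \<and> - l \<in> SD (y t)"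
      if X: "\<And>n. 0 < X n \<and> X n < t" "X \<longlonglongrightarrow> 0" and l: "(\<lambda>n. (y t - y (t - X n)) /\<^sub>R X n) \<longlonglongrightarrow> l" for X :: "nat \<Rightarrow> real" and l
    proof
      have XX: "0 < X n" "0 \<le> t - X n" for n using X(1)[of n] by auto
      show "- l \<in> SD (y t)" using left_limit_in_SD[OF less_imp_le[OF t(2)] XX X(2) l] .
      have le: "norm ((y t - y (t - X n)) /\<^sub>R X n) \<le> minspeed (t - X n) + C * X n" for n
        using C(2)[of "t - X n" "X n"] XX[of n] t by (subst norm_scaleR_inverse_le) auto
      have Xt: "(\<lambda>n. t - X n) \<longlonglongrightarrow> t" using tendsto_diff[OF tendsto_const X(2), of t] by simp
      \<comment> \<open>Continuity at \<open>t\<close> enters here: quotients from the left are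
        bounded by the minimal slopes at earlier times, which must tend to that at
        \<open>t\<close>.\<close>
      have "(\<lambda>n. Q (t - X n)) \<longlonglongrightarrow> Q t"
      proof -
        have "t - X n \<in> {0..<b}" for n using XX[of n] t by auto
        then show ?thesis
          using Qc[unfolded continuous_within_sequentially, rule_format, of "\<lambda>n. t - X n"] Xt by (simp add: o_def)
      qed
      then have "(\<lambda>n. - exp (K * (t - X n)) * Q (t - X n)) \<longlonglongrightarrow> - exp (K * t) * Q t"
        by (intro tendsto_intros Xt)
      moreover have "- exp (K * s) * Q s = minspeed s" for s
      proof -
        have "exp (K * s) * exp (- K * s) = 1" by (simp add: exp_add[symmetric])
        then have "exp (K * s) * (exp (- K * s) * minspeed s) = minspeed s" by (simp only: mult.assoc[symmetric] mult_1)
        then show ?thesis by (simp add: Q_def)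
      qed
      ultimately have ms: "(\<lambda>n. minspeed (t - X n)) \<longlonglongrightarrow> minspeed t" by simp
      have "norm l \<le> minspeed t + C * 0"
        by (rule norm_limit_le[OF l tendsto_add[OF ms tendsto_mult[OF tendsto_const X(2)]] le])
      then show "norm l \<le> minspeed t" by simp
    qed
    obtain p r where r: "strict_mono (r :: nat \<Rightarrow> nat)" "(\<lambda>n. (y (t + H (Suc (r n))) - y t) /\<^sub>R H (Suc (r n))) \<longlonglongrightarrow> p"
      by (rule right_cluster[OF less_imp_le[OF t(1)] H(1) H(2) LIMSEQ_Suc[OF H(3)]]) (rule that)
    have Hlt: "H (Suc n) < b - t" for n using t by (simp add: H_def divide_less_eq)
    have p: "norm p \<le> minspeed t" "- p \<in> SD (y t)"
      using right[OF _ _ r(2)] H(1) Hlt LIMSEQ_subseq_LIMSEQ[OF LIMSEQ_Suc[OF H(3)] r(1)] by (auto simp: o_def)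
    have uniq: "l = p" if "norm l \<le> minspeed t \<and> - l \<in> SD (y t)" for l
      using SD_minspeed_unique[of "- l" t "- p"] that p by auto
    have "(y has_vector_derivative p) (at t)"
      unfolding has_vector_derivative_def has_derivative_at_alt
    proof (intro conjI allI impI)
      show "bounded_linear (\<lambda>x. x *\<^sub>R p)" by (rule bounded_linear_scaleR_left)
      fix e :: real assume e: "e > 0"
      have "\<exists>d>0. \<forall>k. 0 < k \<longrightarrow> k < d \<longrightarrow> norm ((y (t + k) - y t) /\<^sub>R k - p) < e"
      proof (rule tendsto_from_clusters[where \<eta> = "b - t" and B = M])
        show "norm ((y (t + k) - y t) /\<^sub>R k) \<le> M" if "0 < k" "k < b - t" for k
          using y_lip[of t "t + k"] t that by (subst norm_scaleR_inverse_le) auto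
        fix X :: "nat \<Rightarrow> real" and l assume X: "\<And>n. 0 < X n \<and> X n < b - t" "X \<longlonglongrightarrow> 0"
          "(\<lambda>n. (y (t + X n) - y t) /\<^sub>R X n) \<longlonglongrightarrow> l"
        show "l = p" by (rule uniq, rule right[OF X])
      qed (use t e in auto)
      then obtain d1 where d1: "d1 > 0" "\<And>k. 0 < k \<Longrightarrow> k < d1 \<Longrightarrow> norm ((y (t + k) - y t) /\<^sub>R k - p) < e" by blast
      have "\<exists>d>0. \<forall>k. 0 < k \<longrightarrow> k < d \<longrightarrow> norm ((y t - y (t - k)) /\<^sub>R k - p) < e"
      proof (rule tendsto_from_clusters[where \<eta> = t and B = M])
        show "norm ((y t - y (t - k)) /\<^sub>R k) \<le> M" if "0 < k" "k < t" for k
          using y_lip[of "t - k" t] t that by (subst norm_scaleR_inverse_le) auto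
        fix X :: "nat \<Rightarrow> real" and l assume X: "\<And>n. 0 < X n \<and> X n < t" "X \<longlonglongrightarrow> 0"
          "(\<lambda>n. (y t - y (t - X n)) /\<^sub>R X n) \<longlonglongrightarrow> l"
        show "l = p" by (rule uniq, rule left[OF X])
      qed (use t e in auto)
      then obtain d2 where d2: "d2 > 0" "\<And>k. 0 < k \<Longrightarrow> k < d2 \<Longrightarrow> norm ((y t - y (t - k)) /\<^sub>R k - p) < e" by blast
      have scale: "norm (z - k *\<^sub>R p) \<le> e * k" if "k > 0" "norm (z /\<^sub>R k - p) < e" for z k
      proof -
        have "z - k *\<^sub>R p = k *\<^sub>R (z /\<^sub>R k - p)" using that(1) by (simp add: scaleR_right_diff_distrib)
        then have "norm (z - k *\<^sub>R p) = k * norm (z /\<^sub>R k - p)" using that(1) by (simp only: norm_scaleR abs_of_pos)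
        then show ?thesis using that by (simp add: mult.commute)
      qed
      show "\<exists>d>0. \<forall>s. norm (s - t) < d \<longrightarrow> norm (y s - y t - (s - t) *\<^sub>R p) \<le> e * norm (s - t)"
      proof (intro exI[of _ "min d1 d2"] conjI allI impI)
        show "min d1 d2 > 0" using d1 d2 by simp
        fix s assume s: "norm (s - t) < min d1 d2"
        consider "s = t" | "s > t" | "s < t" by linarith
        then show "norm (y s - y t - (s - t) *\<^sub>R p) \<le> e * norm (s - t)"
        proof cases
          case 2
          then have "norm (y (t + (s - t)) - y t - (s - t) *\<^sub>R p) \<le> e * (s - t)" using s by (intro scale d1(2)) auto
          then show ?thesis using 2 by simp
        next
          case 3
          then have "norm (y t - y (t - (t - s)) - (t - s) *\<^sub>R p) \<le> e * (t - s)" using s by (intro scale d2(2)) auto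
          moreover have "y s - y t - (s - t) *\<^sub>R p = - (y t - y (t - (t - s)) - (t - s) *\<^sub>R p)"
            by (simp add: algebra_simps)
          ultimately show ?thesis using 3 by (simp only: norm_minus_cancel) simp
        qed simp
      qed
    qed
    then show ?thesis using p(2) by (intro bexI[of _ "- p"]) auto
  qed
  ultimately show thesis using that by blast
qed

end

subsection \<open>Descent sequences and the Kurdyka--Lojasiewicz length estimate\<close>

text \<open>The desingularizing function \<open>s powr p\<close> is continued oddly to negative
  \<open>s\<close>, because the energy may cross the critical level. On either side the mean value
  theorem costs the derivative at the endpoint farther from 0, hence the sum over both
  endpoints.\<close>

lemma signed_power_increment:
  fixes A B p :: real
  assumes p: "0 < p" "p < 1" and AB: "B \<le> A"
  defines "\<Psi> \<equiv> \<lambda>s::real. sgn s * \<bar>s\<bar> powr p"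
  shows "A - B \<le> (\<bar>A\<bar> powr (1 - p) + \<bar>B\<bar> powr (1 - p)) * ((\<Psi> A - \<Psi> B) / p)"
proof -
  have id: "s powr (1 - p) * s powr p = s" if "s \<ge> 0" for s :: real
    using that by (cases "s = 0") (simp_all add: powr_add[symmetric])
  have pos: "A - B \<le> A powr (1 - p) * ((A powr p - B powr p) / p)" if B0: "0 \<le> B" and BA: "B \<le> A" for A B :: real
  proof -
    consider "A = B" | "B = 0" "A > 0" | "0 < B" "B < A" using B0 BA by linarith
    then show ?thesis
    proof cases
      case 2
      have "A \<le> A / p" using 2 p by (simp add: pos_le_divide_eq mult_left_le)
      also have "\<dots> = A powr (1 - p) * (A powr p / p)" using id[of A] 2 by simp
      finally show ?thesis using 2 p by simp
    next
      case 3
      have "\<exists>\<xi>. B < \<xi> \<and> \<xi> < A \<and> A powr p - B powr p = (A - B) * (p * \<xi> powr (p - 1))"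
        by (rule MVT2[OF 3(2)]) (use 3 in \<open>auto intro!: derivative_eq_intros\<close>)
      then obtain \<xi> where \<xi>: "B < \<xi>" "\<xi> < A" "A powr p - B powr p = (A - B) * (p * \<xi> powr (p - 1))" by blast
      have "A powr (p - 1) \<le> \<xi> powr (p - 1)" using \<xi> 3 p by (intro powr_mono2') auto
      then have "(A - B) * (p * A powr (p - 1)) \<le> A powr p - B powr p"
        unfolding \<xi>(3) using 3 p by (intro mult_left_mono) auto
      then have "A powr (1 - p) * ((A - B) * (p * A powr (p - 1)) / p) \<le> A powr (1 - p) * ((A powr p - B powr p) / p)"
        using p by (intro mult_left_mono divide_right_mono) auto
      moreover have "A powr (1 - p) * ((A - B) * (p * A powr (p - 1)) / p) = (A - B) * (A powr (1 - p) * A powr (p - 1))"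
        using p by simp
      moreover have "A powr (1 - p) * A powr (p - 1) = 1" using 3 by (simp add: powr_add[symmetric])
      ultimately show ?thesis by simp
    qed simp
  qed
  consider "0 \<le> B" | "A \<le> 0" | "B < 0" "0 < A" by linarith
  then show ?thesis
  proof cases
    case 1
    have "\<Psi> A = A powr p" "\<Psi> B = B powr p" using 1 AB by (auto simp: \<Psi>_def sgn_if)
    moreover have "0 \<le> B powr (1 - p) * ((A powr p - B powr p) / p)"
      using 1 AB p by (intro mult_nonneg_nonneg divide_nonneg_pos) (auto intro!: powr_mono2)
    ultimately show ?thesis using pos[OF 1 AB] 1 AB unfolding distrib_right by (simp only: abs_of_nonneg order_trans[OF 1 AB])
  next
    case 2
    have "\<Psi> A = - ((- A) powr p)" "\<Psi> B = - ((- B) powr p)" using 2 AB by (auto simp: \<Psi>_def sgn_if)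
    moreover have "0 \<le> (- A) powr (1 - p) * (((- B) powr p - (- A) powr p) / p)"
      using 2 AB p by (intro mult_nonneg_nonneg divide_nonneg_pos) (auto intro!: powr_mono2)
    moreover have "\<bar>A\<bar> = - A" "\<bar>B\<bar> = - B" using 2 AB by auto
    moreover have "A - B \<le> (- B) powr (1 - p) * (((- B) powr p - (- A) powr p) / p)" using pos[of "- A" "- B"] 2 AB by simp
    ultimately show ?thesis unfolding distrib_right by simp
  next
    case 3
    have P: "\<Psi> A = A powr p" "\<Psi> B = - ((- B) powr p)" using 3 by (auto simp: \<Psi>_def sgn_if)
    have nn: "0 \<le> A powr (1 - p) * (- B) powr p" "0 \<le> (- B) powr (1 - p) * A powr p" by auto
    have "A - B = A powr (1 - p) * A powr p + (- B) powr (1 - p) * (- B) powr p"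
      using id[of A] id[of "- B"] 3 by simp
    also have "\<dots> \<le> (A powr (1 - p) + (- B) powr (1 - p)) * (A powr p + (- B) powr p)"
      using nn by (simp add: distrib_left distrib_right)
    also have "\<dots> \<le> (A powr (1 - p) + (- B) powr (1 - p)) * ((A powr p + (- B) powr p) / p)"
      using p by (intro mult_left_mono) (auto simp: pos_le_divide_eq mult_left_le)
    finally show ?thesis using 3 unfolding P by simp
  qed
qed

text \<open>Mean value theorem for \<open>x powr (- q)\<close> between \<open>n\<close> and
  \<open>n + 1\<close>, with the intermediate point at most \<open>2 * n\<close>. It dominates a
  summable power by a telescoping one.\<close>

lemma powr_tail_bound:
  fixes n q :: real
  assumes n: "n \<ge> 1" and q: "q > 0"
  shows "n powr (- (q + 1)) \<le> (2 powr (q + 1) / q) * (n powr (- q) - (n + 1) powr (- q))"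
proof -
  have "\<exists>\<xi>. n < \<xi> \<and> \<xi> < n + 1 \<and> (n + 1) powr (- q) - n powr (- q) = (n + 1 - n) * (- q * \<xi> powr (- q - 1))"
    by (rule MVT2) (use n in \<open>auto intro!: derivative_eq_intros\<close>)
  then obtain \<xi> where \<xi>: "n < \<xi>" "\<xi> < n + 1" "n powr (- q) - (n + 1) powr (- q) = q * \<xi> powr (- q - 1)" by auto
  have "(2 * n) powr (- q - 1) \<le> \<xi> powr (- q - 1)" using \<xi> n q by (intro powr_mono2') auto
  then have "2 powr (- q - 1) * n powr (- q - 1) \<le> \<xi> powr (- q - 1)" using n by (simp add: powr_mult)
  then have "2 powr (q + 1) * (2 powr (- q - 1) * n powr (- q - 1)) \<le> 2 powr (q + 1) * \<xi> powr (- q - 1)"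
    by (intro mult_left_mono) auto
  also have "2 powr (q + 1) * (2 powr (- q - 1) * n powr (- q - 1)) = n powr (- q - 1)"
    by (simp add: mult.assoc[symmetric] powr_add[symmetric])
  finally have "n powr (- q - 1) \<le> 2 powr (q + 1) * \<xi> powr (- q - 1)" .
  moreover have "- (q + 1) = - q - 1" by simp
  ultimately show ?thesis unfolding \<xi>(3) using q by simp
qed

lemma powr_add_le:
  fixes a b \<theta> :: real
  assumes "0 \<le> a" "0 \<le> b" "0 < \<theta>" "\<theta> \<le> 1"
  shows "(a + b) powr \<theta> \<le> a powr \<theta> + b powr \<theta>"
proof (cases "a + b = 0")
  case False
  then have s: "a + b > 0" using assms by linarith
  have le: "x / (a + b) \<le> (x / (a + b)) powr \<theta>" if "0 \<le> x" "x \<le> a + b" for x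
  proof (cases "x = 0")
    case False
    then have "(x / (a + b)) powr 1 \<le> (x / (a + b)) powr \<theta>" using that s assms by (intro powr_mono') auto
    then show ?thesis using that s by simp
  qed simp
  have "1 = a / (a + b) + b / (a + b)" using s by (simp add: add_divide_distrib[symmetric])
  also have "\<dots> \<le> (a / (a + b)) powr \<theta> + (b / (a + b)) powr \<theta>" using assms by (intro add_mono le) auto
  also have "\<dots> = (a powr \<theta> + b powr \<theta>) / (a + b) powr \<theta>"
    using assms by (simp add: powr_divide add_divide_distrib)
  finally show ?thesis using s by (simp add: pos_le_divide_eq)
qed (use assms in simp)

section \<open>Abstract descent sequences and their error sums\<close>

locale descent_model = flow_model D \<phi> SD + semialgebraic_model D \<phi> SD
  for D :: "'a::euclidean_space set" and \<phi> SD +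
  fixes \<kappa> \<beta> :: real and step :: "real \<Rightarrow> 'a \<Rightarrow> 'a \<Rightarrow> bool"
  assumes \<kappa>\<beta>: "(\<kappa> = 0 \<and> \<beta> = 0) \<or> (\<kappa> = 1 \<and> 1 / 2 < \<beta> \<and> \<beta> < 1)"
    and \<phi>_lipschitz: "\<And>R. \<exists>L>0. \<forall>x\<in>D. \<forall>y\<in>D. norm x \<le> R \<longrightarrow> norm y \<le> R \<longrightarrow> \<bar>\<phi> x - \<phi> y\<bar> \<le> L * norm (x - y)"
    and \<phi>_bounded_below: "\<exists>m. \<forall>x\<in>D. m \<le> \<phi> x"
    and step_D: "\<And>a x x'. a > 0 \<Longrightarrow> step a x x' \<Longrightarrow> x' \<in> D"
    and step_bounds: "\<And>R. \<exists>M>0. \<exists>abar>0. \<forall>a x x'. 0 < a \<longrightarrow> a \<le> abar \<longrightarrow> x \<in> D \<longrightarrow> norm x \<le> R \<longrightarrow> step a x x' \<longrightarrow>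
     x' \<in> D \<and> norm (x' - x) \<le> M * a \<and>
     \<phi> x' \<le> \<phi> x - (norm (x' - x))\<^sup>2 / (2 * a) + \<kappa> * M * a ^ 3 \<and>
     (\<exists>w\<in>SD x'. a * norm w \<le> 2 * norm (x' - x) + \<kappa> * M * a\<^sup>2) \<and>
     (\<forall>z\<in>D. norm z \<le> R \<longrightarrow> (norm (x' - z))\<^sup>2 / 2 - (norm (x - z))\<^sup>2 / 2 \<le> a * (\<phi> z - \<phi> x + M * (norm (x - z))\<^sup>2 + M * a))"
begin

text \<open>\<open>K\<close> counts the steps already made, so that a tail of a run is again a run
  (\<open>run_shift\<close>).\<close>

definition "stepsize \<alpha> K k = \<alpha> / (real k + real K + 1) powr \<beta>"

definition "run \<alpha> K x \<longleftrightarrow> x 0 \<in> D \<and> (\<forall>k. step (stepsize \<alpha> K k) (x k) (x (Suc k)))"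

lemma \<beta>: "0 \<le> \<beta>" "\<beta> < 1" and \<kappa>: "0 \<le> \<kappa>" "\<kappa> \<le> 1"
  using \<kappa>\<beta> by auto

lemma stepsize_pos: "\<alpha> > 0 \<Longrightarrow> stepsize \<alpha> K k > 0"
  by (simp add: stepsize_def)

lemma stepsize_le: assumes "\<alpha> > 0" shows "stepsize \<alpha> K k \<le> \<alpha>"
proof -
  have "1 \<le> (real k + real K + 1) powr \<beta>" using \<beta> by (intro ge_one_powr_ge_zero) auto
  then show ?thesis using assms by (simp add: stepsize_def divide_le_eq mult_le_cancel_left1)
qed

lemma stepsize_mono: "\<alpha> > 0 \<Longrightarrow> stepsize \<alpha> K (Suc k) \<le> stepsize \<alpha> K k"
  unfolding stepsize_def using \<beta> by (intro divide_left_mono powr_mono2) auto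

lemma stepsize_shift: "stepsize \<alpha> (K + m) k = stepsize \<alpha> K (m + k)"
  by (simp add: stepsize_def algebra_simps)

lemma run_D: "\<alpha> > 0 \<Longrightarrow> run \<alpha> K x \<Longrightarrow> x k \<in> D"
  by (cases k) (auto simp: run_def intro: step_D[OF stepsize_pos])

lemma run_shift: "\<alpha> > 0 \<Longrightarrow> run \<alpha> K x \<Longrightarrow> run \<alpha> (K + m) (\<lambda>k. x (m + k))"
  using run_D[of \<alpha> K x m] by (auto simp: run_def stepsize_shift)

text \<open>An explicit bound for the tail, from \<open>k\<close> on, of the sum of the cubed step
  sizes: \<open>powr_tail_bound\<close> with \<open>q = 3 * \<beta> - 1\<close>.\<close>

definition "excess \<alpha> K k = \<kappa> * (2 powr (3 * \<beta>) / (3 * \<beta> - 1)) * \<alpha> ^ 3 * (real k + real K + 1) powr (- (3 * \<beta> - 1))"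

text \<open>Adding \<open>M * excess\<close> to the objective absorbs the errors of order \<open>a ^ 3\<close>.\<close>

lemma excess_decrease:
  assumes "\<alpha> > 0" shows "\<kappa> * stepsize \<alpha> K k ^ 3 \<le> excess \<alpha> K k - excess \<alpha> K (Suc k)"
proof (cases "\<kappa> = 0")
  case False
  then have b: "\<kappa> = 1" "\<beta> > 1 / 2" using \<kappa>\<beta> by auto
  define n where "n = real k + real K + 1"
  have n: "n \<ge> 1" by (simp add: n_def)
  have "(n powr \<beta>) ^ 3 = n powr (3 * \<beta>)" using n by (subst powr_power) (auto simp: mult.commute)
  then have "stepsize \<alpha> K k ^ 3 = \<alpha> ^ 3 * n powr (- ((3 * \<beta> - 1) + 1))"
    using n by (simp add: stepsize_def n_def[symmetric] power_mult_distrib power_inverse powr_minus divide_inverse)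
  also have "\<dots> \<le> \<alpha> ^ 3 * ((2 powr ((3 * \<beta> - 1) + 1) / (3 * \<beta> - 1)) * (n powr (- (3 * \<beta> - 1)) - (n + 1) powr (- (3 * \<beta> - 1))))"
    using b assms by (intro mult_left_mono powr_tail_bound n) auto
  also have "\<dots> = excess \<alpha> K k - excess \<alpha> K (Suc k)"
    unfolding excess_def using b(1) by (simp add: n_def algebra_simps)
  finally show ?thesis using b by simp
next
  case True
  then show ?thesis unfolding excess_def by simp
qed

lemma excess_nonneg: "\<alpha> > 0 \<Longrightarrow> excess \<alpha> K k \<ge> 0"
  using \<kappa>\<beta> by (auto simp: excess_def)

lemma excess_mono: "\<alpha> > 0 \<Longrightarrow> excess \<alpha> K (Suc k) \<le> excess \<alpha> K k"
proof -
  assume a: "\<alpha> > 0"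
  have "0 \<le> \<kappa> * stepsize \<alpha> K k ^ 3" using \<kappa>(1) stepsize_pos[OF a, of K k] by simp
  then show ?thesis using excess_decrease[OF a, of K k] by linarith
qed

lemma excess_le:
  obtains C where "C > 0" "\<And>\<alpha> K k. 0 < \<alpha> \<Longrightarrow> \<alpha> \<le> 1 \<Longrightarrow> excess \<alpha> K k \<le> C * \<alpha>"
    "\<And>\<alpha> K k. 0 < \<alpha> \<Longrightarrow> \<alpha> \<le> 1 \<Longrightarrow> excess \<alpha> K k \<le> \<kappa> * C * (real k + real K + 1) powr (- (3 * \<beta> - 1))"
proof -
  define C where "C = \<bar>2 powr (3 * \<beta>) / (3 * \<beta> - 1)\<bar> + 1"
  have C: "C > 0" unfolding C_def by (rule add_nonneg_pos) auto
  have *: "excess \<alpha> K k \<le> \<kappa> * C * \<alpha> ^ 3 * (real k + real K + 1) powr (- (3 * \<beta> - 1))" if "0 < \<alpha>" for \<alpha> K k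
  proof -
    have "t \<le> \<bar>t\<bar> + 1" for t :: real by linarith
    then show ?thesis unfolding excess_def C_def using \<kappa> that
      by (intro mult_right_mono mult_left_mono) (simp_all only: zero_le_power less_imp_le powr_ge_zero)
  qed
  show thesis
  proof (rule that[OF C])
    fix \<alpha> :: real and K k :: nat assume a: "0 < \<alpha>" "\<alpha> \<le> 1"
    have a3: "\<alpha> ^ 3 \<le> \<alpha>" "\<alpha> ^ 3 \<le> 1" using a by (auto simp: power3_eq_cube mult_le_one intro: mult_left_le)
    have "\<kappa> * C * \<alpha> ^ 3 * (real k + real K + 1) powr (- (3 * \<beta> - 1)) \<le> \<kappa> * C * 1 * (real k + real K + 1) powr (- (3 * \<beta> - 1))"
      using a3 \<kappa>(1) C by (intro mult_right_mono mult_left_mono) auto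
    then show "excess \<alpha> K k \<le> \<kappa> * C * (real k + real K + 1) powr (- (3 * \<beta> - 1))" using *[OF a(1), of K k] by simp
    show "excess \<alpha> K k \<le> C * \<alpha>"
    proof (cases "\<kappa> = 0")
      case False
      then have b: "\<kappa> = 1" "\<beta> > 1 / 2" using \<kappa>\<beta> by auto
      have "(real k + real K + 1) powr (- (3 * \<beta> - 1)) \<le> (real k + real K + 1) powr 0"
        using b by (intro powr_mono) auto
      then have "C * \<alpha> ^ 3 * (real k + real K + 1) powr (- (3 * \<beta> - 1)) \<le> C * \<alpha> * 1"
        using a3 a C by (intro mult_mono) auto
      then show ?thesis using *[OF a(1), of K k] b by simp
    next
      case True
      then have "excess \<alpha> K k = 0" unfolding excess_def by simp
      then show ?thesis using a C by simp
    qed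
  qed
qed

lemma shifted_powr_sum:
  assumes "s > 1"
  obtains B where "B > 0" "\<And>n K. (\<Sum>k<n. (real k + real K + 1) powr (- s)) \<le> B"
proof -
  have sm: "summable (\<lambda>n. real n powr (- s))" using assms by (simp add: summable_real_powr_iff)
  define B where "B = (\<Sum>n. real n powr (- s)) + 1"
  have "(\<Sum>k<n. (real k + real K + 1) powr (- s)) \<le> B" for n K
  proof -
    have "(\<Sum>k<n. (real k + real K + 1) powr (- s)) = (\<Sum>i\<in>(\<lambda>k. k + K + 1) ` {..<n}. real i powr (- s))"
      by (subst sum.reindex) (auto simp: inj_on_def o_def add_ac intro!: sum.cong)
    also have "\<dots> \<le> (\<Sum>n. real n powr (- s))" by (intro sum_le_suminf sm) auto
    finally show ?thesis by (simp add: B_def)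
  qed
  moreover have "B > 0" using suminf_nonneg[OF sm] by (simp add: B_def add_nonneg_pos)
  ultimately show thesis using that by blast
qed

text \<open>The exponent \<open>\<theta>\<close> must be close to 1 for the errors to be summable; this is where \<open>\<beta> > 1/2\<close> enters.\<close>

lemma error_sum:
  assumes \<theta>0: "0 < \<theta>0" "\<theta>0 < 1"
  obtains \<theta> W where "\<theta>0 \<le> \<theta>" "\<theta> < 1" "W > 0" "\<And>\<alpha> K n. 0 < \<alpha> \<Longrightarrow> \<alpha> \<le> 1 \<Longrightarrow>
    (\<Sum>k<n. \<kappa> * (stepsize \<alpha> K k)\<^sup>2 + stepsize \<alpha> K k * excess \<alpha> K k powr \<theta>) \<le> W * \<alpha>"
proof (cases "\<kappa> = 0")
  case True
  have "excess \<alpha> K k = 0" for \<alpha> K k unfolding excess_def using True by simp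
  then show thesis by (intro that[of \<theta>0 1]) (use \<theta>0 True in auto)
next
  case False
  then have b: "\<kappa> = 1" "\<beta> > 1 / 2" using \<kappa>\<beta> by auto
  define q where "q = 3 * \<beta> - 1"
  have q: "q > 0" "1 - \<beta> < q" using b by (auto simp: q_def)
  \<comment> \<open>At least halfway between \<open>(1 - \<beta>) / q\<close> and 1, so that
    \<open>\<beta> + q * \<theta> > 1\<close>. There is room because
    \<open>1 - \<beta> < 3 * \<beta> - 1\<close>.\<close>
  define \<theta> where "\<theta> = max \<theta>0 (((1 - \<beta>) / q + 1) / 2)"
  have "(1 - \<beta>) / q < 1" using q by simp
  moreover have "s < max t ((s + 1) / 2)" "t < 1 \<Longrightarrow> max t ((s + 1) / 2) < 1" if "s < 1" for s t :: real
    using that by (auto simp: less_max_iff_disj)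
  ultimately have \<theta>: "\<theta>0 \<le> \<theta>" "\<theta> < 1" "(1 - \<beta>) / q < \<theta>" using \<theta>0 unfolding \<theta>_def by (blast intro: max.cobounded1)+
  have "1 - \<beta> < \<theta> * q" using \<theta>(3) q by (simp add: pos_divide_less_eq)
  then have s: "\<beta> + q * \<theta> > 1" by (simp add: mult.commute)
  obtain A where A: "A > 0" "\<And>n K. (\<Sum>k<n. (real k + real K + 1) powr (- (2 * \<beta>))) \<le> A"
    by (rule shifted_powr_sum[of "2 * \<beta>"]) (use b in auto)
  obtain B where B: "B > 0" "\<And>n K. (\<Sum>k<n. (real k + real K + 1) powr (- (\<beta> + q * \<theta>))) \<le> B"
    by (rule shifted_powr_sum[OF s]) (rule that)
  obtain C where C: "C > 0" "\<And>\<alpha> K k. 0 < \<alpha> \<Longrightarrow> \<alpha> \<le> 1 \<Longrightarrow> excess \<alpha> K k \<le> \<kappa> * C * (real k + real K + 1) powr (- (3 * \<beta> - 1))"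
    by (rule excess_le) (rule that)
  show thesis
  proof (rule that[OF \<theta>(1,2)])
    show "A + C powr \<theta> * B > 0" using A B C by (simp add: add_pos_pos)
    fix \<alpha> :: real and K n :: nat assume a: "0 < \<alpha>" "\<alpha> \<le> 1"
    have "(\<Sum>k<n. \<kappa> * (stepsize \<alpha> K k)\<^sup>2 + stepsize \<alpha> K k * excess \<alpha> K k powr \<theta>) \<le>
      (\<Sum>k<n. \<alpha> * (real k + real K + 1) powr (- (2 * \<beta>)) + \<alpha> * C powr \<theta> * (real k + real K + 1) powr (- (\<beta> + q * \<theta>)))"
    proof (rule sum_mono)
      fix k
      define m where "m = real k + real K + 1"
      have m: "m > 0" by (simp add: m_def)
      have sz: "stepsize \<alpha> K k = \<alpha> * m powr (- \<beta>)" by (simp add: stepsize_def m_def powr_minus divide_inverse)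
      have "(stepsize \<alpha> K k)\<^sup>2 = \<alpha>\<^sup>2 * m powr (- (2 * \<beta>))" unfolding sz using m by (simp add: power_mult_distrib powr_power mult.commute)
      also have "\<dots> \<le> \<alpha> * m powr (- (2 * \<beta>))" using a by (intro mult_right_mono) (auto simp: power2_eq_square mult_left_le)
      finally have 1: "\<kappa> * (stepsize \<alpha> K k)\<^sup>2 \<le> \<alpha> * m powr (- (2 * \<beta>))" using b by simp
      have "excess \<alpha> K k powr \<theta> \<le> (C * m powr (- q)) powr \<theta>"
        using C(2)[OF a, of K k] excess_nonneg[OF a(1)] b \<theta>(1) \<theta>0(1)
        by (intro powr_mono2) (auto simp: m_def q_def)
      also have "\<dots> = C powr \<theta> * m powr (- (q * \<theta>))" using C(1) by (simp add: powr_mult powr_powr)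
      finally have "stepsize \<alpha> K k * excess \<alpha> K k powr \<theta> \<le> (\<alpha> * m powr (- \<beta>)) * (C powr \<theta> * m powr (- (q * \<theta>)))"
        unfolding sz using a by (intro mult_left_mono) auto
      also have "\<dots> = \<alpha> * C powr \<theta> * (m powr (- \<beta>) * m powr (- (q * \<theta>)))" by simp
      also have "m powr (- \<beta>) * m powr (- (q * \<theta>)) = m powr (- (\<beta> + q * \<theta>))" by (simp add: powr_add[symmetric])
      finally show "\<kappa> * (stepsize \<alpha> K k)\<^sup>2 + stepsize \<alpha> K k * excess \<alpha> K k powr \<theta> \<le>
        \<alpha> * (real k + real K + 1) powr (- (2 * \<beta>)) + \<alpha> * C powr \<theta> * (real k + real K + 1) powr (- (\<beta> + q * \<theta>))"
        using 1 unfolding m_def by linarith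
    qed
    also have "\<dots> = \<alpha> * (\<Sum>k<n. (real k + real K + 1) powr (- (2 * \<beta>))) +
        \<alpha> * C powr \<theta> * (\<Sum>k<n. (real k + real K + 1) powr (- (\<beta> + q * \<theta>)))"
      by (simp only: sum.distrib sum_distrib_left)
    also have "\<dots> \<le> \<alpha> * A + \<alpha> * C powr \<theta> * B" using a by (intro add_mono mult_left_mono A(2) B(2)) auto
    also have "\<dots> = (A + C powr \<theta> * B) * \<alpha>" by (simp add: algebra_simps)
    finally show "(\<Sum>k<n. \<kappa> * (stepsize \<alpha> K k)\<^sup>2 + stepsize \<alpha> K k * excess \<alpha> K k powr \<theta>) \<le> (A + C powr \<theta> * B) * \<alpha>" .
  qed
qed

lemma step_constants:
  obtains M abar where "M > 0" "abar > 0"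
    "\<And>\<alpha> K x k. 0 < \<alpha> \<Longrightarrow> \<alpha> \<le> abar \<Longrightarrow> run \<alpha> K x \<Longrightarrow> norm (x k) \<le> R \<Longrightarrow> norm (x (Suc k) - x k) \<le> M * stepsize \<alpha> K k"
    "\<And>\<alpha> K x k. 0 < \<alpha> \<Longrightarrow> \<alpha> \<le> abar \<Longrightarrow> run \<alpha> K x \<Longrightarrow> norm (x k) \<le> R \<Longrightarrow>
      \<phi> (x (Suc k)) \<le> \<phi> (x k) - (norm (x (Suc k) - x k))\<^sup>2 / (2 * stepsize \<alpha> K k) + \<kappa> * M * stepsize \<alpha> K k ^ 3"
    "\<And>\<alpha> K x k. 0 < \<alpha> \<Longrightarrow> \<alpha> \<le> abar \<Longrightarrow> run \<alpha> K x \<Longrightarrow> norm (x k) \<le> R \<Longrightarrow>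
      \<exists>w\<in>SD (x (Suc k)). stepsize \<alpha> K k * norm w \<le> 2 * norm (x (Suc k) - x k) + \<kappa> * M * (stepsize \<alpha> K k)\<^sup>2"
    "\<And>\<alpha> K x k z. 0 < \<alpha> \<Longrightarrow> \<alpha> \<le> abar \<Longrightarrow> run \<alpha> K x \<Longrightarrow> norm (x k) \<le> R \<Longrightarrow> z \<in> D \<Longrightarrow> norm z \<le> R \<Longrightarrow>
      (norm (x (Suc k) - z))\<^sup>2 / 2 - (norm (x k - z))\<^sup>2 / 2 \<le>
        stepsize \<alpha> K k * (\<phi> z - \<phi> (x k) + M * (norm (x k - z))\<^sup>2 + M * stepsize \<alpha> K k)"
proof -
  obtain M abar where M: "M > 0" "abar > 0" and H: "\<And>a x x'. 0 < a \<Longrightarrow> a \<le> abar \<Longrightarrow> x \<in> D \<Longrightarrow> norm x \<le> R \<Longrightarrow> step a x x' \<Longrightarrow>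
     x' \<in> D \<and> norm (x' - x) \<le> M * a \<and>
     \<phi> x' \<le> \<phi> x - (norm (x' - x))\<^sup>2 / (2 * a) + \<kappa> * M * a ^ 3 \<and>
     (\<exists>w\<in>SD x'. a * norm w \<le> 2 * norm (x' - x) + \<kappa> * M * a\<^sup>2) \<and>
     (\<forall>z\<in>D. norm z \<le> R \<longrightarrow> (norm (x' - z))\<^sup>2 / 2 - (norm (x - z))\<^sup>2 / 2 \<le> a * (\<phi> z - \<phi> x + M * (norm (x - z))\<^sup>2 + M * a))"
    using step_bounds[of R] by metis
  have H': "norm (x (Suc k) - x k) \<le> M * stepsize \<alpha> K k \<and>
     \<phi> (x (Suc k)) \<le> \<phi> (x k) - (norm (x (Suc k) - x k))\<^sup>2 / (2 * stepsize \<alpha> K k) + \<kappa> * M * stepsize \<alpha> K k ^ 3 \<and>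
     (\<exists>w\<in>SD (x (Suc k)). stepsize \<alpha> K k * norm w \<le> 2 * norm (x (Suc k) - x k) + \<kappa> * M * (stepsize \<alpha> K k)\<^sup>2) \<and>
     (\<forall>z\<in>D. norm z \<le> R \<longrightarrow> (norm (x (Suc k) - z))\<^sup>2 / 2 - (norm (x k - z))\<^sup>2 / 2 \<le>
        stepsize \<alpha> K k * (\<phi> z - \<phi> (x k) + M * (norm (x k - z))\<^sup>2 + M * stepsize \<alpha> K k))"
    if "0 < \<alpha>" "\<alpha> \<le> abar" "run \<alpha> K x" "norm (x k) \<le> R" for \<alpha> K x k
  proof -
    have "stepsize \<alpha> K k \<le> abar" using stepsize_le[OF that(1), of K k] that(2) by linarith
    then show ?thesis using H[OF stepsize_pos[OF that(1)] _ run_D[OF that(1,3)] that(4)] that(3) unfolding run_def by blast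
  qed
  show thesis by (rule that[OF M]) (use H' in blast)+
qed

text \<open>The energy \<open>E\<close> falls by at least \<open>d\<^sup>2 / (2 * a)\<close> per
  step, while the Kurdyka--Lojasiewicz inequality bounds \<open>a\<close> times a power of the
  energy by \<open>d\<close> up to errors. Together they bound \<open>d\<close> by an increment of
  \<open>\<Psi>\<close> along \<open>E\<close>, which telescopes, plus a fraction of the
  neighbouring step lengths.\<close>

theorem kl_phase:
  assumes \<epsilon>: "\<epsilon> > 0"
  obtains \<delta> \<alpha>1 where "\<delta> > 0" "\<alpha>1 > 0" "\<And>\<alpha> K x n. 0 < \<alpha> \<Longrightarrow> \<alpha> \<le> \<alpha>1 \<Longrightarrow> run \<alpha> K x \<Longrightarrow>
    \<forall>k\<le>n. norm (x k) \<le> R \<and> \<bar>\<phi> (x k) - v\<bar> < \<delta> \<Longrightarrow> (\<Sum>k<n. norm (x (Suc k) - x k)) \<le> \<epsilon>"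
proof -
  obtain M abar where M: "M > 0" and abar: "abar > 0"
    and S1: "\<And>\<alpha> K x k. 0 < \<alpha> \<Longrightarrow> \<alpha> \<le> abar \<Longrightarrow> run \<alpha> K x \<Longrightarrow> norm (x k) \<le> R \<Longrightarrow> norm (x (Suc k) - x k) \<le> M * stepsize \<alpha> K k"
    and S2: "\<And>\<alpha> K x k. 0 < \<alpha> \<Longrightarrow> \<alpha> \<le> abar \<Longrightarrow> run \<alpha> K x \<Longrightarrow> norm (x k) \<le> R \<Longrightarrow>
      \<phi> (x (Suc k)) \<le> \<phi> (x k) - (norm (x (Suc k) - x k))\<^sup>2 / (2 * stepsize \<alpha> K k) + \<kappa> * M * stepsize \<alpha> K k ^ 3"
    and S3: "\<And>\<alpha> K x k. 0 < \<alpha> \<Longrightarrow> \<alpha> \<le> abar \<Longrightarrow> run \<alpha> K x \<Longrightarrow> norm (x k) \<le> R \<Longrightarrow>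
      \<exists>w\<in>SD (x (Suc k)). stepsize \<alpha> K k * norm w \<le> 2 * norm (x (Suc k) - x k) + \<kappa> * M * (stepsize \<alpha> K k)\<^sup>2"
    by (rule step_constants[of R]) (rule that)
  obtain \<delta>0 c \<theta>0 where kl0: "0 < \<delta>0" "0 < c" "0 < \<theta>0" "\<theta>0 < 1"
    and kl: "\<And>\<theta> x w. \<theta>0 \<le> \<theta> \<Longrightarrow> \<theta> < 1 \<Longrightarrow> norm x \<le> R \<Longrightarrow> w \<in> SD x \<Longrightarrow> \<bar>\<phi> x - v\<bar> < \<delta>0 \<Longrightarrow> \<bar>\<phi> x - v\<bar> powr \<theta> \<le> c * norm w"
    by (rule kl_inequality[of R v]) (rule that)
  obtain \<theta> W where \<theta>: "\<theta>0 \<le> \<theta>" "\<theta> < 1" and W: "W > 0" "\<And>\<alpha> K n. 0 < \<alpha> \<Longrightarrow> \<alpha> \<le> 1 \<Longrightarrow>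
    (\<Sum>k<n. \<kappa> * (stepsize \<alpha> K k)\<^sup>2 + stepsize \<alpha> K k * excess \<alpha> K k powr \<theta>) \<le> W * \<alpha>"
    by (rule error_sum[OF kl0(3,4)]) (rule that)
  obtain C where C: "C > 0" "\<And>\<alpha> K k. 0 < \<alpha> \<Longrightarrow> \<alpha> \<le> 1 \<Longrightarrow> excess \<alpha> K k \<le> C * \<alpha>" by (rule excess_le) (rule that)
  define p where "p = 1 - \<theta>"
  have p: "0 < p" "p < 1" "1 - p = \<theta>" using \<theta> kl0 by (auto simp: p_def)
  define Q where "Q = c * M + M powr \<theta> + 1"
  have Q: "Q > 0" "c * M \<le> Q" "M powr \<theta> \<le> Q" using kl0 M by (auto simp: Q_def add_pos_pos)
  \<comment> \<open>Makes the telescoped part at most \<open>\<epsilon> / 2\<close>; during the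
    phase the energy stays within \<open>2 * \<delta>\<close> of 0.\<close>
  define \<delta> where "\<delta> = min \<delta>0 ((\<epsilon> * p / (32 * c)) powr (1 / p) / 2)"
  have \<delta>: "\<delta> > 0" "\<delta> \<le> \<delta>0" "(16 * c / p) * (2 * \<delta>) powr p \<le> \<epsilon> / 2"
  proof -
    show "\<delta> > 0" "\<delta> \<le> \<delta>0" using kl0 \<epsilon> p by (auto simp: \<delta>_def)
    have "(2 * \<delta>) powr p \<le> ((\<epsilon> * p / (32 * c)) powr (1 / p)) powr p"
      using \<open>\<delta> > 0\<close> p by (intro powr_mono2) (auto simp: \<delta>_def)
    also have "\<dots> = \<epsilon> * p / (32 * c)" using \<epsilon> p kl0 by (simp add: powr_powr)
    finally show "(16 * c / p) * (2 * \<delta>) powr p \<le> \<epsilon> / 2" using p kl0 by (simp add: field_simps)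
  qed
  \<comment> \<open>Collects the terms proportional to \<alpha>: the first step and the summed
    errors.\<close>
  define T where "T = 2 * M + Q * W / (2 * c)"
  have T: "T > 0" using M Q W kl0 by (simp add: T_def add_pos_pos)
  define \<alpha>1 where "\<alpha>1 = min (min 1 abar) (min (\<delta> / (M * C)) (\<epsilon> / (2 * T)))"
  have \<alpha>1: "\<alpha>1 > 0" "\<alpha>1 \<le> 1" "\<alpha>1 \<le> abar" "\<alpha>1 \<le> \<delta> / (M * C)" "\<alpha>1 \<le> \<epsilon> / (2 * T)"
    using abar \<delta> M C \<epsilon> T by (auto simp: \<alpha>1_def)
  show thesis
  proof (rule that[OF \<delta>(1) \<alpha>1(1)])
    fix \<alpha> K x n
    assume \<alpha>: "0 < \<alpha>" "\<alpha> \<le> \<alpha>1" and run: "run \<alpha> K x"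
      and H: "\<forall>k\<le>n. norm (x k) \<le> R \<and> \<bar>\<phi> (x k) - v\<bar> < \<delta>"
    note stay = H[rule_format]
    have \<alpha>': "\<alpha> \<le> 1" "\<alpha> \<le> abar" "M * (C * \<alpha>) \<le> \<delta>" "T * \<alpha> \<le> \<epsilon> / 2"
    proof -
      show "\<alpha> \<le> 1" "\<alpha> \<le> abar" using \<alpha> \<alpha>1 by linarith+
      have "\<alpha> \<le> \<delta> / (M * C)" "\<alpha> \<le> \<epsilon> / (2 * T)" using \<alpha> \<alpha>1 by linarith+
      then show "M * (C * \<alpha>) \<le> \<delta>" "T * \<alpha> \<le> \<epsilon> / 2" using M C T by (auto simp: field_simps)
    qed
    define a where "a k = stepsize \<alpha> K k" for k
    define d where "d k = norm (x (Suc k) - x k)" for k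
    define E where "E k = \<phi> (x k) - v + M * excess \<alpha> K k" for k
    define \<Psi> where "\<Psi> s = sgn s * \<bar>s\<bar> powr p" for s :: real
    define \<eta> where "\<eta> k = Q * (\<kappa> * (a k)\<^sup>2 + a k * excess \<alpha> K k powr \<theta>)" for k
    have a: "a k > 0" "a (Suc k) \<le> a k" "a k \<le> \<alpha>" for k
      using stepsize_pos stepsize_mono stepsize_le \<alpha>(1) by (auto simp: a_def)
    have \<eta>0: "\<eta> k \<ge> 0" for k using a(1)[of k] Q(1) \<kappa>(1) by (simp add: \<eta>_def)
    have \<theta>0: "\<theta> > 0" using kl0 \<theta> by simp
    have E_dec: "(d k)\<^sup>2 / (2 * a k) \<le> E k - E (Suc k)" if "k < n" for k
    proof -
      have "\<phi> (x (Suc k)) \<le> \<phi> (x k) - (d k)\<^sup>2 / (2 * a k) + M * (\<kappa> * a k ^ 3)"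
        using S2[OF \<alpha>(1) \<alpha>'(2) run, of k] stay[of k] that by (simp add: a_def d_def algebra_simps)
      moreover have "M * (\<kappa> * a k ^ 3) \<le> M * (excess \<alpha> K k - excess \<alpha> K (Suc k))"
        using excess_decrease[OF \<alpha>(1)] M by (simp add: a_def)
      ultimately show ?thesis unfolding E_def by (simp only: right_diff_distrib)
    qed
    have E_kl: "a k * \<bar>E (Suc k)\<bar> powr \<theta> \<le> 2 * c * d k + \<eta> k" if kn: "k < n" for k
    proof -
      obtain w where w: "w \<in> SD (x (Suc k))" "a k * norm w \<le> 2 * d k + \<kappa> * M * (a k)\<^sup>2"
        using S3[OF \<alpha>(1) \<alpha>'(2) run, of k] stay[of k] kn by (auto simp: a_def d_def)
      have ex: "0 \<le> M * excess \<alpha> K (Suc k)" "M * excess \<alpha> K (Suc k) \<le> M * excess \<alpha> K k"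
        using excess_nonneg[OF \<alpha>(1)] excess_mono[OF \<alpha>(1)] M by auto
      have "\<bar>E (Suc k)\<bar> \<le> \<bar>\<phi> (x (Suc k)) - v\<bar> + M * excess \<alpha> K k" using ex unfolding E_def by linarith
      then have "\<bar>E (Suc k)\<bar> powr \<theta> \<le> (\<bar>\<phi> (x (Suc k)) - v\<bar> + M * excess \<alpha> K k) powr \<theta>"
        using \<theta>0 by (intro powr_mono2) auto
      also have "\<dots> \<le> \<bar>\<phi> (x (Suc k)) - v\<bar> powr \<theta> + (M * excess \<alpha> K k) powr \<theta>"
        using ex \<theta>0 \<theta> by (intro powr_add_le) auto
      also have "\<bar>\<phi> (x (Suc k)) - v\<bar> powr \<theta> \<le> c * norm w"
        using stay[of "Suc k"] that \<delta>(2) w(1) by (intro kl \<theta>) auto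
      also have "(M * excess \<alpha> K k) powr \<theta> = M powr \<theta> * excess \<alpha> K k powr \<theta>"
        using M excess_nonneg[OF \<alpha>(1)] by (simp add: powr_mult)
      finally have "a k * \<bar>E (Suc k)\<bar> powr \<theta> \<le> a k * (c * norm w + M powr \<theta> * excess \<alpha> K k powr \<theta>)"
        using a(1)[of k] by (intro mult_left_mono) auto
      also have "\<dots> = c * (a k * norm w) + M powr \<theta> * (a k * excess \<alpha> K k powr \<theta>)" by (simp add: algebra_simps)
      also have "\<dots> \<le> c * (2 * d k + \<kappa> * M * (a k)\<^sup>2) + M powr \<theta> * (a k * excess \<alpha> K k powr \<theta>)"
        using w(2) kl0(2) by simp
      also have "\<dots> = 2 * c * d k + ((c * M) * (\<kappa> * (a k)\<^sup>2) + M powr \<theta> * (a k * excess \<alpha> K k powr \<theta>))"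
        by (simp add: algebra_simps)
      also have "\<dots> \<le> 2 * c * d k + (Q * (\<kappa> * (a k)\<^sup>2) + Q * (a k * excess \<alpha> K k powr \<theta>))"
        using Q(2,3) a(1)[of k] \<kappa>(1) by (intro add_left_mono add_mono mult_right_mono) auto
      finally show ?thesis by (simp add: \<eta>_def distrib_left)
    qed
    have E_mono: "E (Suc k) \<le> E k" if "k < n" for k
    proof -
      have "0 \<le> (d k)\<^sup>2 / (2 * a k)" using a(1)[of k] by simp
      then show ?thesis using E_dec[OF that] by linarith
    qed
    have step: "d (Suc k) \<le> d k / 4 + d (Suc k) / 4 + (\<eta> k + \<eta> (Suc k)) / (8 * c) + (4 * c / p) * (\<Psi> (E (Suc k)) - \<Psi> (E (Suc (Suc k))))"
      if k: "Suc k < n" for k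
    proof -
      define Y where "Y = (\<Psi> (E (Suc k)) - \<Psi> (E (Suc (Suc k)))) / p"
      define X where "X = 2 * c * d k + \<eta> k + (2 * c * d (Suc k) + \<eta> (Suc k))"
      have inc: "E (Suc k) - E (Suc (Suc k)) \<le> (\<bar>E (Suc k)\<bar> powr \<theta> + \<bar>E (Suc (Suc k))\<bar> powr \<theta>) * Y"
        using signed_power_increment[OF p(1,2) E_mono[OF k]] unfolding Y_def \<Psi>_def p(3) .
      have X: "a (Suc k) * (\<bar>E (Suc k)\<bar> powr \<theta> + \<bar>E (Suc (Suc k))\<bar> powr \<theta>) \<le> X"
      proof -
        \<comment> \<open>The subgradient at an iterate is controlled by the step leading to it, so
          \<open>E (Suc k)\<close> comes with \<open>a k\<close>; the step sizes do not
          increase.\<close>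
        have "a (Suc k) * \<bar>E (Suc k)\<bar> powr \<theta> \<le> a k * \<bar>E (Suc k)\<bar> powr \<theta>" using a(2) by (intro mult_right_mono) auto
        then show ?thesis using E_kl[of k] E_kl[of "Suc k"] k unfolding X_def distrib_left by linarith
      qed
      have Y0: "Y \<ge> 0"
      proof (rule ccontr)
        assume "\<not> Y \<ge> 0"
        then have "Y < 0" by simp
        have mono: "\<Psi> s \<le> \<Psi> t" if "s \<le> t" for s t
        proof -
          consider "0 \<le> s" | "t \<le> 0" | "s < 0" "0 < t" by linarith
          then show ?thesis
          proof cases
            case 1 then show ?thesis using that p by (cases "s = 0") (auto simp: \<Psi>_def sgn_if intro: powr_mono2)
          next
            case 2 then show ?thesis using that p by (cases "t = 0") (auto simp: \<Psi>_def sgn_if intro: powr_mono2)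
          next
            case 3 then show ?thesis by (auto simp: \<Psi>_def intro: order_trans[of _ 0])
          qed
        qed
        then show False using mono[OF E_mono[OF k]] p \<open>Y < 0\<close> unfolding Y_def by (simp add: divide_less_0_iff)
      qed
      have X0: "X \<ge> 0" using \<eta>0 kl0(2) unfolding X_def by (intro add_nonneg_nonneg mult_nonneg_nonneg) (auto simp: d_def)
      have "(d (Suc k))\<^sup>2 \<le> 2 * a (Suc k) * (E (Suc k) - E (Suc (Suc k)))"
        using E_dec[OF k] a(1)[of "Suc k"] by (simp add: pos_divide_le_eq mult.commute)
      also have "\<dots> \<le> 2 * a (Suc k) * ((\<bar>E (Suc k)\<bar> powr \<theta> + \<bar>E (Suc (Suc k))\<bar> powr \<theta>) * Y)"
        using inc a(1)[of "Suc k"] by (intro mult_left_mono) auto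
      also have "\<dots> = 2 * (a (Suc k) * (\<bar>E (Suc k)\<bar> powr \<theta> + \<bar>E (Suc (Suc k))\<bar> powr \<theta>)) * Y" by simp
      also have "\<dots> \<le> 2 * X * Y" using X Y0 by (intro mult_right_mono) auto
      \<comment> \<open>The weight \<open>1 / (8 * c)\<close> gives \<open>d k\<close> and
        \<open>d (Suc k)\<close> the factor 1/4 each, so that after summation half of the total
        length is absorbed on the left.\<close>
      also have "\<dots> \<le> (X / (8 * c) + 4 * c * Y)\<^sup>2"
      proof -
        have "0 \<le> (X / (8 * c) - 4 * c * Y)\<^sup>2" by simp
        moreover have "(X / (8 * c) + 4 * c * Y)\<^sup>2 - (X / (8 * c) - 4 * c * Y)\<^sup>2 = 2 * X * Y"
          using kl0(2) by (simp add: power2_eq_square algebra_simps)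
        ultimately show ?thesis by linarith
      qed
      finally have "d (Suc k) \<le> X / (8 * c) + 4 * c * Y"
        by (rule power2_le_imp_le) (use X0 Y0 kl0(2) in auto)
      also have "X / (8 * c) = d k / 4 + d (Suc k) / 4 + (\<eta> k + \<eta> (Suc k)) / (8 * c)"
        using kl0(2) by (simp add: X_def field_simps)
      also have "4 * c * Y = (4 * c / p) * (\<Psi> (E (Suc k)) - \<Psi> (E (Suc (Suc k))))" by (simp add: Y_def)
      finally show ?thesis .
    qed
    have \<Psi>_le: "\<bar>\<Psi> (E k)\<bar> \<le> (2 * \<delta>) powr p" if "k \<le> n" for k
    proof -
      have "M * excess \<alpha> K k \<le> M * (C * \<alpha>)" using C(2)[OF \<alpha>(1) \<alpha>'(1)] M by (intro mult_left_mono) auto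
      moreover have "0 \<le> M * excess \<alpha> K k" using excess_nonneg[OF \<alpha>(1)] M by simp
      ultimately have "\<bar>E k\<bar> \<le> 2 * \<delta>" using stay[OF that] \<alpha>'(3) unfolding E_def by linarith
      moreover have "\<bar>\<Psi> (E k)\<bar> \<le> \<bar>E k\<bar> powr p" by (simp add: \<Psi>_def abs_mult sgn_if)
      ultimately show ?thesis using powr_mono2[of p "\<bar>E k\<bar>" "2 * \<delta>"] p by auto
    qed
    have \<eta>sum: "(\<Sum>k<m. \<eta> k) \<le> Q * (W * \<alpha>)" for m
      unfolding \<eta>_def sum_distrib_left[symmetric] using W(2)[OF \<alpha>(1) \<alpha>'(1), of K m] Q(1) by (simp add: a_def)
    show "(\<Sum>k<n. norm (x (Suc k) - x k)) \<le> \<epsilon>"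
    proof (cases n)
      case 0
      then show ?thesis using \<epsilon> by simp
    next
      case (Suc m)
      define S where "S = (\<Sum>k<n. d k)"
      have d0: "d 0 \<le> M * \<alpha>"
      proof -
        have "d 0 \<le> M * a 0" using S1[OF \<alpha>(1) \<alpha>'(2) run, of 0] stay[of 0] by (simp add: a_def d_def)
        also have "\<dots> \<le> M * \<alpha>" using a(3) M by simp
        finally show ?thesis .
      qed
      have Sm: "S = d 0 + (\<Sum>k<m. d (Suc k))" unfolding S_def Suc by (rule sum.lessThan_Suc_shift)
      have "(\<Sum>k<m. d (Suc k)) \<le> (\<Sum>k<m. d k / 4 + d (Suc k) / 4 + (\<eta> k + \<eta> (Suc k)) / (8 * c) +
          (4 * c / p) * (\<Psi> (E (Suc k)) - \<Psi> (E (Suc (Suc k)))))"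
        by (intro sum_mono step) (use Suc in auto)
      also have "\<dots> = (\<Sum>k<m. d k) / 4 + (\<Sum>k<m. d (Suc k)) / 4 + ((\<Sum>k<m. \<eta> k) + (\<Sum>k<m. \<eta> (Suc k))) / (8 * c) +
          (4 * c / p) * (\<Sum>k<m. \<Psi> (E (Suc k)) - \<Psi> (E (Suc (Suc k))))"
        by (simp add: sum.distrib sum_divide_distrib[symmetric] sum_distrib_left[symmetric])
      also have "(\<Sum>k<m. \<Psi> (E (Suc k)) - \<Psi> (E (Suc (Suc k)))) = \<Psi> (E (Suc 0)) - \<Psi> (E (Suc m))"
        by (rule sum_lessThan_telescope')
      also have "(4 * c / p) * (\<Psi> (E (Suc 0)) - \<Psi> (E (Suc m))) \<le> (4 * c / p) * (2 * (2 * \<delta>) powr p)"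
        using \<Psi>_le[of "Suc 0"] \<Psi>_le[of "Suc m"] Suc kl0(2) p by (intro mult_left_mono) (auto simp: abs_le_iff)
      also have "(\<Sum>k<m. d k) / 4 \<le> S / 4"
        unfolding S_def Suc by (simp add: d_def)
      also have "(\<Sum>k<m. d (Suc k)) / 4 \<le> S / 4" unfolding Sm by (simp add: d_def)
      also have "((\<Sum>k<m. \<eta> k) + (\<Sum>k<m. \<eta> (Suc k))) / (8 * c) \<le> (Q * (W * \<alpha>) + Q * (W * \<alpha>)) / (8 * c)"
      proof (intro divide_right_mono add_mono \<eta>sum)
        have "(\<Sum>k<m. \<eta> (Suc k)) \<le> (\<Sum>k<Suc m. \<eta> k)" unfolding sum.lessThan_Suc_shift using \<eta>0[of 0] by simp
        also have "\<dots> \<le> Q * (W * \<alpha>)" by (rule \<eta>sum)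
        finally show "(\<Sum>k<m. \<eta> (Suc k)) \<le> Q * (W * \<alpha>)" .
      qed (use kl0(2) in simp)
      finally have "(\<Sum>k<m. d (Suc k)) \<le> S / 4 + S / 4 + (Q * (W * \<alpha>) + Q * (W * \<alpha>)) / (8 * c) + (4 * c / p) * (2 * (2 * \<delta>) powr p)"
        by simp
      then have "S \<le> 2 * (M * \<alpha>) + (Q * (W * \<alpha>) + Q * (W * \<alpha>)) / (8 * c) * 2 + (4 * c / p) * (2 * (2 * \<delta>) powr p) * 2"
        using d0 Sm by linarith
      also have "\<dots> = T * \<alpha> + (16 * c / p) * (2 * \<delta>) powr p" using kl0(2) by (simp add: T_def field_simps)
      also have "\<dots> \<le> \<epsilon> / 2 + \<epsilon> / 2" using \<alpha>'(4) \<delta>(3) by (rule add_mono)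
      finally show ?thesis by (simp add: S_def d_def)
    qed
  qed
qed

end

subsection \<open>Interpolated descent sequences\<close>

text \<open>Joint convexity of \<open>U\<^sup>2 / S\<close>. It merges the quadratic decreases of
  consecutive steps into that of the whole displacement.\<close>

lemma square_divide_add_le:
  fixes U V S a :: real
  assumes "0 < S" "0 < a"
  shows "(U + V)\<^sup>2 / (S + a) \<le> U\<^sup>2 / S + V\<^sup>2 / a"
proof -
  have "U\<^sup>2 / S + V\<^sup>2 / a - (U + V)\<^sup>2 / (S + a) = (U * a - V * S)\<^sup>2 / (S * a * (S + a))"
    using assms by (simp add: divide_simps add_pos_pos[THEN less_imp_neq, symmetric])
      (simp add: power2_eq_square algebra_simps)
  moreover have "0 \<le> (U * a - V * S)\<^sup>2 / (S * a * (S + a))" using assms by simp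
  ultimately show ?thesis by linarith
qed

text \<open>Zorn's lemma on the proper filters below \<open>F\<close>. Along such a filter all
  bounded families converge at once, which yields a limit curve at uncountably many times without
  extracting subsequences.\<close>

lemma ultrafilter_below:
  fixes F :: "'b filter"
  assumes "F \<noteq> bot"
  obtains U where "U \<le> F" "U \<noteq> bot" "\<And>P. eventually P U \<or> eventually (\<lambda>x. \<not> P x) U"
proof -
  let ?A = "{G. G \<le> F \<and> G \<noteq> bot}"
  have "\<exists>m\<in>?A. \<forall>a\<in>?A. m \<ge> a \<longrightarrow> a = m"
  proof (rule predicate_Zorn[of ?A "(\<ge>)"])
    show "partial_order_on ?A (relation_of (\<ge>) ?A)"
      by (rule partial_order_on_relation_ofI) auto
    fix C assume C: "C \<in> Chains (relation_of (\<ge>) ?A)"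
    then have CA: "C \<subseteq> ?A" by (rule Chains_relation_of)
    show "\<exists>u\<in>?A. \<forall>a\<in>C. a \<ge> u"
    proof (cases "C = {}")
      case False
      have lin: "x \<le> y \<or> y \<le> x" if "x \<in> C" "y \<in> C" for x y
        using C that unfolding Chains_def relation_of_def by blast
      \<comment> \<open>A chain is directed, so its infimum is improper only if one of its members
        is.\<close>
      have "Inf C = bot \<longleftrightarrow> (\<exists>x\<in>C. x = bot)"
      proof -
        have "eventually (\<lambda>_. False) (Inf C) \<longleftrightarrow> (\<exists>x\<in>C. eventually (\<lambda>_. False) x)"
        proof (rule eventually_Inf_base[OF False])
          fix X Y assume XY: "X \<in> C" "Y \<in> C"
          then show "\<exists>x\<in>C. x \<le> inf X Y" using lin[OF XY] by (auto intro: bexI[of _ X] bexI[of _ Y])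
        qed
        then show ?thesis by (simp add: trivial_limit_def)
      qed
      then have "Inf C \<noteq> bot" using CA by blast
      moreover have "Inf C \<le> F" proof -
        obtain X where "X \<in> C" using False by blast
        then show ?thesis using CA by (intro order_trans[OF Inf_lower[of X C]]) auto
      qed
      ultimately have "Inf C \<in> ?A" by blast
      moreover have "\<forall>a\<in>C. a \<ge> Inf C" by (simp add: Inf_lower)
      ultimately show ?thesis by blast
    qed (use assms in auto)
  qed
  then obtain U where U: "U \<le> F" "U \<noteq> bot" and min: "\<And>G. G \<le> F \<Longrightarrow> G \<noteq> bot \<Longrightarrow> G \<le> U \<Longrightarrow> G = U" by auto
  have "eventually P U \<or> eventually (\<lambda>x. \<not> P x) U" for P
  proof (cases "inf U (principal {x. P x}) = bot")
    case True
    then have "eventually (\<lambda>x. \<not> P x) U" by (simp add: trivial_limit_def eventually_inf_principal)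
    then show ?thesis ..
  next
    case False
    have "inf U (principal {x. P x}) = U" by (rule min) (use U(1) False in \<open>auto intro: le_infI1\<close>)
    then have "U \<le> principal {x. P x}" by (metis inf.cobounded2)
    then show ?thesis by (simp add: le_principal)
  qed
  then show thesis using that U by blast
qed

lemma ultrafilter_limit:
  fixes u :: "'b \<Rightarrow> 'c::euclidean_space"
  assumes U: "U \<noteq> bot" "\<And>P. eventually P U \<or> eventually (\<lambda>x. \<not> P x) U"
    and B: "\<forall>\<^sub>F j in U. norm (u j) \<le> B"
  obtains l where "(u \<longlongrightarrow> l) U" "norm l \<le> B"
proof -
  have "filtermap u U \<noteq> bot" using U(1) by (simp add: filtermap_bot_iff)
  moreover have "eventually (\<lambda>x. x \<in> cball 0 B) (filtermap u U)" using B by (simp add: eventually_filtermap)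
  ultimately have "\<exists>l\<in>cball 0 B. inf (nhds l) (filtermap u U) \<noteq> bot"
    using compact_cball[of "0::'c" B, unfolded compact_filter, rule_format, of "filtermap u U"] by blast
  then obtain l where l: "l \<in> cball 0 B" "inf (nhds l) (filtermap u U) \<noteq> bot" by blast
  have "(u \<longlongrightarrow> l) U"
  proof (rule topological_tendstoI)
    fix S assume S: "open S" "l \<in> S"
    show "\<forall>\<^sub>F j in U. u j \<in> S"
    proof (rule ccontr)
      assume "\<not> (\<forall>\<^sub>F j in U. u j \<in> S)"
      then have "\<forall>\<^sub>F j in U. u j \<notin> S" using U(2) by blast
      then have "eventually (\<lambda>z. z \<notin> S) (filtermap u U)" by (simp add: eventually_filtermap)
      moreover have "eventually (\<lambda>z. z \<in> S) (nhds l)" using S by (rule eventually_nhds_in_open)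
      ultimately have "eventually (\<lambda>_. False) (inf (nhds l) (filtermap u U))"
        unfolding eventually_inf by blast
      then show False using l(2) by (simp add: trivial_limit_def)
    qed
  qed
  then show thesis using that l(1) by simp
qed

context descent_model begin

definition "time \<alpha> K k = (\<Sum>i<k. stepsize \<alpha> K i)"

text \<open>Since \<beta> < 1 the step sizes are not summable, so the interpolations are defined for
  all times.\<close>

lemma time_unbounded:
  assumes "\<alpha> > 0" shows "\<exists>n. B < time \<alpha> K n"
proof (rule ccontr)
  assume "\<nexists>n. B < time \<alpha> K n"
  then have "(\<Sum>i<n. stepsize \<alpha> K i) \<le> B" for n by (simp add: time_def not_less)
  then have "summable (stepsize \<alpha> K)"
    using stepsize_pos[OF assms] by (intro summableI_nonneg_bounded[of _ B]) (auto intro: less_imp_le)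
  moreover have "stepsize \<alpha> K = (\<lambda>k. \<alpha> * real (k + (K + 1)) powr (- \<beta>))"
    by (rule ext) (simp add: stepsize_def powr_minus divide_inverse add_ac)
  ultimately have "summable (\<lambda>k. real (k + (K + 1)) powr (- \<beta>))" using assms by (simp only: summable_cmult_iff) auto
  then have "summable (\<lambda>k. real k powr (- \<beta>))" by (simp only: summable_iff_shift[of "\<lambda>k. real k powr (- \<beta>)"])
  then show False using \<beta> by (simp add: summable_real_powr_iff)
qed

lemma time_Suc: "time \<alpha> K (Suc k) = time \<alpha> K k + stepsize \<alpha> K k"
  by (simp add: time_def)

lemma time_mono: assumes "\<alpha> > 0" "m \<le> n" shows "time \<alpha> K m \<le> time \<alpha> K n"
  unfolding time_def using assms(2) stepsize_pos[OF assms(1)]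
  by (intro sum_mono2) (auto intro: less_imp_le)

lemma time_less: assumes "\<alpha> > 0" "m < n" shows "time \<alpha> K m < time \<alpha> K n"
  using time_mono[OF assms(1), of "Suc m" n K] stepsize_pos[OF assms(1), of K m] assms(2) unfolding time_Suc by simp

text \<open>The step estimates summed from \<open>m\<close> to \<open>n\<close>. In the energy bound
  the decreases are merged by \<open>square_divide_add_le\<close>; in the variational inequality the
  iterates in between are replaced by \<open>x m\<close>, at a cost of elapsed time multiplied by
  elapsed time plus \<alpha>.\<close>

lemma run_bounds:
  obtains M abar where "M > 0" "abar > 0"
    "\<And>\<alpha> K x m n. 0 < \<alpha> \<Longrightarrow> \<alpha> \<le> abar \<Longrightarrow> run \<alpha> K x \<Longrightarrow> m \<le> n \<Longrightarrow> \<forall>k\<in>{m..<n}. norm (x k) \<le> R \<Longrightarrow>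
      (\<Sum>k=m..<n. norm (x (Suc k) - x k)) \<le> M * (time \<alpha> K n - time \<alpha> K m)"
    "\<And>\<alpha> K x m n. 0 < \<alpha> \<Longrightarrow> \<alpha> \<le> abar \<Longrightarrow> run \<alpha> K x \<Longrightarrow> m \<le> n \<Longrightarrow> \<forall>k\<in>{m..<n}. norm (x k) \<le> R \<Longrightarrow>
      norm (x n - x m) \<le> M * (time \<alpha> K n - time \<alpha> K m)"
    "\<And>\<alpha> K x m n. 0 < \<alpha> \<Longrightarrow> \<alpha> \<le> abar \<Longrightarrow> run \<alpha> K x \<Longrightarrow> m \<le> n \<Longrightarrow> \<forall>k\<in>{m..<n}. norm (x k) \<le> R \<Longrightarrow>
      \<phi> (x n) \<le> \<phi> (x m) - (norm (x n - x m))\<^sup>2 / (2 * (time \<alpha> K n - time \<alpha> K m)) + M * \<alpha>\<^sup>2 * (time \<alpha> K n - time \<alpha> K m)"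
    "\<And>\<alpha> K x m n z. 0 < \<alpha> \<Longrightarrow> \<alpha> \<le> abar \<Longrightarrow> run \<alpha> K x \<Longrightarrow> m \<le> n \<Longrightarrow> \<forall>k\<in>{m..<n}. norm (x k) \<le> R \<Longrightarrow>
      z \<in> D \<Longrightarrow> norm z \<le> R \<Longrightarrow> (norm (x n - z))\<^sup>2 / 2 - (norm (x m - z))\<^sup>2 / 2 \<le>
        (time \<alpha> K n - time \<alpha> K m) * (\<phi> z - \<phi> (x m) + M * (norm (x m - z))\<^sup>2) +
        M * (time \<alpha> K n - time \<alpha> K m) * (time \<alpha> K n - time \<alpha> K m + \<alpha>)"
proof -
  obtain M abar where M: "M > 0" and abar: "abar > 0"
    and S1: "\<And>\<alpha> K x k. 0 < \<alpha> \<Longrightarrow> \<alpha> \<le> abar \<Longrightarrow> run \<alpha> K x \<Longrightarrow> norm (x k) \<le> R \<Longrightarrow> norm (x (Suc k) - x k) \<le> M * stepsize \<alpha> K k"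
    and S2: "\<And>\<alpha> K x k. 0 < \<alpha> \<Longrightarrow> \<alpha> \<le> abar \<Longrightarrow> run \<alpha> K x \<Longrightarrow> norm (x k) \<le> R \<Longrightarrow>
      \<phi> (x (Suc k)) \<le> \<phi> (x k) - (norm (x (Suc k) - x k))\<^sup>2 / (2 * stepsize \<alpha> K k) + \<kappa> * M * stepsize \<alpha> K k ^ 3"
    and S4: "\<And>\<alpha> K x k z. 0 < \<alpha> \<Longrightarrow> \<alpha> \<le> abar \<Longrightarrow> run \<alpha> K x \<Longrightarrow> norm (x k) \<le> R \<Longrightarrow> z \<in> D \<Longrightarrow> norm z \<le> R \<Longrightarrow>
      (norm (x (Suc k) - z))\<^sup>2 / 2 - (norm (x k - z))\<^sup>2 / 2 \<le>
        stepsize \<alpha> K k * (\<phi> z - \<phi> (x k) + M * (norm (x k - z))\<^sup>2 + M * stepsize \<alpha> K k)"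
    by (rule step_constants[of R]) (rule that)
  obtain L where L: "L > 0" "\<And>x y. x \<in> D \<Longrightarrow> y \<in> D \<Longrightarrow> norm x \<le> R \<Longrightarrow> norm y \<le> R \<Longrightarrow> \<bar>\<phi> x - \<phi> y\<bar> \<le> L * norm (x - y)"
    using \<phi>_lipschitz[of R] by blast
  \<comment> \<open>The drift of \<phi> and of the squared distance to \<open>z\<close> while moving
    away from \<open>x m\<close>, plus the error of a single step.\<close>
  define C where "C = L * M + M * (M * (4 * \<bar>R\<bar>)) + M"
  have C: "C > 0" "M \<le> C" using L M by (auto simp: C_def add_nonneg_pos)
  show thesis
  proof (rule that[OF C(1) abar])
    fix \<alpha> :: real and K :: nat and x :: "nat \<Rightarrow> 'a" and m n :: nat
    assume \<alpha>: "0 < \<alpha>" "\<alpha> \<le> abar" and run: "run \<alpha> K x" and mn: "m \<le> n"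
      and bounded: "\<forall>k\<in>{m..<n}. norm (x k) \<le> R"
    have R: "norm (x k) \<le> R" if "m \<le> k" "k < n" for k using bounded that by simp
    define \<sigma> where "\<sigma> k = time \<alpha> K k - time \<alpha> K m" for k
    have \<sigma>: "0 \<le> \<sigma> k" "m < k \<Longrightarrow> 0 < \<sigma> k" if "m \<le> k" for k
      using time_mono[OF \<alpha>(1) that, of K] time_less[OF \<alpha>(1), of m k K] by (auto simp: \<sigma>_def)
    have \<sigma>m: "\<sigma> m = 0" and \<sigma>S: "\<sigma> (Suc k) = \<sigma> k + stepsize \<alpha> K k" for k by (auto simp: \<sigma>_def time_Suc)
    note a = stepsize_pos[OF \<alpha>(1), of K] stepsize_le[OF \<alpha>(1), of K]
    have len: "(\<Sum>i=m..<k. norm (x (Suc i) - x i)) \<le> M * \<sigma> k" if "m \<le> k" "k \<le> n" for k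
      using that
    proof (induction k rule: dec_induct)
      case (step k)
      then show ?case using S1[OF \<alpha> run R[of k]] by (simp add: \<sigma>S distrib_left)
    qed (simp add: \<sigma>m)
    have dist: "norm (x k - x m) \<le> M * \<sigma> k" if "m \<le> k" "k \<le> n" for k
    proof -
      have "x k - x m = (\<Sum>i=m..<k. x (Suc i) - x i)" using that(1) by (simp add: sum_Suc_diff')
      then have "norm (x k - x m) \<le> (\<Sum>i=m..<k. norm (x (Suc i) - x i))" by (simp add: norm_sum)
      then show ?thesis using len[OF that] by linarith
    qed
    have en: "\<phi> (x k) \<le> \<phi> (x m) - (norm (x k - x m))\<^sup>2 / (2 * \<sigma> k) + M * \<alpha>\<^sup>2 * \<sigma> k" if "m \<le> k" "k \<le> n" for k
      using that
    proof (induction k rule: dec_induct)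
      case (step k)
      define A where "A = stepsize \<alpha> K k"
      have A: "0 < A" "A \<le> \<alpha>" using a by (auto simp: A_def)
      have "A ^ 3 \<le> \<alpha>\<^sup>2 * A" using A by (simp add: power3_eq_cube power2_eq_square mult_mono)
      then have "M * A ^ 3 \<le> M * (\<alpha>\<^sup>2 * A)" using M by simp
      moreover have "\<kappa> * (M * A ^ 3) \<le> 1 * (M * A ^ 3)" using \<kappa> M A by (intro mult_right_mono) auto
      ultimately have 1: "\<kappa> * M * A ^ 3 \<le> M * \<alpha>\<^sup>2 * A" by (simp add: mult.assoc)
      have 2: "\<phi> (x (Suc k)) \<le> \<phi> (x k) - (norm (x (Suc k) - x k))\<^sup>2 / (2 * A) + \<kappa> * M * A ^ 3"
        unfolding A_def by (rule S2[OF \<alpha> run R]) (use step in auto)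
      have 3: "(norm (x (Suc k) - x m))\<^sup>2 / (2 * (\<sigma> k + A)) \<le> (norm (x k - x m))\<^sup>2 / (2 * \<sigma> k) + (norm (x (Suc k) - x k))\<^sup>2 / (2 * A)"
      proof (cases "k = m")
        case True
        then show ?thesis by (simp add: \<sigma>m)
      next
        case False
        then have s: "0 < \<sigma> k" using \<sigma>(2)[of k] step by simp
        have "norm (x (Suc k) - x m) \<le> norm (x k - x m) + norm (x (Suc k) - x k)"
          using norm_triangle_ineq[of "x k - x m" "x (Suc k) - x k"] by simp
        then have "(norm (x (Suc k) - x m))\<^sup>2 / (\<sigma> k + A) \<le> (norm (x k - x m) + norm (x (Suc k) - x k))\<^sup>2 / (\<sigma> k + A)"
          using s A by (intro divide_right_mono power_mono) auto
        also have "\<dots> \<le> (norm (x k - x m))\<^sup>2 / \<sigma> k + (norm (x (Suc k) - x k))\<^sup>2 / A"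
          by (rule square_divide_add_le[OF s A(1)])
        finally have le: "(norm (x (Suc k) - x m))\<^sup>2 / (\<sigma> k + A) \<le> (norm (x k - x m))\<^sup>2 / \<sigma> k + (norm (x (Suc k) - x k))\<^sup>2 / A" .
        have half: "u / (2 * w) = u / w / 2" for u w :: real by simp
        show ?thesis unfolding half add_divide_distrib[symmetric] using le by (rule divide_right_mono) simp
      qed
      have "\<phi> (x k) \<le> \<phi> (x m) - (norm (x k - x m))\<^sup>2 / (2 * \<sigma> k) + M * \<alpha>\<^sup>2 * \<sigma> k" using step by simp
      then show ?case using 1 2 3 unfolding \<sigma>S A_def[symmetric] distrib_left[of "M * \<alpha>\<^sup>2"] by linarith
    qed (simp add: \<sigma>m)
    show "(\<Sum>k=m..<n. norm (x (Suc k) - x k)) \<le> C * (time \<alpha> K n - time \<alpha> K m)"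
      using len[OF mn order_refl] mult_right_mono[OF C(2) \<sigma>(1)[OF mn]] by (simp add: \<sigma>_def)
    show "norm (x n - x m) \<le> C * (time \<alpha> K n - time \<alpha> K m)"
      using dist[OF mn order_refl] mult_right_mono[OF C(2) \<sigma>(1)[OF mn]] by (simp add: \<sigma>_def)
    have "M * (\<alpha>\<^sup>2 * \<sigma> n) \<le> C * (\<alpha>\<^sup>2 * \<sigma> n)" using C(2) \<sigma>(1)[OF mn] by (intro mult_right_mono) auto
    then show "\<phi> (x n) \<le> \<phi> (x m) - (norm (x n - x m))\<^sup>2 / (2 * (time \<alpha> K n - time \<alpha> K m)) + C * \<alpha>\<^sup>2 * (time \<alpha> K n - time \<alpha> K m)"
      using en[OF mn order_refl] unfolding \<sigma>_def mult.assoc by linarith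
    fix z assume z: "z \<in> D" "norm z \<le> R"
    define A where "A = \<phi> z - \<phi> (x m) + M * (norm (x m - z))\<^sup>2"
    have ev: "(norm (x k - z))\<^sup>2 / 2 - (norm (x m - z))\<^sup>2 / 2 \<le> \<sigma> k * A + C * \<sigma> k * (\<sigma> k + \<alpha>)" if "m \<le> k" "k \<le> n" for k
      using that
    proof (induction k rule: dec_induct)
      case (step k)
      define s where "s = stepsize \<alpha> K k"
      have s: "0 < s" "s \<le> \<alpha>" using a by (auto simp: s_def)
      have k: "m \<le> k" "k < n" using step by auto
      have Rk: "norm (x k) \<le> R" "norm (x m) \<le> R" using R[OF k] R[of m] k by auto
      have \<sigma>k: "0 \<le> \<sigma> k" "norm (x k - x m) \<le> M * \<sigma> k" using \<sigma>(1)[OF k(1)] dist[of k] k by auto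
      have "\<phi> (x m) - \<phi> (x k) \<le> L * norm (x k - x m)"
        using L(2)[OF run_D[OF \<alpha>(1) run] run_D[OF \<alpha>(1) run] Rk] by linarith
      also have "\<dots> \<le> L * (M * \<sigma> k)" using \<sigma>k L by simp
      finally have 1: "\<phi> (x m) - \<phi> (x k) \<le> L * M * \<sigma> k" by (simp add: mult.assoc)
      have "(norm (x k - z))\<^sup>2 - (norm (x m - z))\<^sup>2 = (norm (x k - z) - norm (x m - z)) * (norm (x k - z) + norm (x m - z))"
        by (simp add: power2_eq_square algebra_simps)
      also have "\<dots> \<le> norm (x k - x m) * (4 * \<bar>R\<bar>)"
      proof (intro order_trans[OF mult_right_mono mult_left_mono])
        show "norm (x k - z) - norm (x m - z) \<le> norm (x k - x m)"
          using norm_triangle_ineq2[of "x k - z" "x m - z"] by simp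
        show "norm (x k - z) + norm (x m - z) \<le> 4 * \<bar>R\<bar>"
          using norm_triangle_ineq4[of "x k" z] norm_triangle_ineq4[of "x m" z] Rk z by linarith
      qed auto
      also have "\<dots> \<le> M * \<sigma> k * (4 * \<bar>R\<bar>)" using \<sigma>k by (intro mult_right_mono) auto
      finally have 2: "M * (norm (x k - z))\<^sup>2 \<le> M * ((norm (x m - z))\<^sup>2 + M * \<sigma> k * (4 * \<bar>R\<bar>))" using M by simp
      have "\<phi> z - \<phi> (x k) + M * (norm (x k - z))\<^sup>2 + M * s \<le> A + (L * M * \<sigma> k + M * (M * \<sigma> k * (4 * \<bar>R\<bar>)) + M * \<alpha>)"
        using 1 2 s M unfolding A_def distrib_left[of M] by (smt (verit) mult_left_mono)
      also have "L * M * \<sigma> k + M * (M * \<sigma> k * (4 * \<bar>R\<bar>)) + M * \<alpha> \<le> C * (\<sigma> k + \<alpha>)"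
      proof -
        have "C * (\<sigma> k + \<alpha>) - (L * M * \<sigma> k + M * (M * \<sigma> k * (4 * \<bar>R\<bar>)) + M * \<alpha>) = M * \<sigma> k + L * M * \<alpha> + M * (M * (4 * \<bar>R\<bar>)) * \<alpha>"
          by (simp add: C_def algebra_simps)
        moreover have "0 \<le> M * \<sigma> k + L * M * \<alpha> + M * (M * (4 * \<bar>R\<bar>)) * \<alpha>"
          using M L \<alpha> \<sigma>k by (intro add_nonneg_nonneg mult_nonneg_nonneg) auto
        ultimately show ?thesis by linarith
      qed
      also have "\<dots> \<le> C * (\<sigma> (Suc k) + \<alpha>)" using C s by (simp add: \<sigma>S s_def)
      finally have "s * (\<phi> z - \<phi> (x k) + M * (norm (x k - z))\<^sup>2 + M * s) \<le> s * (A + C * (\<sigma> (Suc k) + \<alpha>))" using s by simp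
      moreover have "(norm (x (Suc k) - z))\<^sup>2 / 2 - (norm (x k - z))\<^sup>2 / 2 \<le> s * (\<phi> z - \<phi> (x k) + M * (norm (x k - z))\<^sup>2 + M * s)"
        unfolding s_def by (rule S4[OF \<alpha> run Rk(1) z])
      moreover have "(norm (x k - z))\<^sup>2 / 2 - (norm (x m - z))\<^sup>2 / 2 \<le> \<sigma> k * A + C * \<sigma> k * (\<sigma> k + \<alpha>)" using step by simp
      moreover have "C * \<sigma> k * (\<sigma> k + \<alpha>) \<le> C * \<sigma> k * (\<sigma> (Suc k) + \<alpha>)" using C \<sigma>k s by (intro mult_left_mono) (auto simp: \<sigma>S s_def)
      moreover have "\<sigma> (Suc k) * A + C * \<sigma> (Suc k) * (\<sigma> (Suc k) + \<alpha>) = \<sigma> k * A + C * \<sigma> k * (\<sigma> (Suc k) + \<alpha>) + s * (A + C * (\<sigma> (Suc k) + \<alpha>))"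
      proof -
        have "\<sigma> (Suc k) = \<sigma> k + s" by (simp add: \<sigma>S s_def)
        then show ?thesis by (simp add: algebra_simps)
      qed
      ultimately show ?case by linarith
    qed (simp add: \<sigma>m)
    have "M * (norm (x m - z))\<^sup>2 \<le> C * (norm (x m - z))\<^sup>2" using C(2) by (intro mult_right_mono) auto
    then have "\<sigma> n * A \<le> \<sigma> n * (\<phi> z - \<phi> (x m) + C * (norm (x m - z))\<^sup>2)"
      using \<sigma>(1)[OF mn] by (intro mult_left_mono) (auto simp: A_def)
    then show "(norm (x n - z))\<^sup>2 / 2 - (norm (x m - z))\<^sup>2 / 2 \<le>
        (time \<alpha> K n - time \<alpha> K m) * (\<phi> z - \<phi> (x m) + C * (norm (x m - z))\<^sup>2) +
        C * (time \<alpha> K n - time \<alpha> K m) * (time \<alpha> K n - time \<alpha> K m + \<alpha>)"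
      using ev[OF mn order_refl] unfolding \<sigma>_def by linarith
  qed
qed

end

text \<open>Boundedness of maximal trajectories in the language of the model. Maximality appears as
  \<open>T = \<infinity>\<close> or unboundedness, since an unbounded curve on a finite interval has
  no continuous extension to its endpoint.\<close>

locale bounded_descent_model = descent_model D \<phi> SD \<kappa> \<beta> step
  for D :: "'a::euclidean_space set" and \<phi> SD \<kappa> \<beta> step +
  assumes bounded_flow: "\<And>T y. 0 < T \<Longrightarrow> (\<And>t. 0 \<le> t \<Longrightarrow> ereal t < T \<Longrightarrow> \<exists>L. L-lipschitz_on {0..t} y) \<Longrightarrow>
    (\<exists>C. countable C \<and> (\<forall>t. 0 < t \<longrightarrow> ereal t < T \<longrightarrow> t \<notin> C \<longrightarrow> (\<exists>w\<in>SD (y t). (y has_vector_derivative - w) (at t)))) \<Longrightarrow>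
    T = \<infinity> \<or> \<not> bounded (y ` time_interval T) \<Longrightarrow> bounded (y ` time_interval T)"

section \<open>Ultralimits of sequences with vanishing step sizes\<close>

locale descent_limit = bounded_descent_model D \<phi> SD \<kappa> \<beta> step
  for D :: "'a::euclidean_space set" and \<phi> SD \<kappa> \<beta> step +
  fixes x :: "nat \<Rightarrow> nat \<Rightarrow> 'a" and \<alpha> :: "nat \<Rightarrow> real" and K :: "nat \<Rightarrow> nat" and U :: "nat filter" and r :: real
  assumes run: "\<And>j. run (\<alpha> j) (K j) (x j)"
    and \<alpha>_pos: "\<And>j. 0 < \<alpha> j" and \<alpha>_le: "\<And>j. \<alpha> j \<le> 1 / (real j + 1)"
    and start: "\<And>j. norm (x j 0) \<le> r"
    and U: "U \<noteq> bot" "\<And>P. eventually P U \<or> eventually (\<lambda>j. \<not> P j) U" "U \<le> sequentially"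
begin

lemma \<alpha>_tendsto: "(\<alpha> \<longlongrightarrow> 0) U"
proof (rule tendsto_mono[OF U(3)], rule tendsto_sandwich[of "\<lambda>_. 0"])
  show "(\<lambda>j. 1 / (real j + 1)) \<longlonglongrightarrow> 0" using LIMSEQ_inverse_real_of_nat by (simp add: inverse_eq_divide add.commute)
qed (use \<alpha>_pos \<alpha>_le in \<open>auto intro!: always_eventually less_imp_le\<close>)

lemma \<alpha>_small: assumes "c > 0" shows "\<forall>\<^sub>F j in U. \<alpha> j \<le> c"
  using order_tendstoD(2)[OF \<alpha>_tendsto assms] by (rule eventually_mono) simp

abbreviation "\<tau> j \<equiv> time (\<alpha> j) (K j)"

text \<open>The last iterate reached by time \<open>t\<close>; the interpolations are piecewise
  constant.\<close>

definition "idx j t = (LEAST k. t < \<tau> j (Suc k))"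

lemma idx: assumes "0 \<le> t" shows "\<tau> j (idx j t) \<le> t" "t < \<tau> j (Suc (idx j t))" "t < \<tau> j (idx j t) + \<alpha> j"
proof -
  obtain n where n: "t < \<tau> j n" using time_unbounded[OF \<alpha>_pos] by blast
  then have "n \<noteq> 0" using assms by (cases n) (simp_all add: time_def)
  then obtain m where "t < \<tau> j (Suc m)" using n by (cases n) auto
  then show lt: "t < \<tau> j (Suc (idx j t))" unfolding idx_def by (rule LeastI)
  show "\<tau> j (idx j t) \<le> t"
  proof (cases "idx j t")
    case 0
    then show ?thesis using assms by (simp add: time_def)
  next
    case (Suc k)
    then have "\<not> t < \<tau> j (Suc k)" unfolding idx_def by (intro not_less_Least) simp
    then show ?thesis using Suc by simp
  qed
  show "t < \<tau> j (idx j t) + \<alpha> j" using lt stepsize_le[OF \<alpha>_pos, of j "K j" "idx j t"] by (simp add: time_Suc)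
qed

lemma idx_mono: assumes "0 \<le> s" "s \<le> t" shows "idx j s \<le> idx j t"
proof (rule ccontr)
  assume "\<not> idx j s \<le> idx j t"
  then have "\<tau> j (Suc (idx j t)) \<le> \<tau> j (idx j s)" by (intro time_mono \<alpha>_pos) simp
  then show False using idx(1)[OF assms(1), of j] idx(2)[of t j] assms by linarith
qed

lemma \<tau>_tendsto: assumes "0 \<le> t" shows "((\<lambda>j. \<tau> j (idx j t)) \<longlongrightarrow> t) U"
proof (rule tendsto_sandwich[of "\<lambda>j. t - \<alpha> j"])
  show "((\<lambda>j. t - \<alpha> j) \<longlongrightarrow> t) U" using tendsto_diff[OF tendsto_const \<alpha>_tendsto, of t] by simp
  show "\<forall>\<^sub>F j in U. t - \<alpha> j \<le> \<tau> j (idx j t)" using idx(3)[OF assms] by (intro always_eventually) (simp add: less_imp_le diff_le_eq)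
qed (use idx(1)[OF assms] in auto)

definition "p j t = x j (idx j t)"

definition "y t = (SOME l. ((\<lambda>j. p j t) \<longlongrightarrow> l) U)"

text \<open>Boundedness of the whole past for almost all \<open>j\<close>, and not only of the value
  at time \<open>t\<close>: the summed estimates ask for it at every iterate on the way.\<close>

definition "good R t \<longleftrightarrow> (\<forall>\<^sub>F j in U. \<forall>k\<le>idx j t. norm (x j k) \<le> R)"

lemma good_mono: "good R t \<Longrightarrow> 0 \<le> s \<Longrightarrow> s \<le> t \<Longrightarrow> R \<le> R' \<Longrightarrow> good R' s"
  unfolding good_def by (erule eventually_mono) (meson idx_mono order_trans)

lemma good_p: "good R t \<Longrightarrow> \<forall>\<^sub>F j in U. norm (p j t) \<le> R"
  unfolding good_def p_def by (erule eventually_mono) blast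

lemma idx_0: "idx j 0 = 0"
proof -
  have "0 < \<tau> j (Suc 0)" using stepsize_pos[OF \<alpha>_pos] by (simp add: time_def)
  then have "idx j 0 \<le> 0" unfolding idx_def by (rule Least_le)
  then show ?thesis by simp
qed

lemma good_0: "good r 0"
  using start by (simp add: good_def idx_0)

lemma p_D: "p j t \<in> D" unfolding p_def by (rule run_D[OF \<alpha>_pos run])

lemma limits:
  assumes "good R t"
  shows "((\<lambda>j. p j t) \<longlongrightarrow> y t) U" "y t \<in> D" "norm (y t) \<le> R" "((\<lambda>j. \<phi> (p j t)) \<longlongrightarrow> \<phi> (y t)) U"
proof -
  obtain l where "((\<lambda>j. p j t) \<longlongrightarrow> l) U" by (rule ultrafilter_limit[OF U(1,2) good_p[OF assms]])
  then show yt: "((\<lambda>j. p j t) \<longlongrightarrow> y t) U" unfolding y_def by (rule someI)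
  show yD: "y t \<in> D" by (rule Lim_in_closed_set[OF D_closed _ U(1) yt]) (simp add: p_D)
  show "norm (y t) \<le> R" by (rule tendsto_upperbound[OF tendsto_norm[OF yt] good_p[OF assms] U(1)])
  show "((\<lambda>j. \<phi> (p j t)) \<longlongrightarrow> \<phi> (y t)) U"
    by (rule continuous_on_tendsto_compose[OF \<phi>_cont yt yD]) (simp add: p_D)
qed

lemma limit_bounds:
  obtains M where "M > 0" "\<And>s t. 0 \<le> s \<Longrightarrow> s \<le> t \<Longrightarrow> good R t \<Longrightarrow> norm (y t - y s) \<le> M * (t - s)"
    "\<And>s t. 0 \<le> s \<Longrightarrow> s < t \<Longrightarrow> good R t \<Longrightarrow> \<phi> (y t) \<le> \<phi> (y s) - (norm (y t - y s))\<^sup>2 / (2 * (t - s))"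
    "\<And>s t z. 0 \<le> s \<Longrightarrow> s \<le> t \<Longrightarrow> good R t \<Longrightarrow> z \<in> D \<Longrightarrow> norm z \<le> R \<Longrightarrow>
      (norm (y t - z))\<^sup>2 / 2 - (norm (y s - z))\<^sup>2 / 2 \<le>
        (t - s) * (\<phi> z - \<phi> (y s) + M * (norm (y s - z))\<^sup>2 + M * (t - s))"
    "\<And>t. 0 \<le> t \<Longrightarrow> good R t \<Longrightarrow> \<forall>\<^sub>F j in U. (\<Sum>k<idx j t. norm (x j (Suc k) - x j k)) \<le> M * t"
proof -
  obtain M abar where M: "M > 0" and abar: "abar > 0"
    and B0: "\<And>\<alpha> K x m n. 0 < \<alpha> \<Longrightarrow> \<alpha> \<le> abar \<Longrightarrow> run \<alpha> K x \<Longrightarrow> m \<le> n \<Longrightarrow> \<forall>k\<in>{m..<n}. norm (x k) \<le> R \<Longrightarrow>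
      (\<Sum>k=m..<n. norm (x (Suc k) - x k)) \<le> M * (time \<alpha> K n - time \<alpha> K m)"
    and B1: "\<And>\<alpha> K x m n. 0 < \<alpha> \<Longrightarrow> \<alpha> \<le> abar \<Longrightarrow> run \<alpha> K x \<Longrightarrow> m \<le> n \<Longrightarrow> \<forall>k\<in>{m..<n}. norm (x k) \<le> R \<Longrightarrow>
      norm (x n - x m) \<le> M * (time \<alpha> K n - time \<alpha> K m)"
    and B2: "\<And>\<alpha> K x m n. 0 < \<alpha> \<Longrightarrow> \<alpha> \<le> abar \<Longrightarrow> run \<alpha> K x \<Longrightarrow> m \<le> n \<Longrightarrow> \<forall>k\<in>{m..<n}. norm (x k) \<le> R \<Longrightarrow>
      \<phi> (x n) \<le> \<phi> (x m) - (norm (x n - x m))\<^sup>2 / (2 * (time \<alpha> K n - time \<alpha> K m)) + M * \<alpha>\<^sup>2 * (time \<alpha> K n - time \<alpha> K m)"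
    and B3: "\<And>\<alpha> K x m n z. 0 < \<alpha> \<Longrightarrow> \<alpha> \<le> abar \<Longrightarrow> run \<alpha> K x \<Longrightarrow> m \<le> n \<Longrightarrow> \<forall>k\<in>{m..<n}. norm (x k) \<le> R \<Longrightarrow>
      z \<in> D \<Longrightarrow> norm z \<le> R \<Longrightarrow> (norm (x n - z))\<^sup>2 / 2 - (norm (x m - z))\<^sup>2 / 2 \<le>
        (time \<alpha> K n - time \<alpha> K m) * (\<phi> z - \<phi> (x m) + M * (norm (x m - z))\<^sup>2) +
        M * (time \<alpha> K n - time \<alpha> K m) * (time \<alpha> K n - time \<alpha> K m + \<alpha>)"
    by (rule run_bounds[of R]) (rule that)
  have ev: "\<forall>\<^sub>F j in U. \<alpha> j \<le> abar \<and> (\<forall>k\<le>idx j t. norm (x j k) \<le> R)" if "good R t" for t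
    using \<alpha>_small[OF abar] that unfolding good_def by (rule eventually_conj)
  have \<sigma>: "((\<lambda>j. \<tau> j (idx j t) - \<tau> j (idx j s)) \<longlongrightarrow> t - s) U" if "0 \<le> s" "s \<le> t" for s t
    using that by (intro tendsto_diff \<tau>_tendsto) auto
  show thesis
  proof (rule that[OF M])
    fix s t assume st: "0 \<le> s" "s \<le> t" and t: "good R t"
    note s = good_mono[OF t st order_refl]
    show "norm (y t - y s) \<le> M * (t - s)"
    proof (rule tendsto_le[OF U(1)])
      show "((\<lambda>j. M * (\<tau> j (idx j t) - \<tau> j (idx j s))) \<longlongrightarrow> M * (t - s)) U" by (intro tendsto_mult_left \<sigma> st)
      show "((\<lambda>j. norm (p j t - p j s)) \<longlongrightarrow> norm (y t - y s)) U" by (intro tendsto_norm tendsto_diff limits[OF t] limits[OF s])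
      show "\<forall>\<^sub>F j in U. norm (p j t - p j s) \<le> M * (\<tau> j (idx j t) - \<tau> j (idx j s))"
        using ev[OF t] by (rule eventually_mono) (auto simp: p_def intro!: B1[OF \<alpha>_pos _ run idx_mono[OF st]])
    qed
  next
    fix s t assume st: "0 \<le> s" "s < t" and t: "good R t"
    have st': "s \<le> t" using st by simp
    note s = good_mono[OF t st(1) st' order_refl]
    show "\<phi> (y t) \<le> \<phi> (y s) - (norm (y t - y s))\<^sup>2 / (2 * (t - s))"
    proof (rule tendsto_le[OF U(1)])
      have "((\<lambda>j. \<phi> (p j s) - (norm (p j t - p j s))\<^sup>2 / (2 * (\<tau> j (idx j t) - \<tau> j (idx j s))) + M * (\<alpha> j)\<^sup>2 * (\<tau> j (idx j t) - \<tau> j (idx j s)))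
        \<longlongrightarrow> \<phi> (y s) - (norm (y t - y s))\<^sup>2 / (2 * (t - s)) + M * 0\<^sup>2 * (t - s)) U"
        by (intro tendsto_intros \<sigma> st(1) st' limits[OF t] limits[OF s] \<alpha>_tendsto) (use st in auto)
      then show "((\<lambda>j. \<phi> (p j s) - (norm (p j t - p j s))\<^sup>2 / (2 * (\<tau> j (idx j t) - \<tau> j (idx j s))) + M * (\<alpha> j)\<^sup>2 * (\<tau> j (idx j t) - \<tau> j (idx j s)))
        \<longlongrightarrow> \<phi> (y s) - (norm (y t - y s))\<^sup>2 / (2 * (t - s))) U" by simp
      show "((\<lambda>j. \<phi> (p j t)) \<longlongrightarrow> \<phi> (y t)) U" by (rule limits[OF t])
      show "\<forall>\<^sub>F j in U. \<phi> (p j t) \<le> \<phi> (p j s) - (norm (p j t - p j s))\<^sup>2 / (2 * (\<tau> j (idx j t) - \<tau> j (idx j s))) + M * (\<alpha> j)\<^sup>2 * (\<tau> j (idx j t) - \<tau> j (idx j s))"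
        using ev[OF t] unfolding p_def by (rule eventually_mono) (intro B2[OF \<alpha>_pos _ run idx_mono[OF st(1) st']], auto)
    qed
  next
    fix s t z assume st: "0 \<le> s" "s \<le> t" and t: "good R t" and z: "z \<in> D" "norm z \<le> R"
    note s = good_mono[OF t st order_refl]
    have "(norm (y t - z))\<^sup>2 / 2 - (norm (y s - z))\<^sup>2 / 2 \<le>
        (t - s) * (\<phi> z - \<phi> (y s) + M * (norm (y s - z))\<^sup>2) + M * (t - s) * (t - s + 0)"
    proof (rule tendsto_le[OF U(1)])
      show "((\<lambda>j. (\<tau> j (idx j t) - \<tau> j (idx j s)) * (\<phi> z - \<phi> (p j s) + M * (norm (p j s - z))\<^sup>2) +
        M * (\<tau> j (idx j t) - \<tau> j (idx j s)) * (\<tau> j (idx j t) - \<tau> j (idx j s) + \<alpha> j)) \<longlongrightarrow>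
        (t - s) * (\<phi> z - \<phi> (y s) + M * (norm (y s - z))\<^sup>2) + M * (t - s) * (t - s + 0)) U"
        by (intro tendsto_intros \<sigma> st limits[OF t] limits[OF s] \<alpha>_tendsto)
      show "((\<lambda>j. (norm (p j t - z))\<^sup>2 / 2 - (norm (p j s - z))\<^sup>2 / 2) \<longlongrightarrow> (norm (y t - z))\<^sup>2 / 2 - (norm (y s - z))\<^sup>2 / 2) U"
        by (intro tendsto_intros limits[OF t] limits[OF s]) auto
      show "\<forall>\<^sub>F j in U. (norm (p j t - z))\<^sup>2 / 2 - (norm (p j s - z))\<^sup>2 / 2 \<le>
        (\<tau> j (idx j t) - \<tau> j (idx j s)) * (\<phi> z - \<phi> (p j s) + M * (norm (p j s - z))\<^sup>2) +
        M * (\<tau> j (idx j t) - \<tau> j (idx j s)) * (\<tau> j (idx j t) - \<tau> j (idx j s) + \<alpha> j)"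
        using ev[OF t] unfolding p_def by (rule eventually_mono) (intro B3[OF \<alpha>_pos _ run idx_mono[OF st] _ z], auto)
    qed
    then show "(norm (y t - z))\<^sup>2 / 2 - (norm (y s - z))\<^sup>2 / 2 \<le>
        (t - s) * (\<phi> z - \<phi> (y s) + M * (norm (y s - z))\<^sup>2 + M * (t - s))"
      by (simp add: distrib_left mult_ac)
  next
    fix t assume t: "0 \<le> t" "good R t"
    show "\<forall>\<^sub>F j in U. (\<Sum>k<idx j t. norm (x j (Suc k) - x j k)) \<le> M * t"
    proof (rule eventually_mono[OF ev[OF t(2)]], elim conjE)
      fix j assume j: "\<alpha> j \<le> abar" "\<forall>k\<le>idx j t. norm (x j k) \<le> R"
      have "(\<Sum>k=0..<idx j t. norm (x j (Suc k) - x j k)) \<le> M * (\<tau> j (idx j t) - \<tau> j 0)"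
        by (rule B0[OF \<alpha>_pos j(1) run]) (use j in auto)
      also have "\<dots> \<le> M * t" using idx(1)[OF t(1), of j] M by (simp add: time_def)
      finally show "(\<Sum>k<idx j t. norm (x j (Suc k) - x j k)) \<le> M * t" by (simp add: lessThan_atLeast0)
    qed
  qed
qed

text \<open>The gained time \<open>\<eta>\<close> depends on the radius \<open>R\<close> of the
  current iterates, but not on the radius \<open>R'\<close> of their past. This lets
  \<open>all_good\<close> step over a finite time once the limit curve is bounded before it.\<close>

lemma good_extend:
  obtains \<eta> where "\<eta> > 0" "\<And>t R'. 0 \<le> t \<Longrightarrow> good R' t \<Longrightarrow> (\<forall>\<^sub>F j in U. norm (p j t) \<le> R) \<Longrightarrow> good (max R' (R + 1)) (t + \<eta>)"
proof -
  obtain M abar where M: "M > 0" and abar: "abar > 0"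
    and B1: "\<And>\<alpha> K x m n. 0 < \<alpha> \<Longrightarrow> \<alpha> \<le> abar \<Longrightarrow> run \<alpha> K x \<Longrightarrow> m \<le> n \<Longrightarrow> \<forall>k\<in>{m..<n}. norm (x k) \<le> R + 1 \<Longrightarrow>
      norm (x n - x m) \<le> M * (time \<alpha> K n - time \<alpha> K m)"
    by (rule run_bounds[of "R + 1"]) (rule that)
  \<comment> \<open>At most \<open>2 * \<eta>\<close> elapses, because the interpolation may lag
    behind \<open>t\<close> by one step of size at most \<open>\<eta>\<close>; the motion is then at
    most 1.\<close>
  define \<eta> where "\<eta> = 1 / (2 * M)"
  have \<eta>: "\<eta> > 0" using M by (simp add: \<eta>_def)
  show thesis
  proof (rule that[OF \<eta>])
    fix t R' assume t: "0 \<le> t" "good R' t" and pj: "\<forall>\<^sub>F j in U. norm (p j t) \<le> R"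
    have "\<forall>\<^sub>F j in U. (\<alpha> j \<le> abar \<and> \<alpha> j \<le> \<eta>) \<and> (\<forall>k\<le>idx j t. norm (x j k) \<le> R') \<and> norm (p j t) \<le> R"
      using t(2) unfolding good_def by (intro eventually_conj \<alpha>_small abar \<eta> pj)
    then show "good (max R' (R + 1)) (t + \<eta>)" unfolding good_def
    proof (rule eventually_mono, intro allI impI)
      fix j k assume j: "(\<alpha> j \<le> abar \<and> \<alpha> j \<le> \<eta>) \<and> (\<forall>k\<le>idx j t. norm (x j k) \<le> R') \<and> norm (p j t) \<le> R"
        and k: "k \<le> idx j (t + \<eta>)"
      have "norm (x j i) \<le> R + 1" if "idx j t \<le> i" "i \<le> idx j (t + \<eta>)" for i
        using that
      proof (induction i rule: less_induct)
        case (less i)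
        have "norm (x j i - x j (idx j t)) \<le> M * (\<tau> j i - \<tau> j (idx j t))"
          by (rule B1[OF \<alpha>_pos _ run]) (use j less in auto)
        also have "\<dots> \<le> M * (2 * \<eta>)"
        proof (rule mult_left_mono)
          have "\<tau> j i \<le> \<tau> j (idx j (t + \<eta>))" by (intro time_mono \<alpha>_pos less)
          then show "\<tau> j i - \<tau> j (idx j t) \<le> 2 * \<eta>"
            using idx(1)[of "t + \<eta>" j] idx(3)[OF t(1), of j] j t(1) \<eta> by linarith
        qed (use M in simp)
        also have "\<dots> = 1" using M by (simp add: \<eta>_def)
        finally have "norm (x j i - x j (idx j t)) \<le> 1" .
        then show ?case using norm_triangle_ineq2[of "x j i" "x j (idx j t)"] j unfolding p_def by linarith
      qed
      then show "norm (x j k) \<le> max R' (R + 1)" using j k by (cases "k \<le> idx j t") (auto simp: le_max_iff_disj)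
    qed
  qed
qed

lemma evi_curve_limit:
  assumes "good R b" "0 < b"
  obtains M where "evi_curve D \<phi> SD y b R M"
proof -
  obtain M where M: "M > 0" "\<And>s t. 0 \<le> s \<Longrightarrow> s \<le> t \<Longrightarrow> good (R + 1) t \<Longrightarrow> norm (y t - y s) \<le> M * (t - s)"
    "\<And>s t z. 0 \<le> s \<Longrightarrow> s \<le> t \<Longrightarrow> good (R + 1) t \<Longrightarrow> z \<in> D \<Longrightarrow> norm z \<le> R + 1 \<Longrightarrow>
      (norm (y t - z))\<^sup>2 / 2 - (norm (y s - z))\<^sup>2 / 2 \<le>
        (t - s) * (\<phi> z - \<phi> (y s) + M * (norm (y s - z))\<^sup>2 + M * (t - s))"
    by (rule limit_bounds[of "R + 1"]) (rule that)
  have g: "good R t" "good (R + 1) t" if "0 \<le> t" "t \<le> b" for t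
    using good_mono[OF assms(1) that] by auto
  have "evi_curve D \<phi> SD y b R M"
    by unfold_locales (use assms(2) M limits(2,3)[OF g(1)] g in auto)
  then show thesis by (rule that)
qed

lemma flow_bounded:
  assumes T: "0 < T" and g: "\<And>t. 0 \<le> t \<Longrightarrow> ereal t < T \<Longrightarrow> \<exists>R. good R t"
    and mx: "T = \<infinity> \<or> \<not> bounded (y ` time_interval T)"
  shows "bounded (y ` time_interval T)"
proof (rule bounded_flow[OF T _ _ mx])
  fix t :: real assume t: "0 \<le> t" "ereal t < T"
  obtain R where R: "good R t" using g[OF t] by blast
  obtain M where M: "M > 0" "\<And>s t. 0 \<le> s \<Longrightarrow> s \<le> t \<Longrightarrow> good R t \<Longrightarrow> norm (y t - y s) \<le> M * (t - s)"
    by (rule limit_bounds[of R]) (rule that)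
  have "M-lipschitz_on {0..t} y"
  proof (rule lipschitz_onI)
    fix u v assume uv: "u \<in> {0..t}" "v \<in> {0..t}"
    have "good R u" "good R v" using uv good_mono[OF R] by auto
    then show "dist (y u) (y v) \<le> M * dist u v"
      using M(2)[of u v] M(2)[of v u] uv by (cases "u \<le> v") (auto simp: dist_norm norm_minus_commute)
  qed (use M in simp)
  then show "\<exists>L. L-lipschitz_on {0..t} y" ..
next
  have "\<exists>S. countable S \<and> (\<forall>t. 0 < t \<longrightarrow> t < q \<longrightarrow> t \<notin> S \<longrightarrow> (\<exists>w\<in>SD (y t). (y has_vector_derivative - w) (at t)))"
    if q: "0 < q" "ereal q < T" for q
  proof -
    obtain R where R: "good R q" using g[of q] q by auto
    obtain M where "evi_curve D \<phi> SD y q R M" by (rule evi_curve_limit[OF R q(1)])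
    then interpret evi_curve D \<phi> SD y q R M .
    obtain S where "countable S" "\<And>t. 0 < t \<Longrightarrow> t < q \<Longrightarrow> t \<notin> S \<Longrightarrow> \<exists>w\<in>SD (y t). (y has_vector_derivative - w) (at t)"
      by (rule differentiable_off_countable) (rule that)
    then show ?thesis by blast
  qed
  then obtain S where S: "\<And>q. 0 < q \<Longrightarrow> ereal q < T \<Longrightarrow> countable (S q) \<and>
      (\<forall>t. 0 < t \<longrightarrow> t < q \<longrightarrow> t \<notin> S q \<longrightarrow> (\<exists>w\<in>SD (y t). (y has_vector_derivative - w) (at t)))" by metis
  \<comment> \<open>Differentiability is known off a countable set on each initial interval of
    length \<open>q\<close>; rational \<open>q\<close> exhaust the whole interval with countably
    many such sets.\<close>
  define C where "C = (\<Union>q\<in>{q\<in>\<rat>. 0 < q \<and> ereal q < T}. S q)"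
  have "countable C" unfolding C_def
  proof (rule countable_UN)
    show "countable {q\<in>\<rat>. 0 < q \<and> ereal q < T}" by (rule countable_subset[OF _ countable_rat]) auto
  qed (use S in auto)
  moreover have "\<exists>w\<in>SD (y t). (y has_vector_derivative - w) (at t)" if t: "0 < t" "ereal t < T" "t \<notin> C" for t
  proof -
    obtain s where s: "ereal t < ereal s" "ereal s < T" using ereal_dense2[OF t(2)] by blast
    obtain q where q: "q \<in> \<rat>" "t < q" "q < s" using Rats_dense_in_real[of t s] s by auto
    have qT: "0 < q" "ereal q < T" using q t s by (auto intro: less_trans[of _ "ereal s"])
    then have "t \<notin> S q" using q t(3) by (auto simp: C_def)
    then show ?thesis using S[OF qT] t q by blast
  qed
  ultimately show "\<exists>C. countable C \<and> (\<forall>t. 0 < t \<longrightarrow> ereal t < T \<longrightarrow> t \<notin> C \<longrightarrow>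
    (\<exists>w\<in>SD (y t). (y has_vector_derivative - w) (at t)))" by blast
qed

text \<open>Up to a finite supremum \<open>T\<close> of the good times the limit solves the
  inclusion. Were it unbounded, it would be maximal and hence bounded by assumption. So it is
  bounded, and \<open>good_extend\<close> started shortly before \<open>T\<close> leads beyond
  \<open>T\<close>.\<close>

lemma all_good:
  assumes "0 \<le> t" shows "\<exists>R. good R t"
proof (rule ccontr)
  assume no: "\<nexists>R. good R t"
  define G where "G = {s. 0 \<le> s \<and> (\<exists>R. good R s)}"
  have G0: "0 \<in> G" using good_0 by (auto simp: G_def)
  have Gt: "s < t" if "s \<in> G" for s
  proof (rule ccontr)
    assume "\<not> s < t"
    then show False using that no good_mono[of _ s t] assms unfolding G_def by force
  qed
  then have bd: "bdd_above G" by (intro bdd_aboveI[of _ t]) (simp add: less_imp_le)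
  define T where "T = Sup G"
  have le: "s \<le> T" if "s \<in> G" for s unfolding T_def by (rule cSup_upper[OF that bd])
  have GT: "s \<in> G" if s: "0 \<le> s" "s < T" for s
  proof -
    obtain u where u: "u \<in> G" "s < u" using s(2) less_cSup_iff[of G s] G0 bd by (auto simp: T_def)
    then show ?thesis using good_mono[of _ u s] s(1) unfolding G_def by force
  qed
  obtain \<eta>0 where \<eta>0: "\<eta>0 > 0" "\<And>t R'. 0 \<le> t \<Longrightarrow> good R' t \<Longrightarrow> (\<forall>\<^sub>F j in U. norm (p j t) \<le> r) \<Longrightarrow> good (max R' (r + 1)) (t + \<eta>0)"
    by (rule good_extend[of r]) (rule that)
  have "0 + \<eta>0 \<in> G" using \<eta>0(2)[OF order_refl good_0 good_p[OF good_0]] \<eta>0(1) by (auto simp: G_def)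
  then have T0: "0 < T" using le \<eta>0(1) by fastforce
  have "bounded (y ` time_interval (ereal T))"
  proof (rule ccontr)
    assume nb: "\<not> bounded (y ` time_interval (ereal T))"
    have "bounded (y ` time_interval (ereal T))"
      by (rule flow_bounded) (use T0 nb GT in \<open>auto simp: G_def\<close>)
    then show False using nb by blast
  qed
  then obtain B where B: "\<And>s. 0 \<le> s \<Longrightarrow> s < T \<Longrightarrow> norm (y s) \<le> B"
    unfolding bounded_iff time_interval_def by auto
  obtain \<eta> where \<eta>: "\<eta> > 0" "\<And>t R'. 0 \<le> t \<Longrightarrow> good R' t \<Longrightarrow> (\<forall>\<^sub>F j in U. norm (p j t) \<le> B + 1) \<Longrightarrow> good (max R' (B + 1 + 1)) (t + \<eta>)"
    by (rule good_extend[of "B + 1"]) (rule that)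
  define s where "s = max 0 (T - \<eta> / 2)"
  have s: "0 \<le> s" "s < T" "T < s + \<eta>" using T0 \<eta>(1) by (auto simp: s_def)
  obtain R where R: "good R s" using GT[OF s(1,2)] by (auto simp: G_def)
  have "\<forall>\<^sub>F j in U. norm (p j s) < B + 1"
    by (rule order_tendstoD[OF tendsto_norm[OF limits(1)[OF R]]]) (use B[OF s(1,2)] in simp)
  then have "\<forall>\<^sub>F j in U. norm (p j s) \<le> B + 1" by (rule eventually_mono) simp
  from \<eta>(2)[OF s(1) R this] have "s + \<eta> \<in> G" using s \<eta>(1) by (auto simp: G_def)
  then show False using le s(3) by fastforce
qed

lemma limit_bounded: obtains R0 where "\<And>t. 0 \<le> t \<Longrightarrow> norm (y t) \<le> R0"
proof -
  have "bounded (y ` time_interval \<infinity>)" by (rule flow_bounded) (use all_good in auto)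
  then show thesis using that unfolding bounded_iff time_interval_def by auto
qed

lemma energy:
  assumes "0 \<le> s" "s < t" shows "\<phi> (y t) \<le> \<phi> (y s) - (norm (y t - y s))\<^sup>2 / (2 * (t - s))"
proof -
  obtain R where R: "good R t" using all_good[of t] assms by auto
  obtain M where "\<And>s t. 0 \<le> s \<Longrightarrow> s < t \<Longrightarrow> good R t \<Longrightarrow> \<phi> (y t) \<le> \<phi> (y s) - (norm (y t - y s))\<^sup>2 / (2 * (t - s))"
    by (rule limit_bounds[of R]) (rule that)
  then show ?thesis using assms R by blast
qed

lemma \<phi>_decreasing: assumes "0 \<le> s" "s \<le> t" shows "\<phi> (y t) \<le> \<phi> (y s)"
proof (cases "s = t")
  case False
  then have "s < t" using assms by simp
  moreover from this have "0 \<le> (norm (y t - y s))\<^sup>2 / (2 * (t - s))" by simp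
  ultimately show ?thesis using energy[OF assms(1), of t] by linarith
qed simp

lemma y_D: "0 \<le> t \<Longrightarrow> y t \<in> D"
  using all_good[of t] limits(2) by blast

text \<open>If all slopes from time \<open>a\<close> on were at least \<epsilon>, every point would
  have difference quotients above \<open>\<epsilon> / 2\<close> over arbitrarily short steps, and
  the energy would fall at rate \<open>\<epsilon>\<^sup>2 / 8\<close>.\<close>

lemma small_slope:
  assumes \<epsilon>: "\<epsilon> > 0" and a: "0 \<le> a"
  shows "\<exists>t\<ge>a. \<exists>w\<in>SD (y t). norm w < \<epsilon>"
proof (rule ccontr)
  assume "\<not> ?thesis"
  then have big: "\<epsilon> \<le> norm w" if "a \<le> t" "w \<in> SD (y t)" for t w using that by (meson not_less)
  obtain m where m: "\<And>z. z \<in> D \<Longrightarrow> m \<le> \<phi> z" using \<phi>_bounded_below by blast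
  \<comment> \<open>Late enough for the energy to have fallen to one less than its lower bound
    \<open>m\<close>.\<close>
  define b where "b = a + 8 * (\<phi> (y a) - m + 1) / \<epsilon>\<^sup>2"
  have ma: "m \<le> \<phi> (y a)" using m[OF y_D[OF a]] .
  have b: "a < b" "- (\<epsilon>\<^sup>2 / 8) * (b - a) = m - 1 - \<phi> (y a)"
  proof -
    show "a < b" using ma \<epsilon> by (simp add: b_def)
    show "- (\<epsilon>\<^sup>2 / 8) * (b - a) = m - 1 - \<phi> (y a)" using \<epsilon> by (simp add: b_def field_simps)
  qed
  obtain R where R: "good R b" using all_good[of b] a b by auto
  obtain M where "evi_curve D \<phi> SD y b R M" by (rule evi_curve_limit[OF R]) (use a b in auto)
  then interpret evi: evi_curve D \<phi> SD y b R M .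
  have "\<phi> (y b) - \<phi> (y a) \<le> - (\<epsilon>\<^sup>2 / 8) * (b - a)"
  proof (rule dini_increment)
    show "continuous_on {a..b} (\<lambda>t. \<phi> (y t))"
      by (rule continuous_on_compose2[OF \<phi>_cont continuous_on_subset[OF evi.y_continuous]]) (use a y_D in auto)
    fix t e :: real assume t: "a \<le> t" "t < b" and e: "0 < e"
    define H where "H n = (b - t) / real (Suc n)" for n
    have bt: "0 < b - t" using t by simp
    have H: "H \<longlonglongrightarrow> 0" "H n > 0" for n
      using small_steps[OF bt] unfolding H_def by auto
    have Hb: "t + H n \<le> b" for n
      using small_steps(3)[OF bt, of n] unfolding H_def by linarith
    have t0: "0 \<le> t" using a t by simp
    obtain q \<rho> where q: "strict_mono (\<rho> :: nat \<Rightarrow> nat)" "(\<lambda>n. (y (t + H (\<rho> n)) - y t) /\<^sub>R H (\<rho> n)) \<longlonglongrightarrow> q" "- q \<in> SD (y t)"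
      by (rule evi.right_cluster[OF t0 H(2) Hb H(1)]) (rule that)
    have "\<epsilon> / 2 < norm q" using big[OF t(1) q(3)] \<epsilon> by simp
    then have "\<forall>\<^sub>F n in sequentially. \<epsilon> / 2 < norm ((y (t + H (\<rho> n)) - y t) /\<^sub>R H (\<rho> n))"
      by (rule order_tendstoD(1)[OF tendsto_norm[OF q(2)]])
    then obtain n where n: "\<epsilon> / 2 < norm ((y (t + H (\<rho> n)) - y t) /\<^sub>R H (\<rho> n))"
      using eventually_happens[of _ sequentially] by auto
    define k where "k = H (\<rho> n)"
    have k: "0 < k" "t + k \<le> b" using H Hb by (auto simp: k_def)
    have "\<epsilon> / 2 * k \<le> norm (y (t + k) - y t)"
      using n norm_scaleR_inverse_le[OF k(1), of "y (t + k) - y t" "\<epsilon> / 2"] unfolding k_def by linarith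
    then have "(\<epsilon> / 2 * k)\<^sup>2 \<le> (norm (y (t + k) - y t))\<^sup>2" using \<epsilon> k by (intro power_mono) auto
    then have "(\<epsilon> / 2 * k)\<^sup>2 / (2 * k) \<le> (norm (y (t + k) - y t))\<^sup>2 / (2 * k)" using k by (intro divide_right_mono) auto
    moreover have "(\<epsilon> / 2 * k)\<^sup>2 / (2 * k) = \<epsilon>\<^sup>2 / 8 * k" using k by (simp add: power2_eq_square)
    moreover have "\<phi> (y (t + k)) \<le> \<phi> (y t) - (norm (y (t + k) - y t))\<^sup>2 / (2 * k)" using energy[OF t0, of "t + k"] k by simp
    moreover have "0 < e * k" using e k by simp
    ultimately have "\<phi> (y (t + k)) - \<phi> (y t) \<le> (- (\<epsilon>\<^sup>2 / 8) + e) * k" unfolding distrib_right by simp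
    then show "\<exists>h>0. t + h \<le> b \<and> \<phi> (y (t + h)) - \<phi> (y t) \<le> (- (\<epsilon>\<^sup>2 / 8) + e) * h" using k by blast
  qed (use b in simp)
  moreover have "m \<le> \<phi> (y b)" by (rule m, rule y_D) (use a b in simp)
  ultimately show False using b(2) by linarith
qed

text \<open>\<open>v\<close> is the value at a limit point of the curve along times with vanishing
  slope. For given \<epsilon> one fixed time of the curve is already below
  \<open>v + \<epsilon>\<close>, and almost all sequences are close to it after a bounded length.
  \<open>R0\<close> is independent of \<epsilon>, as it must be: the \<epsilon> inserted later
  depends on \<open>R0\<close>.\<close>

lemma tracking_limit:
  assumes "\<And>j. \<phi> (x j 0) \<le> lam"
  obtains R0 v where "v \<le> lam" "\<exists>z. 0 \<in> SD z \<and> \<phi> z = v"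
    "\<And>\<epsilon>. \<epsilon> > 0 \<Longrightarrow> \<exists>B. \<forall>\<^sub>F j in U. \<exists>k. norm (x j k) \<le> R0 + 1 \<and> \<phi> (x j k) < v + \<epsilon> \<and> (\<Sum>i<k. norm (x j (Suc i) - x j i)) \<le> B"
proof -
  obtain R0 where R0: "\<And>t. 0 \<le> t \<Longrightarrow> norm (y t) \<le> R0" by (rule limit_bounded) (rule that)
  have "\<exists>t w. real n \<le> t \<and> w \<in> SD (y t) \<and> norm w < 1 / real (Suc n)" for n
    using small_slope[of "1 / real (Suc n)" "real n"] by auto
  then obtain t w where tw: "\<And>n. real n \<le> t n" "\<And>n. w n \<in> SD (y (t n))" "\<And>n. norm (w n) < 1 / real (Suc n)" by metis
  have t0: "0 \<le> t n" for n using tw(1)[of n] by (rule order_trans[rotated]) simp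
  obtain z \<rho> where \<rho>: "strict_mono (\<rho> :: nat \<Rightarrow> nat)" "((\<lambda>n. y (t n)) \<circ> \<rho>) \<longlonglongrightarrow> z"
    by (rule bounded_seq_subseq[of "\<lambda>n. y (t n)" R0]) (use R0 t0 in auto)
  have w: "w \<longlonglongrightarrow> 0"
  proof (rule Lim_null_comparison)
    show "\<forall>\<^sub>F n in sequentially. norm (w n) \<le> 1 / real (Suc n)" using tw(3) by (intro always_eventually) (simp add: less_imp_le)
    show "(\<lambda>n. 1 / real (Suc n)) \<longlonglongrightarrow> 0" using LIMSEQ_inverse_real_of_nat by (simp add: inverse_eq_divide)
  qed
  have crit: "0 \<in> SD z"
    by (rule SD_closed[OF _ \<rho>(2) LIMSEQ_subseq_LIMSEQ[OF w \<rho>(1)]]) (simp add: tw)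
  have lim: "(\<lambda>n. \<phi> (((\<lambda>n. y (t n)) \<circ> \<rho>) n)) \<longlonglongrightarrow> \<phi> z"
    by (rule continuous_on_tendsto_compose[OF \<phi>_cont \<rho>(2) SD_dom[OF crit]]) (simp add: y_D t0)
  have y0: "\<phi> (y 0) \<le> lam"
    by (rule tendsto_upperbound[OF limits(4)[OF good_0] _ U(1)]) (use assms in \<open>simp add: p_def idx_0\<close>)
  show thesis
  proof (rule that[of "\<phi> z" R0])
    have "\<phi> (((\<lambda>n. y (t n)) \<circ> \<rho>) n) \<le> lam" for n using \<phi>_decreasing[OF order_refl t0[of "\<rho> n"]] y0 by simp
    then show "\<phi> z \<le> lam" by (intro LIMSEQ_le_const2[OF lim]) auto
    show "\<exists>z'. 0 \<in> SD z' \<and> \<phi> z' = \<phi> z" using crit by blast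
    fix \<epsilon> :: real assume \<epsilon>: "\<epsilon> > 0"
    have "\<forall>\<^sub>F n in sequentially. \<phi> (((\<lambda>n. y (t n)) \<circ> \<rho>) n) < \<phi> z + \<epsilon>" by (rule order_tendstoD[OF lim]) (use \<epsilon> in simp)
    then obtain n where n: "\<phi> (y (t (\<rho> n))) < \<phi> z + \<epsilon>" using eventually_happens[of _ sequentially] by auto
    define s where "s = t (\<rho> n)"
    have s: "0 \<le> s" "\<phi> (y s) < \<phi> z + \<epsilon>" using t0 n by (auto simp: s_def)
    obtain R where R: "good R s" using all_good[OF s(1)] by blast
    obtain M where M: "\<And>t. 0 \<le> t \<Longrightarrow> good R t \<Longrightarrow> \<forall>\<^sub>F j in U. (\<Sum>k<idx j t. norm (x j (Suc k) - x j k)) \<le> M * t"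
      by (rule limit_bounds[of R]) (rule that)
    have "\<forall>\<^sub>F j in U. (\<Sum>k<idx j s. norm (x j (Suc k) - x j k)) \<le> M * s \<and> norm (p j s) < R0 + 1 \<and> \<phi> (p j s) < \<phi> z + \<epsilon>"
      by (intro eventually_conj M s(1) R order_tendstoD(2)[OF tendsto_norm[OF limits(1)[OF R]]] order_tendstoD(2)[OF limits(4)[OF R]])
        (use R0[OF s(1)] s in auto)
    then have "\<forall>\<^sub>F j in U. \<exists>k. norm (x j k) \<le> R0 + 1 \<and> \<phi> (x j k) < \<phi> z + \<epsilon> \<and> (\<Sum>i<k. norm (x j (Suc i) - x j i)) \<le> M * s"
      by (rule eventually_mono) (auto simp: p_def intro: less_imp_le)
    then show "\<exists>B. \<forall>\<^sub>F j in U. \<exists>k. norm (x j k) \<le> R0 + 1 \<and> \<phi> (x j k) < \<phi> z + \<epsilon> \<and> (\<Sum>i<k. norm (x j (Suc i) - x j i)) \<le> B" ..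
  qed
qed

end

context bounded_descent_model begin

lemma tracking:
  assumes run: "\<And>j. run (\<alpha> j) (K j) (x j)" and \<alpha>: "\<And>j. 0 < \<alpha> j" "\<And>j. \<alpha> j \<le> 1 / (real j + 1)"
    and x: "\<And>j. norm (x j 0) \<le> r" "\<And>j. \<phi> (x j 0) \<le> lam"
  obtains U R0 v where "U \<noteq> bot" "U \<le> sequentially" "v \<le> lam" "\<exists>z. 0 \<in> SD z \<and> \<phi> z = v"
    "\<And>\<epsilon>. \<epsilon> > 0 \<Longrightarrow> \<exists>B. \<forall>\<^sub>F j in U. \<exists>k. norm (x j k) \<le> R0 + 1 \<and> \<phi> (x j k) < v + \<epsilon> \<and> (\<Sum>i<k. norm (x j (Suc i) - x j i)) \<le> B"
proof -
  obtain U where Uf: "U \<le> (sequentially :: nat filter)" "U \<noteq> bot" "\<And>P. eventually P U \<or> eventually (\<lambda>j. \<not> P j) U"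
    by (rule ultrafilter_below[of sequentially]) auto
  interpret descent_limit D \<phi> SD \<kappa> \<beta> step x \<alpha> K U r
    by unfold_locales (use assms Uf in auto)
  show thesis by (rule tracking_limit[OF x(2)]) (rule that[OF Uf(2,1)])
qed

end

subsection \<open>Uniform length bounds\<close>

context descent_model begin

lemma run_dist: "norm (x n - x 0) \<le> (\<Sum>k<n. norm (x (Suc k) - x k))" for x :: "nat \<Rightarrow> 'a"
proof -
  have "x n - x 0 = (\<Sum>k<n. x (Suc k) - x k)" by (simp add: sum_lessThan_telescope)
  then show ?thesis by (simp add: norm_sum)
qed

text \<open>A bootstrap: above the lower threshold \<open>kl_phase\<close> keeps the length at most
  1/2, and this keeps the iterates in the ball of radius \<open>R + 1\<close> where it applies. One
  further step of length at most 1/2 may cross the threshold.\<close>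

lemma critical_level_passage:
  obtains \<delta> \<alpha>1 where "\<delta> > 0" "\<alpha>1 > 0" "\<And>\<alpha> K z. 0 < \<alpha> \<Longrightarrow> \<alpha> \<le> \<alpha>1 \<Longrightarrow> run \<alpha> K z \<Longrightarrow>
    norm (z 0) \<le> R \<Longrightarrow> \<phi> (z 0) < v + \<delta> \<Longrightarrow>
    (\<forall>n. (\<Sum>i<n. norm (z (Suc i) - z i)) \<le> 1) \<or>
    (\<exists>m. (\<Sum>i<m. norm (z (Suc i) - z i)) \<le> 1 \<and> norm (z m) \<le> R + 1 \<and> \<phi> (z m) \<le> v - \<delta>)"
proof -
  obtain \<delta> \<alpha>1 where kl0: "\<delta> > 0" "\<alpha>1 > 0" and kl: "\<And>\<alpha> K x n. 0 < \<alpha> \<Longrightarrow> \<alpha> \<le> \<alpha>1 \<Longrightarrow> run \<alpha> K x \<Longrightarrow>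
    \<forall>k\<le>n. norm (x k) \<le> R + 1 \<and> \<bar>\<phi> (x k) - v\<bar> < \<delta> \<Longrightarrow> (\<Sum>k<n. norm (x (Suc k) - x k)) \<le> 1 / 2"
    by (rule kl_phase[of "1 / 2" "R + 1" v], simp) (rule that)
  obtain M abar where M: "M > 0" "abar > 0"
    and S1: "\<And>\<alpha> K x k. 0 < \<alpha> \<Longrightarrow> \<alpha> \<le> abar \<Longrightarrow> run \<alpha> K x \<Longrightarrow> norm (x k) \<le> R + 1 \<Longrightarrow> norm (x (Suc k) - x k) \<le> M * stepsize \<alpha> K k"
    and S2: "\<And>\<alpha> K x k. 0 < \<alpha> \<Longrightarrow> \<alpha> \<le> abar \<Longrightarrow> run \<alpha> K x \<Longrightarrow> norm (x k) \<le> R + 1 \<Longrightarrow>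
      \<phi> (x (Suc k)) \<le> \<phi> (x k) - (norm (x (Suc k) - x k))\<^sup>2 / (2 * stepsize \<alpha> K k) + \<kappa> * M * stepsize \<alpha> K k ^ 3"
    by (rule step_constants[of "R + 1"]) (rule that)
  obtain C where C: "C > 0" "\<And>\<alpha> K k. 0 < \<alpha> \<Longrightarrow> \<alpha> \<le> 1 \<Longrightarrow> excess \<alpha> K k \<le> C * \<alpha>" by (rule excess_le) (rule that)
  \<comment> \<open>The last two bounds make a single step at most 1/2 long and the excess term at
    most \<open>\<delta> / 2\<close>.\<close>
  define \<alpha>2 where "\<alpha>2 = min (min \<alpha>1 abar) (min 1 (min (1 / (2 * M)) (\<delta> / (2 * M * C))))"
  have \<alpha>2: "\<alpha>2 > 0" using kl0 M C by (simp add: \<alpha>2_def)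
  \<comment> \<open>Half of the \<delta> of \<open>kl_phase\<close> is handed out; the other half
    pays for the excess, so that values starting below \<open>v + \<delta> / 2\<close> stay below
    \<open>v + \<delta>\<close>.\<close>
  have d2: "\<delta> / 2 > 0" using kl0 by simp
  show thesis
  proof (rule that[OF d2 \<alpha>2])
    fix \<alpha> :: real and K :: nat and z :: "nat \<Rightarrow> 'a"
    assume \<alpha>: "0 < \<alpha>" "\<alpha> \<le> \<alpha>2" and run: "run \<alpha> K z" and z0: "norm (z 0) \<le> R" "\<phi> (z 0) < v + \<delta> / 2"
    have \<alpha>': "\<alpha> \<le> \<alpha>1" "\<alpha> \<le> abar" "\<alpha> \<le> 1" "M * \<alpha> \<le> 1 / 2" "M * (C * \<alpha>) \<le> \<delta> / 2"
    proof -
      show "\<alpha> \<le> \<alpha>1" "\<alpha> \<le> abar" "\<alpha> \<le> 1" using \<alpha> by (auto simp: \<alpha>2_def)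
      have "\<alpha> \<le> 1 / (2 * M)" "\<alpha> \<le> \<delta> / (2 * M * C)" using \<alpha> by (auto simp: \<alpha>2_def)
      then show "M * \<alpha> \<le> 1 / 2" "M * (C * \<alpha>) \<le> \<delta> / 2" using M C by (auto simp: field_simps)
    qed
    define S where "S n = (\<Sum>i<n. norm (z (Suc i) - z i))" for n
    define E where "E k = \<phi> (z k) + M * excess \<alpha> K k" for k
    have near: "norm (z n) \<le> R + S n" for n
      using norm_triangle_ineq2[of "z n" "z 0"] run_dist[of z n] z0(1) unfolding S_def by linarith
    have step: "norm (z (Suc k) - z k) \<le> 1 / 2" if "norm (z k) \<le> R + 1" for k
    proof -
      have "norm (z (Suc k) - z k) \<le> M * stepsize \<alpha> K k" by (rule S1[OF \<alpha>(1) \<alpha>'(2) run that])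
      also have "\<dots> \<le> M * \<alpha>" using stepsize_le[OF \<alpha>(1)] M by simp
      finally show ?thesis using \<alpha>'(4) by linarith
    qed
    have E_Suc: "E (Suc k) \<le> E k" if "norm (z k) \<le> R + 1" for k
    proof -
      have "\<phi> (z (Suc k)) \<le> \<phi> (z k) - (norm (z (Suc k) - z k))\<^sup>2 / (2 * stepsize \<alpha> K k) + M * (\<kappa> * stepsize \<alpha> K k ^ 3)"
        using S2[OF \<alpha>(1) \<alpha>'(2) run that] by (simp add: algebra_simps)
      moreover have "M * (\<kappa> * stepsize \<alpha> K k ^ 3) \<le> M * (excess \<alpha> K k - excess \<alpha> K (Suc k))"
        using excess_decrease[OF \<alpha>(1)] M by simp
      moreover have "0 \<le> (norm (z (Suc k) - z k))\<^sup>2 / (2 * stepsize \<alpha> K k)" using stepsize_pos[OF \<alpha>(1), of K k] by simp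
      ultimately show ?thesis unfolding E_def by (simp only: right_diff_distrib)
    qed
    have upper: "\<phi> (z n) < v + \<delta>" if "\<forall>k<n. norm (z k) \<le> R + 1" for n
    proof -
      have "E n \<le> E 0" using that
      proof (induction n)
        case (Suc n)
        then show ?case using E_Suc[of n] by fastforce
      qed simp
      moreover have "M * excess \<alpha> K 0 \<le> M * (C * \<alpha>)" using C(2)[OF \<alpha>(1) \<alpha>'(3)] M by simp
      moreover have "0 \<le> M * excess \<alpha> K n" using excess_nonneg[OF \<alpha>(1)] M by simp
      ultimately show ?thesis using z0(2) \<alpha>'(5) unfolding E_def by linarith
    qed
    have stay: "S n \<le> 1 / 2" if "\<forall>i\<le>n. v - \<delta> / 2 < \<phi> (z i)" for n
      using that
    proof (induction n)
      case (Suc n)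
      have Sn: "S k \<le> 1 / 2" if "k \<le> n" for k
      proof -
        have "S k \<le> S n" unfolding S_def using that by (intro sum_mono2) auto
        then show ?thesis using Suc by simp
      qed
      have R1: "norm (z k) \<le> R + 1" if "k \<le> Suc n" for k
      proof (cases "k = Suc n")
        case True
        have "norm (z n) \<le> R + 1" using near[of n] Sn[of n] by simp
        then show ?thesis using step[of n] near[of n] Sn[of n] norm_triangle_ineq2[of "z (Suc n)" "z n"] True by simp
      next
        case False
        then show ?thesis using near[of k] Sn[of k] that by simp
      qed
      show ?case unfolding S_def
      proof (rule kl[OF \<alpha>(1) \<alpha>'(1) run], intro allI impI)
        fix k assume k: "k \<le> Suc n"
        have "\<phi> (z k) < v + \<delta>" by (rule upper) (use R1 k in auto)
        moreover have "v - \<delta> / 2 < \<phi> (z k)" using Suc.prems k by blast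
        ultimately show "norm (z k) \<le> R + 1 \<and> \<bar>\<phi> (z k) - v\<bar> < \<delta>" using R1[OF k] kl0(1) by linarith
      qed
    qed (simp add: S_def)
    show "(\<forall>n. (\<Sum>i<n. norm (z (Suc i) - z i)) \<le> 1) \<or>
      (\<exists>m. (\<Sum>i<m. norm (z (Suc i) - z i)) \<le> 1 \<and> norm (z m) \<le> R + 1 \<and> \<phi> (z m) \<le> v - \<delta> / 2)"
    proof (cases "\<forall>i. v - \<delta> / 2 < \<phi> (z i)")
      case True
      then have "S n \<le> 1" for n using stay[of n] by simp
      then show ?thesis unfolding S_def by blast
    next
      case False
      define m where "m = (LEAST i. \<phi> (z i) \<le> v - \<delta> / 2)"
      have m: "\<phi> (z m) \<le> v - \<delta> / 2" unfolding m_def by (rule LeastI_ex) (use False in \<open>auto simp: not_less\<close>)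
      have "S m \<le> 1"
      proof (cases m)
        case (Suc k)
        have "v - \<delta> / 2 < \<phi> (z i)" if "i \<le> k" for i
          using not_less_Least[of i "\<lambda>i. \<phi> (z i) \<le> v - \<delta> / 2"] that Suc unfolding m_def[symmetric] by simp
        then have "S k \<le> 1 / 2" by (intro stay) blast
        moreover from this have "norm (z (Suc k) - z k) \<le> 1 / 2" using near[of k] by (intro step) linarith
        ultimately show ?thesis by (simp add: Suc S_def)
      qed (simp add: S_def)
      then show ?thesis using near[of m] m unfolding S_def by (intro disjI2 exI[of _ m]) auto
    qed
  qed
qed

end

context bounded_descent_model begin

text \<open>The quantification over all offsets \<open>K\<close> carries the induction: its
  hypothesis is applied to tails of the sequences, which start at indices without a common
  bound.\<close>

theorem uniform_length:
  "\<exists>abar>0. \<exists>c. \<forall>\<alpha> K x. 0 < \<alpha> \<longrightarrow> \<alpha> \<le> abar \<longrightarrow> run \<alpha> K x \<longrightarrow> norm (x 0) \<le> r \<longrightarrow> \<phi> (x 0) \<le> lam \<longrightarrow>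
     (\<forall>n. (\<Sum>k<n. norm (x (Suc k) - x k)) \<le> c)"
proof (induction "card {t. t \<le> lam \<and> (\<exists>z. 0 \<in> SD z \<and> \<phi> z = t)}" arbitrary: r lam rule: less_induct)
  case less
  show ?case
  proof (rule ccontr)
    assume contr: "\<not> ?case"
    have "\<exists>\<alpha> K x n. 0 < \<alpha> \<and> \<alpha> \<le> 1 / (real j + 1) \<and> run \<alpha> K x \<and> norm (x 0) \<le> r \<and> \<phi> (x 0) \<le> lam \<and>
        real j < (\<Sum>k<n. norm (x (Suc k) - x k))" for j
    proof (rule ccontr)
      assume H: "\<nexists>\<alpha> K x n. 0 < \<alpha> \<and> \<alpha> \<le> 1 / (real j + 1) \<and> run \<alpha> K x \<and> norm (x 0) \<le> r \<and> \<phi> (x 0) \<le> lam \<and>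
        real j < (\<Sum>k<n. norm (x (Suc k) - x k))"
      have holds: ?case
      proof (rule exI[of _ "1 / (real j + 1)"], rule conjI, simp, rule exI[of _ "real j"], intro allI impI)
        fix \<alpha> K x n assume A: "0 < \<alpha>" "\<alpha> \<le> 1 / (real j + 1)" "run \<alpha> K x" "norm (x 0) \<le> r" "\<phi> (x 0) \<le> lam"
        show "(\<Sum>k<n. norm (x (Suc k) - x k)) \<le> real j"
        proof (rule ccontr)
          assume "\<not> ?thesis"
          then have "real j < (\<Sum>k<n. norm (x (Suc k) - x k))" by simp
          then show False using H A by blast
        qed
      qed
      show False by (rule notE[OF contr holds])
    qed
    then have "\<forall>j. \<exists>\<alpha> K x n. 0 < \<alpha> \<and> \<alpha> \<le> 1 / (real j + 1) \<and> run \<alpha> K x \<and> norm (x 0) \<le> r \<and> \<phi> (x 0) \<le> lam \<and>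
        real j < (\<Sum>k<n. norm (x (Suc k) - x k))" by blast
    from this[THEN choice] obtain \<alpha> where "\<forall>j. \<exists>K x n. 0 < \<alpha> j \<and> \<alpha> j \<le> 1 / (real j + 1) \<and> run (\<alpha> j) K x \<and> norm (x 0) \<le> r \<and>
        \<phi> (x 0) \<le> lam \<and> real j < (\<Sum>k<n. norm (x (Suc k) - x k))" by (rule exE)
    from this[THEN choice] obtain K where "\<forall>j. \<exists>x n. 0 < \<alpha> j \<and> \<alpha> j \<le> 1 / (real j + 1) \<and> run (\<alpha> j) (K j) x \<and> norm (x 0) \<le> r \<and>
        \<phi> (x 0) \<le> lam \<and> real j < (\<Sum>k<n. norm (x (Suc k) - x k))" by (rule exE)
    from this[THEN choice] obtain x where "\<forall>j. \<exists>n. 0 < \<alpha> j \<and> \<alpha> j \<le> 1 / (real j + 1) \<and> run (\<alpha> j) (K j) (x j) \<and> norm (x j 0) \<le> r \<and>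
        \<phi> (x j 0) \<le> lam \<and> real j < (\<Sum>k<n. norm (x j (Suc k) - x j k))" by (rule exE)
    from this[THEN choice] obtain N where all: "\<forall>j. 0 < \<alpha> j \<and> \<alpha> j \<le> 1 / (real j + 1) \<and> run (\<alpha> j) (K j) (x j) \<and> norm (x j 0) \<le> r \<and>
        \<phi> (x j 0) \<le> lam \<and> real j < (\<Sum>k<N j. norm (x j (Suc k) - x j k))" by (rule exE)
    have \<alpha>: "\<And>j. 0 < \<alpha> j" "\<And>j. \<alpha> j \<le> 1 / (real j + 1)" and run: "\<And>j. run (\<alpha> j) (K j) (x j)"
      and x0: "\<And>j. norm (x j 0) \<le> r" "\<And>j. \<phi> (x j 0) \<le> lam"
      and long: "\<And>j. real j < (\<Sum>k<N j. norm (x j (Suc k) - x j k))"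
      using all by blast+
    obtain U R0 v where U: "U \<noteq> bot" "U \<le> sequentially" and v: "v \<le> lam" "\<exists>z. 0 \<in> SD z \<and> \<phi> z = v"
      and tr: "\<And>\<epsilon>. \<epsilon> > 0 \<Longrightarrow> \<exists>B. \<forall>\<^sub>F j in U. \<exists>k. norm (x j k) \<le> R0 + 1 \<and> \<phi> (x j k) < v + \<epsilon> \<and> (\<Sum>i<k. norm (x j (Suc i) - x j i)) \<le> B"
      by (rule tracking[OF run \<alpha> x0]) (rule that)
    obtain \<delta> \<alpha>1 where \<delta>: "\<delta> > 0" "\<alpha>1 > 0" and pass: "\<And>\<alpha> K z. 0 < \<alpha> \<Longrightarrow> \<alpha> \<le> \<alpha>1 \<Longrightarrow> run \<alpha> K z \<Longrightarrow>
      norm (z 0) \<le> R0 + 1 \<Longrightarrow> \<phi> (z 0) < v + \<delta> \<Longrightarrow>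
      (\<forall>n. (\<Sum>i<n. norm (z (Suc i) - z i)) \<le> 1) \<or>
      (\<exists>m. (\<Sum>i<m. norm (z (Suc i) - z i)) \<le> 1 \<and> norm (z m) \<le> R0 + 1 + 1 \<and> \<phi> (z m) \<le> v - \<delta>)"
      by (rule critical_level_passage[of "R0 + 1" v]) (rule that)
    \<comment> \<open>At least the critical value \<open>v\<close> itself is lost.\<close>
    have "card {t. t \<le> v - \<delta> \<and> (\<exists>z. 0 \<in> SD z \<and> \<phi> z = t)} < card {t. t \<le> lam \<and> (\<exists>z. 0 \<in> SD z \<and> \<phi> z = t)}"
    proof (rule psubset_card_mono)
      show "finite {t. t \<le> lam \<and> (\<exists>z. 0 \<in> SD z \<and> \<phi> z = t)}"
        by (rule finite_subset[OF _ finite_critical_values]) auto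
      have "v \<in> {t. t \<le> lam \<and> (\<exists>z. 0 \<in> SD z \<and> \<phi> z = t)}" "v \<notin> {t. t \<le> v - \<delta> \<and> (\<exists>z. 0 \<in> SD z \<and> \<phi> z = t)}"
        using v \<delta> by auto
      moreover have "{t. t \<le> v - \<delta> \<and> (\<exists>z. 0 \<in> SD z \<and> \<phi> z = t)} \<subseteq> {t. t \<le> lam \<and> (\<exists>z. 0 \<in> SD z \<and> \<phi> z = t)}"
        using v(1) \<delta> by auto
      ultimately show "{t. t \<le> v - \<delta> \<and> (\<exists>z. 0 \<in> SD z \<and> \<phi> z = t)} \<subset> {t. t \<le> lam \<and> (\<exists>z. 0 \<in> SD z \<and> \<phi> z = t)}" by blast
    qed
    from less[OF this, of "R0 + 1 + 1"] obtain a1 c where a1: "0 < a1" and c0: "\<forall>\<alpha> K x. 0 < \<alpha> \<longrightarrow> \<alpha> \<le> a1 \<longrightarrow> run \<alpha> K x \<longrightarrow>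
      norm (x 0) \<le> R0 + 1 + 1 \<longrightarrow> \<phi> (x 0) \<le> v - \<delta> \<longrightarrow> (\<forall>n. (\<Sum>k<n. norm (x (Suc k) - x k)) \<le> c)" by blast
    note c = c0[rule_format]
    obtain B where B: "\<forall>\<^sub>F j in U. \<exists>k. norm (x j k) \<le> R0 + 1 \<and> \<phi> (x j k) < v + \<delta> \<and> (\<Sum>i<k. norm (x j (Suc i) - x j i)) \<le> B"
      using tr[OF \<delta>(1)] by blast
    have "(\<lambda>j. 1 / (real j + 1)) \<longlonglongrightarrow> 0" using LIMSEQ_inverse_real_of_nat by (simp add: inverse_eq_divide add.commute)
    then have "\<forall>\<^sub>F j in sequentially. 1 / (real j + 1) < min \<alpha>1 a1" by (rule order_tendstoD) (use \<delta> a1 in simp)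
    \<comment> \<open>The length is at most \<open>B\<close> until the level \<open>v\<close> is
      approached, 1 during the passage and \<open>\<bar>c\<bar>\<close> afterwards, whereas sequence
      \<open>j\<close> is longer than \<open>j\<close>.\<close>
    moreover have "\<forall>\<^sub>F j in sequentially. B + 1 + \<bar>c\<bar> \<le> real j" using filterlim_real_sequentially unfolding filterlim_at_top by blast
    ultimately have "\<forall>\<^sub>F j in sequentially. 1 / (real j + 1) < min \<alpha>1 a1 \<and> B + 1 + \<bar>c\<bar> \<le> real j" by (rule eventually_conj)
    then have "\<forall>\<^sub>F j in U. 1 / (real j + 1) < min \<alpha>1 a1 \<and> B + 1 + \<bar>c\<bar> \<le> real j" using U(2) by (rule filter_leD[rotated])
    then have "\<exists>j. (1 / (real j + 1) < min \<alpha>1 a1 \<and> B + 1 + \<bar>c\<bar> \<le> real j) \<and>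
      (\<exists>k. norm (x j k) \<le> R0 + 1 \<and> \<phi> (x j k) < v + \<delta> \<and> (\<Sum>i<k. norm (x j (Suc i) - x j i)) \<le> B)"
      using eventually_happens'[OF U(1) eventually_conj[OF _ B]] by blast
    then obtain j k where j: "1 / (real j + 1) < min \<alpha>1 a1" "B + 1 + \<bar>c\<bar> \<le> real j"
      and k: "norm (x j k) \<le> R0 + 1" "\<phi> (x j k) < v + \<delta>" "(\<Sum>i<k. norm (x j (Suc i) - x j i)) \<le> B" by blast
    have \<alpha>j: "0 < \<alpha> j" "\<alpha> j \<le> \<alpha>1" "\<alpha> j \<le> a1" using \<alpha>[of j] j(1) by auto
    define z where "z i = x j (k + i)" for i
    have rz: "run (\<alpha> j) (K j + k) z" unfolding z_def by (rule run_shift[OF \<alpha>(1) run])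
    have split: "(\<Sum>i<m + n. norm (w (Suc i) - w i)) =
        (\<Sum>i<m. norm (w (Suc i) - w i)) + (\<Sum>i<n. norm (w (m + Suc i) - w (m + i)))" for m n and w :: "nat \<Rightarrow> 'a"
      by (induction n) auto
    have tail: "(\<Sum>i<n. norm (z (Suc i) - z i)) \<le> 1 + \<bar>c\<bar>" for n
    proof -
      consider "\<And>n. (\<Sum>i<n. norm (z (Suc i) - z i)) \<le> 1"
        | m where "(\<Sum>i<m. norm (z (Suc i) - z i)) \<le> 1" "norm (z m) \<le> R0 + 1 + 1" "\<phi> (z m) \<le> v - \<delta>"
        using pass[OF \<alpha>j(1,2) rz] k(1,2) unfolding z_def by auto
      then show ?thesis
      proof cases
        case (2 m)
        have "(\<Sum>i<n. norm (z (m + Suc i) - z (m + i))) \<le> c"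
          by (rule c[OF \<alpha>j(1,3) run_shift[OF \<alpha>j(1) rz, of m]]) (use 2 in auto)
        moreover have "(\<Sum>i<n. norm (z (Suc i) - z i)) \<le> (\<Sum>i<m + n. norm (z (Suc i) - z i))" by (rule sum_mono2) auto
        ultimately show ?thesis using split[of z m n] 2(1) by linarith
      qed (meson abs_ge_zero add_increasing2 order_trans)
    qed
    have "(\<Sum>i<N j. norm (x j (Suc i) - x j i)) \<le> (\<Sum>i<k + N j. norm (x j (Suc i) - x j i))" by (rule sum_mono2) auto
    also have "\<dots> \<le> B + (1 + \<bar>c\<bar>)" using split[of "x j" k "N j"] k(3) tail[of "N j"] unfolding z_def by simp
    finally show False using long[of j] j(2) by linarith
  qed
qed

end

subsection \<open>Convergence and rate\<close>

lemma summable_dyadic_block: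
  fixes F :: "nat \<Rightarrow> real"
  assumes "summable F"
  shows "(\<lambda>k. \<Sum>i\<in>{k div 2..<k}. F i) \<longlonglongrightarrow> 0"
proof -
  have S: "(\<lambda>n. \<Sum>i<n. F i) \<longlonglongrightarrow> suminf F" using assms by (simp add: summable_LIMSEQ)
  have half: "filterlim (\<lambda>k::nat. k div 2) at_top sequentially"
    unfolding filterlim_at_top
  proof
    fix Z :: nat
    show "\<forall>\<^sub>F k in sequentially. Z \<le> k div 2" using eventually_ge_at_top[of "2 * Z"] by (rule eventually_mono) auto
  qed
  have "(\<lambda>k. (\<Sum>i<k. F i) - (\<Sum>i<k div 2. F i)) \<longlonglongrightarrow> suminf F - suminf F"
    by (intro tendsto_diff S filterlim_compose[OF S half])
  moreover have "(\<Sum>i<k. F i) - (\<Sum>i<k div 2. F i) = (\<Sum>i\<in>{k div 2..<k}. F i)" for k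
  proof -
    have "{..<k} = {..<k div 2} \<union> {k div 2..<k}" by auto
    then show ?thesis by (simp add: sum.union_disjoint ivl_disj_int)
  qed
  ultimately show ?thesis by simp
qed

context descent_model begin

text \<open>The sum of \<open>a i * norm (w i)\<close> over a dyadic block is dominated by a block
  of a convergent series and tends to 0, while the weights \<open>a i\<close> in the block add up to
  at least \<open>\<alpha> / 2 * k powr (1 - \<beta>)\<close>. So the smallest
  \<open>norm (w i)\<close> of the block has the asserted rate.\<close>

lemma run_convergence:
  obtains abar where "abar > 0" "\<And>\<alpha> x. 0 < \<alpha> \<Longrightarrow> \<alpha> \<le> abar \<Longrightarrow> run \<alpha> 0 x \<Longrightarrow> norm (x 0) \<le> R \<Longrightarrow>
    (\<forall>n. (\<Sum>k<n. norm (x (Suc k) - x k)) \<le> c) \<Longrightarrow>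
    (\<exists>xs. x \<longlonglongrightarrow> xs \<and> 0 \<in> SD xs) \<and> summable (\<lambda>k. norm (x (Suc k) - x k)) \<and> (\<Sum>k. norm (x (Suc k) - x k)) \<le> c \<and>
    (\<exists>w e. (\<forall>k. w k \<in> SD (x (Suc k))) \<and> e \<longlonglongrightarrow> 0 \<and>
       (\<forall>k\<ge>1. \<exists>i\<in>{k div 2..<k}. norm (w i) \<le> e k * real k powr (\<beta> - 1)))"
proof -
  obtain M abar where M: "M > 0" and abar: "abar > 0"
    and S3: "\<And>\<alpha> K x k. 0 < \<alpha> \<Longrightarrow> \<alpha> \<le> abar \<Longrightarrow> run \<alpha> K x \<Longrightarrow> norm (x k) \<le> R + c \<Longrightarrow>
      \<exists>w\<in>SD (x (Suc k)). stepsize \<alpha> K k * norm w \<le> 2 * norm (x (Suc k) - x k) + \<kappa> * M * (stepsize \<alpha> K k)\<^sup>2"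
    by (rule step_constants[of "R + c"]) (rule that)
  show thesis
  proof (rule that[OF abar], intro conjI)
    fix \<alpha> :: real and x :: "nat \<Rightarrow> 'a"
    assume \<alpha>: "0 < \<alpha>" "\<alpha> \<le> abar" and run: "run \<alpha> 0 x" and x0: "norm (x 0) \<le> R"
      and len: "\<forall>n. (\<Sum>k<n. norm (x (Suc k) - x k)) \<le> c"
    define a where "a = stepsize \<alpha> 0"
    define d where "d k = norm (x (Suc k) - x k)" for k
    have a: "a k > 0" for k using stepsize_pos[OF \<alpha>(1)] by (simp add: a_def)
    have sd: "summable d"
      by (rule summableI_nonneg_bounded[of _ c]) (use len in \<open>auto simp: d_def\<close>)
    have dd: "d = (\<lambda>k. norm (x (Suc k) - x k))" by (rule ext) (simp add: d_def)
    show "summable (\<lambda>k. norm (x (Suc k) - x k))" using sd unfolding dd .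
    show "(\<Sum>k. norm (x (Suc k) - x k)) \<le> c"
      by (rule suminf_le_const) (use sd len in \<open>simp_all add: dd\<close>)
    have bd: "norm (x k) \<le> R + c" for k
      using norm_triangle_ineq2[of "x k" "x 0"] run_dist[of x k] len[rule_format, of k] x0 by linarith
    have "\<forall>k. \<exists>w. w \<in> SD (x (Suc k)) \<and> a k * norm w \<le> 2 * d k + \<kappa> * M * (a k)\<^sup>2"
      using S3[OF \<alpha> run bd] unfolding a_def d_def by blast
    from this[THEN choice] obtain w where w: "\<And>k. w k \<in> SD (x (Suc k))" "\<And>k. a k * norm (w k) \<le> 2 * d k + \<kappa> * M * (a k)\<^sup>2" by blast
    have "summable (\<lambda>k. x (Suc k) - x k)" using sd unfolding dd by (rule summable_norm_cancel)
    then have "(\<lambda>n. \<Sum>k<n. x (Suc k) - x k) \<longlonglongrightarrow> (\<Sum>k. x (Suc k) - x k)" by (rule summable_LIMSEQ)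
    then have "(\<lambda>n. (\<Sum>k<n. x (Suc k) - x k) + x 0) \<longlonglongrightarrow> (\<Sum>k. x (Suc k) - x k) + x 0" by (intro tendsto_add tendsto_const)
    then obtain xs where xs: "x \<longlonglongrightarrow> xs" by (simp add: sum_lessThan_telescope)
    have "summable (\<lambda>k. \<kappa> * (a k)\<^sup>2)"
    proof (cases "\<kappa> = 0")
      case False
      then have b: "\<beta> > 1 / 2" using \<kappa>\<beta> by auto
      have "summable (\<lambda>k. real k powr (- (2 * \<beta>)))" using b by (simp add: summable_real_powr_iff)
      then have "summable (\<lambda>k. real (Suc k) powr (- (2 * \<beta>)))" by (subst summable_Suc_iff[of "\<lambda>k. real k powr (- (2 * \<beta>))"])
      then have "summable (\<lambda>k. (\<kappa> * \<alpha>\<^sup>2) * real (Suc k) powr (- (2 * \<beta>)))" by (rule summable_mult)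
      moreover have "(\<kappa> * \<alpha>\<^sup>2) * real (Suc k) powr (- (2 * \<beta>)) = \<kappa> * (a k)\<^sup>2" for k
      proof -
        have "(real (Suc k) powr \<beta>)\<^sup>2 = real (Suc k) powr (2 * \<beta>)" by (subst powr_power) (auto simp: mult.commute)
        moreover have "a k = \<alpha> / real (Suc k) powr \<beta>" by (simp add: a_def stepsize_def add.commute)
        ultimately show ?thesis by (simp add: power_mult_distrib power_inverse powr_minus divide_inverse del: of_nat_Suc)
      qed
      ultimately show ?thesis by (simp only:)
    qed simp
    from summable_add[OF summable_mult[OF sd, of 2] summable_mult[OF this, of M]]
    have "summable (\<lambda>k. 2 * d k + M * (\<kappa> * (a k)\<^sup>2))" .
    from summable_dyadic_block[OF this] have blk: "(\<lambda>k. \<Sum>i\<in>{k div 2..<k}. 2 * d i + M * (\<kappa> * (a i)\<^sup>2)) \<longlonglongrightarrow> 0" .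
    define e where "e k = 2 / \<alpha> * (\<Sum>i\<in>{k div 2..<k}. 2 * d i + M * (\<kappa> * (a i)\<^sup>2))" for k
    have e: "e \<longlonglongrightarrow> 0" using tendsto_mult[OF tendsto_const[of "2 / \<alpha>"] blk] unfolding e_def by simp
    have rate: "\<exists>i\<in>{k div 2..<k}. norm (w i) \<le> e k * real k powr (\<beta> - 1)" if k: "k \<ge> 1" for k
    proof (rule ccontr)
      assume "\<not> ?thesis"
      then have big: "e k * real k powr (\<beta> - 1) < norm (w i)" if "i \<in> {k div 2..<k}" for i using that by (meson not_less)
      have ne: "{k div 2..<k} \<noteq> {}" using k by auto
      have e0: "0 \<le> e k" unfolding e_def using \<alpha>(1) M \<kappa>(1) by (intro mult_nonneg_nonneg sum_nonneg add_nonneg_nonneg) (auto simp: d_def)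
      have "\<alpha> / 2 * e k = (\<Sum>i\<in>{k div 2..<k}. 2 * d i + M * (\<kappa> * (a i)\<^sup>2))" using \<alpha>(1) by (simp add: e_def)
      also have "\<dots> \<ge> (\<Sum>i\<in>{k div 2..<k}. a i * norm (w i))"
        using w(2) by (intro sum_mono) (simp add: mult_ac)
      finally have 1: "(\<Sum>i\<in>{k div 2..<k}. a i * norm (w i)) \<le> \<alpha> / 2 * e k" .
      have 2: "(\<Sum>i\<in>{k div 2..<k}. \<alpha> / real k powr \<beta> * (e k * real k powr (\<beta> - 1))) < (\<Sum>i\<in>{k div 2..<k}. a i * norm (w i))"
      proof (rule sum_strict_mono[OF _ ne])
        fix i assume i: "i \<in> {k div 2..<k}"
        \<comment> \<open>Here \<open>i < k\<close> gives \<open>i + 1 \<le> k\<close>, which takes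
          care of the shift in the step size.\<close>
        have "(real i + real 0 + 1) powr \<beta> \<le> real k powr \<beta>" using i \<beta> by (intro powr_mono2) auto
        then have ai: "\<alpha> / real k powr \<beta> \<le> a i" unfolding a_def stepsize_def using \<alpha>(1) k by (intro divide_left_mono mult_pos_pos) auto
        have "\<alpha> / real k powr \<beta> * (e k * real k powr (\<beta> - 1)) \<le> a i * (e k * real k powr (\<beta> - 1))"
          using ai e0 by (intro mult_right_mono) auto
        also have "\<dots> < a i * norm (w i)" using big[OF i] a[of i] by simp
        finally show "\<alpha> / real k powr \<beta> * (e k * real k powr (\<beta> - 1)) < a i * norm (w i)" .
      qed simp
      have 3: "\<alpha> / real k powr \<beta> * (e k * real k powr (\<beta> - 1)) = \<alpha> * e k / real k"
        using k by (simp add: powr_diff)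
      have 4: "\<alpha> / 2 * e k \<le> (\<Sum>i\<in>{k div 2..<k}. \<alpha> * e k / real k)"
      proof -
        have "real k / 2 \<le> real (k - k div 2)" by linarith
        then have "real k / 2 * (\<alpha> * e k / real k) \<le> real (k - k div 2) * (\<alpha> * e k / real k)"
          using \<alpha>(1) e0 by (intro mult_right_mono) auto
        then show ?thesis using k by (simp add: field_simps)
      qed
      show False using 1 2 4 unfolding 3 by linarith
    qed
    show "\<exists>w e. (\<forall>k. w k \<in> SD (x (Suc k))) \<and> e \<longlonglongrightarrow> 0 \<and>
       (\<forall>k\<ge>1. \<exists>i\<in>{k div 2..<k}. norm (w i) \<le> e k * real k powr (\<beta> - 1))"
      using w(1) e rate by blast
    \<comment> \<open>The blocks move to infinity, so the chosen iterates converge to the limit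
      while their subgradients tend to 0; the graph of \<open>SD\<close> is closed.\<close>
    have "\<forall>k. \<exists>i. Suc k div 2 \<le> i \<and> norm (w i) \<le> e (Suc k) * real (Suc k) powr (\<beta> - 1)"
      using rate[of "Suc _"] by fastforce
    from this[THEN choice] obtain \<iota> where \<iota>: "\<And>k. Suc k div 2 \<le> \<iota> k" "\<And>k. norm (w (\<iota> k)) \<le> e (Suc k) * real (Suc k) powr (\<beta> - 1)" by blast
    have wl: "(\<lambda>k. w (\<iota> k)) \<longlonglongrightarrow> 0"
    proof (rule Lim_null_comparison)
      show "(\<lambda>k. \<bar>e (Suc k)\<bar>) \<longlonglongrightarrow> 0" using tendsto_rabs[OF LIMSEQ_Suc[OF e]] by simp
      show "\<forall>\<^sub>F k in sequentially. norm (w (\<iota> k)) \<le> \<bar>e (Suc k)\<bar>"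
      proof (rule always_eventually, rule allI)
        fix k
        have "real (Suc k) powr (\<beta> - 1) \<le> real (Suc k) powr 0" using \<beta> by (intro powr_mono) auto
        then have "\<bar>e (Suc k)\<bar> * real (Suc k) powr (\<beta> - 1) \<le> \<bar>e (Suc k)\<bar> * 1" by (intro mult_left_mono) auto
        moreover have "e (Suc k) * real (Suc k) powr (\<beta> - 1) \<le> \<bar>e (Suc k)\<bar> * real (Suc k) powr (\<beta> - 1)" by (intro mult_right_mono) auto
        ultimately show "norm (w (\<iota> k)) \<le> \<bar>e (Suc k)\<bar>" using \<iota>(2)[of k] by linarith
      qed
    qed
    have "filterlim (\<lambda>k. Suc (\<iota> k)) at_top sequentially"
      unfolding filterlim_at_top
    proof
      fix Z :: nat
      show "\<forall>\<^sub>F k in sequentially. Z \<le> Suc (\<iota> k)"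
      proof (rule eventually_mono[OF eventually_ge_at_top[of "2 * Z"]])
        fix k assume "2 * Z \<le> k"
        then show "Z \<le> Suc (\<iota> k)" using \<iota>(1)[of k] by linarith
      qed
    qed
    then have "(\<lambda>k. x (Suc (\<iota> k))) \<longlonglongrightarrow> xs" by (rule filterlim_compose[OF xs])
    then have "0 \<in> SD xs" using w(1) by (intro SD_closed[OF _ _ wl]) auto
    then show "\<exists>xs. x \<longlonglongrightarrow> xs \<and> 0 \<in> SD xs" using xs by blast
  qed
qed

end

section \<open>From limit curves to subgradient trajectories\<close>

lemma lipschitz_imp_absolutely_continuous_on:
  fixes x :: "real \<Rightarrow> 'a::real_normed_vector"
  assumes "L-lipschitz_on I x"
  shows "absolutely_continuous_on I x"
  unfolding absolutely_continuous_on_def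
proof (intro allI impI)
  fix \<epsilon> :: real assume \<epsilon>: "\<epsilon> > 0"
  have L: "0 \<le> L" by (rule lipschitz_on_nonneg[OF assms])
  show "\<exists>\<delta>>0. \<forall>(n::nat) a b. (\<forall>i<n. a i \<le> b i \<and> {a i..b i} \<subseteq> I) \<and>
        disjoint_family_on (\<lambda>i. {a i<..<b i}) {..<n} \<and> (\<Sum>i<n. b i - a i) < \<delta> \<longrightarrow>
        (\<Sum>i<n. norm (x (b i) - x (a i))) < \<epsilon>"
  proof (rule exI[of _ "\<epsilon> / (L + 1)"], rule conjI)
    show "0 < \<epsilon> / (L + 1)" using \<epsilon> L by simp
    show "\<forall>(n::nat) a b. (\<forall>i<n. a i \<le> b i \<and> {a i..b i} \<subseteq> I) \<and>
        disjoint_family_on (\<lambda>i. {a i<..<b i}) {..<n} \<and> (\<Sum>i<n. b i - a i) < \<epsilon> / (L + 1) \<longrightarrow>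
        (\<Sum>i<n. norm (x (b i) - x (a i))) < \<epsilon>"
    proof (intro allI impI, elim conjE)
      fix n :: nat and a b :: "nat \<Rightarrow> real"
      assume ab: "\<forall>i<n. a i \<le> b i \<and> {a i..b i} \<subseteq> I" and small: "(\<Sum>i<n. b i - a i) < \<epsilon> / (L + 1)"
      have "(\<Sum>i<n. norm (x (b i) - x (a i))) \<le> (\<Sum>i<n. (L + 1) * (b i - a i))"
      proof (rule sum_mono)
        fix i assume "i \<in> {..<n}"
        then have i: "a i \<le> b i" "{a i..b i} \<subseteq> I" using ab by auto
        then have "a i \<in> I" "b i \<in> I" by auto
        then have "norm (x (b i) - x (a i)) \<le> L * (b i - a i)"
          using lipschitz_onD[OF assms, of "b i" "a i"] i(1) by (simp add: dist_norm)
        also have "\<dots> \<le> (L + 1) * (b i - a i)" using i(1) by (intro mult_right_mono) auto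
        finally show "norm (x (b i) - x (a i)) \<le> (L + 1) * (b i - a i)" .
      qed
      also have "\<dots> = (L + 1) * (\<Sum>i<n. b i - a i)" by (simp add: sum_distrib_left)
      also have "\<dots> < \<epsilon>" using small L by (simp add: pos_less_divide_eq mult.commute)
      finally show "(\<Sum>i<n. norm (x (b i) - x (a i))) < \<epsilon>" .
    qed
  qed
qed

lemma absolutely_continuous_on_imp_continuous_on:
  fixes x :: "real \<Rightarrow> 'a::real_normed_vector"
  assumes ac: "absolutely_continuous_on {u..v} x"
  shows "continuous_on {u..v} x"
  unfolding continuous_on_iff
proof (intro ballI allI impI)
  fix s \<epsilon> :: real assume s: "s \<in> {u..v}" and \<epsilon>: "0 < \<epsilon>"
  obtain \<delta> where \<delta>: "\<delta> > 0" and H: "\<forall>(n::nat) a b. (\<forall>i<n. a i \<le> b i \<and> {a i..b i} \<subseteq> {u..v}) \<and>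
        disjoint_family_on (\<lambda>i. {a i<..<b i}) {..<n} \<and> (\<Sum>i<n. b i - a i) < \<delta> \<longrightarrow>
        (\<Sum>i<n. norm (x (b i) - x (a i))) < \<epsilon>"
    using ac[unfolded absolutely_continuous_on_def, rule_format, OF \<epsilon>] by blast
  have "dist (x t) (x s) < \<epsilon>" if t: "t \<in> {u..v}" "dist t s < \<delta>" for t
  proof -
    have "disjoint_family_on (\<lambda>i::nat. {min s t<..<max s t}) {..<1}" by (auto simp: disjoint_family_on_def)
    moreover have "\<bar>t - s\<bar> < \<delta>" using t(2) by (simp add: dist_real_def)
    ultimately have "(\<Sum>i<1::nat. norm (x (max s t) - x (min s t))) < \<epsilon>"
      using s t(1) by (intro H[rule_format]) auto
    then show ?thesis by (cases "s \<le> t") (auto simp: dist_norm norm_minus_commute max_def min_def)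
  qed
  then show "\<exists>d>0. \<forall>x'\<in>{u..v}. dist x' s < d \<longrightarrow> dist (x x') (x s) < \<epsilon>" using \<delta> by blast
qed

context composite_problem begin

text \<open>A solution on a larger interval would be continuous up to the finite time
  \<open>T\<close> and therefore bounded before it, against \<open>mx\<close>; beyond an infinite
  \<open>T\<close> there is no larger interval.\<close>

lemma subgradient_trajectoryI:
  assumes T: "0 < T" and lip: "\<And>t. 0 \<le> t \<Longrightarrow> ereal t < T \<Longrightarrow> \<exists>L. L-lipschitz_on {0..t} y"
    and C: "countable C" "\<And>t. 0 < t \<Longrightarrow> ereal t < T \<Longrightarrow> t \<notin> C \<Longrightarrow> \<exists>w\<in>SD (y t). (y has_vector_derivative - w) (at t)"
    and mx: "T = \<infinity> \<or> \<not> bounded (y ` time_interval T)"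
  shows "subgradient_trajectory (objective N f g) T y"
  unfolding subgradient_trajectory_def
proof
  show "subgradient_solution (objective N f g) T y"
    unfolding subgradient_solution_def
  proof (intro conjI allI impI T)
    fix a b assume ab: "{a..b} \<subseteq> time_interval T"
    have "\<exists>L. L-lipschitz_on {a..b} y"
    proof (cases "a \<le> b")
      case True
      then have "a \<in> time_interval T" "b \<in> time_interval T" using ab by auto
      then have ab0: "0 \<le> a" "0 \<le> b" "ereal b < T" by (auto simp: time_interval_def)
      obtain L where "L-lipschitz_on {0..b} y" using lip[OF ab0(2,3)] by blast
      then have "L-lipschitz_on {a..b} y" by (rule lipschitz_on_subset) (use ab0 in auto)
      then show ?thesis ..
    next
      case False
      then have "0-lipschitz_on {a..b} y" by (simp add: lipschitz_on_def)
      then show ?thesis ..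
    qed
    then show "absolutely_continuous_on {a..b} y" using lipschitz_imp_absolutely_continuous_on by blast
  next
    \<comment> \<open>The time 0 joins the exceptional set, because the hypothesis on derivatives
      covers positive times only.\<close>
    have "insert 0 C \<in> null_sets lborel" using C(1) by (intro countable_imp_null_set_lborel) simp
    moreover have "\<exists>v. (y has_vector_derivative v) (at t) \<and> v \<in> uminus ` clarke_subdifferential (objective N f g) (y t)"
      if "t \<in> time_interval T" "t \<notin> insert 0 C" for t
    proof -
      have "0 < t" "ereal t < T" "t \<notin> C" using that by (auto simp: time_interval_def)
      from C(2)[OF this] show ?thesis unfolding SD_eq by blast
    qed
    ultimately show "AE t in lborel. t \<in> time_interval T \<longrightarrow>
        (\<exists>v. (y has_vector_derivative v) (at t) \<and> v \<in> uminus ` clarke_subdifferential (objective N f g) (y t))"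
      by (intro AE_I'[of "insert 0 C"]) auto
  qed
  show "\<not> (\<exists>T' z. T < T' \<and> subgradient_solution (objective N f g) T' z \<and> (\<forall>t\<in>time_interval T. z t = y t))"
  proof
    assume "\<exists>T' z. T < T' \<and> subgradient_solution (objective N f g) T' z \<and> (\<forall>t\<in>time_interval T. z t = y t)"
    then obtain T' z where z: "T < T'" "subgradient_solution (objective N f g) T' z" "\<And>t. t \<in> time_interval T \<Longrightarrow> z t = y t" by blast
    obtain \<tau> where \<tau>: "T = ereal \<tau>" using T z(1) by (cases T) auto
    have "{0..\<tau>} \<subseteq> time_interval T'"
    proof
      fix t assume "t \<in> {0..\<tau>}"
      then have "0 \<le> t" "ereal t \<le> T" using \<tau> by auto
      then show "t \<in> time_interval T'" using z(1) unfolding time_interval_def by (auto intro: le_less_trans)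
    qed
    then have "absolutely_continuous_on {0..\<tau>} z" using z(2) unfolding subgradient_solution_def by blast
    then have "continuous_on {0..\<tau>} z" by (rule absolutely_continuous_on_imp_continuous_on)
    then have "bounded (z ` {0..\<tau>})" by (intro compact_imp_bounded compact_continuous_image) auto
    moreover have "y ` time_interval T \<subseteq> z ` {0..\<tau>}"
    proof
      fix u assume "u \<in> y ` time_interval T"
      then obtain t where t: "t \<in> time_interval T" "u = y t" by blast
      then have "u = z t" "t \<in> {0..\<tau>}" using z(3) by (auto simp: time_interval_def \<tau>)
      then show "u \<in> z ` {0..\<tau>}" by blast
    qed
    ultimately have "bounded (y ` time_interval T)" by (rule bounded_subset)
    then show False using mx \<tau> by auto
  qed
qed

lemma bounded_descent_model:
  assumes bounded_below: "\<exists>m::real. \<forall>x. ereal m \<le> objective N f g x"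
    and beta: "if N = 1 then \<beta> = 0 else \<beta> \<in> {1/2<..<1}"
    and sa: "semialgebraic_function (objective N f g)"
    and bt: "has_bounded_subgradient_trajectories (objective N f g)"
  shows "bounded_descent_model D \<phi> SD (reshuffling N) \<beta> (prr_step N f g)"
proof -
  interpret semialgebraic_model D \<phi> SD by (rule semialgebraic_model[OF sa])
  show ?thesis
  proof
    show "convex (SD x)" for x by (rule SD_convex)
    show "w \<in> SD x" if "x \<in> D" "\<rho> > 0"
      "\<And>y. y \<in> D \<Longrightarrow> norm (y - x) \<le> \<rho> \<Longrightarrow> \<phi> x + w \<bullet> (y - x) - L * (norm (y - x))\<^sup>2 \<le> \<phi> y" for x \<rho> w L
      by (rule SD_localI[OF that])
    show "(reshuffling N = 0 \<and> \<beta> = 0) \<or> (reshuffling N = 1 \<and> 1 / 2 < \<beta> \<and> \<beta> < 1)"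
      using beta by (auto simp: reshuffling_def split: if_splits)
    show "\<exists>L>0. \<forall>x\<in>D. \<forall>y\<in>D. norm x \<le> R \<longrightarrow> norm y \<le> R \<longrightarrow> \<bar>\<phi> x - \<phi> y\<bar> \<le> L * norm (x - y)" for R by (rule \<phi>_lipschitz)
    obtain m where m: "\<And>x. ereal m \<le> objective N f g x" using bounded_below by blast
    have "m \<le> \<phi> x" if "x \<in> D" for x using m[of x] that by (simp add: objective_eq)
    then show "\<exists>m. \<forall>x\<in>D. m \<le> \<phi> x" by blast
    show "x' \<in> D" if "a > 0" "prr_step N f g a x x'" for a x x'
      using that(2) prox_optimality(1)[OF _ that(1)] unfolding prr_step_def by blast
    show "\<exists>M>0. \<exists>abar>0. \<forall>a x x'. 0 < a \<longrightarrow> a \<le> abar \<longrightarrow> x \<in> D \<longrightarrow> norm x \<le> R \<longrightarrow> prr_step N f g a x x' \<longrightarrow>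
     x' \<in> D \<and> norm (x' - x) \<le> M * a \<and>
     \<phi> x' \<le> \<phi> x - (norm (x' - x))\<^sup>2 / (2 * a) + reshuffling N * M * a ^ 3 \<and>
     (\<exists>w\<in>SD x'. a * norm w \<le> 2 * norm (x' - x) + reshuffling N * M * a\<^sup>2) \<and>
     (\<forall>z\<in>D. norm z \<le> R \<longrightarrow> (norm (x' - z))\<^sup>2 / 2 - (norm (x - z))\<^sup>2 / 2 \<le> a * (\<phi> z - \<phi> x + M * (norm (x - z))\<^sup>2 + M * a))" for R
      by (rule prr_step_bounds)
    fix T :: ereal and y :: "real \<Rightarrow> 'a"
    assume A: "0 < T" "\<And>t. 0 \<le> t \<Longrightarrow> ereal t < T \<Longrightarrow> \<exists>L. L-lipschitz_on {0..t} y"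
      "\<exists>C. countable C \<and> (\<forall>t. 0 < t \<longrightarrow> ereal t < T \<longrightarrow> t \<notin> C \<longrightarrow> (\<exists>w\<in>SD (y t). (y has_vector_derivative - w) (at t)))"
      "T = \<infinity> \<or> \<not> bounded (y ` time_interval T)"
    obtain C where "countable C" "\<And>t. 0 < t \<Longrightarrow> ereal t < T \<Longrightarrow> t \<notin> C \<Longrightarrow> \<exists>w\<in>SD (y t). (y has_vector_derivative - w) (at t)"
      using A(3) by blast
    from subgradient_trajectoryI[OF A(1,2) this A(4)] show "bounded (y ` time_interval T)"
      using bt unfolding has_bounded_subgradient_trajectories_def by blast
  qed
qed

end

section \<open>Distances of subdifferentials to the origin, and the final estimates\<close>

lemma edist_set_nonneg: "0 \<le> edist_set x S"
  unfolding edist_set_def by (rule INF_greatest) simp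

lemma edist_set_le: "w \<in> S \<Longrightarrow> edist_set 0 S \<le> ereal (norm w)"
  unfolding edist_set_def by (rule INF_lower2[of w]) auto

theorem theorem3p11:
  fixes N :: nat
    and f :: "nat \<Rightarrow> 'a::euclidean_space \<Rightarrow> real"
    and g :: "'a \<Rightarrow> ereal"
    and \<beta> :: real
    and X0 :: "'a set"
  defines "\<Phi> \<equiv> objective N f g"
  assumes N: "1 \<le> N"
    and f_diff: "\<forall>i\<in>{1..N}. \<forall>x. f i differentiable (at x)"
    and f_grad: "\<forall>i\<in>{1..N}. locally_lipschitz_on UNIV (gradient (f i))"
    and g_proper: "proper_function g"
    and g_convex: "convex_function g"
    and g_dom: "closed (edom g)"
    and g_lip: "locally_lipschitz_on (edom g) (\<lambda>x. real_of_ereal (g x))"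
    and bounded_below: "\<exists>m::real. \<forall>x. ereal m \<le> \<Phi> x"
    and beta: "if N = 1 then \<beta> = 0 else \<beta> \<in> {1/2<..<1}"
    and semialg: "semialgebraic_function \<Phi>"
    and bounded_traj: "has_bounded_subgradient_trajectories \<Phi>"
    and X0: "bounded X0" "X0 \<subseteq> edom \<Phi>"
  shows "\<exists>\<alpha>bar>0. \<exists>c>0. \<forall>\<alpha> x.
           \<alpha> \<in> {0<..\<alpha>bar} \<and> prr_sequence N f g (\<lambda>k. \<alpha> / (real k + 1) powr \<beta>) x \<and> x 0 \<in> X0 \<longrightarrow>
             (\<exists>xstar. x \<longlonglongrightarrow> xstar \<and> edist_set 0 (clarke_subdifferential \<Phi> xstar) = 0) \<and>
             summable (\<lambda>i. norm (x (Suc i) - x i)) \<and> (\<Sum>i. norm (x (Suc i) - x i)) \<le> c \<and>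
             (\<exists>m :: nat \<Rightarrow> real.
                (\<forall>\<^sub>F k in sequentially.
                   (MIN i\<in>{0..k}. edist_set 0 (clarke_subdifferential \<Phi> (x i))) = ereal (m k)) \<and>
                m \<in> o(\<lambda>k. real k powr (\<beta> - 1)))"
proof -
  interpret cp: composite_problem N f g
    by unfold_locales (use N f_diff f_grad g_proper g_convex g_dom g_lip in auto)
  interpret bounded_descent_model "edom g" cp.\<phi> cp.SD "reshuffling N" \<beta> "prr_step N f g"
    by (rule cp.bounded_descent_model) (use bounded_below beta semialg bounded_traj in \<open>auto simp: \<Phi>_def\<close>)
  have SD: "clarke_subdifferential \<Phi> z = cp.SD z" for z unfolding \<Phi>_def by (rule cp.SD_eq)
  have dom: "edom \<Phi> = edom g" unfolding \<Phi>_def by (auto simp: edom_def cp.objective_eq)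
  obtain r where r: "\<And>z. z \<in> X0 \<Longrightarrow> norm z \<le> r" using X0(1) unfolding bounded_iff by blast
  obtain lam where lam: "\<And>z. z \<in> X0 \<Longrightarrow> cp.\<phi> z \<le> lam"
  proof (cases "X0 = {}")
    case False
    then obtain z0 where z0: "z0 \<in> X0" by blast
    obtain L where L: "L > 0" "\<forall>x\<in>edom g. \<forall>y\<in>edom g. norm x \<le> r \<longrightarrow> norm y \<le> r \<longrightarrow> \<bar>cp.\<phi> x - cp.\<phi> y\<bar> \<le> L * norm (x - y)"
      using \<phi>_lipschitz[of r] by blast
    have "cp.\<phi> z \<le> cp.\<phi> z0 + L * (r + r)" if z: "z \<in> X0" for z
    proof -
      have "\<bar>cp.\<phi> z - cp.\<phi> z0\<bar> \<le> L * norm (z - z0)" using L(2) X0(2) z z0 r dom by blast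
      also have "\<dots> \<le> L * (r + r)" using norm_triangle_ineq4[of z z0] r[OF z] r[OF z0] L(1) by (intro mult_left_mono) auto
      finally show ?thesis by linarith
    qed
    then show thesis by (rule that)
  qed (use that in blast)
  obtain a1 c0 where a1: "0 < a1" and c0: "\<forall>\<alpha> K x. 0 < \<alpha> \<longrightarrow> \<alpha> \<le> a1 \<longrightarrow> run \<alpha> K x \<longrightarrow> norm (x 0) \<le> r \<longrightarrow> cp.\<phi> (x 0) \<le> lam \<longrightarrow>
     (\<forall>n. (\<Sum>k<n. norm (x (Suc k) - x k)) \<le> c0)"
    using uniform_length[of r lam] by blast
  obtain a2 where a2: "0 < a2" and conv: "\<And>\<alpha> x. 0 < \<alpha> \<Longrightarrow> \<alpha> \<le> a2 \<Longrightarrow> run \<alpha> 0 x \<Longrightarrow> norm (x 0) \<le> r \<Longrightarrow>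
    (\<forall>n. (\<Sum>k<n. norm (x (Suc k) - x k)) \<le> c0) \<Longrightarrow>
    (\<exists>xs. x \<longlonglongrightarrow> xs \<and> 0 \<in> cp.SD xs) \<and> summable (\<lambda>k. norm (x (Suc k) - x k)) \<and> (\<Sum>k. norm (x (Suc k) - x k)) \<le> c0 \<and>
    (\<exists>w e. (\<forall>k. w k \<in> cp.SD (x (Suc k))) \<and> e \<longlonglongrightarrow> 0 \<and>
       (\<forall>k\<ge>1. \<exists>i\<in>{k div 2..<k}. norm (w i) \<le> e k * real k powr (\<beta> - 1)))"
    by (rule run_convergence[of r c0]) (rule that)
  show ?thesis
  \<comment> \<open>The bound \<open>c0\<close> carries no sign information, so
    \<open>max c0 1\<close> supplies a positive constant.\<close>
  proof (rule exI[of _ "min a1 a2"], rule conjI, simp add: a1 a2, rule exI[of _ "max c0 1"], rule conjI, simp, intro allI impI, elim conjE)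
    fix \<alpha> :: real and x :: "nat \<Rightarrow> 'a"
    assume "\<alpha> \<in> {0<..min a1 a2}" and seq: "prr_sequence N f g (\<lambda>k. \<alpha> / (real k + 1) powr \<beta>) x" and x0: "x 0 \<in> X0"
    then have \<alpha>: "0 < \<alpha>" "\<alpha> \<le> a1" "\<alpha> \<le> a2" by auto
    have run: "run \<alpha> 0 x" unfolding run_def
    proof (intro conjI allI)
      show "x 0 \<in> edom g" using x0 X0(2) dom by blast
      show "prr_step N f g (stepsize \<alpha> 0 k) (x k) (x (Suc k))" for k
      proof -
        obtain \<sigma> X where "\<forall>k. \<sigma> k permutes {1..N} \<and> X k 0 = x k \<and>
          (\<forall>i\<in>{1..N}. X k i = X k (i - 1) - (\<alpha> / (real k + 1) powr \<beta>) *\<^sub>R gradient (f (\<sigma> k i)) (X k (i - 1))) \<and>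
          x (Suc k) \<in> prox (\<lambda>y. ereal (\<alpha> / (real k + 1) powr \<beta>) * g y) (X k N)"
          using seq unfolding prr_sequence_def by blast
        then show ?thesis unfolding prr_step_def stepsize_def by (intro exI[of _ "\<sigma> k"] exI[of _ "X k"]) simp
      qed
    qed
    have len: "\<forall>n. (\<Sum>k<n. norm (x (Suc k) - x k)) \<le> c0"
      using c0 \<alpha>(1,2) run r[OF x0] lam[OF x0] by blast
    from conv[OF \<alpha>(1,3) run r[OF x0] len]
    obtain xs w e where xs: "x \<longlonglongrightarrow> xs" "0 \<in> cp.SD xs" and sm: "summable (\<lambda>k. norm (x (Suc k) - x k))" "(\<Sum>k. norm (x (Suc k) - x k)) \<le> c0"
      and w: "\<And>k. w k \<in> cp.SD (x (Suc k))" and e: "e \<longlonglongrightarrow> 0" and rate: "\<And>k. k \<ge> 1 \<Longrightarrow> \<exists>i\<in>{k div 2..<k}. norm (w i) \<le> e k * real k powr (\<beta> - 1)"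
      by blast
    define E where "E i = edist_set 0 (cp.SD (x i))" for i
    \<comment> \<open>The minimum is real from \<open>k = 1\<close> on. At \<open>k = 0\<close> it
      may be infinite, since the subdifferential at the starting point may be empty.\<close>
    define m where "m k = real_of_ereal (MIN i\<in>{0..k}. E i)" for k
    have mk: "(MIN i\<in>{0..k}. E i) = ereal (m k)" "0 \<le> m k" "m k \<le> e k * real k powr (\<beta> - 1)" if k: "k \<ge> 1" for k
    proof -
      obtain i where i: "i \<in> {k div 2..<k}" "norm (w i) \<le> e k * real k powr (\<beta> - 1)" using rate[OF k] by blast
      \<comment> \<open>\<open>w i\<close> is a subgradient at the next iterate, whose index
        \<open>Suc i \<le> k\<close> still takes part in the minimum.\<close>
      have "(MIN i\<in>{0..k}. E i) \<le> E (Suc i)" by (rule Min_le) (use i in auto)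
      also have "\<dots> \<le> ereal (norm (w i))" unfolding E_def by (rule edist_set_le[OF w])
      finally have up: "(MIN i\<in>{0..k}. E i) \<le> ereal (norm (w i))" .
      have "0 \<le> (MIN i\<in>{0..k}. E i)" by (subst Min_ge_iff) (auto simp: E_def edist_set_nonneg)
      then show eq: "(MIN i\<in>{0..k}. E i) = ereal (m k)" and "0 \<le> m k"
        using up unfolding m_def by (cases "MIN i\<in>{0..k}. E i"; simp)+
      show "m k \<le> e k * real k powr (\<beta> - 1)" using up i(2) unfolding eq by simp
    qed
    have "m \<in> o(\<lambda>k. real k powr (\<beta> - 1))"
    proof (rule smalloI_tendsto)
      show "(\<lambda>k. m k / real k powr (\<beta> - 1)) \<longlonglongrightarrow> 0"
      proof (rule tendsto_sandwich[OF _ _ tendsto_const e])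
        show "\<forall>\<^sub>F k in sequentially. 0 \<le> m k / real k powr (\<beta> - 1)"
          using eventually_ge_at_top[of 1] by (rule eventually_mono) (simp add: mk)
        show "\<forall>\<^sub>F k in sequentially. m k / real k powr (\<beta> - 1) \<le> e k"
          using eventually_ge_at_top[of 1] by (rule eventually_mono) (use mk(3) in \<open>simp add: pos_divide_le_eq\<close>)
      qed
      show "\<forall>\<^sub>F k in sequentially. real k powr (\<beta> - 1) \<noteq> 0"
        using eventually_ge_at_top[of 1] by (rule eventually_mono) simp
    qed
    moreover have "\<forall>\<^sub>F k in sequentially. (MIN i\<in>{0..k}. edist_set 0 (clarke_subdifferential \<Phi> (x i))) = ereal (m k)"
      using eventually_ge_at_top[of 1] by (rule eventually_mono) (use mk(1) in \<open>simp add: SD E_def\<close>)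
    moreover have "edist_set 0 (clarke_subdifferential \<Phi> xs) = 0"
      using edist_set_le[OF xs(2)] edist_set_nonneg[of 0 "cp.SD xs"] by (simp add: SD antisym zero_ereal_def[symmetric])
    moreover have "(\<Sum>k. norm (x (Suc k) - x k)) \<le> max c0 1" using sm(2) by simp
    ultimately show "(\<exists>xstar. x \<longlonglongrightarrow> xstar \<and> edist_set 0 (clarke_subdifferential \<Phi> xstar) = 0) \<and>
             summable (\<lambda>i. norm (x (Suc i) - x i)) \<and> (\<Sum>i. norm (x (Suc i) - x i)) \<le> max c0 1 \<and>
             (\<exists>m :: nat \<Rightarrow> real.
                (\<forall>\<^sub>F k in sequentially.
                   (MIN i\<in>{0..k}. edist_set 0 (clarke_subdifferential \<Phi> (x i))) = ereal (m k)) \<and>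
                m \<in> o(\<lambda>k. real k powr (\<beta> - 1)))"
      using xs(1) sm(1) by blast
  qed
qed

end
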